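(* Let $X$ be an LB$_s$-space. Then the following conditions are equivalent: (1) $X$ admits no hypercyclic operator (that is, no $T\in L(X)$ is hypercyclic); (2) $X$ admits no cyclic operator with dense range (that is, no cyclic $T\in L(X)$ has dense range); (3) $X$ is isomorphic to $Y\times\varphi$, where $Y$ is the inductive limit of a sequence $\{Y_n\}_{n\in\mathbb Z_+}$ of separable Banach spaces such that $Y_0$ is dense in $Y$.
   Context: Conventions: $\mathbb K$ is $\mathbb R$ or $\mathbb C$; all vector spaces are non-trivial (non-zero) and over $\mathbb K$; all topological spaces (in particular all inductive limits below) are Hausdorff; $\mathbb Z_+=\{0,1,2,\dots\}$. $L(X)$ is the space of continuous linear operators on $X$. Isomorphic means linearly homeomorphic. Let $\{X_n\}_{n\in\mathbb Z_+}$ be a sequence of vector spaces such that $X_n$ is a subspace of $X_{n+1}$ for each $n$ and each $X_n$ carries its own locally convex topology $\tau_n$ with $\tau_n$ (maybe non-strictly) stronger than the topology $\tau_{n+1}|_{X_n}$. The inductive limit of the sequence is $X=\bigcup_{n}X_n$ with the strongest locally convex topology $\tau$ such that $\tau|_{X_n}\subseteq\tau_n$ for each $n$; i.e. a convex set $U$ is a neighborhood of zero in $X$ iff $U\cap X_n$ is a neighborhood of zero in $X_n$ for each $n$. An LB$_s$-space is an inductive limit of a sequence of separable Banach spaces. $\varphi$ is the locally convex direct sum of countably many copies of $\mathbb K$, i.e. a vector space of countably infinite algebraic dimension with the strongest locally convex topology. $T\in L(X)$ is hypercyclic if $\{T^nx:n\in\mathbb Z_+\}$ is dense in $X$ for some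 $x\in X$; $T$ is cyclic if the linear span of $\{T^nx:n\in\mathbb Z_+\}$ is dense in $X$ for some $x\in X$.
   Formalization: (1)⇔(2) is stated only for infinite-dimensional X, since for X = K^n (1) holds while (2) and (3) fail; (2)⇔(3) is stated for every X. In (3), Y is taken inside the ambient vector space of X, which loses nothing because Y is isomorphic to a subspace of X. *)

theory Defs
  imports "HOL-Analysis.Analysis" "HOL-Library.Function_Algebras"
begin

text \<open>
  The scalar field is \<open>\<real>\<close> or \<open>\<complex>\<close>, up to a norm-preserving field isomorphism.

  A topological vector space is given by a vector space structure \<open>s\<close> on a type and a topology
  \<open>X\<close> (type constructor \<^type>\<open>topology\<close>) whose carrier \<open>topspace X\<close> is a linear subspace
  of that type.
\<close>

class real_or_complex = real_normed_field +
  assumes real_or_complex: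
    "(\<exists>f::'a \<Rightarrow> real. bij f \<and> (\<forall>x y. f (x + y) = f x + f y) \<and> (\<forall>x y. f (x * y) = f x * f y)
        \<and> (\<forall>x. norm (f x) = norm x)) \<or>
     (\<exists>f::'a \<Rightarrow> complex. bij f \<and> (\<forall>x y. f (x + y) = f x + f y) \<and> (\<forall>x y. f (x * y) = f x * f y)
        \<and> (\<forall>x. norm (f x) = norm x))"

instance real :: real_or_complex
  by standard (rule disjI1, rule exI[of _ "\<lambda>x. x"], auto simp: bij_def)

instance complex :: real_or_complex
  by standard (rule disjI2, rule exI[of _ "\<lambda>x. x"], auto simp: bij_def)

definition finer :: "'a topology \<Rightarrow> 'a topology \<Rightarrow> bool" where
  "finer S T \<longleftrightarrow> topspace S = topspace T \<and> (\<forall>U. openin T U \<longrightarrow> openin S U)"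

definition strongest_topology :: "('a topology \<Rightarrow> bool) \<Rightarrow> 'a topology \<Rightarrow> bool" where
  "strongest_topology P T \<longleftrightarrow> P T \<and> (\<forall>S. P S \<longrightarrow> finer T S)"

definition convex_set :: "('k::real_normed_field \<Rightarrow> 'a::ab_group_add \<Rightarrow> 'a) \<Rightarrow> 'a set \<Rightarrow> bool" where
  "convex_set s C \<longleftrightarrow>
     (\<forall>x\<in>C. \<forall>y\<in>C. \<forall>t\<in>{0..1::real}. s (of_real (1 - t)) x + s (of_real t) y \<in> C)"

text \<open>Not assumed to be Hausdorff.\<close>

definition locally_convex_space ::
  "('k::real_normed_field \<Rightarrow> 'a::ab_group_add \<Rightarrow> 'a) \<Rightarrow> 'a topology \<Rightarrow> bool" where
  "locally_convex_space s X \<longleftrightarrow>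
     module.subspace s (topspace X) \<and>
     continuous_map (prod_topology X X) X (\<lambda>(x, y). x + y) \<and>
     continuous_map (prod_topology euclidean X) X (\<lambda>(c, x). s c x) \<and>
     (\<forall>U. openin X U \<and> 0 \<in> U \<longrightarrow> (\<exists>C. openin X C \<and> convex_set s C \<and> 0 \<in> C \<and> C \<subseteq> U))"

text \<open>
  The values of the norm \<open>N\<close> outside \<open>topspace X\<close> are immaterial; there
  \<^const>\<open>Metric_space\<close> only asks for the distance to be nonnegative and symmetric.
\<close>

definition separable_Banach_space ::
  "('k::real_normed_field \<Rightarrow> 'a::ab_group_add \<Rightarrow> 'a) \<Rightarrow> 'a topology \<Rightarrow> bool" where
  "separable_Banach_space s X \<longleftrightarrow>
     module.subspace s (topspace X) \<and> topspace X \<noteq> {0} \<and> separable_space X \<and>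
     (\<exists>N :: 'a \<Rightarrow> real.
        Metric_space (topspace X) (\<lambda>x y. N (x - y)) \<and>
        (\<forall>c. \<forall>x\<in>topspace X. N (s c x) = norm c * N x) \<and>
        Metric_space.mcomplete (topspace X) (\<lambda>x y. N (x - y)) \<and>
        X = Metric_space.mtopology (topspace X) (\<lambda>x y. N (x - y)))"

definition inductive_limit ::
  "('k::real_normed_field \<Rightarrow> 'a::ab_group_add \<Rightarrow> 'a) \<Rightarrow> (nat \<Rightarrow> 'a topology) \<Rightarrow> 'a topology \<Rightarrow> bool"
  where
  "inductive_limit s Xs X \<longleftrightarrow>
     (\<forall>n. topspace (Xs n) \<subseteq> topspace (Xs (Suc n)) \<and>
          finer (Xs n) (subtopology (Xs (Suc n)) (topspace (Xs n)))) \<and>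
     strongest_topology
       (\<lambda>T. topspace T = (\<Union>n. topspace (Xs n)) \<and> locally_convex_space s T \<and>
            (\<forall>n. finer (Xs n) (subtopology T (topspace (Xs n))))) X \<and>
     Hausdorff_space X"

definition separable_Banach_limit ::
  "('k::real_normed_field \<Rightarrow> 'a::ab_group_add \<Rightarrow> 'a) \<Rightarrow> (nat \<Rightarrow> 'a topology) \<Rightarrow> 'a topology \<Rightarrow> bool"
  where
  "separable_Banach_limit s Xs X \<longleftrightarrow>
     (\<forall>n. separable_Banach_space s (Xs n)) \<and> inductive_limit s Xs X"

definition LBs_space ::
  "('k::real_normed_field \<Rightarrow> 'a::ab_group_add \<Rightarrow> 'a) \<Rightarrow> 'a topology \<Rightarrow> bool" where
  "LBs_space s X \<longleftrightarrow> (\<exists>Xs. separable_Banach_limit s Xs X)"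

definition linear_between ::
  "('k \<Rightarrow> 'a::ab_group_add \<Rightarrow> 'a) \<Rightarrow> ('k \<Rightarrow> 'b::ab_group_add \<Rightarrow> 'b) \<Rightarrow> 'a set \<Rightarrow> ('a \<Rightarrow> 'b) \<Rightarrow> bool" where
  "linear_between s s' V f \<longleftrightarrow>
     (\<forall>x\<in>V. \<forall>y\<in>V. f (x + y) = f x + f y) \<and> (\<forall>c. \<forall>x\<in>V. f (s c x) = s' c (f x))"

definition continuous_operator ::
  "('k \<Rightarrow> 'a::ab_group_add \<Rightarrow> 'a) \<Rightarrow> 'a topology \<Rightarrow> ('a \<Rightarrow> 'a) \<Rightarrow> bool" where
  "continuous_operator s X T \<longleftrightarrow> linear_between s s (topspace X) T \<and> continuous_map X X T"

definition hypercyclic :: "'a topology \<Rightarrow> ('a \<Rightarrow> 'a) \<Rightarrow> bool" where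
  "hypercyclic X T \<longleftrightarrow>
     (\<exists>x\<in>topspace X. X closure_of (range (\<lambda>n. (T ^^ n) x)) = topspace X)"

definition cyclic ::
  "('k::field \<Rightarrow> 'a::ab_group_add \<Rightarrow> 'a) \<Rightarrow> 'a topology \<Rightarrow> ('a \<Rightarrow> 'a) \<Rightarrow> bool" where
  "cyclic s X T \<longleftrightarrow>
     (\<exists>x\<in>topspace X. X closure_of (module.span s (range (\<lambda>n. (T ^^ n) x))) = topspace X)"

definition dense_range :: "'a topology \<Rightarrow> ('a \<Rightarrow> 'a) \<Rightarrow> bool" where
  "dense_range X T \<longleftrightarrow> X closure_of (T ` topspace X) = topspace X"

definition isomorphic_spaces ::
  "('k \<Rightarrow> 'a::ab_group_add \<Rightarrow> 'a) \<Rightarrow> 'a topology \<Rightarrow> ('k \<Rightarrow> 'b::ab_group_add \<Rightarrow> 'b) \<Rightarrow> 'b topology \<Rightarrow> bool"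
  where
  "isomorphic_spaces s X s' X' \<longleftrightarrow>
     (\<exists>h. linear_between s s' (topspace X) h \<and> homeomorphic_map X X' h)"

definition prod_scale :: "('k \<Rightarrow> 'a \<Rightarrow> 'a) \<Rightarrow> ('k \<Rightarrow> 'b \<Rightarrow> 'b) \<Rightarrow> 'k \<Rightarrow> 'a \<times> 'b \<Rightarrow> 'a \<times> 'b" where
  "prod_scale s s' c = (\<lambda>(x, y). (s c x, s' c y))"

definition seq_scale :: "'k::times \<Rightarrow> (nat \<Rightarrow> 'k) \<Rightarrow> (nat \<Rightarrow> 'k)" where
  "seq_scale c f = (\<lambda>i. c * f i)"

text \<open>The space \<open>\<phi>\<close>, realised on the finitely supported scalar sequences.\<close>

definition is_phi :: "(nat \<Rightarrow> 'k::real_normed_field) topology \<Rightarrow> bool" where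
  "is_phi =
     strongest_topology
       (\<lambda>T. topspace T = {f. finite {i. f i \<noteq> 0}} \<and> locally_convex_space seq_scale T)"

definition infinite_dimensional ::
  "('k::field \<Rightarrow> 'a::ab_group_add \<Rightarrow> 'a) \<Rightarrow> 'a set \<Rightarrow> bool" where
  "infinite_dimensional s V \<longleftrightarrow> \<not> (\<exists>B. finite B \<and> V \<subseteq> module.span s B)"

end

theory Submission
  imports Defs
begin

text \<open>
  If \<open>X\<close> is \<open>Y \<times> \<phi>\<close> with \<open>Y 0\<close> dense in \<open>Y\<close>, then by Baire's theorem every operator maps \<open>Y\<close>
  into finitely many coordinates of \<open>\<phi>\<close>. Comparing leading terms, the span \<open>E\<close> of an orbit meets \<open>Y\<close>
  in a finite-dimensional space. A dense subspace with this property is all of \<open>X\<close>, so \<open>X = E\<close>; the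
  same applies to the dense range of \<open>T\<close>, so \<open>T\<close> is onto, although a generator of \<open>E\<close> with linearly
  independent orbit is not in the range.

  Conversely, if no such splitting exists and \<open>X\<close> is infinite-dimensional, then either some step
  \<open>X m\<close> is dense or, along a subsequence, every step has infinite codimension modulo the closure of
  the preceding one. In both cases there is a sequence \<open>e j\<close> with dense span and biorthogonal
  functionals such that the shift \<open>S (e (j + 1)) = e j\<close> is continuous, and \<open>T = I + S\<close> is
  hypercyclic: on the Jordan blocks spanned by the first \<open>e j\<close>, arbitrarily small corrections
  supported on far indices steer \<open>T ^ n\<close> to any target. As the orbit has to return to \<open>X 0\<close>
  approximately, the \<open>e j\<close> are ordered so that long stretches of them lie in \<open>X 0\<close>.
\<close>

text \<open>No neighbourhood of an inductive limit is handled directly. The limit topology is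
  generated by the seminorms that are bounded on every step, so continuity of a linear map means
  that it pulls such seminorms back to such seminorms. For \<phi> all seminorms are allowed: every
  linear map out of it is continuous and each of its subspaces is closed.

  The obstacle on the constructive side is that \<open>X\<close> need not be metrizable. A
  hypercyclic vector has to be the sum of a series, and convergence is available only inside a
  single Banach step; so all corrections are made in \<open>V 0\<close> and measured by
  \<open>N 0\<close>, although the targets range over all steps. Functionals attached to step
  \<open>k\<close> vanish on the closure of the preceding step, so only those with
  \<open>\<beta> j \<le> m\<close> act on \<open>V m\<close>, and the shift is bounded from each
  step to the next.

  The shift is tamed by small functionals and cannot be relied on for growth. The binomial
  coefficients in the powers of \<open>I + S\<close> supply it: a coefficient at a far index is
  amplified by a power of \<open>n\<close>, so tiny corrections suffice.\<close>

section \<open>Scalars\<close>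

text \<open>The class speaks of abstract isomorphisms, so real scalars are recognised through the
  norm: integers are fixed, and stretching by \<open>n\<close> confines the displacement of a real
  number to \<open>2 / n\<close>.\<close>

lemma field_hom_of_real:
  fixes f :: "'k::real_normed_field \<Rightarrow> 'l::real_normed_field"
  assumes add: "\<And>x y. f (x + y) = f x + f y" and mult: "\<And>x y. f (x * y) = f x * f y"
    and norm: "\<And>x. norm (f x) = norm x"
  shows "f (of_real r) = of_real r"
proof -
  have zero: "f 0 = 0" using norm[of 0] by simp
  have one: "f 1 = 1"
  proof -
    have "f 1 * f 1 = f 1" using mult[of 1 1] by simp
    moreover have "f 1 \<noteq> 0" using norm[of 1] by auto
    ultimately show ?thesis by simp
  qed
  have nat: "f (of_nat n) = of_nat n" for n
    by (induction n) (auto simp: zero one add)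
  have minus: "f (- x) = - f x" for x
    using add[of x "-x"] zero by (simp add: eq_neg_iff_add_eq_0 add.commute)
  have int: "f (of_int m) = of_int m" for m
    by (cases m rule: int_cases2) (auto simp: nat minus)
  have bound: "norm (f (of_real r) - of_real r) \<le> 2 / real n" if "n > 0" for n :: nat
  proof -
    define m where "m = \<lfloor>real n * r\<rfloor>"
    define t where "t = real n * r - of_int m"
    have t: "\<bar>t\<bar> \<le> 1" unfolding t_def m_def by linarith
    have "of_real (real n * r) = (of_int m :: 'k) + of_real t"
      unfolding t_def by (metis add_diff_cancel_left' of_real_add of_real_of_int_eq diff_add_cancel add.commute)
    then have "f (of_nat n * of_real r) = of_int m + f (of_real t)"
      by (simp add: add int)
    then have "of_nat n * f (of_real r) = of_int m + f (of_real t)"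
      by (simp add: mult nat)
    moreover have "(of_nat n * of_real r :: 'l) = of_int m + of_real t"
      unfolding t_def by (metis add_diff_cancel_left' of_real_add of_real_of_int_eq diff_add_cancel
          add.commute of_real_mult of_real_of_nat_eq)
    ultimately have "of_nat n * (f (of_real r) - of_real r) = f (of_real t) - of_real t"
      by (simp add: algebra_simps)
    then have "real n * norm (f (of_real r) - of_real r) = norm (f (of_real t) - of_real t)"
      by (metis norm_mult norm_of_nat)
    also have "\<dots> \<le> norm (f (of_real t)) + norm (of_real t :: 'l)" by (rule norm_triangle_ineq4)
    also have "\<dots> \<le> 2" using t by (simp add: norm)
    finally show ?thesis using that by (simp add: field_simps)
  qed
  have "norm (f (of_real r) - of_real r) \<le> e" if e: "e > 0" for e
  proof -
    obtain n :: nat where n: "real n > 2 / e" using reals_Archimedean2 by blast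
    then have pos: "n > 0" using e by (metis divide_pos_pos gr0I less_asym of_nat_0 zero_less_numeral)
    have "2 / real n \<le> e" using n e pos by (simp add: field_simps)
    then show ?thesis using bound[OF pos] by simp
  qed
  then have "norm (f (of_real r) - of_real r) \<le> 0" by (rule field_le_epsilon) simp
  then show ?thesis by simp
qed

text \<open>Serves the passage from real-linear to scalar-linear functionals, for which a basis of
  the field over the reals is enough.\<close>

lemma real_or_complex_cases:
  obtains (real) "\<And>c::'k::real_or_complex. \<exists>a. c = of_real a"
  | (complex) i :: "'k::real_or_complex" where "i * i = -1" "\<And>c. \<exists>a b. c = of_real a + i * of_real b"
proof -
  from real_or_complex[where 'a='k] show ?thesis
  proof (elim disjE exE conjE)
    fix f :: "'k \<Rightarrow> real"
    assume R: "bij f" "\<forall>x y. f (x + y) = f x + f y" "\<forall>x y. f (x * y) = f x * f y" "\<forall>x. norm (f x) = norm x"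
    have "c = of_real (f c)" for c
    proof -
      have "f (of_real (f c)) = f c" using field_hom_of_real[of f "f c"] R(2-4) by simp
      then show ?thesis using bij_is_inj[OF R(1)] by (simp add: inj_eq)
    qed
    then show ?thesis by (intro real exI)
  next
    fix f :: "'k \<Rightarrow> complex"
    assume C: "bij f" "\<forall>x y. f (x + y) = f x + f y" "\<forall>x y. f (x * y) = f x * f y" "\<forall>x. norm (f x) = norm x"
    define i where "i = inv f \<i>"
    have fi: "f i = \<i>" unfolding i_def by (rule surj_f_inv_f[OF bij_is_surj[OF C(1)]])
    have of: "f (of_real r) = of_real r" for r
      by (rule field_hom_of_real) (simp_all add: C(2-4))
    have inj: "x = y" if "f x = f y" for x y using bij_is_inj[OF C(1)] that by (rule injD)
    have "f (i * i) = f (of_real (-1))" by (simp only: of C(3) fi) simp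
    then have "i * i = of_real (-1)" by (rule inj)
    then have "i * i = -1" by simp
    moreover have "\<exists>a b. c = of_real a + i * of_real b" for c
    proof -
      have "f c = f (of_real (Re (f c)) + i * of_real (Im (f c)))"
        by (simp only: C(2,3) of fi) (rule complex_eq)
      then show ?thesis using inj by blast
    qed
    ultimately show ?thesis by (rule complex)
  qed
qed

section \<open>The Hahn-Banach theorem\<close>

locale scalar_space = vector_space s
  for s :: "'k::real_or_complex \<Rightarrow> 'a::ab_group_add \<Rightarrow> 'a"
begin

definition sublinear :: "('a \<Rightarrow> real) \<Rightarrow> bool" where
  "sublinear q \<longleftrightarrow> (\<forall>x y. q (x + y) \<le> q x + q y) \<and> (\<forall>t\<ge>0. \<forall>x. q (s (of_real t) x) = t * q x)"

lemma sublinearD: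
  assumes "sublinear q"
  shows "q (x + y) \<le> q x + q y" "t \<ge> 0 \<Longrightarrow> q (s (of_real t) x) = t * q x" "q 0 = 0"
    "- q (- x) \<le> q x"
proof -
  show "q (x + y) \<le> q x + q y" "t \<ge> 0 \<Longrightarrow> q (s (of_real t) x) = t * q x" for x y t
    using assms by (auto simp: sublinear_def)
  show z: "q 0 = 0" using assms[unfolded sublinear_def, THEN conjunct2, rule_format, of 0 0] by simp
  have "q (x + - x) \<le> q x + q (- x)" using assms by (simp only: sublinear_def)
  then show "- q (- x) \<le> q x" using z by simp
qed

text \<open>The infimum lowers \<open>q\<close> as far as is needed along \<open>v\<close>: the
  result is still sublinear, lies below \<open>q\<close>, and is at most \<open>- q v\<close> at
  \<open>- v\<close>.\<close>

definition directional_inf :: "('a \<Rightarrow> real) \<Rightarrow> 'a \<Rightarrow> 'a \<Rightarrow> real" where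
  "directional_inf q v x = (INF t\<in>{0..}. q (x + s (of_real t) v) - t * q v)"

lemma directional_inf_lower:
  assumes q: "sublinear q" and "t \<ge> 0"
  shows "directional_inf q v x \<le> q (x + s (of_real t) v) - t * q v"
  unfolding directional_inf_def
proof (rule cINF_lower)
  have "- q (- x) \<le> q (x + s (of_real t) v) - t * q v" if "t \<ge> 0" for t
  proof -
    have "t * q v = q ((x + s (of_real t) v) + - x)" using sublinearD(2)[OF q that, of v] by simp
    also have "\<dots> \<le> q (x + s (of_real t) v) + q (- x)" by (rule sublinearD(1)[OF q])
    finally show ?thesis by simp
  qed
  then show "bdd_below ((\<lambda>t. q (x + s (of_real t) v) - t * q v) ` {0..})"
    by (intro bdd_belowI2) auto
qed (use assms in simp)

lemma directional_inf_greatest: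
  assumes "\<And>t. t \<ge> 0 \<Longrightarrow> m \<le> q (x + s (of_real t) v) - t * q v"
  shows "m \<le> directional_inf q v x"
  unfolding directional_inf_def by (rule cINF_greatest) (use assms in auto)

lemma sublinear_directional_inf:
  assumes q: "sublinear q"
  shows "sublinear (directional_inf q v)"
proof -
  let ?r = "directional_inf q v"
  have "?r (x + y) \<le> ?r x + ?r y" for x y
  proof -
    have *: "?r (x + y) - (q (x + s (of_real t) v) - t * q v) \<le> q (y + s (of_real u) v) - u * q v"
      if "t \<ge> 0" "u \<ge> 0" for t u
    proof -
      have "?r (x + y) \<le> q (x + y + s (of_real (t + u)) v) - (t + u) * q v"
        by (rule directional_inf_lower) (use q that in auto)
      also have "x + y + s (of_real (t + u)) v = (x + s (of_real t) v) + (y + s (of_real u) v)"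
        by (simp add: scale_left_distrib algebra_simps)
      also have "q \<dots> \<le> q (x + s (of_real t) v) + q (y + s (of_real u) v)" by (rule sublinearD(1)[OF q])
      finally show ?thesis by (simp add: algebra_simps)
    qed
    have "?r (x + y) - (q (x + s (of_real t) v) - t * q v) \<le> ?r y" if "t \<ge> 0" for t
      by (rule directional_inf_greatest) (use * that in blast)
    then have "?r (x + y) - ?r y \<le> ?r x" by (intro directional_inf_greatest) (simp add: algebra_simps)
    then show ?thesis by simp
  qed
  moreover have zero: "?r 0 = 0"
  proof (rule antisym)
    show "?r 0 \<le> 0" using directional_inf_lower[OF q, of 0 v 0] sublinearD(3)[OF q] by simp
    show "0 \<le> ?r 0" by (rule directional_inf_greatest) (simp add: sublinearD(2)[OF q])
  qed
  moreover have le: "t * ?r x \<le> ?r (s (of_real t) x)" if t: "t > 0" for t x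
  proof (rule directional_inf_greatest)
    fix u :: real assume u: "u \<ge> 0"
    have "?r x \<le> q (x + s (of_real (u / t)) v) - u / t * q v"
      by (rule directional_inf_lower) (use q u t in auto)
    then have "t * ?r x \<le> t * q (x + s (of_real (u / t)) v) - u * q v"
      using t by (simp add: field_simps)
    also have "t * q (x + s (of_real (u / t)) v) = q (s (of_real t) (x + s (of_real (u / t)) v))"
      using sublinearD(2)[OF q, of t] t by simp
    also have "s (of_real t) (x + s (of_real (u / t)) v) = s (of_real t) x + s (of_real u) v"
      using t by (simp add: scale_right_distrib)
    finally show "t * ?r x \<le> q (s (of_real t) x + s (of_real u) v) - u * q v" .
  qed
  have "?r (s (of_real t) x) = t * ?r x" if "t \<ge> 0" for t x
  proof (cases "t = 0")
    case False
    then have t: "t > 0" using that by simp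
    have "(1 / t) * ?r (s (of_real t) x) \<le> ?r (s (of_real (1 / t)) (s (of_real t) x))"
      by (rule le) (use t in simp)
    also have "s (of_real (1 / t)) (s (of_real t) x) = x" using t by (simp flip: of_real_mult)
    finally show ?thesis using le[OF t, of x] t by (simp add: field_simps)
  qed (simp add: zero)
  ultimately show ?thesis by (simp add: sublinear_def)
qed

text \<open>A minimal \<open>m\<close> equals each \<open>directional_inf m v\<close>; the choice
  \<open>t = 1\<close> in the infimum gives \<open>m x + m v \<le> m (x + v)\<close>, the reverse of
  subadditivity.\<close>

lemma minimal_sublinear_linear:
  assumes m: "sublinear m" and min: "\<And>q. sublinear q \<Longrightarrow> (\<And>x. q x \<le> m x) \<Longrightarrow> q = m"
  shows "m (x + y) = m x + m y" "m (s (of_real t) x) = t * m x"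
proof -
  have "directional_inf m v = m" for v
  proof (rule min[OF sublinear_directional_inf[OF m]])
    show "directional_inf m v x \<le> m x" for x using directional_inf_lower[OF m, of 0 v x] by simp
  qed
  then have super: "m x \<le> m (x + v) - m v" for x v
    using directional_inf_lower[OF m, of 1 v x] by (metis mult_1 of_real_1 scale_one zero_le_one)
  have add: "m (x + y) = m x + m y" for x y
    using sublinearD(1)[OF m, of x y] super[of x y] by linarith
  then show "m (x + y) = m x + m y" .
  have neg: "m (- x) = - m x" for x using add[of x "-x"] sublinearD(3)[OF m] by simp
  show "m (s (of_real t) x) = t * m x"
  proof (cases "t \<ge> 0")
    case False
    have "m (s (of_real t) x) = m (- s (of_real (- t)) x)" by simp
    also have "\<dots> = t * m x" unfolding neg using sublinearD(2)[OF m, of "- t" x] False by simp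
    finally show ?thesis .
  qed (simp add: sublinearD(2)[OF m])
qed

text \<open>Zorn's lemma, with the pointwise infimum as bound of a chain. The infimum is finite
  because \<open>- p (- x)\<close> bounds every member from below, and subadditive because the
  smaller of two members serves both summands.\<close>

lemma exists_minimal_sublinear:
  assumes p: "sublinear p"
  shows "\<exists>m. sublinear m \<and> (\<forall>x. m x \<le> p x) \<and> (\<forall>q. sublinear q \<longrightarrow> (\<forall>x. q x \<le> m x) \<longrightarrow> q = m)"
proof -
  define A where "A = {q. sublinear q \<and> (\<forall>x. q x \<le> p x)}"
  define R where "R = (\<lambda>(q::'a \<Rightarrow> real) r. \<forall>x. r x \<le> q x)"
  have "\<exists>m\<in>A. \<forall>q\<in>A. R m q \<longrightarrow> q = m"
  proof (rule predicate_Zorn)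
    show "partial_order_on A (relation_of R A)"
    proof (rule partial_order_on_relation_ofI)
      show "R a c" if "R a b" "R b c" for a b c
        unfolding R_def
      proof
        show "c x \<le> a x" for x using that order_trans[of "c x" "b x" "a x"] by (simp add: R_def)
      qed
      show "a = b" if "R a b" "R b a" for a b using that by (simp add: R_def fun_eq_iff order_eq_iff)
    qed (simp add: R_def)
  next
    fix C assume C: "C \<in> Chains (relation_of R A)"
    then have CA: "C \<subseteq> A" by (auto simp: Chains_def relation_of_def)
    have chain: "R q r \<or> R r q" if "q \<in> C" "r \<in> C" for q r
      using C that by (auto simp: Chains_def relation_of_def)
    show "\<exists>u\<in>A. \<forall>q\<in>C. R q u"
    proof (cases "C = {}")
      case True
      then show ?thesis using p by (auto simp: A_def)
    next
      case False
      define u where "u = (\<lambda>x. INF q\<in>C. q x)"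
      have lower: "u x \<le> q x" if "q \<in> C" for q x
        unfolding u_def
      proof (rule cINF_lower[OF _ that])
        have "- p (- x) \<le> q x" if "q \<in> C" for q
        proof -
          have q: "sublinear q" "q (- x) \<le> p (- x)" using CA that by (auto simp: A_def)
          show ?thesis using q(2) sublinearD(4)[OF q(1), of x] by simp
        qed
        then show "bdd_below ((\<lambda>q. q x) ` C)" by (intro bdd_belowI2)
      qed
      have greatest: "m \<le> u x" if "\<And>q. q \<in> C \<Longrightarrow> m \<le> q x" for m x
        unfolding u_def by (rule cINF_greatest) (use False that in auto)
      have sub: "sublinear q" if "q \<in> C" for q using CA that by (auto simp: A_def)
      have "u (x + y) \<le> u x + u y" for x y
      proof -
        have *: "u (x + y) - q x \<le> r y" if "q \<in> C" "r \<in> C" for q r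
          using chain[OF that]
        proof
          assume "R q r"
          then have "r x \<le> q x" by (simp add: R_def)
          then show ?thesis using lower[OF that(2), of "x + y"] sublinearD(1)[OF sub[OF that(2)], of x y] by simp
        next
          assume "R r q"
          then have "q y \<le> r y" by (simp add: R_def)
          then show ?thesis using lower[OF that(1), of "x + y"] sublinearD(1)[OF sub[OF that(1)], of x y] by simp
        qed
        have "u (x + y) - q x \<le> u y" if "q \<in> C" for q by (rule greatest) (use * that in blast)
        then have "u (x + y) - u y \<le> u x" by (intro greatest) (simp add: algebra_simps)
        then show ?thesis by simp
      qed
      moreover have "u (s (of_real t) x) = t * u x" if "t \<ge> 0" for t x
      proof (cases "t = 0")
        case True
        have "u 0 = 0" unfolding u_def using False by (simp add: sublinearD(3)[OF sub])
        then show ?thesis using True by simp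
      next
        case False
        then have t: "t > 0" using that by simp
        have le: "u (s (of_real t) x) \<le> t * q x" if "q \<in> C" for q
          using lower[OF that, of "s (of_real t) x"] sublinearD(2)[OF sub[OF that], of t x] t by simp
        then have "u (s (of_real t) x) / t \<le> u x"
          by (intro greatest) (use t in \<open>simp add: field_simps\<close>)
        moreover have "t * u x \<le> u (s (of_real t) x)"
        proof (rule greatest)
          fix q assume "q \<in> C"
          then show "t * u x \<le> q (s (of_real t) x)"
            using lower[of q x] sublinearD(2)[OF sub, of q t x] t by simp
        qed
        ultimately show ?thesis using t by (simp add: field_simps)
      qed
      moreover have "u x \<le> p x" for x
      proof -
        obtain q where "q \<in> C" using False by blast
        then have "u x \<le> q x" "q x \<le> p x" using lower[of q x] CA by (auto simp: A_def)
        then show ?thesis by simp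
      qed
      ultimately have "u \<in> A" by (simp add: A_def sublinear_def)
      then show ?thesis using lower by (intro bexI[of _ u]) (auto simp: R_def)
    qed
  qed
  then obtain m where m: "m \<in> A" and min: "\<And>q. q \<in> A \<Longrightarrow> R m q \<Longrightarrow> q = m" by blast
  have "q = m" if "sublinear q" "\<forall>x. q x \<le> m x" for q
  proof (rule min)
    have "q x \<le> p x" for x
      using m that(2) order_trans[of "q x" "m x" "p x"] by (auto simp: A_def)
    then show "q \<in> A" using that(1) by (simp add: A_def)
  qed (use that(2) in \<open>simp add: R_def\<close>)
  then show ?thesis using m by (auto simp: A_def)
qed

text \<open>Minimising below \<open>directional_inf p v\<close> instead of \<open>p\<close> fixes
  the value at \<open>v\<close>: it forces \<open>g (- v) \<le> - p v\<close>, while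
  \<open>g v \<le> p v\<close> holds anyway.\<close>

lemma real_Hahn_Banach:
  assumes p: "sublinear p"
  shows "\<exists>g. (\<forall>x y. g (x + y) = g x + g y) \<and> (\<forall>t x. g (s (of_real t) x) = t * g x) \<and>
    (\<forall>x. g x \<le> p x) \<and> g v = p v"
proof -
  obtain g where g: "sublinear g" and le: "\<And>x. g x \<le> directional_inf p v x"
    and min: "\<And>q. sublinear q \<Longrightarrow> (\<And>x. q x \<le> g x) \<Longrightarrow> q = g"
    using exists_minimal_sublinear[OF sublinear_directional_inf[OF p]] by metis
  note lin = minimal_sublinear_linear[OF g min]
  have gp: "g x \<le> p x" for x
    using le[of x] directional_inf_lower[OF p, of 0 v x] by simp
  have "g (- v) \<le> p (- v + s (of_real 1) v) - 1 * p v"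
    using le[of "- v"] directional_inf_lower[OF p, of 1 v "- v"] by simp
  then have "- g v \<le> - p v" using lin(1)[of v "- v"] sublinearD(3)[OF g] sublinearD(3)[OF p] by simp
  then have "g v = p v" using gp[of v] by simp
  then show ?thesis using lin gp by blast
qed

end

section \<open>Seminorms and scalar functionals on a subspace\<close>

definition seminorm_on ::
  "('k::real_normed_field \<Rightarrow> 'a::ab_group_add \<Rightarrow> 'a) \<Rightarrow> 'a set \<Rightarrow> ('a \<Rightarrow> real) \<Rightarrow> bool" where
  "seminorm_on s U p \<longleftrightarrow>
     (\<forall>x\<in>U. \<forall>y\<in>U. p (x + y) \<le> p x + p y) \<and> (\<forall>c. \<forall>x\<in>U. p (s c x) = norm c * p x)"

lemma linear_betweenD:
  assumes "linear_between s s' U f"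
  shows "x \<in> U \<Longrightarrow> y \<in> U \<Longrightarrow> f (x + y) = f x + f y" "x \<in> U \<Longrightarrow> f (s c x) = s' c (f x)"
  using assms by (auto simp: linear_between_def)

context scalar_space
begin

context
  fixes U assumes U: "subspace U"
begin

lemma seminorm_onD:
  assumes p: "seminorm_on s U p"
  shows "x \<in> U \<Longrightarrow> y \<in> U \<Longrightarrow> p (x + y) \<le> p x + p y"
    and "x \<in> U \<Longrightarrow> p (s c x) = norm c * p x"
    and "p 0 = 0"
    and "x \<in> U \<Longrightarrow> p (- x) = p x"
    and "x \<in> U \<Longrightarrow> y \<in> U \<Longrightarrow> p (x - y) = p (y - x)"
    and "x \<in> U \<Longrightarrow> p x \<ge> 0"
    and "x \<in> U \<Longrightarrow> y \<in> U \<Longrightarrow> p (x - y) \<le> p x + p y"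
proof -
  show add: "p (x + y) \<le> p x + p y" if "x \<in> U" "y \<in> U" for x y
    using p that by (auto simp: seminorm_on_def)
  show scale: "p (s c x) = norm c * p x" if "x \<in> U" for x c
    using p that by (auto simp: seminorm_on_def)
  show zero: "p 0 = 0" using scale[of 0 0] subspace_0[OF U] by simp
  show minus: "p (- x) = p x" if "x \<in> U" for x using scale[OF that, of "-1"] by simp
  show "p (x - y) = p (y - x)" if "x \<in> U" "y \<in> U" for x y
    using minus[of "x - y"] subspace_diff[OF U that] by simp
  show "p x \<ge> 0" if "x \<in> U" for x
    using add[of x "-x"] minus[OF that] zero subspace_neg[OF U] that by simp
  show "p (x - y) \<le> p x + p y" if "x \<in> U" "y \<in> U" for x y
    using add[of x "- y"] minus[of y] subspace_neg[OF U] that by simp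
qed

lemma seminorm_on_sum:
  assumes p: "seminorm_on s U p" and "\<And>i. i \<in> A \<Longrightarrow> g i \<in> U"
  shows "p (sum g A) \<le> (\<Sum>i\<in>A. p (g i))"
  using assms(2)
proof (induction A rule: infinite_finite_induct)
  case (insert i A)
  then have "p (g i + sum g A) \<le> p (g i) + p (sum g A)"
    by (intro seminorm_onD(1)[OF p] subspace_sum[OF U]) auto
  then show ?case using insert by auto
qed (auto simp: seminorm_onD(3)[OF p])

lemma linear_between_facts:
  assumes f: "linear_between s (*) U f"
  shows "f 0 = 0" "x \<in> U \<Longrightarrow> f (- x) = - f x" "x \<in> U \<Longrightarrow> y \<in> U \<Longrightarrow> f (x - y) = f x - f y"
    "(\<And>i. i \<in> A \<Longrightarrow> g i \<in> U) \<Longrightarrow> f (sum g A) = (\<Sum>i\<in>A. f (g i))"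
proof -
  show zero: "f 0 = 0" using linear_betweenD(2)[OF f, of 0 0] subspace_0[OF U] by simp
  show neg: "f (- x) = - f x" if "x \<in> U" for x
    using linear_betweenD(2)[OF f that, of "-1"] by simp
  show "f (x - y) = f x - f y" if "x \<in> U" "y \<in> U" for x y
    using linear_betweenD(1)[OF f that(1), of "- y"] neg[OF that(2)] subspace_neg[OF U that(2)] by simp
  show "f (sum g A) = (\<Sum>i\<in>A. f (g i))" if "\<And>i. i \<in> A \<Longrightarrow> g i \<in> U"
    using that
  proof (induction A rule: infinite_finite_induct)
    case (insert i A)
    have "sum g A \<in> U" by (intro subspace_sum[OF U]) (use insert in auto)
    then show ?case using insert linear_betweenD(1)[OF f, of "g i" "sum g A"] by auto
  qed (auto simp: zero)
qed

lemma seminorm_on_norm_linear: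
  "linear_between s (*) U f \<Longrightarrow> seminorm_on s U (\<lambda>x. norm (f x))"
  by (auto simp: linear_between_def seminorm_on_def norm_mult norm_triangle_ineq)

lemma Hahn_Banach_functional:
  assumes p: "seminorm_on s U p" and v: "v \<in> U" "p v > 0"
  shows "\<exists>f C. linear_between s (*) U f \<and> (\<forall>x\<in>U. norm (f x) \<le> C * p x) \<and> f v = 1"
proof -
  interpret vector_space_pair s s ..
  obtain B where B: "B \<subseteq> U" "independent B" "U \<subseteq> span B" using basis_exists[of U] by metis
  \<comment> \<open>The sublinear theorem concerns functionals on the whole type; an algebraic
    projection onto \<open>U\<close> carries \<open>p\<close> over to it.\<close>
  obtain \<pi> where \<pi>: "Vector_Spaces.linear s s \<pi>" "\<And>x. x \<in> B \<Longrightarrow> \<pi> x = x" "range \<pi> = span ((\<lambda>x. x) ` B)"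
    using linear_independent_extend_subspace[OF B(2), of "\<lambda>x. x"] by blast
  interpret \<pi>: Vector_Spaces.linear s s \<pi> by (rule \<pi>(1))
  have \<pi>U: "\<pi> x \<in> U" for x using \<pi>(3) span_minimal[OF B(1) U] by auto
  have \<pi>id: "\<pi> x = x" if "x \<in> U" for x
    by (rule linear_eq_on[OF \<pi>(1) linear_ident subsetD[OF B(3) that] \<pi>(2)])
  define q where "q = (\<lambda>x. p (\<pi> x))"
  have "sublinear q"
    unfolding sublinear_def q_def
    by (auto simp: \<pi>.add \<pi>.scale seminorm_onD(1,2)[OF p] \<pi>U)
  then obtain g where g: "\<And>x y. g (x + y) = g x + g y" "\<And>t x. g (s (of_real t) x) = t * g x"
    "\<And>x. g x \<le> q x" "g v = q v"
    using real_Hahn_Banach[of q v] by blast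
  have g_abs: "\<bar>g x\<bar> \<le> p x" if "x \<in> U" for x
  proof -
    have "g (- x) = - g x" using g(2)[of "-1" x] by simp
    then show ?thesis
      using g(3)[of x] g(3)[of "-x"] \<pi>id[OF that] seminorm_onD(4)[OF p that] by (auto simp: q_def \<pi>.neg)
  qed
  have gv: "g v > 0" using g(4) v by (simp add: q_def \<pi>id)
  have "\<exists>f C. linear_between s (*) U f \<and> (\<forall>x\<in>U. norm (f x) \<le> C * p x) \<and> f v \<noteq> (0::'k)"
  proof (cases rule: real_or_complex_cases[where 'k='k])
    case real
    define f where "f = (\<lambda>x. of_real (g x) :: 'k)"
    have "f (s c x) = c * f x" for c x
      using real[of c] by (auto simp: f_def g(2))
    then have "linear_between s (*) U f" by (auto simp: linear_between_def f_def g)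
    moreover have "norm (f x) \<le> 1 * p x" if "x \<in> U" for x
      using g_abs[OF that] by (simp add: f_def)
    ultimately show ?thesis using gv by (intro exI[of _ f] exI[of _ 1]) (auto simp: f_def)
  next
    case (complex i)
    have norm_i: "norm i = 1"
    proof -
      have "norm i * norm i = 1" using complex(1) by (metis norm_minus_cancel norm_mult norm_one)
      then show ?thesis by (metis abs_norm_cancel abs_1 real_sqrt_mult_self real_sqrt_abs2 real_sqrt_one)
    qed
    \<comment> \<open>The standard complexification, with \<open>g\<close> as real part. The crude
      bound \<open>2 * p\<close> is enough, since only some constant is claimed.\<close>
    define f where "f = (\<lambda>x. of_real (g x) - i * of_real (g (s i x)) :: 'k)"
    have add: "f (x + y) = f x + f y" for x y by (simp add: f_def g scale_right_distrib algebra_simps)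
    have re: "f (s (of_real a) x) = of_real a * f x" for a x
    proof -
      have "s i (s (of_real a) x) = s (of_real a) (s i x)" by (simp add: mult.commute)
      then show ?thesis by (simp only: f_def g(2)) (simp add: algebra_simps)
    qed
    have im: "f (s i x) = i * f x" for x
    proof -
      have "s i (s i x) = s (of_real (-1)) x" using complex(1) by simp
      then have "f (s i x) = of_real (g (s i x)) + i * of_real (g x)"
        unfolding f_def by (simp only: g(2)) simp
      also have "\<dots> = i * f x" using complex(1) by (simp add: f_def algebra_simps flip: mult.assoc)
      finally show ?thesis .
    qed
    have "f (s c x) = c * f x" for c x
    proof -
      obtain a b where c: "c = of_real a + i * of_real b" using complex(2) by blast
      have "s c x = s (of_real a) x + s i (s (of_real b) x)" by (simp add: c scale_left_distrib)
      then have "f (s c x) = of_real a * f x + i * (of_real b * f x)" by (simp only: add re im)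
      then show ?thesis by (simp add: c algebra_simps)
    qed
    then have "linear_between s (*) U f" by (auto simp: linear_between_def add)
    moreover have "norm (f x) \<le> 2 * p x" if "x \<in> U" for x
    proof -
      have "norm (f x) \<le> \<bar>g x\<bar> + \<bar>g (s i x)\<bar>"
        unfolding f_def by (rule order_trans[OF norm_triangle_ineq4]) (simp add: norm_mult norm_i)
      also have "\<dots> \<le> p x + p (s i x)"
        by (intro add_mono g_abs that subspace_scale[OF U])
      finally show ?thesis by (simp add: seminorm_onD(2)[OF p that] norm_i)
    qed
    moreover have "f v \<noteq> 0"
    proof
      \<comment> \<open>Real and imaginary parts are not at hand in the abstract field; squaring
        turns \<open>i\<close> into -1 and leaves a clash of signs.\<close>
      assume "f v = 0"
      then have "of_real (g v) = i * of_real (g (s i v))" by (simp add: f_def)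
      then have "of_real (g v * g v) = i * i * of_real (g (s i v) * g (s i v))" by (simp add: algebra_simps)
      then have "(of_real (g v * g v) :: 'k) = of_real (- (g (s i v) * g (s i v)))" using complex(1) by simp
      then have "g v * g v = - (g (s i v) * g (s i v))" by (simp only: of_real_eq_iff)
      moreover have "g v * g v > 0" using gv by simp
      moreover have "g (s i v) * g (s i v) \<ge> 0" by simp
      ultimately show False by linarith
    qed
    ultimately show ?thesis by blast
  qed
  then obtain f :: "'a \<Rightarrow> 'k" and C where f: "linear_between s (*) U f"
    "\<And>x. x \<in> U \<Longrightarrow> norm (f x) \<le> C * p x" "f v \<noteq> 0" by blast
  have "linear_between s (*) U (\<lambda>x. f x / f v)"
    using f(1) by (auto simp: linear_between_def add_divide_distrib)
  moreover have "norm (f x / f v) \<le> C / norm (f v) * p x" if "x \<in> U" for x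
    using f(2)[OF that] f(3) by (simp add: norm_divide divide_right_mono)
  ultimately show ?thesis using f(3) by (intro exI[of _ "\<lambda>x. f x / f v"] exI[of _ "C / norm (f v)"]) simp
qed

end

end

section \<open>Topologies generated by seminorms\<close>

text \<open>Single unit balls suffice as neighbourhoods because the families in use are closed under
  sums and positive multiples.\<close>

definition seminorm_topology :: "'a::ab_group_add set \<Rightarrow> ('a \<Rightarrow> real) set \<Rightarrow> 'a topology" where
  "seminorm_topology U P =
     topology (\<lambda>W. W \<subseteq> U \<and> (\<forall>x\<in>W. \<exists>p\<in>P. \<forall>y\<in>U. p (y - x) < 1 \<longrightarrow> y \<in> W))"

text \<open>The closure conditions make \<open>P\<close> the set of all continuous seminorms rather
  than a mere generating family, so that continuity of a linear map amounts to membership of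
  pulled-back seminorms in \<open>P\<close>.\<close>

locale seminorm_space = scalar_space s
  for s :: "'k::real_or_complex \<Rightarrow> 'a::ab_group_add \<Rightarrow> 'a" +
  fixes U :: "'a set" and P :: "('a \<Rightarrow> real) set"
  assumes subspace_U: "subspace U"
    and seminorm: "p \<in> P \<Longrightarrow> seminorm_on s U p"
    and zero_in_P: "(\<lambda>x. 0) \<in> P"
    and add_in_P: "p \<in> P \<Longrightarrow> q \<in> P \<Longrightarrow> (\<lambda>x. p x + q x) \<in> P"
    and dominated_in_P: "p \<in> P \<Longrightarrow> seminorm_on s U q \<Longrightarrow> (\<And>x. x \<in> U \<Longrightarrow> q x \<le> C * p x) \<Longrightarrow> q \<in> P"
begin

lemmas sn_add = seminorm_onD(1)[OF subspace_U seminorm]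
  and sn_scale = seminorm_onD(2)[OF subspace_U seminorm]
  and sn_zero = seminorm_onD(3)[OF subspace_U seminorm]
  and sn_minus = seminorm_onD(4)[OF subspace_U seminorm]
  and sn_diff_commute = seminorm_onD(5)[OF subspace_U seminorm]
  and sn_nonneg = seminorm_onD(6)[OF subspace_U seminorm]
  and sn_diff = seminorm_onD(7)[OF subspace_U seminorm]
  and sn_sum = seminorm_on_sum[OF subspace_U seminorm]

lemmas U_zero = subspace_0[OF subspace_U] and U_add = subspace_add[OF subspace_U]
  and U_diff = subspace_diff[OF subspace_U] and U_scale = subspace_scale[OF subspace_U]
  and U_minus = subspace_neg[OF subspace_U] and U_sum = subspace_sum[OF subspace_U]

lemma sn_triangle:
  assumes "p \<in> P" "x \<in> U" "y \<in> U" "z \<in> U"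
  shows "p (x - z) \<le> p (x - y) + p (y - z)"
  using sn_add[OF assms(1) U_diff[OF assms(2,3)] U_diff[OF assms(3,4)]] by simp

lemma scaled_in_P: "p \<in> P \<Longrightarrow> C \<ge> 0 \<Longrightarrow> (\<lambda>x. C * p x) \<in> P"
  by (rule dominated_in_P[where p=p and C=C])
    (auto simp: seminorm_on_def sn_scale distrib_left[symmetric] intro!: mult_left_mono sn_add)

abbreviation X where "X \<equiv> seminorm_topology U P"

lemma openin_X: "openin X W \<longleftrightarrow> W \<subseteq> U \<and> (\<forall>x\<in>W. \<exists>p\<in>P. \<forall>y\<in>U. p (y - x) < 1 \<longrightarrow> y \<in> W)"
proof -
  let ?R = "\<lambda>W. W \<subseteq> U \<and> (\<forall>x\<in>W. \<exists>p\<in>P. \<forall>y\<in>U. p (y - x) < 1 \<longrightarrow> y \<in> W)"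
  have "istopology ?R"
    unfolding istopology_def
  proof (intro conjI allI impI)
    fix S T assume S: "?R S" and T: "?R T"
    show "S \<inter> T \<subseteq> U" using S by blast
    show "\<forall>x\<in>S \<inter> T. \<exists>p\<in>P. \<forall>y\<in>U. p (y - x) < 1 \<longrightarrow> y \<in> S \<inter> T"
    proof
      fix x assume x: "x \<in> S \<inter> T"
      then obtain p q where p: "p \<in> P" "\<forall>y\<in>U. p (y - x) < 1 \<longrightarrow> y \<in> S"
        and q: "q \<in> P" "\<forall>y\<in>U. q (y - x) < 1 \<longrightarrow> y \<in> T"
        using S T by blast
      have xU: "x \<in> U" using x S by blast
      have "y \<in> S \<inter> T" if "y \<in> U" "p (y - x) + q (y - x) < 1" for y
      proof -
        have "p (y - x) \<ge> 0" "q (y - x) \<ge> 0" using sn_nonneg p(1) q(1) U_diff[OF that(1) xU] by auto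
        then show ?thesis using that p q by auto
      qed
      then show "\<exists>p\<in>P. \<forall>y\<in>U. p (y - x) < 1 \<longrightarrow> y \<in> S \<inter> T"
        by (intro bexI[OF _ add_in_P[OF p(1) q(1)]]) simp
    qed
  next
    fix \<K> assume "\<forall>K\<in>\<K>. ?R K"
    then show "\<Union>\<K> \<subseteq> U" "\<forall>x\<in>\<Union>\<K>. \<exists>p\<in>P. \<forall>y\<in>U. p (y - x) < 1 \<longrightarrow> y \<in> \<Union>\<K>"
      by (blast, meson UnionE UnionI)
  qed
  then show ?thesis by (simp add: seminorm_topology_def topology_inverse')
qed

lemma topspace_X [simp]: "topspace X = U"
proof
  show "topspace X \<subseteq> U" using openin_X openin_topspace by blast
  have "openin X U" unfolding openin_X by (intro conjI ballI bexI[OF _ zero_in_P]) auto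
  then show "U \<subseteq> topspace X" by (rule openin_subset)
qed

lemma openin_ball:
  assumes "p \<in> P" "x \<in> U"
  shows "openin X {y \<in> U. p (y - x) < e}"
  unfolding openin_X
proof (intro conjI ballI)
  fix z assume "z \<in> {y \<in> U. p (y - x) < e}"
  then have z: "z \<in> U" "p (z - x) < e" by auto
  define d where "d = e - p (z - x)"
  have d: "d > 0" using z by (simp add: d_def)
  have "y \<in> {y \<in> U. p (y - x) < e}" if "y \<in> U" "1 / d * p (y - z) < 1" for y
    using sn_triangle[OF assms(1) that(1) z(1) assms(2)] that d by (simp add: d_def)
  then show "\<exists>q\<in>P. \<forall>y\<in>U. q (y - z) < 1 \<longrightarrow> y \<in> {y \<in> U. p (y - x) < e}"
    using scaled_in_P[OF assms(1), of "1 / d"] d by (intro bexI[of _ "\<lambda>x. 1 / d * p x"]) auto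
qed auto

lemma in_closure_iff:
  assumes "A \<subseteq> U"
  shows "x \<in> X closure_of A \<longleftrightarrow> x \<in> U \<and> (\<forall>p\<in>P. \<forall>e>0. \<exists>y\<in>A. p (y - x) < e)"
proof
  assume x: "x \<in> X closure_of A"
  then have xU: "x \<in> U" using closure_of_subset_topspace[of X A] by auto
  moreover have "\<exists>y\<in>A. p (y - x) < e" if pe: "p \<in> P" "e > 0" for p e
  proof -
    have "x \<in> {y \<in> U. p (y - x) < e}" using xU pe sn_zero[OF pe(1)] by simp
    then obtain y where "y \<in> A" "y \<in> {y \<in> U. p (y - x) < e}"
      using x openin_ball[OF pe(1) xU, of e] by (meson in_closure_of)
    then show ?thesis by auto
  qed
  ultimately show "x \<in> U \<and> (\<forall>p\<in>P. \<forall>e>0. \<exists>y\<in>A. p (y - x) < e)" by blast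
next
  assume x: "x \<in> U \<and> (\<forall>p\<in>P. \<forall>e>0. \<exists>y\<in>A. p (y - x) < e)"
  show "x \<in> X closure_of A"
    unfolding in_closure_of
  proof (intro conjI allI impI)
    fix T assume "x \<in> T \<and> openin X T"
    then obtain p where "p \<in> P" "\<forall>y\<in>U. p (y - x) < 1 \<longrightarrow> y \<in> T" unfolding openin_X by blast
    then show "\<exists>y. y \<in> A \<and> y \<in> T" using x assms by (metis subsetD zero_less_one)
  qed (use x in simp)
qed

lemma locally_convex_X: "locally_convex_space s X"
  unfolding locally_convex_space_def topspace_X
proof (intro conjI allI impI)
  show "subspace U" by (rule subspace_U)
  show "continuous_map (prod_topology X X) X (\<lambda>(x, y). x + y)"
    unfolding continuous_map topspace_prod_topology topspace_X
  proof (intro conjI allI impI)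
    fix W assume "openin X W"
    then have W: "W \<subseteq> U" "\<And>x. x \<in> W \<Longrightarrow> \<exists>p\<in>P. \<forall>y\<in>U. p (y - x) < 1 \<longrightarrow> y \<in> W" by (auto simp: openin_X)
    show "openin (prod_topology X X) {z \<in> U \<times> U. (case z of (x, y) \<Rightarrow> x + y) \<in> W}"
      unfolding openin_prod_topology_alt
    proof (intro allI impI)
      fix x y assume "(x, y) \<in> {z \<in> U \<times> U. (case z of (x, y) \<Rightarrow> x + y) \<in> W}"
      then have xy: "x \<in> U" "y \<in> U" "x + y \<in> W" by auto
      then obtain p where p: "p \<in> P" "\<And>z. z \<in> U \<Longrightarrow> p (z - (x + y)) < 1 \<Longrightarrow> z \<in> W" using W(2) by blast
      have "{z \<in> U. p (z - x) < 1/2} \<times> {z \<in> U. p (z - y) < 1/2} \<subseteq>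
          {z \<in> U \<times> U. (case z of (x, y) \<Rightarrow> x + y) \<in> W}"
      proof clarify
        fix a b assume ab: "a \<in> U" "p (a - x) < 1/2" "b \<in> U" "p (b - y) < 1/2"
        have "p ((a - x) + (b - y)) \<le> p (a - x) + p (b - y)"
          by (intro sn_add p U_diff ab xy)
        also have "(a - x) + (b - y) = (a + b) - (x + y)" by simp
        finally have "p ((a + b) - (x + y)) < 1" using ab by simp
        then show "(a, b) \<in> U \<times> U \<and> a + b \<in> W" using p(2) U_add ab by auto
      qed
      moreover have "x \<in> {z \<in> U. p (z - x) < 1/2}" "y \<in> {z \<in> U. p (z - y) < 1/2}"
        using xy sn_zero[OF p(1)] by auto
      ultimately show "\<exists>A B. openin X A \<and> openin X B \<and> x \<in> A \<and> y \<in> B \<and>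
          A \<times> B \<subseteq> {z \<in> U \<times> U. (case z of (x, y) \<Rightarrow> x + y) \<in> W}"
        using openin_ball[OF p(1)] xy by meson
    qed
  qed (auto simp: U_add)
  show "continuous_map (prod_topology euclidean X) X (\<lambda>(c, x). s c x)"
    unfolding continuous_map topspace_prod_topology topspace_X
  proof (intro conjI allI impI)
    fix W assume "openin X W"
    then have W: "W \<subseteq> U" "\<And>x. x \<in> W \<Longrightarrow> \<exists>p\<in>P. \<forall>y\<in>U. p (y - x) < 1 \<longrightarrow> y \<in> W" by (auto simp: openin_X)
    show "openin (prod_topology euclidean X)
        {z \<in> topspace euclidean \<times> U. (case z of (c, x) \<Rightarrow> s c x) \<in> W}"
      unfolding openin_prod_topology_alt
    proof (intro allI impI)
      fix c x assume "(c, x) \<in> {z \<in> topspace euclidean \<times> U. (case z of (c, x) \<Rightarrow> s c x) \<in> W}"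
      then have cx: "x \<in> U" "s c x \<in> W" by auto
      then obtain p where p: "p \<in> P" "\<And>z. z \<in> U \<Longrightarrow> p (z - s c x) < 1 \<Longrightarrow> z \<in> W" using W(2) by blast
      have px: "p x \<ge> 0" using sn_nonneg[OF p(1) cx(1)] .
      \<comment> \<open>Radii for the splitting
        \<open>s b a - s c x = s (b - c) a + s c (a - x)\<close>: near \<open>x\<close> one has
        \<open>p a \<le> 1 + p x\<close>, so each summand contributes at most one half.\<close>
      define d where "d = 1 / (2 * (1 + p x))"
      define e where "e = min 1 (1 / (2 * (1 + norm c)))"
      have d: "d > 0" "d * (1 + p x) = 1/2" using px by (auto simp: d_def field_simps)
      have e: "e > 0" "e \<le> 1" "norm c * e \<le> 1/2"
      proof -
        show e0: "e > 0" "e \<le> 1" by (auto simp: e_def add_pos_nonneg)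
        have "norm c * e \<le> norm c * (1 / (2 * (1 + norm c)))" by (intro mult_left_mono) (auto simp: e_def)
        also have "\<dots> \<le> 1/2"
        proof -
          have "1 + norm c > 0" by (simp add: add_pos_nonneg)
          then show ?thesis by (simp add: field_simps)
        qed
        finally show "norm c * e \<le> 1/2" .
      qed
      have "ball c d \<times> {z \<in> U. p (z - x) < e} \<subseteq>
          {z \<in> topspace euclidean \<times> U. (case z of (c, x) \<Rightarrow> s c x) \<in> W}"
      proof clarify
        fix b a assume ab: "b \<in> ball c d" "a \<in> U" "p (a - x) < e"
        have bc: "norm (b - c) < d" using ab(1) by (simp add: dist_norm norm_minus_commute)
        have pax: "p (a - x) \<ge> 0" using sn_nonneg[OF p(1)] U_diff ab cx by blast
        have "s b a - s c x = s (b - c) ((a - x) + x) + s c (a - x)"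
          by (simp add: scale_left_diff_distrib scale_right_diff_distrib)
        then have "p (s b a - s c x) \<le> p (s (b - c) ((a - x) + x)) + p (s c (a - x))"
          using sn_add[OF p(1), of "s (b - c) ((a - x) + x)" "s c (a - x)"] U_scale U_diff ab cx by simp
        also have "\<dots> \<le> norm (b - c) * p ((a - x) + x) + norm c * p (a - x)"
          by (metis U_diff ab(2) add.commute add_diff_cancel_left' cx(1) diff_add_cancel order_refl p(1) sn_scale)
        also have "p ((a - x) + x) \<le> 1 + p x"
          using sn_add[OF p(1), of "a - x" x] U_diff ab cx e by force
        also have "norm (b - c) * (1 + p x) + norm c * p (a - x) < d * (1 + p x) + norm c * e"
        proof (rule add_less_le_mono)
          show "norm (b - c) * (1 + p x) < d * (1 + p x)" using bc px by (intro mult_strict_right_mono) auto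
          show "norm c * p (a - x) \<le> norm c * e" using ab by (intro mult_left_mono) auto
        qed
        also have "\<dots> \<le> 1" using d e by simp
        finally have "p (s b a - s c x) < 1" by (simp add: mult_left_mono)
        then show "(b, a) \<in> topspace euclidean \<times> U \<and> s b a \<in> W" using p(2) U_scale ab by auto
      qed
      moreover have "c \<in> ball c d" "x \<in> {z \<in> U. p (z - x) < e}"
        using cx sn_zero[OF p(1)] d e by auto
      moreover have "openin euclidean (ball c d)" by simp
      ultimately show "\<exists>A B. openin euclidean A \<and> openin X B \<and> c \<in> A \<and> x \<in> B \<and>
          A \<times> B \<subseteq> {z \<in> topspace euclidean \<times> U. (case z of (c, x) \<Rightarrow> s c x) \<in> W}"
        using openin_ball[OF p(1) cx(1)] by meson
    qed
  qed (auto simp: U_scale)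
next
  fix W assume "openin X W \<and> 0 \<in> W"
  then obtain p where p: "p \<in> P" "\<And>y. y \<in> U \<Longrightarrow> p y < 1 \<Longrightarrow> y \<in> W" by (force simp: openin_X)
  let ?C = "{y \<in> U. p (y - 0) < 1}"
  have "convex_set s ?C"
    unfolding convex_set_def
  proof (intro ballI)
    fix x y t assume xy: "x \<in> ?C" "y \<in> ?C" and t: "t \<in> {0..1::real}"
    have "p (s (of_real (1 - t)) x + s (of_real t) y) \<le> p (s (of_real (1 - t)) x) + p (s (of_real t) y)"
      using xy by (intro sn_add p U_scale) auto
    also have "\<dots> = (1 - t) * p x + t * p y"
    proof -
      have "norm (of_real (1 - t) :: 'k) = 1 - t" "norm (of_real t :: 'k) = t"
        using t by (auto simp del: of_real_diff)
      then show ?thesis using xy by (simp add: sn_scale[OF p(1)] del: of_real_diff)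
    qed
    also have "\<dots> < 1" using xy t by (intro convex_bound_lt) auto
    finally show "s (of_real (1 - t)) x + s (of_real t) y \<in> ?C"
      using xy by (auto simp: U_add U_scale)
  qed
  moreover have "0 \<in> ?C" using sn_zero[OF p(1)] U_zero by simp
  ultimately show "\<exists>C. openin X C \<and> convex_set s C \<and> 0 \<in> C \<and> C \<subseteq> W"
    using openin_ball[OF p(1) U_zero, of 1] p(2) by (intro exI[of _ ?C]) auto
qed

lemma Hausdorff_X: "Hausdorff_space X \<longleftrightarrow> (\<forall>x\<in>U. x \<noteq> 0 \<longrightarrow> (\<exists>p\<in>P. p x > 0))"
proof
  assume H: "Hausdorff_space X"
  show "\<forall>x\<in>U. x \<noteq> 0 \<longrightarrow> (\<exists>p\<in>P. p x > 0)"
  proof (intro ballI impI)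
    fix x assume x: "x \<in> U" "x \<noteq> 0"
    have "closedin X {x}" by (rule closedin_Hausdorff_singleton[OF H]) (simp add: x)
    then have "openin X (U - {x})" using openin_diff[OF openin_topspace, of X] by simp
    moreover have "0 \<in> U - {x}" using x U_zero by auto
    ultimately have "\<exists>p\<in>P. \<forall>y\<in>U. p (y - 0) < 1 \<longrightarrow> y \<in> U - {x}" by (simp only: openin_X)
    then obtain p where p: "p \<in> P" "\<forall>y\<in>U. p (y - 0) < 1 \<longrightarrow> y \<in> U - {x}" by meson
    then have "\<not> p x < 1" using x by auto
    then show "\<exists>p\<in>P. p x > 0" using p by (intro bexI[of _ p]) auto
  qed
next
  assume sep: "\<forall>x\<in>U. x \<noteq> 0 \<longrightarrow> (\<exists>p\<in>P. p x > 0)"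
  show "Hausdorff_space X"
    unfolding Hausdorff_space_def topspace_X
  proof (intro allI impI)
    fix x y assume xy: "x \<in> U \<and> y \<in> U \<and> x \<noteq> y"
    then have "x - y \<in> U" "x - y \<noteq> 0" using U_diff by auto
    then obtain p where p: "p \<in> P" "p (x - y) > 0" using sep by meson
    let ?e = "p (x - y) / 2"
    have "disjnt {z \<in> U. p (z - x) < ?e} {z \<in> U. p (z - y) < ?e}"
      unfolding disjnt_iff
    proof (intro allI notI)
      fix z assume "z \<in> {z \<in> U. p (z - x) < ?e} \<and> z \<in> {z \<in> U. p (z - y) < ?e}"
      then show False using sn_triangle[OF p(1), of x z y] sn_diff_commute[OF p(1), of x z] xy by auto
    qed
    moreover have "x \<in> {z \<in> U. p (z - x) < ?e}" "y \<in> {z \<in> U. p (z - y) < ?e}"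
      using xy p sn_zero[OF p(1)] by auto
    ultimately show "\<exists>A B. openin X A \<and> openin X B \<and> x \<in> A \<and> y \<in> B \<and> disjnt A B"
      using openin_ball[OF p(1), of x ?e] openin_ball[OF p(1), of y ?e] xy by (meson conjunct1 conjunct2)
  qed
qed

lemma continuous_map_from_X:
  assumes f: "linear_between s s' U f" and "f ` U \<subseteq> topspace Z"
    and "\<And>W x. openin Z W \<Longrightarrow> x \<in> U \<Longrightarrow> f x \<in> W \<Longrightarrow> \<exists>p\<in>P. \<forall>y\<in>U. p (y - x) < 1 \<longrightarrow> f y \<in> W"
  shows "continuous_map X Z f"
  unfolding continuous_map topspace_X
proof (intro conjI allI impI)
  fix W assume W: "openin Z W"
  show "openin X {x \<in> U. f x \<in> W}"
    unfolding openin_X using assms(3)[OF W] by auto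
qed (use assms(2) in auto)

end

lemma continuous_map_seminorm:
  assumes X: "seminorm_space s U P" and Z: "seminorm_space s' U' P'"
    and f: "linear_between s s' U f" and img: "f ` U \<subseteq> U'"
    and pull: "\<And>q. q \<in> P' \<Longrightarrow> (\<lambda>x. q (f x)) \<in> P"
  shows "continuous_map (seminorm_topology U P) (seminorm_topology U' P') f"
proof -
  interpret X: seminorm_space s U P by (rule X)
  interpret Z: seminorm_space s' U' P' by (rule Z)
  have diff: "f (y - x) = f y - f x" if "x \<in> U" "y \<in> U" for x y
  proof -
    have "f (s (-1) x) = s' (-1) (f x)" using linear_betweenD(2)[OF f that(1)] .
    then have "f (- x) = - f x" by simp
    then show ?thesis using linear_betweenD(1)[OF f that(2), of "- x"] X.U_minus[OF that(1)] by simp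
  qed
  show ?thesis
  proof (rule X.continuous_map_from_X[OF f])
    fix W x assume "openin Z.X W" "x \<in> U" "f x \<in> W"
    then obtain q where "q \<in> P'" "\<And>y. y \<in> U' \<Longrightarrow> q (y - f x) < 1 \<Longrightarrow> y \<in> W" unfolding Z.openin_X by blast
    then show "\<exists>p\<in>P. \<forall>y\<in>U. p (y - x) < 1 \<longrightarrow> f y \<in> W"
      using pull[of q] img \<open>x \<in> U\<close> by (intro bexI[of _ "\<lambda>x. q (f x)"]) (auto simp: diff)
  qed (use img in simp)
qed

lemma seminorm_on_add:
  assumes "seminorm_on s U p" "seminorm_on s U q"
  shows "seminorm_on s U (\<lambda>x. p x + q x)"
  unfolding seminorm_on_def
proof (intro conjI ballI allI)
  fix x y assume "x \<in> U" "y \<in> U"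
  then have "p (x + y) \<le> p x + p y" "q (x + y) \<le> q x + q y"
    using assms by (simp_all add: seminorm_on_def)
  then show "p (x + y) + q (x + y) \<le> p x + q x + (p y + q y)" by simp
next
  fix c x assume "x \<in> U"
  then have "p (s c x) = norm c * p x" "q (s c x) = norm c * q x"
    using assms by (simp_all add: seminorm_on_def)
  then show "p (s c x) + q (s c x) = norm c * (p x + q x)" by (simp add: distrib_left)
qed

section \<open>Locally convex topologies are generated by seminorms\<close>

context scalar_space
begin

definition continuous_seminorms :: "'a topology \<Rightarrow> ('a \<Rightarrow> real) set" where
  "continuous_seminorms X =
     {p. seminorm_on s (topspace X) p \<and> (\<exists>W. openin X W \<and> 0 \<in> W \<and> (\<forall>x\<in>W. p x < 1))}"

lemma continuous_map_scale_const:
  assumes "locally_convex_space s X"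
  shows "continuous_map X X (s c)"
proof -
  have "continuous_map X (prod_topology euclidean X) (\<lambda>x. (c, x))"
    by (intro continuous_map_pairedI) auto
  moreover have "continuous_map (prod_topology euclidean X) X (\<lambda>(c, x). s c x)"
    using assms by (simp add: locally_convex_space_def)
  ultimately have "continuous_map X X ((\<lambda>(c, x). s c x) \<circ> (\<lambda>x. (c, x)))"
    by (rule continuous_map_compose)
  then show ?thesis by (simp add: o_def)
qed

lemma continuous_map_add_const:
  assumes "locally_convex_space s X" "a \<in> topspace X"
  shows "continuous_map X X (\<lambda>x. x + a)"
proof -
  have "continuous_map X (prod_topology X X) (\<lambda>x. (x, a))"
    by (intro continuous_map_pairedI) (use assms in auto)
  moreover have "continuous_map (prod_topology X X) X (\<lambda>(x, y). x + y)"
    using assms by (simp add: locally_convex_space_def)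
  ultimately have "continuous_map X X ((\<lambda>(x, y). x + y) \<circ> (\<lambda>x. (x, a)))"
    by (rule continuous_map_compose)
  then show ?thesis by (simp add: o_def)
qed

lemma continuous_seminorm_small:
  assumes X: "locally_convex_space s X" and p: "p \<in> continuous_seminorms X" and e: "e > 0"
  shows "\<exists>W. openin X W \<and> 0 \<in> W \<and> (\<forall>x\<in>W. p x < e)"
proof -
  have U: "subspace (topspace X)" using X by (simp add: locally_convex_space_def)
  have sn: "seminorm_on s (topspace X) p" using p by (simp add: continuous_seminorms_def)
  obtain W where W: "openin X W" "0 \<in> W" "\<forall>x\<in>W. p x < 1"
    using p unfolding continuous_seminorms_def mem_Collect_eq by (elim conjE exE)
  let ?T = "{x \<in> topspace X. s (of_real (1 / e)) x \<in> W}"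
  have "openin X ?T" by (rule openin_continuous_map_preimage[OF continuous_map_scale_const[OF X] W(1)])
  moreover have "0 \<in> ?T" using subspace_0[OF U] W by simp
  moreover have "p x < e" if "x \<in> ?T" for x
  proof -
    have "p (s (of_real (1 / e)) x) < 1" using that W(3) by blast
    moreover have "p (s (of_real (1 / e)) x) = 1 / e * p x"
      using seminorm_onD(2)[OF U sn, of x "of_real (1 / e)"] that e by (simp add: norm_divide)
    ultimately have "1 / e * p x < 1" by simp
    then show ?thesis using e by (simp add: field_simps)
  qed
  ultimately show ?thesis by (intro exI[of _ ?T]) simp
qed

text \<open>\<open>p\<close> is the Minkowski gauge of the balanced core \<open>D\<close> of a
  convex neighbourhood \<open>C\<close>. The core inherits convexity, and continuity of scalar
  multiplication at \<open>(0, x)\<close> makes it absorb \<open>x\<close>.\<close>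

lemma locally_convex_gauge:
  assumes X: "locally_convex_space s X" and W: "openin X W" "0 \<in> W"
  shows "\<exists>p\<in>continuous_seminorms X. \<forall>y\<in>topspace X. p y < 1 \<longrightarrow> y \<in> W"
proof -
  define U where "U = topspace X"
  have U: "subspace U" using X by (simp add: locally_convex_space_def U_def)
  have cont: "continuous_map (prod_topology euclidean X) X (\<lambda>(c, x). s c x)"
    using X by (simp add: locally_convex_space_def)
  obtain C where C: "openin X C" "convex_set s C" "0 \<in> C" "C \<subseteq> W"
    using X W unfolding locally_convex_space_def by meson
  have nbhd: "\<exists>d>0. \<exists>B. openin X B \<and> x \<in> B \<and> (\<forall>c y. norm c < d \<longrightarrow> y \<in> B \<longrightarrow> s c y \<in> C)"
    if x: "x \<in> U" for x
  proof -
    let ?T = "{z \<in> topspace (prod_topology euclidean X). (case z of (c, x) \<Rightarrow> s c x) \<in> C}"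
    have T: "openin (prod_topology euclidean X) ?T"
      by (rule openin_continuous_map_preimage[OF cont C(1)])
    have 0: "(0, x) \<in> ?T" using x C(3) by (simp add: U_def)
    from T[unfolded openin_prod_topology_alt, rule_format, OF 0]
    obtain A B where A: "openin euclidean A" "openin X B" "(0::'k) \<in> A" "x \<in> B" "A \<times> B \<subseteq> ?T"
      by (elim exE conjE)
    obtain d where d: "d > 0" "ball 0 d \<subseteq> A" using A(1,3) by (auto simp: open_contains_ball)
    have "s c y \<in> C" if "norm c < d" "y \<in> B" for c y
    proof -
      have "(c, y) \<in> A \<times> B" using that d(2) by auto
      then have "(c, y) \<in> ?T" using A(5) by (rule subsetD[rotated])
      then show ?thesis by simp
    qed
    then show ?thesis using d(1) A(2,4) by (intro exI[of _ d] conjI exI[of _ B]) simp_all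
  qed
  define D where "D = {x \<in> U. \<forall>c. norm c \<le> 1 \<longrightarrow> s c x \<in> C}"
  have DC: "x \<in> C" if "x \<in> D" for x
  proof -
    have "s 1 x \<in> C" using that unfolding D_def mem_Collect_eq by (metis norm_one order_refl)
    then show ?thesis by simp
  qed
  have zeroD: "0 \<in> D" using C(3) subspace_0[OF U] by (simp add: D_def)
  have balanced: "s c x \<in> D" if "x \<in> D" "norm c \<le> 1" for c x
  proof -
    have "s b (s c x) \<in> C" if b: "norm b \<le> 1" for b
    proof -
      have "norm (b * c) \<le> 1" using b \<open>norm c \<le> 1\<close> by (simp add: norm_mult mult_le_one)
      then show ?thesis using \<open>x \<in> D\<close> by (simp add: D_def)
    qed
    then show ?thesis using \<open>x \<in> D\<close> subspace_scale[OF U] by (simp add: D_def)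
  qed
  have conv: "s (of_real a) x + s (of_real b) y \<in> D"
    if "x \<in> D" "y \<in> D" "a \<ge> 0" "b \<ge> 0" "a + b = 1" for a b x y
  proof -
    have "s c (s (of_real a) x + s (of_real b) y) \<in> C" if c: "norm c \<le> 1" for c
    proof -
      have "s (of_real (1 - b)) (s c x) + s (of_real b) (s c y) \<in> C"
        using C(2)[unfolded convex_set_def, rule_format, of "s c x" "s c y" b] that
          \<open>x \<in> D\<close> \<open>y \<in> D\<close> \<open>a \<ge> 0\<close> \<open>b \<ge> 0\<close> \<open>a + b = 1\<close> by (auto simp: D_def)
      moreover have "1 - b = a" using \<open>a + b = 1\<close> by simp
      ultimately show ?thesis by (simp add: scale_right_distrib mult.commute)
    qed
    then show ?thesis using that subspace_add[OF U] subspace_scale[OF U] by (simp add: D_def)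
  qed
  define G where "G = (\<lambda>x. {r. r > 0 \<and> s (of_real (1 / r)) x \<in> D})"
  define p where "p = (\<lambda>x. Inf (G x))"
  have bdd: "bdd_below (G x)" for x by (rule bdd_belowI[of _ 0]) (simp add: G_def)
  have lower: "p x \<le> r" if "r \<in> G x" for x r unfolding p_def by (rule cInf_lower[OF that bdd])
  have nonempty: "G x \<noteq> {}" if "x \<in> U" for x
  proof -
    obtain d B where d: "d > 0" "x \<in> B" "\<And>c y. norm c < d \<Longrightarrow> y \<in> B \<Longrightarrow> s c y \<in> C"
      using nbhd[OF \<open>x \<in> U\<close>] by metis
    have "s (of_real (1 / (2 / d))) x \<in> D"
    proof -
      have "s c (s (of_real (1 / (2 / d))) x) \<in> C" if "norm c \<le> 1" for c
      proof -
        have "norm (c * of_real (1 / (2 / d))) \<le> 1 * (d / 2)"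
          using that d(1) by (simp add: norm_mult norm_divide)
        then have "norm (c * of_real (1 / (2 / d))) < d" using d(1) by simp
        then have "s (c * of_real (1 / (2 / d))) x \<in> C" using d by blast
        then show ?thesis by simp
      qed
      then show ?thesis using subspace_scale[OF U \<open>x \<in> U\<close>] by (simp add: D_def)
    qed
    then have "2 / d \<in> G x" using d(1) by (simp add: G_def)
    then show ?thesis by auto
  qed
  have greatest: "m \<le> p x" if "x \<in> U" "\<And>r. r \<in> G x \<Longrightarrow> m \<le> r" for m x
    unfolding p_def by (rule cInf_greatest[OF nonempty[OF that(1)] that(2)])
  have scale_le: "p (s c x) \<le> norm c * p x" if "c \<noteq> 0" "x \<in> U" for c x
  proof -
    have "p (s c x) / norm c \<le> p x"
    proof (rule greatest[OF \<open>x \<in> U\<close>])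
      fix r assume r: "r \<in> G x"
      have "s (c / of_real (norm c)) (s (of_real (1 / r)) x) \<in> D"
        by (rule balanced) (use r \<open>c \<noteq> 0\<close> in \<open>simp_all add: G_def norm_divide\<close>)
      then have "norm c * r \<in> G (s c x)"
        using r \<open>c \<noteq> 0\<close> by (simp add: G_def field_simps)
      then show "p (s c x) / norm c \<le> r" using lower \<open>c \<noteq> 0\<close> by (simp add: field_simps)
    qed
    then show ?thesis using \<open>c \<noteq> 0\<close> by (simp add: field_simps)
  qed
  have pzero: "p 0 = 0"
  proof (rule antisym)
    have "p 0 \<le> r" if "r > 0" for r using that zeroD by (intro lower) (simp add: G_def)
    then show "p 0 \<le> 0" by (rule field_le_epsilon) simp
    show "0 \<le> p 0" by (rule greatest) (use subspace_0[OF U] in \<open>auto simp: G_def\<close>)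
  qed
  have scale: "p (s c x) = norm c * p x" if "x \<in> U" for c x
  proof (cases "c = 0")
    case False
    have "p (s (1 / c) (s c x)) \<le> norm (1 / c) * p (s c x)"
      by (rule scale_le) (use False that subspace_scale[OF U] in auto)
    then have "norm c * p x \<le> p (s c x)" using False by (simp add: norm_divide field_simps)
    then show ?thesis using scale_le[OF False that] by simp
  qed (simp add: pzero)
  have add: "p (x + y) \<le> p x + p y" if "x \<in> U" "y \<in> U" for x y
  proof -
    have *: "p (x + y) - r \<le> t" if "r \<in> G x" "t \<in> G y" for r t
    proof -
      have rt: "r > 0" "t > 0" using that by (auto simp: G_def)
      \<comment> \<open>The weights \<open>r / (r + t)\<close> and \<open>t / (r + t)\<close> turn
        the two points of \<open>D\<close> into \<open>x + y\<close> divided by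
        \<open>r + t\<close>.\<close>
      have "s (of_real (r / (r + t))) (s (of_real (1 / r)) x) + s (of_real (t / (r + t))) (s (of_real (1 / t)) y) \<in> D"
        by (rule conv) (use that rt in \<open>auto simp: G_def add_divide_distrib[symmetric]\<close>)
      moreover have "s (of_real (r / (r + t))) (s (of_real (1 / r)) x) + s (of_real (t / (r + t))) (s (of_real (1 / t)) y)
          = s (of_real (1 / (r + t))) (x + y)"
      proof -
        have "s (of_real (r / (r + t))) (s (of_real (1 / r)) x) = s (of_real (1 / (r + t))) x"
          "s (of_real (t / (r + t))) (s (of_real (1 / t)) y) = s (of_real (1 / (r + t))) y"
          using rt by (simp_all flip: of_real_mult of_real_divide del: of_real_add)
        then show ?thesis by (simp only: scale_right_distrib)
      qed
      ultimately have "r + t \<in> G (x + y)" using rt unfolding G_def mem_Collect_eq by simp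
      then show ?thesis using lower[of "r + t" "x + y"] by simp
    qed
    have "p (x + y) - r \<le> p y" if "r \<in> G x" for r
      by (rule greatest[OF \<open>y \<in> U\<close>]) (rule *[OF that])
    then have "p (x + y) - p y \<le> p x"
      by (intro greatest[OF \<open>x \<in> U\<close>]) (simp add: algebra_simps)
    then show ?thesis by simp
  qed
  have sn: "seminorm_on s U p" unfolding seminorm_on_def using add scale by simp
  have unit: "y \<in> W" if y: "y \<in> U" "p y < 1" for y
  proof -
    obtain r where r: "r \<in> G y" "r < 1"
      using cInf_lessD[OF nonempty[OF y(1)]] y(2) unfolding p_def by blast
    have "s (of_real r) (s (of_real (1 / r)) y) \<in> D"
      by (rule balanced) (use r in \<open>auto simp: G_def\<close>)
    then have "y \<in> D" using r by (simp add: G_def)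
    then show ?thesis using DC C(4) by blast
  qed
  have "\<exists>T. openin X T \<and> 0 \<in> T \<and> (\<forall>x\<in>T. p x < 1)"
  proof -
    obtain d B where d: "d > 0" "openin X B" "0 \<in> B" "\<And>c y. norm c < d \<Longrightarrow> y \<in> B \<Longrightarrow> s c y \<in> C"
      using nbhd[OF subspace_0[OF U]] by metis
    \<comment> \<open>With the factor \<open>4 / d\<close>, the scalars \<open>c * (d / 2)\<close>
      for \<open>norm c \<le> 1\<close> stay below \<open>d\<close>; so twice a point of this set
      lies in \<open>D\<close>, and its gauge is at most one half.\<close>
    let ?T = "{x \<in> topspace X. s (of_real (4 / d)) x \<in> B}"
    have "openin X ?T" by (rule openin_continuous_map_preimage[OF continuous_map_scale_const[OF X] d(2)])
    moreover have "0 \<in> ?T" using subspace_0[OF U] d by (simp add: U_def)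
    moreover have "p x < 1" if x: "x \<in> ?T" for x
    proof -
      have "s (of_real (1 / (1 / 2))) x \<in> D"
      proof -
        have "s c (s (of_real (1 / (1 / 2))) x) \<in> C" if "norm c \<le> 1" for c
        proof -
          have "norm (c * of_real (d / 2)) \<le> 1 * (d / 2)"
            using that d(1) by (simp add: norm_mult norm_divide)
          then have "norm (c * of_real (d / 2)) < d" using d(1) by simp
          then have "s (c * of_real (d / 2)) (s (of_real (4 / d)) x) \<in> C" using d x by blast
          moreover have "s (c * of_real (d / 2)) (s (of_real (4 / d)) x) = s c (s (of_real (1 / (1 / 2))) x)"
          proof -
            have "(d / 2) * (4 / d) = 2" using d(1) by simp
            then have "of_real (d / 2) * of_real (4 / d) = (2 :: 'k)" by (metis of_real_mult of_real_numeral)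
            then show ?thesis by (simp add: mult.assoc del: of_real_divide)
          qed
          ultimately show ?thesis by (simp only:)
        qed
        moreover have "s (of_real (1 / (1 / 2))) x \<in> U" using x subspace_scale[OF U] by (simp add: U_def)
        ultimately show ?thesis by (simp add: D_def)
      qed
      then have "p x \<le> 1 / 2" by (intro lower) (simp add: G_def)
      then show ?thesis by simp
    qed
    ultimately show ?thesis by (intro exI[of _ ?T]) simp
  qed
  then have "p \<in> continuous_seminorms X" using sn by (simp add: continuous_seminorms_def U_def)
  then show ?thesis using unit by (intro bexI[of _ p]) (auto simp: U_def)
qed

lemma seminorm_space_continuous_seminorms:
  assumes X: "locally_convex_space s X"
  shows "seminorm_space s (topspace X) (continuous_seminorms X)"
proof
  show U: "subspace (topspace X)" using X by (simp add: locally_convex_space_def)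
  show sn: "seminorm_on s (topspace X) p" if "p \<in> continuous_seminorms X" for p
    using that by (simp add: continuous_seminorms_def)
  show "(\<lambda>x. 0) \<in> continuous_seminorms X"
    using subspace_0[OF U] by (auto simp: continuous_seminorms_def seminorm_on_def)
  show "(\<lambda>x. p x + q x) \<in> continuous_seminorms X"
    if pq: "p \<in> continuous_seminorms X" "q \<in> continuous_seminorms X" for p q
  proof -
    obtain W where W: "openin X W" "0 \<in> W" "\<forall>x\<in>W. p x < 1 / 2"
      using continuous_seminorm_small[OF X pq(1), of "1 / 2"] by auto
    obtain T where T: "openin X T" "0 \<in> T" "\<forall>x\<in>T. q x < 1 / 2"
      using continuous_seminorm_small[OF X pq(2), of "1 / 2"] by auto
    have "seminorm_on s (topspace X) (\<lambda>x. p x + q x)"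
      by (rule seminorm_on_add[OF sn[OF pq(1)] sn[OF pq(2)]])
    moreover have "\<forall>x\<in>W \<inter> T. p x + q x < 1" using W(3) T(3) by fastforce
    ultimately show ?thesis
      using W T unfolding continuous_seminorms_def by (auto intro!: exI[of _ "W \<inter> T"])
  qed
  show "q \<in> continuous_seminorms X"
    if p: "p \<in> continuous_seminorms X" and q: "seminorm_on s (topspace X) q"
      and le: "\<And>x. x \<in> topspace X \<Longrightarrow> q x \<le> C * p x" for p q C
  proof -
    have e: "1 / (\<bar>C\<bar> + 1) > 0" by simp
    obtain W where W: "openin X W" "0 \<in> W" "\<forall>x\<in>W. p x < 1 / (\<bar>C\<bar> + 1)"
      using continuous_seminorm_small[OF X p e] by auto
    have "q x < 1" if x: "x \<in> W" for x
    proof -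
      have xU: "x \<in> topspace X" using x openin_subset[OF W(1)] by blast
      have "q x \<le> C * p x" by (rule le[OF xU])
      also have "\<dots> \<le> (\<bar>C\<bar> + 1) * p x"
        using seminorm_onD(6)[OF U sn[OF p] xU] by (intro mult_right_mono) auto
      also have "\<dots> < 1" using W(3) x by (simp add: field_simps)
      finally show ?thesis .
    qed
    then show ?thesis using q W by (auto simp: continuous_seminorms_def)
  qed
qed

text \<open>Turns a comparison of locally convex topologies into an inclusion of seminorm families,
  which is how the strongest ones are identified below.\<close>

lemma locally_convex_eq_seminorm_topology:
  assumes X: "locally_convex_space s X"
  shows "X = seminorm_topology (topspace X) (continuous_seminorms X)"
proof -
  interpret S: seminorm_space s "topspace X" "continuous_seminorms X"
    by (rule seminorm_space_continuous_seminorms[OF X])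
  have "openin X W \<longleftrightarrow> openin S.X W" for W
  proof
    assume W: "openin X W"
    show "openin S.X W"
      unfolding S.openin_X
    proof (intro conjI ballI)
      show "W \<subseteq> topspace X" by (rule openin_subset[OF W])
      fix x assume x: "x \<in> W"
      then have xU: "x \<in> topspace X" using openin_subset[OF W] by blast
      let ?T = "{y \<in> topspace X. y + x \<in> W}"
      have T: "openin X ?T"
        by (rule openin_continuous_map_preimage[OF continuous_map_add_const[OF X xU] W])
      have "0 \<in> ?T" using x S.U_zero by simp
      from locally_convex_gauge[OF X T this]
      obtain p where p: "p \<in> continuous_seminorms X" "\<forall>y\<in>topspace X. p y < 1 \<longrightarrow> y \<in> ?T"
        by (elim bexE)
      have "y \<in> W" if "y \<in> topspace X" "p (y - x) < 1" for y
      proof -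
        have "y - x \<in> ?T" using p(2)[rule_format, OF S.U_diff[OF that(1) xU] that(2)] .
        then show ?thesis by simp
      qed
      then show "\<exists>p\<in>continuous_seminorms X. \<forall>y\<in>topspace X. p (y - x) < 1 \<longrightarrow> y \<in> W"
        by (intro bexI[OF _ p(1)]) simp
    qed
  next
    assume W: "openin S.X W"
    have WU: "W \<subseteq> topspace X" using openin_subset[OF W] by simp
    have "\<exists>T. openin X T \<and> x \<in> T \<and> T \<subseteq> W" if x: "x \<in> W" for x
    proof -
      obtain p where p: "p \<in> continuous_seminorms X" "\<forall>y\<in>topspace X. p (y - x) < 1 \<longrightarrow> y \<in> W"
        using W x unfolding S.openin_X by (elim conjE) (drule bspec, assumption, elim bexE)
      obtain B where B: "openin X B" "0 \<in> B" "\<forall>x\<in>B. p x < 1"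
        using p(1) unfolding continuous_seminorms_def mem_Collect_eq by (elim conjE exE)
      have mx: "- x \<in> topspace X" using x WU S.U_minus by blast
      let ?T = "{y \<in> topspace X. y + - x \<in> B}"
      have "openin X ?T"
        by (rule openin_continuous_map_preimage[OF continuous_map_add_const[OF X mx] B(1)])
      moreover have "x \<in> ?T" using x WU B(2) by auto
      moreover have "?T \<subseteq> W" using p(2) B(3) by auto
      ultimately show ?thesis by (intro exI[of _ ?T]) simp
    qed
    then show "openin X W" by (subst openin_subopen) simp
  qed
  then show ?thesis by (simp add: topology_eq)
qed

end

section \<open>Strongest topologies and the space \<phi>\<close>

lemma finer_antisym: "finer S T \<Longrightarrow> finer T S \<Longrightarrow> S = T"
  by (auto simp: finer_def topology_eq)

text \<open>Antisymmetry of \<open>finer\<close> leaves room for one strongest topology, so a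
  candidate turns the relation into an equation.\<close>

lemma strongest_topology_unique:
  assumes "P T" "\<And>S. P S \<Longrightarrow> finer T S"
  shows "strongest_topology P X \<longleftrightarrow> X = T"
  using assms by (auto simp: strongest_topology_def intro: finer_antisym)

lemma (in scalar_space) seminorm_space_all_seminorms:
  assumes "subspace U"
  shows "seminorm_space s U {p. seminorm_on s U p}"
proof
  show "(\<lambda>x. p x + q x) \<in> {p. seminorm_on s U p}"
    if "p \<in> {p. seminorm_on s U p}" "q \<in> {p. seminorm_on s U p}" for p q
    using that by (simp add: seminorm_on_add)
qed (use assms in \<open>auto simp: seminorm_on_def\<close>)

lemma scalar_space_seq_scale: "scalar_space (seq_scale :: 'k::real_or_complex \<Rightarrow> _)"
  by standard (auto simp: seq_scale_def fun_eq_iff algebra_simps)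

definition finitely_supported :: "(nat \<Rightarrow> 'k::zero) set" where
  "finitely_supported = {f. finite {i. f i \<noteq> 0}}"

lemma subspace_finitely_supported:
  "module.subspace seq_scale (finitely_supported :: (nat \<Rightarrow> 'k::real_or_complex) set)"
proof -
  interpret scalar_space "seq_scale :: 'k \<Rightarrow> _" by (rule scalar_space_seq_scale)
  show ?thesis
  proof (rule subspaceI)
    fix f g :: "nat \<Rightarrow> 'k" assume fg: "f \<in> finitely_supported" "g \<in> finitely_supported"
    have "{i. (f + g) i \<noteq> 0} \<subseteq> {i. f i \<noteq> 0} \<union> {i. g i \<noteq> 0}" by auto
    then show "f + g \<in> finitely_supported"
      using fg finite_subset by (auto simp: finitely_supported_def)
  next
    fix c :: 'k and f assume f: "f \<in> (finitely_supported :: (nat \<Rightarrow> 'k) set)"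
    have "{i. seq_scale c f i \<noteq> 0} \<subseteq> {i. f i \<noteq> 0}" by (auto simp: seq_scale_def)
    then show "seq_scale c f \<in> finitely_supported"
      using f finite_subset by (auto simp: finitely_supported_def)
  qed (simp add: finitely_supported_def)
qed

text \<open>A competing locally convex topology is generated by its continuous seminorms, and these
  are among all seminorms.\<close>

lemma is_phi_iff:
  fixes F :: "(nat \<Rightarrow> 'k::real_or_complex) topology"
  shows "is_phi F \<longleftrightarrow>
    F = seminorm_topology finitely_supported {p. seminorm_on seq_scale finitely_supported p}"
proof -
  interpret scalar_space "seq_scale :: 'k \<Rightarrow> _" by (rule scalar_space_seq_scale)
  interpret P: seminorm_space seq_scale "finitely_supported :: (nat \<Rightarrow> 'k) set"
      "{p. seminorm_on seq_scale finitely_supported p}"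
    by (rule seminorm_space_all_seminorms[OF subspace_finitely_supported])
  show ?thesis
    unfolding is_phi_def
  proof (rule strongest_topology_unique)
    show "topspace P.X = {f. finite {i. f i \<noteq> 0}} \<and> locally_convex_space seq_scale P.X"
      using P.locally_convex_X unfolding P.topspace_X by (simp flip: finitely_supported_def)
  next
    fix S :: "(nat \<Rightarrow> 'k) topology"
    assume S: "topspace S = {f. finite {i. f i \<noteq> 0}} \<and> locally_convex_space seq_scale S"
    then have top: "topspace S = finitely_supported" by (simp add: finitely_supported_def)
    interpret S: seminorm_space seq_scale "topspace S" "continuous_seminorms S"
      by (rule seminorm_space_continuous_seminorms) (use S in simp)
    have eq: "S = S.X" by (rule locally_convex_eq_seminorm_topology) (use S in simp)
    have "openin P.X W" if "openin S W" for W
    proof -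
      have W: "openin S.X W" using that eq by simp
      show ?thesis
        unfolding P.openin_X
      proof (intro conjI ballI)
        show "W \<subseteq> finitely_supported" using openin_subset[OF that] top by simp
        fix x assume "x \<in> W"
        then obtain p where p: "p \<in> continuous_seminorms S" "\<forall>y\<in>topspace S. p (y - x) < 1 \<longrightarrow> y \<in> W"
          using W unfolding S.openin_X by (elim conjE) (drule bspec, assumption, elim bexE)
        have "p \<in> {p. seminorm_on seq_scale finitely_supported p}"
          using S.seminorm[OF p(1)] top by simp
        then show "\<exists>p\<in>{p. seminorm_on seq_scale finitely_supported p}.
            \<forall>y\<in>finitely_supported. p (y - x) < 1 \<longrightarrow> y \<in> W"
          by (rule bexI[rotated]) (use p(2) top in simp)
      qed
    qed
    then show "finer P.X S" using top by (simp add: finer_def)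
  qed
qed

section \<open>Inductive limits of separable Banach spaces\<close>

text \<open>A norm-level substitute for \<open>Metric_space\<close> that sees \<open>N\<close> on
  \<open>V\<close> only, so a norm can be restricted to a subspace without adjusting its values
  elsewhere.\<close>

definition normed_by :: "'a::ab_group_add set \<Rightarrow> ('a \<Rightarrow> real) \<Rightarrow> 'a topology \<Rightarrow> bool" where
  "normed_by V N X \<longleftrightarrow> topspace X = V \<and>
     (\<forall>W. openin X W \<longleftrightarrow> W \<subseteq> V \<and> (\<forall>x\<in>W. \<exists>e>0. \<forall>y\<in>V. N (y - x) < e \<longrightarrow> y \<in> W))"

definition norm_complete :: "'a::ab_group_add set \<Rightarrow> ('a \<Rightarrow> real) \<Rightarrow> bool" where
  "norm_complete V N \<longleftrightarrow>
     (\<forall>x::nat \<Rightarrow> 'a. range x \<subseteq> V \<longrightarrow> (\<forall>e>0. \<exists>m. \<forall>i\<ge>m. \<forall>j\<ge>m. N (x i - x j) < e) \<longrightarrow>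
        (\<exists>l\<in>V. (\<lambda>i. N (x i - l)) \<longlonglongrightarrow> 0))"

definition norm_separable :: "'a::ab_group_add set \<Rightarrow> ('a \<Rightarrow> real) \<Rightarrow> bool" where
  "norm_separable V N \<longleftrightarrow>
     (\<exists>D. countable D \<and> D \<subseteq> V \<and> (\<forall>x\<in>V. \<forall>e>0. \<exists>d\<in>D. N (d - x) < e))"

definition Banach_norm ::
  "('k::real_normed_field \<Rightarrow> 'a::ab_group_add \<Rightarrow> 'a) \<Rightarrow> 'a set \<Rightarrow> ('a \<Rightarrow> real) \<Rightarrow> bool" where
  "Banach_norm s V N \<longleftrightarrow> module.subspace s V \<and> V \<noteq> {0} \<and> seminorm_on s V N \<and>
     (\<forall>x\<in>V. N x = 0 \<longrightarrow> x = 0) \<and> norm_complete V N \<and> norm_separable V N"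

lemma seminorm_on_subset: "seminorm_on s U p \<Longrightarrow> V \<subseteq> U \<Longrightarrow> seminorm_on s V p"
  by (simp add: seminorm_on_def subset_iff)

lemma normed_by_unique: "normed_by V N X \<Longrightarrow> normed_by V N Y \<Longrightarrow> X = Y"
  by (simp add: normed_by_def topology_eq)

context scalar_space
begin

lemma norm_metric:
  assumes V: "subspace V" and M: "Metric_space V (\<lambda>x y. N (x - y))"
    and scale: "\<forall>c. \<forall>x\<in>V. N (s c x) = norm c * N x"
  shows "seminorm_on s V N" "\<forall>x\<in>V. N x = 0 \<longrightarrow> x = 0"
    "normed_by V N (Metric_space.mtopology V (\<lambda>x y. N (x - y)))"
    "Metric_space.mcomplete V (\<lambda>x y. N (x - y)) \<longleftrightarrow> norm_complete V N"
    "separable_space (Metric_space.mtopology V (\<lambda>x y. N (x - y))) \<longleftrightarrow> norm_separable V N"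
proof -
  interpret M: Metric_space V "\<lambda>x y. N (x - y)" by (rule M)
  have comm: "N (x - y) = N (y - x)" for x y by (rule M.commute)
  have add: "N (x + y) \<le> N x + N y" if "x \<in> V" "y \<in> V" for x y
    using M.triangle[of x 0 "- y"] that subspace_0[OF V] subspace_neg[OF V that(2)] by simp
  show sn: "seminorm_on s V N" using scale add by (simp add: seminorm_on_def)
  show "\<forall>x\<in>V. N x = 0 \<longrightarrow> x = 0"
    using M.zero[OF _ subspace_0[OF V]] by simp
  show nb: "normed_by V N M.mtopology"
    unfolding normed_by_def M.openin_mtopology
  proof (intro conjI allI)
    fix W
    have "(\<exists>r>0. M.mball x r \<subseteq> W) \<longleftrightarrow> (\<exists>e>0. \<forall>y\<in>V. N (y - x) < e \<longrightarrow> y \<in> W)"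
      if "x \<in> V" for x
      unfolding M.mball_def using that comm[of x] by (simp add: subset_iff) blast
    then show "(W \<subseteq> V \<and> (\<forall>x. x \<in> W \<longrightarrow> (\<exists>r>0. M.mball x r \<subseteq> W))) \<longleftrightarrow>
      (W \<subseteq> V \<and> (\<forall>x\<in>W. \<exists>e>0. \<forall>y\<in>V. N (y - x) < e \<longrightarrow> y \<in> W))"
      unfolding Ball_def by (intro conj_cong all_cong1 imp_cong refl) auto
  qed simp
  have lim: "limitin M.mtopology x l sequentially \<longleftrightarrow> l \<in> V \<and> (\<lambda>i. N (x i - l)) \<longlonglongrightarrow> 0"
    if "range x \<subseteq> V" for x :: "nat \<Rightarrow> 'a" and l
  proof -
    have "N (x i - l) \<ge> 0" for i using M.nonneg[of "x i" l] by simp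
    moreover have "x i \<in> V" for i using that by auto
    ultimately show ?thesis
      unfolding M.limit_metric_sequentially tendsto_iff eventually_sequentially by (simp add: dist_real_def)
  qed
  show "M.mcomplete \<longleftrightarrow> norm_complete V N"
  proof
    assume c: M.mcomplete
    show "norm_complete V N"
      unfolding norm_complete_def
    proof (intro allI impI)
      fix x :: "nat \<Rightarrow> 'a"
      assume x: "range x \<subseteq> V" "\<forall>e>0. \<exists>m. \<forall>i\<ge>m. \<forall>j\<ge>m. N (x i - x j) < e"
      then have "M.MCauchy x" unfolding M.MCauchy_def by meson
      then obtain l where "limitin M.mtopology x l sequentially" using c M.mcomplete_def by blast
      then show "\<exists>l\<in>V. (\<lambda>i. N (x i - l)) \<longlonglongrightarrow> 0" using lim[OF x(1)] by blast
    qed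
  next
    assume c: "norm_complete V N"
    show M.mcomplete
      unfolding M.mcomplete_def
    proof (intro allI impI)
      fix x assume "M.MCauchy x"
      then have x: "range x \<subseteq> V" "\<forall>e>0. \<exists>m. \<forall>i\<ge>m. \<forall>j\<ge>m. N (x i - x j) < e"
        unfolding M.MCauchy_def by meson+
      then obtain l where "l \<in> V" "(\<lambda>i. N (x i - l)) \<longlonglongrightarrow> 0"
        using c unfolding norm_complete_def by meson
      then show "\<exists>l. limitin M.mtopology x l sequentially" using lim[OF x(1)] by blast
    qed
  qed
  have dense: "M.mtopology closure_of D = V \<longleftrightarrow> (\<forall>x\<in>V. \<forall>e>0. \<exists>d\<in>D. N (d - x) < e)"
    if "D \<subseteq> V" for D
  proof -
    have "d \<in> M.mball x e \<longleftrightarrow> N (d - x) < e" if "x \<in> V" "d \<in> D" for x d e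
      using that \<open>D \<subseteq> V\<close> comm[of x d] by auto
    then show ?thesis unfolding M.metric_closure_of by blast
  qed
  show "separable_space M.mtopology \<longleftrightarrow> norm_separable V N"
    unfolding separable_space_def norm_separable_def M.topspace_mtopology
    using dense by (intro ex_cong1) meson
qed

lemma separable_Banach_space_iff:
  "separable_Banach_space s X \<longleftrightarrow>
     (\<exists>N. Banach_norm s (topspace X) N \<and> normed_by (topspace X) N X)"
proof
  assume X: "separable_Banach_space s X"
  then have sep: "subspace (topspace X)" "topspace X \<noteq> {0}" "separable_space X"
    unfolding separable_Banach_space_def by meson+
  obtain N where N: "Metric_space (topspace X) (\<lambda>x y. N (x - y))"
    "\<forall>c. \<forall>x\<in>topspace X. N (s c x) = norm c * N x"
    "Metric_space.mcomplete (topspace X) (\<lambda>x y. N (x - y))"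
    "X = Metric_space.mtopology (topspace X) (\<lambda>x y. N (x - y))"
    using X unfolding separable_Banach_space_def by (elim conjE exE)
  note m = norm_metric[OF sep(1) N(1,2), folded N(4)]
  have "Banach_norm s (topspace X) N"
    unfolding Banach_norm_def using sep N m by simp
  then show "\<exists>N. Banach_norm s (topspace X) N \<and> normed_by (topspace X) N X" using m(3) by (intro exI[of _ N]) simp
next
  assume "\<exists>N. Banach_norm s (topspace X) N \<and> normed_by (topspace X) N X"
  then obtain N where N: "Banach_norm s (topspace X) N" "normed_by (topspace X) N X" by (elim exE conjE)
  define V where "V = topspace X"
  have V: "subspace V" "V \<noteq> {0}" and sn: "seminorm_on s V N" and definite: "\<forall>x\<in>V. N x = 0 \<longrightarrow> x = 0"
    and comp: "norm_complete V N" and sep: "norm_separable V N" and nb: "normed_by V N X"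
    using N by (simp_all add: Banach_norm_def V_def)
  \<comment> \<open>\<open>Metric_space\<close> asks for a nonnegative symmetric distance on the
    whole type, while \<open>N\<close> is unconstrained outside \<open>V\<close>.\<close>
  define N' where "N' = (\<lambda>x. if x \<in> V then N x else 0)"
  have diff: "x - y \<in> V" if "x \<in> V" "y \<in> V" for x y by (rule subspace_diff[OF V(1) that])
  have M: "Metric_space V (\<lambda>x y. N' (x - y))"
  proof
    show "0 \<le> N' (x - y)" for x y using seminorm_onD(6)[OF V(1) sn] by (simp add: N'_def)
    show "N' (x - y) = N' (y - x)" for x y
    proof -
      have "x - y \<in> V \<longleftrightarrow> y - x \<in> V" using subspace_neg[OF V(1), of "x - y"] subspace_neg[OF V(1), of "y - x"] by auto
      moreover have "N (x - y) = N (y - x)" if "y - x \<in> V" using seminorm_onD(4)[OF V(1) sn that] by simp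
      ultimately show ?thesis by (simp add: N'_def)
    qed
    show "N' (x - y) = 0 \<longleftrightarrow> x = y" if "x \<in> V" "y \<in> V" for x y
      using definite diff[OF that] seminorm_onD(3)[OF V(1) sn] by (auto simp: N'_def)
    show "N' (x - z) \<le> N' (x - y) + N' (y - z)" if "x \<in> V" "y \<in> V" "z \<in> V" for x y z
      using seminorm_onD(1)[OF V(1) sn diff[OF that(1,2)] diff[OF that(2,3)]] diff that by (simp add: N'_def)
  qed
  have scale: "\<forall>c. \<forall>x\<in>V. N' (s c x) = norm c * N' x"
    using subspace_scale[OF V(1)] seminorm_onD(2)[OF V(1) sn] by (simp add: N'_def)
  note m = norm_metric[OF V(1) M scale]
  have N'_diff: "N' (x - y) = N (x - y)" if "x \<in> V" "y \<in> V" for x y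
    using diff[OF that] by (simp add: N'_def)
  have "normed_by V N' X"
  proof -
    have "(\<forall>y\<in>V. N' (y - x) < e \<longrightarrow> y \<in> W) \<longleftrightarrow> (\<forall>y\<in>V. N (y - x) < e \<longrightarrow> y \<in> W)"
      if "x \<in> V" for x e W using N'_diff[OF _ that] by simp
    then have "(W \<subseteq> V \<and> (\<forall>x\<in>W. \<exists>e>0. \<forall>y\<in>V. N' (y - x) < e \<longrightarrow> y \<in> W)) \<longleftrightarrow>
        (W \<subseteq> V \<and> (\<forall>x\<in>W. \<exists>e>0. \<forall>y\<in>V. N (y - x) < e \<longrightarrow> y \<in> W))" for W
      by (intro conj_cong ball_cong refl) (simp add: subset_iff)
    then show ?thesis using nb by (simp add: normed_by_def)
  qed
  then have X: "X = Metric_space.mtopology V (\<lambda>x y. N' (x - y))"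
    by (rule normed_by_unique[OF _ m(3)])
  have "norm_complete V N'"
    unfolding norm_complete_def
  proof (intro allI impI)
    fix x :: "nat \<Rightarrow> 'a"
    assume x: "range x \<subseteq> V" "\<forall>e>0. \<exists>m. \<forall>i\<ge>m. \<forall>j\<ge>m. N' (x i - x j) < e"
    then have xV: "x i \<in> V" for i by auto
    then have "\<forall>e>0. \<exists>m. \<forall>i\<ge>m. \<forall>j\<ge>m. N (x i - x j) < e" using x(2) by (simp add: N'_diff)
    then obtain l where "l \<in> V" "(\<lambda>i. N (x i - l)) \<longlonglongrightarrow> 0"
      using comp x(1) unfolding norm_complete_def by meson
    then show "\<exists>l\<in>V. (\<lambda>i. N' (x i - l)) \<longlonglongrightarrow> 0"
      using xV by (intro bexI[of _ l]) (simp_all add: N'_diff)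
  qed
  moreover have "norm_separable V N'"
  proof -
    obtain D where D: "countable D" "D \<subseteq> V" "\<forall>x\<in>V. \<forall>e>0. \<exists>d\<in>D. N (d - x) < e"
      using sep unfolding norm_separable_def by (elim exE conjE)
    have "\<exists>d\<in>D. N' (d - x) < e" if xe: "x \<in> V" "e > 0" for x e
    proof -
      obtain d where "d \<in> D" "N (d - x) < e" using D(3)[rule_format, OF xe] by (elim bexE)
      then show ?thesis using D(2) xe by (intro bexI[of _ d]) (auto simp: N'_diff)
    qed
    then show ?thesis using D(1,2) unfolding norm_separable_def by (intro exI[of _ D]) simp
  qed
  ultimately have "Metric_space.mcomplete V (\<lambda>x y. N' (x - y))"
    "separable_space (Metric_space.mtopology V (\<lambda>x y. N' (x - y)))"
    using m(4,5) by simp_all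
  then show "separable_Banach_space s X"
    unfolding separable_Banach_space_def V_def[symmetric]
    using V M scale X by (intro conjI exI[of _ N']) simp_all
qed

end

text \<open>The continuous seminorms of the inductive limit: a bound by \<open>N n\<close> on each
  step expresses continuity there (see \<open>inductive_limit_iff\<close>).\<close>

definition bounded_seminorms ::
  "('k::real_normed_field \<Rightarrow> 'a::ab_group_add \<Rightarrow> 'a) \<Rightarrow> (nat \<Rightarrow> 'a set) \<Rightarrow> (nat \<Rightarrow> 'a \<Rightarrow> real) \<Rightarrow>
    ('a \<Rightarrow> real) set" where
  "bounded_seminorms s V N =
     {p. seminorm_on s (\<Union>n. V n) p \<and> (\<forall>n. \<exists>C. \<forall>x\<in>V n. p x \<le> C * N n x)}"

text \<open>Consecutive norms are not compared here: the limit topology is formed, and shown to be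
  the strongest one, before such a comparison is available.\<close>

locale normed_chain = scalar_space s
  for s :: "'k::real_or_complex \<Rightarrow> 'a::ab_group_add \<Rightarrow> 'a" +
  fixes V :: "nat \<Rightarrow> 'a set" and N :: "nat \<Rightarrow> 'a \<Rightarrow> real"
  assumes subspace_V: "subspace (V n)"
    and V_Suc: "V n \<subseteq> V (Suc n)"
    and seminorm_N: "seminorm_on s (V n) (N n)"
begin

abbreviation "U \<equiv> (\<Union>n. V n)"
abbreviation "P \<equiv> bounded_seminorms s V N"

lemma V_mono: "m \<le> n \<Longrightarrow> V m \<subseteq> V n"
  using V_Suc by (rule lift_Suc_mono_le)

lemma V_U: "x \<in> V n \<Longrightarrow> x \<in> U"
  by blast

lemma subspace_U: "subspace U"
proof (rule subspaceI)
  show "0 \<in> U" using subspace_0[OF subspace_V[of 0]] by (rule V_U)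
  show "x + y \<in> U" if xy: "x \<in> U" "y \<in> U" for x y
  proof -
    obtain m n where "x \<in> V m" "y \<in> V n" using xy by (elim UN_E)
    then have "x \<in> V (max m n)" "y \<in> V (max m n)"
      using V_mono[of m "max m n"] V_mono[of n "max m n"] by auto
    then show ?thesis by (intro V_U subspace_add[OF subspace_V])
  qed
  show "s c x \<in> U" if "x \<in> U" for c x
    using that subspace_scale[OF subspace_V] by (elim UN_E) (rule V_U)
qed

lemma P_bound:
  assumes "p \<in> P"
  obtains C where "C > 0" "\<And>x. x \<in> V n \<Longrightarrow> p x \<le> C * N n x"
proof -
  have "\<exists>C. \<forall>x\<in>V n. p x \<le> C * N n x"
    using assms unfolding bounded_seminorms_def mem_Collect_eq by (elim conjE allE)
  then obtain C where C: "\<forall>x\<in>V n. p x \<le> C * N n x" by (elim exE)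
  have "p x \<le> (\<bar>C\<bar> + 1) * N n x" if x: "x \<in> V n" for x
  proof -
    have "C * N n x \<le> (\<bar>C\<bar> + 1) * N n x"
      using seminorm_onD(6)[OF subspace_V seminorm_N x] by (intro mult_right_mono) auto
    then show ?thesis using C x by force
  qed
  then show ?thesis by (intro that[of "\<bar>C\<bar> + 1"]) auto
qed

lemma P_intro:
  assumes "seminorm_on s U p" "\<And>n. \<exists>C. \<forall>x\<in>V n. p x \<le> C * N n x"
  shows "p \<in> P"
  using assms by (simp add: bounded_seminorms_def)

sublocale seminorm_space s U P
proof
  show "subspace U" by (rule subspace_U)
  show sn: "seminorm_on s U p" if "p \<in> P" for p
    using that by (simp add: bounded_seminorms_def)
  show "(\<lambda>x. 0) \<in> P"
    by (rule P_intro) (auto simp: seminorm_on_def intro!: exI[of _ 0])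
  show "(\<lambda>x. p x + q x) \<in> P" if pq: "p \<in> P" "q \<in> P" for p q
  proof (rule P_intro)
    show "seminorm_on s U (\<lambda>x. p x + q x)" by (rule seminorm_on_add[OF sn[OF pq(1)] sn[OF pq(2)]])
    fix n
    obtain C where "\<And>x. x \<in> V n \<Longrightarrow> p x \<le> C * N n x" using P_bound[OF pq(1)] by metis
    moreover obtain D where "\<And>x. x \<in> V n \<Longrightarrow> q x \<le> D * N n x" using P_bound[OF pq(2)] by metis
    ultimately have "\<forall>x\<in>V n. p x + q x \<le> (C + D) * N n x"
      unfolding distrib_right by (intro ballI add_mono)
    then show "\<exists>C. \<forall>x\<in>V n. p x + q x \<le> C * N n x" by (rule exI)
  qed
  show "q \<in> P" if p: "p \<in> P" and q: "seminorm_on s U q" and le: "\<And>x. x \<in> U \<Longrightarrow> q x \<le> C * p x" for p q C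
  proof (rule P_intro[OF q])
    fix n
    obtain B where B: "\<And>x. x \<in> V n \<Longrightarrow> p x \<le> B * N n x" using P_bound[OF p] by metis
    have "q x \<le> \<bar>C\<bar> * B * N n x" if x: "x \<in> V n" for x
    proof -
      have "q x \<le> C * p x" by (rule le[OF V_U[OF x]])
      also have "\<dots> \<le> \<bar>C\<bar> * p x"
        using seminorm_onD(6)[OF subspace_U sn[OF p] V_U[OF x]] by (intro mult_right_mono) auto
      also have "\<dots> \<le> \<bar>C\<bar> * (B * N n x)" by (intro mult_left_mono B x) simp
      finally show ?thesis by (simp add: mult.assoc)
    qed
    then show "\<exists>C. \<forall>x\<in>V n. q x \<le> C * N n x" by blast
  qed
qed

lemmas N_add = seminorm_onD(1)[OF subspace_V seminorm_N]
  and N_scale = seminorm_onD(2)[OF subspace_V seminorm_N]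
  and N_zero = seminorm_onD(3)[OF subspace_V seminorm_N]
  and N_minus = seminorm_onD(4)[OF subspace_V seminorm_N]
  and N_diff_commute = seminorm_onD(5)[OF subspace_V seminorm_N]
  and N_nonneg = seminorm_onD(6)[OF subspace_V seminorm_N]
  and N_diff = seminorm_onD(7)[OF subspace_V seminorm_N]
  and N_sum = seminorm_on_sum[OF subspace_V seminorm_N]

lemmas V_zero = subspace_0[OF subspace_V] and V_add = subspace_add[OF subspace_V]
  and V_diff = subspace_diff[OF subspace_V] and V_scale = subspace_scale[OF subspace_V]
  and V_minus = subspace_neg[OF subspace_V] and V_sum = subspace_sum[OF subspace_V]

lemma openin_X_inter_V:
  assumes W: "openin X W" and x: "x \<in> W" "x \<in> V n"
  shows "\<exists>e>0. \<forall>y\<in>V n. N n (y - x) < e \<longrightarrow> y \<in> W"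
proof -
  obtain p where p: "p \<in> P" "\<forall>y\<in>U. p (y - x) < 1 \<longrightarrow> y \<in> W"
    using W x(1) unfolding openin_X by (elim conjE) (drule bspec, assumption, elim bexE)
  obtain C where C: "C > 0" "\<And>x. x \<in> V n \<Longrightarrow> p x \<le> C * N n x" using P_bound[OF p(1)] by metis
  have "y \<in> W" if y: "y \<in> V n" "N n (y - x) < 1 / C" for y
  proof -
    have "p (y - x) \<le> C * N n (y - x)" by (rule C(2)[OF V_diff[OF y(1) x(2)]])
    also have "\<dots> < 1" using y(2) C(1) by (simp add: field_simps)
    finally show ?thesis using p(2)[rule_format, OF V_U[OF y(1)]] by simp
  qed
  then show ?thesis using C(1) by (intro exI[of _ "1 / C"]) simp
qed

end

context scalar_space
begin

lemma seminorm_bound: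
  assumes V: "subspace V" and N: "seminorm_on s V N" and p: "seminorm_on s V p"
    and e: "e > 0" "\<And>y. y \<in> V \<Longrightarrow> N y < e \<Longrightarrow> p y < 1"
  shows "\<exists>C. \<forall>x\<in>V. p x \<le> C * N x"
proof -
  have "p x \<le> 2 / e * N x" if x: "x \<in> V" for x
  proof -
    \<comment> \<open>\<open>N x\<close> may vanish, so \<open>x\<close> is normalised by an
      arbitrary \<open>t > N x\<close> and the estimate is carried to the limit afterwards.\<close>
    have bound: "p x < t * 2 / e" if t: "t > N x" for t
    proof -
      have t0: "t > 0" using seminorm_onD(6)[OF V N x] t by simp
      define c :: 'k where "c = of_real (e / (2 * t))"
      have nc: "norm c = e / (2 * t)" using t0 e(1) by (simp add: c_def norm_divide norm_mult)
      have "N (s c x) = e / (2 * t) * N x" using seminorm_onD(2)[OF V N x] nc by simp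
      also have "\<dots> \<le> e / (2 * t) * t" using t t0 e(1) by (intro mult_left_mono) auto
      also have "\<dots> < e" using t0 e(1) by simp
      finally have "p (s c x) < 1" by (rule e(2)[OF subspace_scale[OF V x]])
      then have "e / (2 * t) * p x < 1" using seminorm_onD(2)[OF V p x] nc by simp
      then show ?thesis using t0 e(1) by (simp add: field_simps)
    qed
    have "p x \<le> 2 / e * N x + d" if d: "d > 0" for d
      using bound[of "N x + d * e / 2"] d e(1) by (simp add: field_simps)
    then show ?thesis by (rule field_le_epsilon)
  qed
  then show ?thesis by blast
qed

lemma finer_normed_iff:
  assumes nb: "normed_by V N S" and T: "topspace T = U" "V \<subseteq> U"
  shows "finer S (subtopology T V) \<longleftrightarrow>
    (\<forall>W. openin T W \<longrightarrow> (\<forall>x\<in>W \<inter> V. \<exists>e>0. \<forall>y\<in>V. N (y - x) < e \<longrightarrow> y \<in> W))"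
proof -
  have top: "topspace S = topspace (subtopology T V)"
    using nb T by (simp add: normed_by_def Int_absorb1)
  have "openin S (W \<inter> V) \<longleftrightarrow> (\<forall>x\<in>W \<inter> V. \<exists>e>0. \<forall>y\<in>V. N (y - x) < e \<longrightarrow> y \<in> W)" for W
    using nb unfolding normed_by_def by auto
  moreover have "finer S (subtopology T V) \<longleftrightarrow> (\<forall>W. openin T W \<longrightarrow> openin S (W \<inter> V))"
    unfolding finer_def openin_subtopology using top by blast
  ultimately show ?thesis by simp
qed

text \<open>The continuous seminorms of any competing topology are bounded on each step and so
  belong to \<open>bounded_seminorms\<close>; hence the topology generated by the latter is the
  strongest. The Hausdorff property becomes separation of points by seminorms.\<close>

lemma inductive_limit_iff:
  assumes nb: "\<And>n. normed_by (V n) (N n) (Xs n)"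
    and sub: "\<And>n. subspace (V n)" and sn: "\<And>n. seminorm_on s (V n) (N n)"
  shows "inductive_limit s Xs X \<longleftrightarrow>
    (\<forall>n. V n \<subseteq> V (Suc n) \<and> (\<exists>C. \<forall>x\<in>V n. N (Suc n) x \<le> C * N n x)) \<and>
    X = seminorm_topology (\<Union>n. V n) (bounded_seminorms s V N) \<and>
    (\<forall>x\<in>(\<Union>n. V n). x \<noteq> 0 \<longrightarrow> (\<exists>p\<in>bounded_seminorms s V N. p x > 0))"
proof -
  have top: "topspace (Xs n) = V n" for n using nb by (simp add: normed_by_def)
  let ?Q = "\<lambda>T. topspace T = (\<Union>n. V n) \<and> locally_convex_space s T \<and>
    (\<forall>n. finer (Xs n) (subtopology T (V n)))"
  have step: "(V n \<subseteq> V (Suc n) \<and> finer (Xs n) (subtopology (Xs (Suc n)) (V n))) \<longleftrightarrow>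
    (V n \<subseteq> V (Suc n) \<and> (\<exists>C. \<forall>x\<in>V n. N (Suc n) x \<le> C * N n x))" (is "?l \<longleftrightarrow> ?r") for n
  proof (cases "V n \<subseteq> V (Suc n)")
    case True
    note fin = finer_normed_iff[OF nb[of n] top[of "Suc n"] True]
    have open_iff: "openin (Xs (Suc n)) W \<longleftrightarrow> W \<subseteq> V (Suc n) \<and>
      (\<forall>x\<in>W. \<exists>e>0. \<forall>y\<in>V (Suc n). N (Suc n) (y - x) < e \<longrightarrow> y \<in> W)" for W
      using nb[of "Suc n"] by (simp add: normed_by_def)
    have "finer (Xs n) (subtopology (Xs (Suc n)) (V n)) \<longleftrightarrow> (\<exists>C. \<forall>x\<in>V n. N (Suc n) x \<le> C * N n x)"
      unfolding fin
    proof
      assume fine: "\<forall>W. openin (Xs (Suc n)) W \<longrightarrow>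
        (\<forall>x\<in>W \<inter> V n. \<exists>e>0. \<forall>y\<in>V n. N n (y - x) < e \<longrightarrow> y \<in> W)"
      let ?B = "{x \<in> V (Suc n). N (Suc n) x < 1}"
      have "openin (Xs (Suc n)) ?B"
        unfolding open_iff
      proof (intro conjI ballI)
        fix x assume x: "x \<in> ?B"
        have "y \<in> ?B" if y: "y \<in> V (Suc n)" "N (Suc n) (y - x) < 1 - N (Suc n) x" for y
        proof -
          have "N (Suc n) ((y - x) + x) \<le> N (Suc n) (y - x) + N (Suc n) x"
            by (rule seminorm_onD(1)[OF sub sn]) (use x y subspace_diff[OF sub] in auto)
          then show ?thesis using y by simp
        qed
        then show "\<exists>e>0. \<forall>y\<in>V (Suc n). N (Suc n) (y - x) < e \<longrightarrow> y \<in> ?B"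
          using x by (intro exI[of _ "1 - N (Suc n) x"]) simp
      qed auto
      moreover have "0 \<in> ?B \<inter> V n"
        using subspace_0[OF sub] seminorm_onD(3)[OF sub sn] by simp
      ultimately have "\<exists>e>0. \<forall>y\<in>V n. N n (y - 0) < e \<longrightarrow> y \<in> ?B" using fine by blast
      then obtain e where e: "e > 0" "\<And>y. y \<in> V n \<Longrightarrow> N n y < e \<Longrightarrow> N (Suc n) y < 1" by auto
      have "seminorm_on s (V n) (N (Suc n))"
        by (rule seminorm_on_subset[OF sn True])
      then show "\<exists>C. \<forall>x\<in>V n. N (Suc n) x \<le> C * N n x"
        by (rule seminorm_bound[OF sub sn _ e])
    next
      assume "\<exists>C. \<forall>x\<in>V n. N (Suc n) x \<le> C * N n x"
      then obtain C where C: "\<And>x. x \<in> V n \<Longrightarrow> N (Suc n) x \<le> C * N n x" by blast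
      show "\<forall>W. openin (Xs (Suc n)) W \<longrightarrow>
        (\<forall>x\<in>W \<inter> V n. \<exists>e>0. \<forall>y\<in>V n. N n (y - x) < e \<longrightarrow> y \<in> W)"
      proof (intro allI impI ballI)
        fix W x assume W: "openin (Xs (Suc n)) W" and x: "x \<in> W \<inter> V n"
        obtain e where e: "e > 0" "\<And>y. y \<in> V (Suc n) \<Longrightarrow> N (Suc n) (y - x) < e \<Longrightarrow> y \<in> W"
          using W x unfolding open_iff by blast
        have "y \<in> W" if y: "y \<in> V n" "N n (y - x) < e / (\<bar>C\<bar> + 1)" for y
        proof (rule e(2))
          have d: "y - x \<in> V n" using y x subspace_diff[OF sub] by blast
          have "N (Suc n) (y - x) \<le> C * N n (y - x)" by (rule C[OF d])
          also have "\<dots> \<le> (\<bar>C\<bar> + 1) * N n (y - x)"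
            using seminorm_onD(6)[OF sub sn d] by (intro mult_right_mono) auto
          also have "\<dots> < e" using y(2) by (simp add: field_simps)
          finally show "N (Suc n) (y - x) < e" .
        qed (use y True in auto)
        then show "\<exists>e>0. \<forall>y\<in>V n. N n (y - x) < e \<longrightarrow> y \<in> W"
          using e(1) by (intro exI[of _ "e / (\<bar>C\<bar> + 1)"]) auto
      qed
    qed
    then show ?thesis by simp
  qed simp
  have main: "strongest_topology ?Q X \<and> Hausdorff_space X \<longleftrightarrow>
    X = seminorm_topology (\<Union>n. V n) (bounded_seminorms s V N) \<and>
    (\<forall>x\<in>(\<Union>n. V n). x \<noteq> 0 \<longrightarrow> (\<exists>p\<in>bounded_seminorms s V N. p x > 0))"
    if chain: "\<And>n. V n \<subseteq> V (Suc n)"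
  proof -
    interpret C: normed_chain s V N by unfold_locales (rule sub chain sn)+
    have VU: "V n \<subseteq> C.U" for n by blast
    have "strongest_topology ?Q X \<longleftrightarrow> X = C.X"
    proof (rule strongest_topology_unique)
      have "finer (Xs n) (subtopology C.X (V n))" for n
        unfolding finer_normed_iff[OF nb C.topspace_X VU] using C.openin_X_inter_V by simp
      then show "?Q C.X" using C.locally_convex_X by simp
    next
      fix T assume T: "?Q T"
      then have top: "topspace T = C.U" and lc: "locally_convex_space s T"
        and fine: "\<And>n. finer (Xs n) (subtopology T (V n))" by blast+
      interpret T: seminorm_space s "topspace T" "continuous_seminorms T"
        by (rule seminorm_space_continuous_seminorms[OF lc])
      have eq: "T = T.X" by (rule locally_convex_eq_seminorm_topology[OF lc])
      have PT: "p \<in> C.P" if p: "p \<in> continuous_seminorms T" for p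
      proof (rule C.P_intro)
        show "seminorm_on s C.U p" using T.seminorm[OF p] top by simp
        fix n
        obtain W where W: "openin T W" "0 \<in> W" "\<forall>x\<in>W. p x < 1"
          using p unfolding continuous_seminorms_def mem_Collect_eq by (elim conjE exE)
        have "\<exists>e>0. \<forall>y\<in>V n. N n (y - 0) < e \<longrightarrow> y \<in> W"
          using fine[of n] W C.V_zero unfolding finer_normed_iff[OF nb top VU] by blast
        then obtain e where e: "e > 0" "\<And>y. y \<in> V n \<Longrightarrow> N n y < e \<Longrightarrow> y \<in> W" by auto
        have "seminorm_on s (V n) p"
          by (rule seminorm_on_subset[OF T.seminorm[OF p]]) (use VU[of n] top in simp)
        moreover have "p y < 1" if "y \<in> V n" "N n y < e" for y
          using e(2)[OF that] W(3) by blast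
        ultimately show "\<exists>C. \<forall>x\<in>V n. p x \<le> C * N n x"
          by (intro seminorm_bound[OF sub sn _ e(1)])
      qed
      have "openin C.X W" if W: "openin T W" for W
        unfolding C.openin_X
      proof (intro conjI ballI)
        show "W \<subseteq> C.U" using openin_subset[OF W] top by simp
        fix x assume "x \<in> W"
        moreover have "openin T.X W" using W eq by simp
        ultimately obtain p where p: "p \<in> continuous_seminorms T" "\<forall>y\<in>topspace T. p (y - x) < 1 \<longrightarrow> y \<in> W"
          unfolding T.openin_X by (elim conjE) (drule bspec, assumption, elim bexE)
        show "\<exists>p\<in>C.P. \<forall>y\<in>C.U. p (y - x) < 1 \<longrightarrow> y \<in> W"
          by (rule bexI[OF _ PT[OF p(1)]]) (use p(2) top in simp)
      qed
      then show "finer C.X T" using top by (simp add: finer_def)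
    qed
    then show ?thesis using C.Hausdorff_X by auto
  qed
  show ?thesis
    unfolding inductive_limit_def top using step main by (metis (no_types, lifting))
qed

end

section \<open>Duality and closed subspaces\<close>

context seminorm_space
begin

definition dual :: "('a \<Rightarrow> 'k) set" where
  "dual = {f. linear_between s (*) U f \<and> (\<lambda>x. norm (f x)) \<in> P}"

lemma dualD:
  assumes "f \<in> dual"
  shows "linear_between s (*) U f" "(\<lambda>x. norm (f x)) \<in> P"
    "x \<in> U \<Longrightarrow> y \<in> U \<Longrightarrow> f (x + y) = f x + f y" "x \<in> U \<Longrightarrow> f (s c x) = c * f x"
    "f 0 = 0" "x \<in> U \<Longrightarrow> f (- x) = - f x" "x \<in> U \<Longrightarrow> y \<in> U \<Longrightarrow> f (x - y) = f x - f y"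
    "(\<And>i. i \<in> A \<Longrightarrow> g i \<in> U) \<Longrightarrow> f (sum g A) = (\<Sum>i\<in>A. f (g i))"
proof -
  show lin: "linear_between s (*) U f" and "(\<lambda>x. norm (f x)) \<in> P" using assms by (simp_all add: dual_def)
  show "x \<in> U \<Longrightarrow> y \<in> U \<Longrightarrow> f (x + y) = f x + f y" "x \<in> U \<Longrightarrow> f (s c x) = c * f x"
    using linear_betweenD[OF lin] by simp_all
  show "f 0 = 0" "x \<in> U \<Longrightarrow> f (- x) = - f x" "x \<in> U \<Longrightarrow> y \<in> U \<Longrightarrow> f (x - y) = f x - f y"
    "(\<And>i. i \<in> A \<Longrightarrow> g i \<in> U) \<Longrightarrow> f (sum g A) = (\<Sum>i\<in>A. f (g i))"
    by (rule linear_between_facts[OF subspace_U lin]; assumption)+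
qed

lemma scaled_in_dual:
  assumes "f \<in> dual"
  shows "(\<lambda>x. c * f x) \<in> dual"
proof -
  have "linear_between s (*) U (\<lambda>x. c * f x)"
    using dualD(1)[OF assms] by (auto simp: linear_between_def algebra_simps)
  moreover have "(\<lambda>x. norm c * norm (f x)) \<in> P" using scaled_in_P[OF dualD(2)[OF assms]] by simp
  ultimately show ?thesis by (simp add: dual_def norm_mult)
qed

lemma closure_mem:
  assumes "A \<subseteq> U" "x \<in> X closure_of A"
  shows "x \<in> U" "p \<in> P \<Longrightarrow> e > 0 \<Longrightarrow> \<exists>y\<in>A. p (y - x) < e"
  using assms in_closure_iff[OF assms(1), of x] by blast+

lemma dual_zero_on_closure:
  assumes f: "f \<in> dual" and A: "A \<subseteq> U" "\<And>x. x \<in> A \<Longrightarrow> f x = 0" and x: "x \<in> X closure_of A"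
  shows "f x = 0"
proof -
  have xU: "x \<in> U" by (rule closure_mem(1)[OF A(1) x])
  have "norm (f x) \<le> 0 + e" if e: "e > 0" for e
  proof -
    obtain y where y: "y \<in> A" "norm (f (y - x)) < e"
      using closure_mem(2)[OF A(1) x dualD(2)[OF f] e] by (elim bexE)
    have "f (y - x) = f y - f x" using dualD(7)[OF f _ xU] y(1) A(1) by blast
    then show ?thesis using y A(2)[OF y(1)] by simp
  qed
  then have "norm (f x) \<le> 0" by (rule field_le_epsilon)
  then show ?thesis by simp
qed

lemma subspace_closure:
  assumes Q: "subspace Q" "Q \<subseteq> U"
  shows "subspace (X closure_of Q)"
proof (rule subspaceI)
  have QX: "Q \<subseteq> X closure_of Q" by (rule closure_of_subset) (use Q in simp)
  then show "0 \<in> X closure_of Q" using subspace_0[OF Q(1)] by blast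
next
  fix x y assume x: "x \<in> X closure_of Q" and y: "y \<in> X closure_of Q"
  have U: "x \<in> U" "y \<in> U" using closure_mem(1)[OF Q(2)] x y by blast+
  have "\<exists>z\<in>Q. p (z - (x + y)) < e" if pe: "p \<in> P" "e > 0" for p e
  proof -
    obtain a b where a: "a \<in> Q" "p (a - x) < e / 2" and b: "b \<in> Q" "p (b - y) < e / 2"
      using closure_mem(2)[OF Q(2) x pe(1), of "e / 2"] closure_mem(2)[OF Q(2) y pe(1), of "e / 2"] pe(2) by auto
    have "p ((a - x) + (b - y)) \<le> p (a - x) + p (b - y)"
      by (intro sn_add pe(1) U_diff U) (use a b Q in auto)
    moreover have "(a + b) - (x + y) = (a - x) + (b - y)" by simp
    ultimately have "p ((a + b) - (x + y)) < e" using a b by (simp only:)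
    then show ?thesis using subspace_add[OF Q(1) a(1) b(1)] by blast
  qed
  then show "x + y \<in> X closure_of Q" using U_add[OF U] by (simp add: in_closure_iff[OF Q(2)])
next
  fix c x assume x: "x \<in> X closure_of Q"
  have U: "x \<in> U" using closure_mem(1)[OF Q(2)] x by blast
  have "\<exists>z\<in>Q. p (z - s c x) < e" if pe: "p \<in> P" "e > 0" for p e
  proof -
    have pos: "e / (norm c + 1) > 0" using pe(2) by (simp add: add_nonneg_pos)
    obtain a where a: "a \<in> Q" "p (a - x) < e / (norm c + 1)"
      using closure_mem(2)[OF Q(2) x pe(1) pos] by auto
    have d: "a - x \<in> U" using a Q(2) U U_diff by blast
    have "p (s c (a - x)) = norm c * p (a - x)" by (rule sn_scale[OF pe(1) d])
    also have "\<dots> \<le> (norm c + 1) * p (a - x)" using sn_nonneg[OF pe(1) d] by (intro mult_right_mono) auto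
    also have "\<dots> < e" using a(2) by (simp add: pos_less_divide_eq add_nonneg_pos mult.commute)
    finally have "p (s c a - s c x) < e" by (simp add: scale_right_diff_distrib)
    then show ?thesis using subspace_scale[OF Q(1) a(1)] by blast
  qed
  then show "s c x \<in> X closure_of Q" using U_scale[OF U] by (simp add: in_closure_iff[OF Q(2)])
qed

text \<open>Hahn-Banach is applied to the distance \<open>q\<close> from \<open>Q\<close> measured
  by some \<open>p\<close> that keeps \<open>v\<close> away from \<open>Q\<close>: it vanishes on
  \<open>Q\<close>, is positive at \<open>v\<close> and is dominated by \<open>p\<close>.\<close>

lemma separating_functional:
  assumes Q: "subspace Q" "Q \<subseteq> U" and v: "v \<in> U" "v \<notin> X closure_of Q"
  shows "\<exists>f\<in>dual. (\<forall>x\<in>Q. f x = 0) \<and> f v = 1"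
proof -
  have "\<not> (\<forall>p\<in>P. \<forall>e>0. \<exists>y\<in>Q. p (y - v) < e)" using v in_closure_iff[OF Q(2), of v] by blast
  then have "\<exists>p\<in>P. \<exists>e>0. \<forall>y\<in>Q. e \<le> p (y - v)" by (simp add: not_less)
  then obtain p e where p: "p \<in> P" and e: "e > 0" "\<forall>y\<in>Q. e \<le> p (y - v)" by (elim bexE exE conjE)
  define q where "q = (\<lambda>x. INF y\<in>Q. p (y - x))"
  have QU: "y \<in> U" if "y \<in> Q" for y using that Q(2) by blast
  have lower: "q x \<le> p (y - x)" if "x \<in> U" "y \<in> Q" for x y
    unfolding q_def
    by (rule cINF_lower) (use that sn_nonneg[OF p] U_diff QU in \<open>auto intro!: bdd_belowI2[of _ 0]\<close>)
  have greatest: "m \<le> q x" if "\<And>y. y \<in> Q \<Longrightarrow> m \<le> p (y - x)" for m x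
    unfolding q_def by (rule cINF_greatest) (use subspace_0[OF Q(1)] that in auto)
  have q0: "q x \<ge> 0" if "x \<in> U" for x
    by (rule greatest) (use sn_nonneg[OF p] U_diff QU that in auto)
  have scale_le: "q (s c x) \<le> norm c * q x" if c: "c \<noteq> 0" and x: "x \<in> U" for c x
  proof -
    have "q (s c x) / norm c \<le> q x"
    proof (rule greatest)
      fix y assume y: "y \<in> Q"
      have "q (s c x) \<le> p (s c y - s c x)"
        by (rule lower[OF U_scale[OF x] subspace_scale[OF Q(1) y]])
      also have "\<dots> = norm c * p (y - x)"
        using sn_scale[OF p U_diff[OF QU[OF y] x]] by (simp add: scale_right_diff_distrib)
      finally show "q (s c x) / norm c \<le> p (y - x)" using c by (simp add: field_simps)
    qed
    then show ?thesis using c by (simp add: field_simps)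
  qed
  have vanish: "q x = 0" if "x \<in> Q" for x
    using lower[OF QU[OF that] that] q0[OF QU[OF that]] sn_zero[OF p] by simp
  have scale: "q (s c x) = norm c * q x" if x: "x \<in> U" for c x
  proof (cases "c = 0")
    case True
    then show ?thesis using vanish[OF subspace_0[OF Q(1)]] by simp
  next
    case False
    have "q (s (1 / c) (s c x)) \<le> norm (1 / c) * q (s c x)"
      by (rule scale_le) (use False U_scale[OF x] in auto)
    then have "norm c * q x \<le> q (s c x)" using False by (simp add: norm_divide field_simps)
    then show ?thesis using scale_le[OF False x] by simp
  qed
  have add: "q (x + y) \<le> q x + q y" if x: "x \<in> U" and y: "y \<in> U" for x y
  proof -
    have *: "q (x + y) - p (a - x) \<le> p (b - y)" if ab: "a \<in> Q" "b \<in> Q" for a b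
    proof -
      have "q (x + y) \<le> p ((a + b) - (x + y))"
        by (rule lower[OF U_add[OF x y] subspace_add[OF Q(1) ab]])
      also have "(a + b) - (x + y) = (a - x) + (b - y)" by simp
      also have "p \<dots> \<le> p (a - x) + p (b - y)" by (intro sn_add p U_diff QU ab x y)
      finally show ?thesis by simp
    qed
    have "q (x + y) - p (a - x) \<le> q y" if "a \<in> Q" for a by (rule greatest) (rule *[OF that])
    then have "q (x + y) - q y \<le> q x" by (intro greatest) (simp add: algebra_simps)
    then show ?thesis by simp
  qed
  have sn: "seminorm_on s U q" using scale add by (simp add: seminorm_on_def)
  have "e \<le> q v" by (rule greatest) (use e(2) in blast)
  then have qv: "q v > 0" using e(1) by simp
  obtain f C where f: "linear_between s (*) U f" "\<forall>x\<in>U. norm (f x) \<le> C * q x" "f v = 1"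
    using Hahn_Banach_functional[OF subspace_U sn v(1) qv] by (elim exE conjE)
  have "q \<in> P"
  proof (rule dominated_in_P[OF p sn])
    fix x assume x: "x \<in> U"
    show "q x \<le> 1 * p x" using lower[OF x subspace_0[OF Q(1)]] sn_minus[OF p x] by simp
  qed
  then have "(\<lambda>x. norm (f x)) \<in> P"
    by (rule dominated_in_P[OF _ seminorm_on_norm_linear[OF subspace_U f(1)]]) (use f(2) in blast)
  moreover have "f x = 0" if "x \<in> Q" for x
    using f(2)[rule_format, OF QU[OF that]] vanish[OF that] by simp
  ultimately show ?thesis using f by (intro bexI[of _ f]) (simp_all add: dual_def)
qed

text \<open>For a continuous \<open>f\<close> vanishing on \<open>Q\<close> with
  \<open>f v = 1\<close>, the map \<open>x - s (f x) v\<close> is continuous and sends the span into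
  \<open>Q\<close>; so it sends the closure of the span into the closed space
  \<open>Q\<close>.\<close>

lemma closed_span_insert:
  assumes Q: "subspace Q" "Q \<subseteq> U" "X closure_of Q = Q" and v: "v \<in> U"
  shows "X closure_of (span (insert v Q)) = span (insert v Q)"
proof (cases "v \<in> Q")
  case True
  then have "span (insert v Q) = Q" using Q(1) by (simp add: insert_absorb span_eq_iff)
  then show ?thesis using Q(3) by simp
next
  case False
  let ?S = "span (insert v Q)"
  have SU: "?S \<subseteq> U" by (rule span_minimal[OF _ subspace_U]) (use Q v in auto)
  obtain f where f: "f \<in> dual" "\<forall>x\<in>Q. f x = 0" "f v = 1"
    using separating_functional[OF Q(1,2) v] False Q(3) by auto
  have "x \<in> ?S" if x: "x \<in> X closure_of ?S" for x
  proof -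
    have xU: "x \<in> U" by (rule closure_mem(1)[OF SU x])
    let ?r = "\<lambda>x. x - s (f x) v"
    have rU: "?r x \<in> U" if "x \<in> U" for x by (intro U_diff U_scale that v)
    have "\<exists>y\<in>Q. p (y - ?r x) < e" if p: "p \<in> P" and e: "e > 0" for p e
    proof -
      \<comment> \<open>This seminorm dominates the value of \<open>p\<close> after the projection
        \<open>?r\<close>.\<close>
      have "(\<lambda>x. p x + p v * norm (f x)) \<in> P"
        by (intro add_in_P scaled_in_P dualD(2)[OF f(1)] p sn_nonneg[OF p v])
      from closure_mem(2)[OF SU x this e]
      obtain y where y: "y \<in> ?S" "p (y - x) + p v * norm (f (y - x)) < e" by (elim bexE)
      have yU: "y \<in> U" using y(1) SU by blast
      obtain k where k: "y - s k v \<in> Q" using y(1) Q(1) by (auto simp: span_insert span_eq_iff[THEN iffD2])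
      have "f (y - s k v) = f y - k"
        using dualD(7)[OF f(1) yU U_scale[OF v]] dualD(4)[OF f(1) v] f(3) by simp
      then have "f y = k" using f(2) k by simp
      then have "?r y \<in> Q" using k by simp
      moreover have "p (?r y - ?r x) \<le> p (y - x) + p v * norm (f (y - x))"
      proof -
        have "?r y - ?r x = (y - x) - s (f (y - x)) v"
          unfolding dualD(7)[OF f(1) yU xU] by (simp add: scale_left_diff_distrib)
        also have "p \<dots> \<le> p (y - x) + p (s (f (y - x)) v)"
          by (intro sn_diff p U_diff yU xU U_scale v)
        finally show ?thesis using sn_scale[OF p v] by (simp add: mult.commute)
      qed
      ultimately show ?thesis using y(2) by force
    qed
    then have "?r x \<in> X closure_of Q" using rU[OF xU] by (simp add: in_closure_iff[OF Q(2)])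
    then have "?r x \<in> Q" using Q(3) by simp
    then have "?r x \<in> ?S" "s (f x) v \<in> ?S" by (auto intro: span_base span_scale)
    then have "?r x + s (f x) v \<in> ?S" by (rule span_add)
    then show ?thesis by simp
  qed
  moreover have "?S \<subseteq> X closure_of ?S" by (rule closure_of_subset) (use SU in simp)
  ultimately show ?thesis by blast
qed

lemma closed_span_Un_finite:
  assumes Q: "subspace Q" "Q \<subseteq> U" "X closure_of Q = Q" and B: "finite B" "B \<subseteq> U"
  shows "X closure_of (span (Q \<union> B)) = span (Q \<union> B)"
  using B
proof (induction B rule: finite_induct)
  case empty
  then show ?case using Q by (simp add: span_eq_iff[THEN iffD2])
next
  case (insert b B)
  have "span (Q \<union> B) \<subseteq> U" by (rule span_minimal[OF _ subspace_U]) (use Q insert in auto)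
  moreover have "span (insert b (span (Q \<union> B))) = span (Q \<union> insert b B)"
    by (simp add: span_insert span_span)
  ultimately show ?case
    using closed_span_insert[OF subspace_span, of "Q \<union> B" b] insert by simp
qed

lemma Hausdorff_closure_zero:
  assumes "Hausdorff_space X"
  shows "X closure_of {0} = {0}"
  using closedin_Hausdorff_singleton[OF assms, of 0] U_zero by (simp add: closure_of_closedin)

lemma closed_finite_span:
  assumes "Hausdorff_space X" "finite B" "B \<subseteq> U"
  shows "X closure_of (span B) = span B"
proof -
  have "span ({0} \<union> B) = span B" by (simp add: span_insert_0)
  then show ?thesis
    using closed_span_Un_finite[of "{0}" B] assms Hausdorff_closure_zero[OF assms(1)] U_zero
    by simp
qed

end

section \<open>Chains of separable Banach spaces with a Hausdorff limit\<close>

locale Banach_chain = normed_chain s V N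
  for s :: "'k::real_or_complex \<Rightarrow> 'a::ab_group_add \<Rightarrow> 'a" and V N +
  assumes N_definite: "x \<in> V n \<Longrightarrow> N n x = 0 \<Longrightarrow> x = 0"
    and N_complete: "norm_complete (V n) (N n)"
    and N_separable: "norm_separable (V n) (N n)"
    and V_nonzero: "V n \<noteq> {0}"
    and N_Suc: "\<exists>C. \<forall>x\<in>V n. N (Suc n) x \<le> C * N n x"
    and P_separates: "x \<in> U \<Longrightarrow> x \<noteq> 0 \<Longrightarrow> \<exists>p\<in>P. p x > 0"
begin

lemma Hausdorff: "Hausdorff_space X"
  unfolding Hausdorff_X using P_separates by blast

lemma dual_bound:
  assumes "f \<in> dual"
  obtains C where "C > 0" "\<And>x. x \<in> V n \<Longrightarrow> norm (f x) \<le> C * N n x"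
  using P_bound[OF dualD(2)[OF assms]] by metis

lemma N_mono:
  assumes "m \<le> n"
  obtains C where "C > 0" "\<And>x. x \<in> V m \<Longrightarrow> N n x \<le> C * N m x"
proof -
  have "\<exists>C>0. \<forall>x\<in>V m. N n x \<le> C * N m x"
    using assms
  proof (induction n rule: dec_induct)
    case base
    then show ?case by (intro exI[of _ 1]) simp
  next
    case (step n)
    then obtain C where C: "C > 0" "\<forall>x\<in>V m. N n x \<le> C * N m x" by blast
    obtain D where D: "\<forall>x\<in>V n. N (Suc n) x \<le> D * N n x" using N_Suc by blast
    have "N (Suc n) x \<le> (\<bar>D\<bar> + 1) * C * N m x" if x: "x \<in> V m" for x
    proof -
      have xn: "x \<in> V n" using x V_mono[of m n] step by auto
      have "N (Suc n) x \<le> D * N n x" using D xn by blast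
      also have "\<dots> \<le> (\<bar>D\<bar> + 1) * N n x" using N_nonneg[OF xn] by (intro mult_right_mono) auto
      also have "\<dots> \<le> (\<bar>D\<bar> + 1) * (C * N m x)" using C x by (intro mult_left_mono) auto
      finally show ?thesis by (simp add: mult.assoc)
    qed
    then show ?case using C(1) by (intro exI[of _ "(\<bar>D\<bar> + 1) * C"]) auto
  qed
  then show ?thesis using that by metis
qed

lemma N_series_converges:
  assumes z: "\<And>i. z i \<in> V n" and sum: "summable (\<lambda>i. N n (z i))"
  shows "\<exists>l\<in>V n. (\<lambda>m. N n ((\<Sum>i<m. z i) - l)) \<longlonglongrightarrow> 0"
proof -
  let ?S = "\<lambda>m. \<Sum>i<m. z i"
  have S: "?S m \<in> V n" for m by (intro V_sum z)
  have diff: "N n (?S i - ?S j) \<le> (\<Sum>k\<in>{j..<i}. N n (z k))" if "j \<le> i" for i j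
  proof -
    have "?S i - ?S j = (\<Sum>k\<in>{j..<i}. z k)" using that by (simp add: sum_diff_nat_ivl lessThan_atLeast0)
    then show ?thesis using N_sum[of "{j..<i}" z n] z by simp
  qed
  have "\<exists>m. \<forall>i\<ge>m. \<forall>j\<ge>m. N n (?S i - ?S j) < e" if e: "e > 0" for e
  proof -
    obtain m where m: "\<And>i j. i \<ge> m \<Longrightarrow> norm (\<Sum>k\<in>{i..<j}. N n (z k)) < e"
      using sum e unfolding summable_Cauchy by blast
    have "N n (?S i - ?S j) < e" if ij: "i \<ge> m" "j \<ge> m" for i j
    proof (cases "j \<le> i")
      case True
      then show ?thesis using diff[OF True] m[OF ij(2), of i] by simp
    next
      case False
      then have "N n (?S j - ?S i) < e" using diff[of i j] m[OF ij(1), of j] by simp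
      then show ?thesis using N_diff_commute[OF S S] by simp
    qed
    then show ?thesis by blast
  qed
  moreover have "range ?S \<subseteq> V n" using S by blast
  ultimately show ?thesis using N_complete[of n] unfolding norm_complete_def by blast
qed

lemma P_tendsto:
  assumes "p \<in> P" "\<And>i. z i \<in> V n" "l \<in> V n" "(\<lambda>i. N n (z i - l)) \<longlonglongrightarrow> 0"
  shows "(\<lambda>i. p (z i - l)) \<longlonglongrightarrow> 0"
proof -
  obtain C where C: "C > 0" "\<And>x. x \<in> V n \<Longrightarrow> p x \<le> C * N n x" using P_bound[OF assms(1)] by metis
  have "z i - l \<in> V n" for i by (intro V_diff assms)
  then have lower: "0 \<le> p (z i - l)" and upper: "p (z i - l) \<le> C * N n (z i - l)" for i
    using C(2)[of "z i - l"] sn_nonneg[OF assms(1) V_U[of "z i - l" n]] by simp_all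
  have lim: "(\<lambda>i. C * N n (z i - l)) \<longlonglongrightarrow> 0"
    using tendsto_mult_left[OF assms(4), of C] by simp
  show ?thesis
    by (rule tendsto_sandwich[OF always_eventually always_eventually tendsto_const lim]) (use lower upper in blast)+
qed

end

lemma (in scalar_space) separable_Banach_limit_iff:
  "separable_Banach_limit s Xs X \<longleftrightarrow>
    (\<exists>N. (\<forall>n. normed_by (topspace (Xs n)) (N n) (Xs n)) \<and> Banach_chain s (\<lambda>n. topspace (Xs n)) N \<and>
       X = seminorm_topology (\<Union>n. topspace (Xs n)) (bounded_seminorms s (\<lambda>n. topspace (Xs n)) N))"
proof
  assume lim: "separable_Banach_limit s Xs X"
  then have "\<forall>n. \<exists>N. Banach_norm s (topspace (Xs n)) N \<and> normed_by (topspace (Xs n)) N (Xs n)"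
    by (simp add: separable_Banach_limit_def separable_Banach_space_iff)
  then obtain N where N: "\<forall>n. Banach_norm s (topspace (Xs n)) (N n) \<and> normed_by (topspace (Xs n)) (N n) (Xs n)"
    by (auto dest: choice)
  then have B: "\<And>n. Banach_norm s (topspace (Xs n)) (N n)" and nb: "\<And>n. normed_by (topspace (Xs n)) (N n) (Xs n)"
    by blast+
  have sub: "\<And>n. subspace (topspace (Xs n))" and sn: "\<And>n. seminorm_on s (topspace (Xs n)) (N n)"
    using B by (simp_all add: Banach_norm_def)
  have ind: "inductive_limit s Xs X" using lim by (simp add: separable_Banach_limit_def)
  note I = ind[unfolded inductive_limit_iff[OF nb sub sn]]
  have "Banach_chain s (\<lambda>n. topspace (Xs n)) N"
    using I B sub sn by unfold_locales (auto simp: Banach_norm_def)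
  then show "\<exists>N. (\<forall>n. normed_by (topspace (Xs n)) (N n) (Xs n)) \<and> Banach_chain s (\<lambda>n. topspace (Xs n)) N \<and>
       X = seminorm_topology (\<Union>n. topspace (Xs n)) (bounded_seminorms s (\<lambda>n. topspace (Xs n)) N)"
    using I nb by (intro exI[of _ N] conjI) auto
next
  assume "\<exists>N. (\<forall>n. normed_by (topspace (Xs n)) (N n) (Xs n)) \<and> Banach_chain s (\<lambda>n. topspace (Xs n)) N \<and>
       X = seminorm_topology (\<Union>n. topspace (Xs n)) (bounded_seminorms s (\<lambda>n. topspace (Xs n)) N)"
  then obtain N where nb: "\<And>n. normed_by (topspace (Xs n)) (N n) (Xs n)"
    and C: "Banach_chain s (\<lambda>n. topspace (Xs n)) N"
    and X: "X = seminorm_topology (\<Union>n. topspace (Xs n)) (bounded_seminorms s (\<lambda>n. topspace (Xs n)) N)"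
    by blast
  interpret C: Banach_chain s "\<lambda>n. topspace (Xs n)" N by (rule C)
  have "Banach_norm s (topspace (Xs n)) (N n)" for n
    unfolding Banach_norm_def
    by (intro conjI ballI impI C.subspace_V C.V_nonzero C.seminorm_N C.N_complete C.N_separable)
      (rule C.N_definite)
  then have "separable_Banach_space s (Xs n)" for n
    unfolding separable_Banach_space_iff using nb by blast
  moreover have "inductive_limit s Xs X"
    unfolding inductive_limit_iff[OF nb C.subspace_V C.seminorm_N]
    by (intro conjI allI ballI impI C.V_Suc C.N_Suc C.P_separates X)
  ultimately show "separable_Banach_limit s Xs X" by (simp add: separable_Banach_limit_def)
qed

section \<open>Powers of a large Jordan block\<close>

text \<open>The weights are those of the \<open>r\<close>-th forward difference in \<open>m\<close>;
  by Pascal's rule each difference lowers the lower index by one.\<close>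

lemma difference_weights:
  "\<exists>\<beta>::nat \<Rightarrow> real. \<forall>m q. (\<Sum>i\<le>r. \<beta> i * real ((m + i) choose q)) =
     (if r \<le> q then real (m choose (q - r)) else 0)"
proof (induction r)
  case 0
  show ?case by (intro exI[of _ "\<lambda>_. 1"]) simp
next
  case (Suc r)
  then obtain \<beta> :: "nat \<Rightarrow> real" where \<beta>: "\<And>m q. (\<Sum>i\<le>r. \<beta> i * real ((m + i) choose q)) =
     (if r \<le> q then real (m choose (q - r)) else 0)" by blast
  define \<gamma> where "\<gamma> i = (if i = 0 then 0 else \<beta> (i - 1)) - (if i \<le> r then \<beta> i else 0)" for i
  have "(\<Sum>i\<le>Suc r. \<gamma> i * real ((m + i) choose q)) =
     (if Suc r \<le> q then real (m choose (q - Suc r)) else 0)" for m q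
  proof -
    have "(\<Sum>i\<le>Suc r. \<gamma> i * real ((m + i) choose q)) =
        (\<Sum>i\<le>Suc r. (if i = 0 then 0 else \<beta> (i - 1)) * real ((m + i) choose q)) -
        (\<Sum>i\<le>Suc r. (if i \<le> r then \<beta> i else 0) * real ((m + i) choose q))"
      by (simp add: \<gamma>_def left_diff_distrib sum_subtractf)
    also have "(\<Sum>i\<le>Suc r. (if i = 0 then 0 else \<beta> (i - 1)) * real ((m + i) choose q)) =
        (\<Sum>i\<le>r. \<beta> i * real ((Suc m + i) choose q))"
      by (subst sum.atMost_Suc_shift) simp
    also have "(\<Sum>i\<le>Suc r. (if i \<le> r then \<beta> i else 0) * real ((m + i) choose q)) =
        (\<Sum>i\<le>r. \<beta> i * real ((m + i) choose q))" by simp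
    finally have eq: "(\<Sum>i\<le>Suc r. \<gamma> i * real ((m + i) choose q)) =
      (if r \<le> q then real (Suc m choose (q - r)) else 0) - (if r \<le> q then real (m choose (q - r)) else 0)"
      by (simp only: \<beta>)
    show ?thesis
    proof (cases "Suc r \<le> q")
      case True
      then obtain k where "q = r + Suc k" by (metis add_Suc_right add_Suc_shift le_Suc_ex)
      then show ?thesis unfolding eq by simp
    next
      case False
      then show ?thesis unfolding eq by (cases "q = r") auto
    qed
  qed
  then show ?case by blast
qed

text \<open>\<open>\<kappa>\<close> inverts the matrix of the binomials
  \<open>(M + i) choose q\<close>. Differences make it triangular: the \<open>r\<close>-th one
  vanishes at \<open>q < r\<close> and is 1 at \<open>q = r\<close>, so the values can be prescribed
  one \<open>q\<close> after another.\<close>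

lemma interpolation_weights:
  "\<exists>\<kappa>::nat \<Rightarrow> nat \<Rightarrow> real. \<forall>p. \<forall>q\<le>Q. (\<Sum>i\<le>Q. \<kappa> p i * real ((M + i) choose q)) = (if p = q then 1 else 0)"
proof -
  have "\<exists>\<kappa>::nat \<Rightarrow> real. \<forall>q<r. (\<Sum>i\<le>Q. \<kappa> i * real ((M + i) choose q)) = g q"
    if "r \<le> Suc Q" for r and g :: "nat \<Rightarrow> real"
    using that
  proof (induction r)
    case (Suc r)
    then obtain \<kappa> :: "nat \<Rightarrow> real" where \<kappa>: "\<And>q. q < r \<Longrightarrow> (\<Sum>i\<le>Q. \<kappa> i * real ((M + i) choose q)) = g q"
      by auto
    obtain \<beta> :: "nat \<Rightarrow> real" where \<beta>: "\<And>m q. (\<Sum>i\<le>r. \<beta> i * real ((m + i) choose q)) =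
      (if r \<le> q then real (m choose (q - r)) else 0)" using difference_weights by blast
    define t where "t = g r - (\<Sum>i\<le>Q. \<kappa> i * real ((M + i) choose r))"
    have sub: "{..Q} \<inter> {i. i \<le> r} = {..r}" using Suc.prems by auto
    have "(\<Sum>i\<le>Q. (\<kappa> i + t * (if i \<le> r then \<beta> i else 0)) * real ((M + i) choose q)) = g q"
      if "q < Suc r" for q
    proof -
      have "(\<Sum>i\<le>Q. (if i \<le> r then \<beta> i else 0) * real ((M + i) choose q)) =
          (\<Sum>i\<le>Q. if i \<le> r then \<beta> i * real ((M + i) choose q) else 0)"
        by (intro sum.cong) auto
      also have "\<dots> = (\<Sum>i\<le>r. \<beta> i * real ((M + i) choose q))"
        by (simp add: sum.If_cases sub)
      finally have b: "(\<Sum>i\<le>Q. (if i \<le> r then \<beta> i else 0) * real ((M + i) choose q)) =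
          (if r \<le> q then real (M choose (q - r)) else 0)" by (simp only: \<beta>)
      have "(\<Sum>i\<le>Q. (\<kappa> i + t * (if i \<le> r then \<beta> i else 0)) * real ((M + i) choose q)) =
        (\<Sum>i\<le>Q. \<kappa> i * real ((M + i) choose q)) +
        t * (\<Sum>i\<le>Q. (if i \<le> r then \<beta> i else 0) * real ((M + i) choose q))"
        unfolding sum_distrib_left sum.distrib[symmetric]
        by (intro sum.cong) (simp_all only: distrib_right mult.assoc)
      then show ?thesis unfolding b using \<kappa>[of q] that by (cases "q = r") (auto simp: t_def)
    qed
    then show ?case
      by (intro exI[of _ "\<lambda>i. \<kappa> i + t * (if i \<le> r then \<beta> i else 0)"]) blast
  qed simp
  then have "\<exists>\<kappa>::nat \<Rightarrow> real. \<forall>q<Suc Q. (\<Sum>i\<le>Q. \<kappa> i * real ((M + i) choose q)) = (if p = q then 1 else 0)" for p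
    by simp
  then have "\<forall>p. \<exists>\<kappa>::nat \<Rightarrow> real. \<forall>q\<le>Q. (\<Sum>i\<le>Q. \<kappa> i * real ((M + i) choose q)) = (if p = q then 1 else 0)"
    unfolding less_Suc_eq_le by blast
  then show ?thesis by (rule choice)
qed

text \<open>Vandermonde's identity with a summation range independent of \<open>i\<close>, so that
  the sums over \<open>i\<close> and \<open>j\<close> can be exchanged later.\<close>

lemma vandermonde_shifted:
  assumes "q \<le> M" "i \<le> Q"
  shows "(\<Sum>j\<le>Q. (i choose j) * (n choose (M + j - q))) = (n + i) choose (M + i - q)"
proof -
  have "(\<Sum>j\<le>Q. (i choose j) * (n choose (M + j - q))) = (\<Sum>j\<le>i. (i choose j) * (n choose (M + j - q)))"
    using assms by (intro sum.mono_neutral_right) (auto simp: binomial_eq_0)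
  also have "\<dots> = (\<Sum>k\<le>i. (i choose k) * (n choose (M + i - q - k)))"
  proof (rule sum.reindex_bij_witness[of _ "\<lambda>k. i - k" "\<lambda>j. i - j"])
    fix j assume j: "j \<in> {..i}"
    have "M + i - q - (i - j) = M + j - q" using j assms by auto
    moreover have "i choose (i - j) = i choose j" using j by (simp add: binomial_symmetric[symmetric])
    ultimately show "(i choose (i - j)) * (n choose (M + i - q - (i - j))) = (i choose j) * (n choose (M + j - q))"
      by simp
  qed auto
  also have "\<dots> = (\<Sum>k\<le>M + i - q. (i choose k) * (n choose (M + i - q - k)))"
    using assms by (intro sum.mono_neutral_left) (auto simp: binomial_eq_0)
  also have "\<dots> = (i + n) choose (M + i - q)" by (rule vandermonde)
  finally show ?thesis by (simp add: add.commute)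
qed

lemma fact_add_ge:
  assumes "0 \<le> x" "x \<le> real a"
  shows "fact a * x ^ k \<le> fact (a + k)"
proof (induction k)
  case (Suc k)
  have "fact a * x ^ Suc k = x * (fact a * x ^ k)" by simp
  also have "\<dots> \<le> real (a + Suc k) * fact (a + k)"
    using assms by (intro mult_mono Suc) auto
  also have "\<dots> = fact (a + Suc k)" by simp
  finally show ?case .
qed simp

lemma binomial_le_power: "n \<ge> 1 \<Longrightarrow> real (n choose k) \<le> real n ^ k"
  by (cases "k \<le> n") (use binomial_le_pow[of k n] in \<open>auto simp: binomial_eq_0 simp flip: of_nat_power\<close>)

text \<open>The combinations \<open>\<Sum>j. (i choose j) e (M + j)\<close> are chosen because Vandermonde's identity turns
  their images under the \<open>n\<close>-th power of a Jordan block into the binomials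
  \<open>(n + i) choose (M + i - q)\<close>, in which \<open>n\<close> and \<open>i\<close> separate up to row and column scalings.\<close>

lemma Jordan_block_steering:
  fixes u y :: "nat \<Rightarrow> 'k::real_normed_field"
  assumes QM: "Q < M" and u: "\<And>i. i > Q \<Longrightarrow> u i = 0" and y: "\<And>i. i > Q \<Longrightarrow> y i = 0" and e: "\<epsilon> > 0"
  shows "\<exists>n a. (\<forall>i. a i \<noteq> 0 \<longrightarrow> M \<le> i \<and> i \<le> M + Q) \<and> (\<forall>i. norm (a i) \<le> \<epsilon>) \<and>
    (\<forall>q\<le>Q. (\<Sum>i=q..M+Q. of_nat (n choose (i - q)) * (u i + a i)) = y q) \<and>
    (\<forall>q. Q < q \<longrightarrow> q \<le> M + Q \<longrightarrow> norm (\<Sum>i=q..M+Q. of_nat (n choose (i - q)) * (u i + a i)) \<le> \<epsilon>)"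
proof -
  obtain \<kappa> :: "nat \<Rightarrow> nat \<Rightarrow> real" where
    \<kappa>: "\<And>p q. q \<le> Q \<Longrightarrow> (\<Sum>i\<le>Q. \<kappa> p i * real ((M + i) choose q)) = (if p = q then 1 else 0)"
    using interpolation_weights[of Q M] by blast
  \<comment> \<open>\<open>G\<close>, \<open>K\<close> and \<open>K'\<close> collect everything that
    does not depend on \<open>n\<close>, so that \<open>n\<close> can be chosen after them.\<close>
  define G where "G = (\<Sum>i\<le>Q. norm (u i) + norm (y i))"
  define K where "K = (\<Sum>i\<le>Q. \<Sum>p\<le>Q. \<bar>\<kappa> p i\<bar> * G * fact (M + i) * 2 ^ (M + i - p))"
  define K' where "K' = K * (\<Sum>i\<le>Q. 2 ^ i)"
  have G0: "G \<ge> 0" unfolding G_def by (intro sum_nonneg) simp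
  have K0: "K \<ge> 0" unfolding K_def by (intro sum_nonneg mult_nonneg_nonneg) (use G0 in auto)
  have K'0: "K' \<ge> 0" unfolding K'_def by (intro mult_nonneg_nonneg K0 sum_nonneg) simp
  obtain n0 :: nat where n0: "real (M + Q + 1) * K' / \<epsilon> < real n0" using reals_Archimedean2 by blast
  \<comment> \<open>\<open>n \<ge> 2 * M\<close> gives \<open>n - M \<ge> n / 2\<close>, which
    enters the bound on factorial quotients.\<close>
  define n where "n = max n0 (2 * M)"
  have n: "n \<ge> 2 * M" "n \<ge> 1" "real (M + Q + 1) * K' \<le> \<epsilon> * real n"
  proof -
    show "n \<ge> 2 * M" "n \<ge> 1" using QM by (auto simp: n_def)
    have "real (M + Q + 1) * K' / \<epsilon> \<le> real n" using n0 by (simp add: n_def)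
    then show "real (M + Q + 1) * K' \<le> \<epsilon> * real n" using e by (simp add: field_simps)
  qed
  \<comment> \<open>\<open>g p\<close> is what the correction has to add in row \<open>p\<close>. As
    \<open>(n + i) choose (M + i - q)\<close> is \<open>(M + i) choose q\<close> times a factor in
    \<open>i\<close> and a factor in \<open>q\<close>, \<open>b\<close> solves the interpolation
    problem with the factor in \<open>q\<close> cancelled, and \<open>c\<close> cancels the factor
    in \<open>i\<close>.\<close>
  define g where "g p = y p - (\<Sum>i=p..Q. of_nat (n choose (i - p)) * u i)" for p
  define b where "b i = (\<Sum>p\<le>Q. of_real (\<kappa> p i * (fact (n - M + p) / fact p)) * g p)" for i
  define c where "c i = of_real (fact (M + i) / fact (n + i)) * b i" for i
  define a where "a j = (if M \<le> j \<and> j \<le> M + Q then \<Sum>i\<le>Q. of_nat (i choose (j - M)) * c i else 0)" for j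
  have g_bound: "norm (g p) \<le> G * real n ^ (Q - p)" if p: "p \<le> Q" for p
  proof -
    have one: "1 \<le> real n ^ (Q - p)" using n by simp
    have "norm (g p) \<le> norm (y p) + (\<Sum>i=p..Q. norm (of_nat (n choose (i - p)) * u i))"
      unfolding g_def by (rule order_trans[OF norm_triangle_ineq4]) (intro add_left_mono norm_sum)
    also have "\<dots> \<le> norm (y p) * real n ^ (Q - p) + (\<Sum>i=p..Q. norm (u i) * real n ^ (Q - p))"
    proof (intro add_mono sum_mono)
      show "norm (y p) \<le> norm (y p) * real n ^ (Q - p)" using one by (simp add: mult_le_cancel_left1)
      fix i assume i: "i \<in> {p..Q}"
      have "real (n choose (i - p)) \<le> real n ^ (i - p)" by (rule binomial_le_power) (use n in simp)
      also have "\<dots> \<le> real n ^ (Q - p)" using n i by (intro power_increasing) auto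
      finally show "norm (of_nat (n choose (i - p)) * u i) \<le> norm (u i) * real n ^ (Q - p)"
        by (simp add: norm_mult mult.commute mult_left_mono)
    qed
    also have "\<dots> = (norm (y p) + (\<Sum>i=p..Q. norm (u i))) * real n ^ (Q - p)"
      by (simp add: distrib_right sum_distrib_right)
    also have "norm (y p) + (\<Sum>i=p..Q. norm (u i)) \<le> G"
    proof -
      have "norm (y p) \<le> (\<Sum>i\<le>Q. norm (y i))" using p by (intro member_le_sum) auto
      moreover have "(\<Sum>i=p..Q. norm (u i)) \<le> (\<Sum>i\<le>Q. norm (u i))" by (intro sum_mono2) auto
      ultimately show ?thesis by (simp add: G_def sum.distrib)
    qed
    finally show ?thesis by (simp add: mult_right_mono)
  qed
  have fact_bound: "fact (n - M + p) / fact (n + i) \<le> 2 ^ (M + i - p) / real n ^ (M + i - p)" if p: "p \<le> Q" for p i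
  proof -
    have "fact (n - M + p) * (real n / 2) ^ (M + i - p) \<le> fact (n - M + p + (M + i - p))"
      by (rule fact_add_ge) (use n in auto)
    also have "n - M + p + (M + i - p) = n + i" using p n QM by auto
    finally show ?thesis using n by (simp add: power_divide divide_simps mult.commute)
  qed
  have c_bound: "norm (c i) \<le> K / real n ^ (M + i - Q)" if i: "i \<le> Q" for i
  proof -
    have "norm (c i) \<le> (\<Sum>p\<le>Q. fact (M + i) / fact (n + i) * (\<bar>\<kappa> p i\<bar> * (fact (n - M + p) / fact p) * norm (g p)))"
      unfolding c_def b_def sum_distrib_left
      by (rule order_trans[OF norm_sum]) (simp add: norm_mult norm_divide abs_mult)
    also have "\<dots> \<le> (\<Sum>p\<le>Q. \<bar>\<kappa> p i\<bar> * G * fact (M + i) * 2 ^ (M + i - p) / real n ^ (M + i - Q))"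
    proof (rule sum_mono)
      fix p assume "p \<in> {..Q}"
      then have p: "p \<le> Q" by simp
      have "fact (M + i) / fact (n + i) * (\<bar>\<kappa> p i\<bar> * (fact (n - M + p) / fact p) * norm (g p)) =
          \<bar>\<kappa> p i\<bar> * fact (M + i) * (1 / fact p) * (fact (n - M + p) / fact (n + i)) * norm (g p)" by (simp add: mult_ac)
      also have "\<dots> \<le> \<bar>\<kappa> p i\<bar> * fact (M + i) * 1 * (2 ^ (M + i - p) / real n ^ (M + i - p)) * (G * real n ^ (Q - p))"
        by (intro mult_mono fact_bound g_bound p order_refl) (auto simp: fact_ge_1)
      also have "real n ^ (M + i - p) = real n ^ (M + i - Q) * real n ^ (Q - p)"
        using p QM by (simp flip: power_add)
      finally show "fact (M + i) / fact (n + i) * (\<bar>\<kappa> p i\<bar> * (fact (n - M + p) / fact p) * norm (g p)) \<le>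
          \<bar>\<kappa> p i\<bar> * G * fact (M + i) * 2 ^ (M + i - p) / real n ^ (M + i - Q)"
        using n by (simp add: mult.assoc mult.left_commute)
    qed
    also have "\<dots> = (\<Sum>p\<le>Q. \<bar>\<kappa> p i\<bar> * G * fact (M + i) * 2 ^ (M + i - p)) / real n ^ (M + i - Q)"
      by (simp add: sum_divide_distrib)
    also have "(\<Sum>p\<le>Q. \<bar>\<kappa> p i\<bar> * G * fact (M + i) * 2 ^ (M + i - p)) \<le> K"
      unfolding K_def using i G0
      by (intro member_le_sum[of i "{..Q}" "\<lambda>i. \<Sum>p\<le>Q. \<bar>\<kappa> p i\<bar> * G * fact (M + i) * 2 ^ (M + i - p)"])
         (auto intro!: sum_nonneg)
    finally show ?thesis by (simp add: divide_right_mono)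
  qed
  \<comment> \<open>This decay is the crux: a row \<open>q > Q\<close> multiplies \<open>a j\<close>
    by at most \<open>n ^ (j - q)\<close>, which leaves \<open>K' / n ^ (q - Q)\<close>.\<close>
  have a_bound: "norm (a j) \<le> K' / real n ^ (j - Q)" if j: "M \<le> j" "j \<le> M + Q" for j
  proof -
    have "norm (a j) \<le> (\<Sum>i\<le>Q. real (i choose (j - M)) * norm (c i))"
      using j by (simp add: a_def) (rule order_trans[OF norm_sum], simp add: norm_mult)
    also have "\<dots> \<le> (\<Sum>i\<le>Q. 2 ^ i * (K / real n ^ (j - Q)))"
    proof (rule sum_mono)
      fix i assume "i \<in> {..Q}"
      then have i: "i \<le> Q" by simp
      show "real (i choose (j - M)) * norm (c i) \<le> 2 ^ i * (K / real n ^ (j - Q))"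
      proof (cases "j - M \<le> i")
        case True
        have "(i choose (j - M)) \<le> 2 ^ i" by (rule binomial_le_pow2)
        then have "real (i choose (j - M)) \<le> 2 ^ i" by (metis of_nat_le_iff of_nat_numeral of_nat_power)
        moreover have "norm (c i) \<le> K / real n ^ (j - Q)"
        proof -
          have "real n ^ (j - Q) \<le> real n ^ (M + i - Q)" using True n j by (intro power_increasing) auto
          then have "K / real n ^ (M + i - Q) \<le> K / real n ^ (j - Q)"
            using n K0 by (intro divide_left_mono) auto
          then show ?thesis using c_bound[OF i] by simp
        qed
        ultimately show ?thesis by (intro mult_mono) auto
      next
        case False
        then show ?thesis using K0 by (simp add: binomial_eq_0)
      qed
    qed
    also have "\<dots> = K' / real n ^ (j - Q)"
      by (simp add: K'_def sum_distrib_left sum_distrib_right sum_divide_distrib mult.commute)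
    finally show ?thesis .
  qed
  have small: "K' / real n \<le> \<epsilon>"
  proof -
    have "K' \<le> real (M + Q + 1) * K'" using K'0 by (simp add: mult_le_cancel_right1)
    then show ?thesis using n(2,3) by (simp add: field_simps)
  qed
  have "norm (a i) \<le> \<epsilon>" for i
  proof (cases "M \<le> i \<and> i \<le> M + Q")
    case True
    then have "real n ^ 1 \<le> real n ^ (i - Q)" using n QM by (intro power_increasing) auto
    then have "K' / real n ^ (i - Q) \<le> K' / real n" using n K'0 by (intro divide_left_mono) auto
    then show ?thesis using a_bound[of i] True small by linarith
  qed (use e in \<open>auto simp: a_def\<close>)
  moreover have "M \<le> i \<and> i \<le> M + Q" if "a i \<noteq> 0" for i
    using that by (auto simp: a_def split: if_splits)
  moreover have "(\<Sum>i=q..M+Q. of_nat (n choose (i - q)) * (u i + a i)) = y q" if q: "q \<le> Q" for q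
  proof -
    have "(\<Sum>i=q..M+Q. of_nat (n choose (i - q)) * a i) = (\<Sum>i=M..M+Q. of_nat (n choose (i - q)) * a i)"
      using q QM by (intro sum.mono_neutral_right) (auto simp: a_def)
    also have "\<dots> = (\<Sum>j\<le>Q. of_nat (n choose (M + j - q)) * a (M + j))"
      by (rule sum.reindex_bij_witness[of _ "\<lambda>j. M + j" "\<lambda>i. i - M"]) auto
    also have "\<dots> = (\<Sum>j\<le>Q. \<Sum>i\<le>Q. of_nat ((i choose j) * (n choose (M + j - q))) * c i)"
      by (simp add: a_def sum_distrib_left mult.assoc mult.left_commute)
    also have "\<dots> = (\<Sum>i\<le>Q. \<Sum>j\<le>Q. of_nat ((i choose j) * (n choose (M + j - q))) * c i)"
      by (rule sum.swap)
    also have "\<dots> = (\<Sum>i\<le>Q. of_nat ((n + i) choose (M + i - q)) * c i)"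
    proof (rule sum.cong[OF refl])
      fix i assume "i \<in> {..Q}"
      then have "(\<Sum>j\<le>Q. (i choose j) * (n choose (M + j - q))) = (n + i) choose (M + i - q)"
        using q QM by (intro vandermonde_shifted) auto
      then show "(\<Sum>j\<le>Q. of_nat ((i choose j) * (n choose (M + j - q))) * c i) = of_nat ((n + i) choose (M + i - q)) * c i"
        by (simp only: sum_distrib_right[symmetric] of_nat_sum[symmetric])
    qed
    also have "\<dots> = (\<Sum>i\<le>Q. of_real (fact q / fact (n - M + q) * real ((M + i) choose q)) * b i)"
    proof (rule sum.cong[OF refl])
      fix i assume "i \<in> {..Q}"
      have "real ((n + i) choose (M + i - q)) = fact (n + i) / (fact (M + i - q) * fact (n - M + q))"
      proof -
        have "n + i - (M + i - q) = n - M + q" using n QM q by auto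
        then show ?thesis using binomial_fact[of "M + i - q" "n + i", where 'a=real] n QM q by simp
      qed
      moreover have "real ((M + i) choose q) = fact (M + i) / (fact q * fact (M + i - q))"
        using binomial_fact[of q "M + i", where 'a=real] QM q by simp
      ultimately have "real ((n + i) choose (M + i - q)) * (fact (M + i) / fact (n + i)) =
          fact q / fact (n - M + q) * real ((M + i) choose q)" by simp
      moreover have "of_nat k * (of_real r * w) = of_real (real k * r) * w" for k r and w :: 'k
        by (simp add: mult.assoc)
      ultimately show "of_nat ((n + i) choose (M + i - q)) * c i =
          of_real (fact q / fact (n - M + q) * real ((M + i) choose q)) * b i"
        unfolding c_def by (simp only:)
    qed
    also have "\<dots> = (\<Sum>i\<le>Q. \<Sum>p\<le>Q. of_real (fact q / fact (n - M + q) * (fact (n - M + p) / fact p)) * g p *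
        of_real (\<kappa> p i * real ((M + i) choose q)))"
      unfolding b_def sum_distrib_left by (intro sum.cong refl) simp
    also have "\<dots> = (\<Sum>p\<le>Q. \<Sum>i\<le>Q. of_real (fact q / fact (n - M + q) * (fact (n - M + p) / fact p)) * g p *
        of_real (\<kappa> p i * real ((M + i) choose q)))" by (rule sum.swap)
    also have "\<dots> = (\<Sum>p\<le>Q. of_real (fact q / fact (n - M + q) * (fact (n - M + p) / fact p)) * g p *
        of_real (if p = q then 1 else 0))"
      unfolding sum_distrib_left[symmetric] of_real_sum[symmetric] \<kappa>[OF q] ..
    also have "\<dots> = (\<Sum>p\<le>Q. if p = q then g p else 0)"
      by (intro sum.cong refl) (simp flip: of_real_mult of_real_divide)
    also have "\<dots> = g q" using q by simp
    finally have "(\<Sum>i=q..M+Q. of_nat (n choose (i - q)) * a i) = g q" .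
    moreover have "(\<Sum>i=q..M+Q. of_nat (n choose (i - q)) * u i) = (\<Sum>i=q..Q. of_nat (n choose (i - q)) * u i)"
      by (intro sum.mono_neutral_right) (use u in auto)
    ultimately show ?thesis by (simp add: distrib_left sum.distrib g_def)
  qed
  moreover have "norm (\<Sum>i=q..M+Q. of_nat (n choose (i - q)) * (u i + a i)) \<le> \<epsilon>"
    if q: "Q < q" "q \<le> M + Q" for q
  proof -
    have "norm (\<Sum>i=q..M+Q. of_nat (n choose (i - q)) * (u i + a i)) \<le>
        (\<Sum>i=q..M+Q. norm (of_nat (n choose (i - q)) * (u i + a i)))" by (rule norm_sum)
    also have "\<dots> \<le> (\<Sum>i=q..M+Q. K' / real n)"
    proof (rule sum_mono)
      fix i assume i: "i \<in> {q..M + Q}"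
      show "norm (of_nat (n choose (i - q)) * (u i + a i)) \<le> K' / real n"
      proof (cases "M \<le> i")
        case True
        have "norm (of_nat (n choose (i - q)) * (u i + a i)) = real (n choose (i - q)) * norm (a i)"
          using u[of i] i q by (simp add: norm_mult)
        also have "\<dots> \<le> real n ^ (i - q) * (K' / real n ^ (i - Q))"
          by (intro mult_mono binomial_le_power a_bound True) (use i n in auto)
        also have "real n ^ (i - Q) = real n ^ (i - q) * real n ^ (q - Q)"
          using i q by (simp flip: power_add)
        also have "real n ^ (i - q) * (K' / (real n ^ (i - q) * real n ^ (q - Q))) = K' / real n ^ (q - Q)"
          using n by simp
        also have "\<dots> \<le> K' / real n"
        proof -
          have "real n ^ 1 \<le> real n ^ (q - Q)" using n q by (intro power_increasing) auto
          then show ?thesis using n K'0 by (intro divide_left_mono) auto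
        qed
        finally show ?thesis .
      next
        case False
        then have "a i = 0" "u i = 0" using u[of i] i q by (auto simp: a_def)
        then show ?thesis using K'0 by simp
      qed
    qed
    also have "\<dots> \<le> real (M + Q + 1) * (K' / real n)"
      using K'0 by (simp add: mult_right_mono divide_right_mono)
    also have "\<dots> \<le> \<epsilon>" using n by (simp add: field_simps)
    finally show ?thesis .
  qed
  ultimately show ?thesis by blast
qed

section \<open>Biorthogonal systems adapted to the chain\<close>

context Banach_chain
begin

text \<open>Functionals attached to step \<open>k\<close> are made to vanish here, hence on all
  earlier steps; for \<open>k = 0\<close> nothing is demanded.\<close>

definition below :: "nat \<Rightarrow> 'a set" where
  "below k = (if k = 0 then {0} else X closure_of (V (k - 1)))"

lemma below_facts:
  "subspace (below k)" "below k \<subseteq> U" "X closure_of (below k) = below k"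
proof -
  have VU: "V n \<subseteq> U" for n by blast
  show "subspace (below k)" using subspace_closure[OF subspace_V VU] by (simp add: below_def)
  show "below k \<subseteq> U" using closure_of_subset_topspace[of X] U_zero by (simp add: below_def)
  show "X closure_of (below k) = below k" using Hausdorff_closure_zero[OF Hausdorff] by (simp add: below_def)
qed

lemma V_below:
  assumes "m < k"
  shows "V m \<subseteq> below k"
proof -
  have "V m \<subseteq> V (k - 1)" by (rule V_mono) (use assms in simp)
  also have "\<dots> \<subseteq> X closure_of (V (k - 1))" by (rule closure_of_subset) auto
  finally show ?thesis using assms by (simp add: below_def)
qed

end

text \<open>The vector with index \<open>j\<close> lives in \<open>V (\<beta> j)\<close>. The stretches on which \<open>\<beta>\<close> vanishes leave room
  for steering inside \<open>V 0\<close>, and \<open>\<beta>_step\<close> makes the backward shift map \<open>V m\<close> into \<open>V (Suc m)\<close>.\<close>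

locale block_chain = Banach_chain s V N
  for s :: "'k::real_or_complex \<Rightarrow> 'a::ab_group_add \<Rightarrow> 'a" and V N +
  fixes \<beta> lab :: "nat \<Rightarrow> nat"
  assumes \<beta>_step: "\<beta> j \<le> Suc (\<beta> (Suc j))"
    and \<beta>_zero: "\<exists>Q\<ge>q. \<forall>j. Q \<le> j \<and> j \<le> 4 * Q \<longrightarrow> \<beta> j = 0"
    and \<beta>_often: "\<exists>j\<ge>m. \<beta> j = \<beta> i \<and> lab j = l"
    and infinite_codimension: "finite B \<Longrightarrow> B \<subseteq> U \<Longrightarrow> \<not> V (\<beta> j) \<subseteq> span (below (\<beta> j) \<union> B)"
    and dense_blocks: "X closure_of (\<Union>j. V (\<beta> j)) = U"
begin

text \<open>Admissibility of \<open>b\<close> and \<open>g\<close> as \<open>e j\<close> and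
  \<open>f j\<close> after the earlier pairs. The two clauses with \<open>d j\<close> bring the span
  of the first \<open>j + 1\<close> vectors close to \<open>d j\<close>; this is how the span
  becomes dense. The last clause makes the terms of the shift summable on each \<open>V m\<close>;
  at stage \<open>j\<close> it concerns only the finitely many \<open>m \<le> j\<close>, so a
  rescaling can achieve it.\<close>

definition good ::
  "(nat \<Rightarrow> 'a) \<Rightarrow> (nat \<Rightarrow> 'a) \<Rightarrow> (nat \<Rightarrow> 'a \<Rightarrow> 'k) \<Rightarrow> nat \<Rightarrow> 'a \<Rightarrow> ('a \<Rightarrow> 'k) \<Rightarrow> 'k \<Rightarrow> bool" where
  "good d e f j b g t \<longleftrightarrow>
     b \<in> V (\<beta> j) \<and> g \<in> dual \<and> g b = 1 \<and> (\<forall>x\<in>below (\<beta> j). g x = 0) \<and>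
     (\<forall>i<j. f i b = 0 \<and> g (e i) = 0) \<and>
     d j - (\<Sum>i<j. s (f i (d j)) (e i)) - s t b \<in> V (\<beta> j) \<and>
     N (\<beta> j) (d j - (\<Sum>i<j. s (f i (d j)) (e i)) - s t b) \<le> 1 / real (Suc j) \<and>
     (\<forall>i. j = Suc i \<longrightarrow> (\<forall>m. \<beta> j \<le> m \<and> m \<le> j \<longrightarrow>
        (\<forall>x\<in>V m. norm (g x) * N (Suc m) (e i) \<le> (1 / 2) ^ j * N m x)))"

text \<open>The new vector is \<open>d j\<close>, freed of its components along the earlier
  \<open>e i\<close>, plus a small multiple of a vector outside \<open>Q\<close>. The functional
  comes from separation, and a final rescaling makes it small.\<close>

lemma good_step:
  assumes d: "d j \<in> V (\<beta> j)" and prev: "\<And>i. i < j \<Longrightarrow> good d e f i (e i) (f i) (t i)"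
  shows "\<exists>b g u. good d e f j b g u"
proof -
  let ?k = "\<beta> j"
  have e: "e i \<in> V (\<beta> i)" and fd: "f i \<in> dual" and fe: "f i (e i) = 1"
    and fb: "x \<in> below (\<beta> i) \<Longrightarrow> f i x = 0" if "i < j" for i x
    using prev[OF that] by (simp_all add: good_def)
  have biorth: "f i (e l) = (if i = l then 1 else 0)" if il: "i < j" "l < j" for i l
  proof (rule linorder_cases[of i l])
    assume "i < l"
    then show ?thesis using prev[OF il(2)] by (simp add: good_def)
  next
    assume "l < i"
    then show ?thesis using prev[OF il(1)] by (simp add: good_def)
  qed (use fe il in simp)
  define R where "R x = x - (\<Sum>i<j. s (f i x) (e i))" for x
  have RV: "R x \<in> V ?k" if x: "x \<in> V ?k" for x
  proof -
    \<comment> \<open>If \<open>e i\<close> was taken from a later step, its functional vanishes on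
      \<open>V ?k\<close>; so removing components never leaves \<open>V ?k\<close>.\<close>
    have "s (f i x) (e i) \<in> V ?k" if i: "i < j" for i
    proof (cases "\<beta> i \<le> ?k")
      case True
      then show ?thesis using e[OF i] V_mono[OF True] by (intro V_scale) blast
    next
      case False
      then have "x \<in> below (\<beta> i)" using V_below[of ?k "\<beta> i"] x by auto
      then show ?thesis using fb[OF i] V_zero by simp
    qed
    then show ?thesis unfolding R_def by (intro V_diff V_sum x) auto
  qed
  have eU: "e i \<in> U" if "i < j" for i using V_U[OF e[OF that]] .
  have fR: "f l (R x) = 0" if l: "l < j" and x: "x \<in> U" for l x
  proof -
    have "f l (\<Sum>i<j. s (f i x) (e i)) = (\<Sum>i<j. f l (s (f i x) (e i)))"
      by (rule dualD(8)[OF fd[OF l]]) (use eU U_scale in auto)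
    also have "\<dots> = (\<Sum>i<j. if i = l then f i x else 0)"
      by (intro sum.cong refl) (use dualD(4)[OF fd[OF l]] eU biorth l in auto)
    finally have "f l (\<Sum>i<j. s (f i x) (e i)) = f l x" using l by simp
    moreover have "(\<Sum>i<j. s (f i x) (e i)) \<in> U" by (intro U_sum U_scale) (use eU in auto)
    ultimately show ?thesis unfolding R_def using dualD(7)[OF fd[OF l] x] by simp
  qed
  define Q where "Q = span (below ?k \<union> e ` {..<j})"
  have Q: "subspace Q" "Q \<subseteq> U" "X closure_of Q = Q"
  proof -
    show "subspace Q" by (simp add: Q_def)
    show "Q \<subseteq> U" unfolding Q_def by (rule span_minimal[OF _ subspace_U]) (use below_facts eU in auto)
    show "X closure_of Q = Q"
      unfolding Q_def by (rule closed_span_Un_finite[OF below_facts]) (use eU in auto)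
  qed
  obtain x where x: "x \<in> V ?k" "x \<notin> Q"
    using infinite_codimension[of "e ` {..<j}" j] eU unfolding Q_def by blast
  define r where "r = R x"
  have r: "r \<in> V ?k" "r \<notin> Q"
  proof -
    show "r \<in> V ?k" unfolding r_def by (rule RV[OF x(1)])
    have "(\<Sum>i<j. s (f i x) (e i)) \<in> Q"
      unfolding Q_def by (intro span_sum span_scale span_base) auto
    then have "r + (\<Sum>i<j. s (f i x) (e i)) \<in> Q" if "r \<in> Q" using subspace_add[OF Q(1) that] by blast
    then show "r \<notin> Q" using x(2) by (auto simp: r_def R_def)
  qed
  define v where "v = R (d j)"
  have v: "v \<in> V ?k" unfolding v_def by (rule RV[OF d])
  define \<eta> where "\<eta> = 1 / (real (Suc j) * (1 + N ?k r))"
  have Nr: "N ?k r \<ge> 0" by (rule N_nonneg[OF r(1)])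
  have \<eta>: "\<eta> > 0" "\<eta> * N ?k r \<le> 1 / real (Suc j)"
  proof -
    show "\<eta> > 0" using Nr by (simp add: \<eta>_def)
    have "\<eta> * N ?k r = 1 / real (Suc j) * (N ?k r / (1 + N ?k r))" by (simp add: \<eta>_def)
    also have "\<dots> \<le> 1 / real (Suc j) * 1" using Nr by (intro mult_left_mono) auto
    finally show "\<eta> * N ?k r \<le> 1 / real (Suc j)" by simp
  qed
  \<comment> \<open>Two different multiples of \<open>r\<close> leading into \<open>Q\<close> would
    put \<open>r\<close> itself into \<open>Q\<close>, so one of \<open>\<eta>\<close> and
    \<open>\<eta> / 2\<close> works.\<close>
  have "\<exists>\<rho>. 0 < \<rho> \<and> \<rho> \<le> \<eta> \<and> v + s (of_real \<rho>) r \<notin> Q"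
  proof (rule ccontr)
    assume "\<not> ?thesis"
    then have all: "v + s (of_real \<rho>) r \<in> Q" if "0 < \<rho>" "\<rho> \<le> \<eta>" for \<rho> using that by blast
    have "v + s (of_real \<eta>) r \<in> Q" "v + s (of_real (\<eta> / 2)) r \<in> Q"
      by (rule all; use \<eta>(1) in simp)+
    then have "(v + s (of_real \<eta>) r) - (v + s (of_real (\<eta> / 2)) r) \<in> Q" by (rule subspace_diff[OF Q(1)])
    also have "(v + s (of_real \<eta>) r) - (v + s (of_real (\<eta> / 2)) r) = s (of_real (\<eta> / 2)) r"
      by (simp flip: scale_left_diff_distrib)
    finally have "s (of_real (2 / \<eta>)) (s (of_real (\<eta> / 2)) r) \<in> Q" by (rule subspace_scale[OF Q(1)])
    also have "s (of_real (2 / \<eta>)) (s (of_real (\<eta> / 2)) r) = r" using \<eta>(1) by simp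
    finally show False using r(2) by simp
  qed
  then obtain \<rho> where \<rho>: "0 < \<rho>" "\<rho> \<le> \<eta>" "v + s (of_real \<rho>) r \<notin> Q" by blast
  define b where "b = v + s (of_real \<rho>) r"
  have b: "b \<in> V ?k" unfolding b_def by (intro V_add V_scale v r)
  have "b \<notin> X closure_of Q" using \<rho>(3) Q(3) by (simp add: b_def)
  from separating_functional[OF Q(1,2) V_U[OF b] this]
  obtain g where g: "g \<in> dual" "\<forall>x\<in>Q. g x = 0" "g b = 1" by (elim bexE conjE)
  have "\<forall>m. \<exists>C>0. \<forall>x\<in>V m. norm (g x) \<le> C * N m x" using dual_bound[OF g(1)] by metis
  then obtain C where C: "\<And>m. C m > 0" "\<And>m x. x \<in> V m \<Longrightarrow> norm (g x) \<le> C m * N m x"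
    by (auto dest!: choice)
  \<comment> \<open>Multiplying \<open>b\<close> by \<open>c\<close> and dividing \<open>g\<close>
    by \<open>c\<close> keeps the duality and makes the products with the already fixed vector
    \<open>e (j - 1)\<close> small. The absolute value is there because that vector need not lie in
    \<open>V (Suc m)\<close> for every \<open>m\<close> in the sum.\<close>
  define c where "c = 1 + (\<Sum>m\<le>j. C m * \<bar>N (Suc m) (e (j - 1))\<bar> * 2 ^ j)"
  have c: "c > 0" unfolding c_def using C(1) by (intro add_pos_nonneg sum_nonneg) (auto simp: less_imp_le)
  have c_ge: "C m * \<bar>N (Suc m) (e (j - 1))\<bar> * 2 ^ j \<le> c" if "m \<le> j" for m
  proof -
    have "C m * \<bar>N (Suc m) (e (j - 1))\<bar> * 2 ^ j \<le> (\<Sum>m\<le>j. C m * \<bar>N (Suc m) (e (j - 1))\<bar> * 2 ^ j)"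
      by (rule member_le_sum) (use that C(1) in \<open>auto simp: less_imp_le\<close>)
    then show ?thesis by (simp add: c_def)
  qed
  let ?b = "s (of_real c) b" and ?g = "\<lambda>x. of_real (1 / c) * g x" and ?t = "of_real (1 / c) :: 'k"
  have "good d e f j ?b ?g ?t"
    unfolding good_def
  proof (intro conjI allI impI ballI)
    show "?b \<in> V ?k" by (rule V_scale[OF b])
    show "?g \<in> dual" by (rule scaled_in_dual[OF g(1)])
    show "?g ?b = 1" using dualD(4)[OF g(1) V_U[OF b]] g(3) c by simp
    show "?g x = 0" if "x \<in> below ?k" for x
      using g(2) span_base[of x "below ?k \<union> e ` {..<j}"] that by (simp add: Q_def)
    show "f i ?b = 0" if i: "i < j" for i
    proof -
      have "f i b = f i v + of_real \<rho> * f i r"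
        unfolding b_def using dualD(3,4)[OF fd[OF i]] V_U[OF v] V_U[OF r(1)] V_U[OF V_scale[OF r(1)]] by simp
      then have "f i b = 0" using fR[OF i V_U[OF d]] fR[OF i V_U[OF x(1)]] by (simp add: v_def r_def)
      then show ?thesis using dualD(4)[OF fd[OF i] V_U[OF b]] by simp
    qed
    show "?g (e i) = 0" if "i < j" for i
      using g(2) span_base[of "e i" "below ?k \<union> e ` {..<j}"] that by (simp add: Q_def)
    have diff: "d j - (\<Sum>i<j. s (f i (d j)) (e i)) - s ?t ?b = - s (of_real \<rho>) r"
    proof -
      have "s ?t ?b = b" using c by simp
      then show ?thesis by (simp add: b_def v_def R_def)
    qed
    show "d j - (\<Sum>i<j. s (f i (d j)) (e i)) - s ?t ?b \<in> V ?k"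
      unfolding diff by (intro V_minus V_scale r)
    have "N ?k (- s (of_real \<rho>) r) = \<rho> * N ?k r"
      using N_minus[OF V_scale[OF r(1)]] N_scale[OF r(1)] \<rho>(1) by simp
    also have "\<dots> \<le> \<eta> * N ?k r" by (rule mult_right_mono[OF \<rho>(2) Nr])
    finally show "N ?k (d j - (\<Sum>i<j. s (f i (d j)) (e i)) - s ?t ?b) \<le> 1 / real (Suc j)"
      unfolding diff using \<eta>(2) by simp
    show "norm (?g x) * N (Suc m) (e i) \<le> (1 / 2) ^ j * N m x"
      if ji: "j = Suc i" and m: "?k \<le> m \<and> m \<le> j" and x: "x \<in> V m" for i m x
    proof -
      have "norm (?g x) * N (Suc m) (e i) = norm (g x) * N (Suc m) (e i) / c"
        using c by (simp add: norm_mult norm_divide)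
      also have "\<dots> \<le> (C m * N m x) * \<bar>N (Suc m) (e i)\<bar> / c"
      proof (rule divide_right_mono)
        have "norm (g x) * N (Suc m) (e i) \<le> norm (g x) * \<bar>N (Suc m) (e i)\<bar>"
          by (rule mult_left_mono) auto
        also have "\<dots> \<le> (C m * N m x) * \<bar>N (Suc m) (e i)\<bar>" by (rule mult_right_mono[OF C(2)[OF x]]) simp
        finally show "norm (g x) * N (Suc m) (e i) \<le> (C m * N m x) * \<bar>N (Suc m) (e i)\<bar>" .
      qed (use c in simp)
      also have "\<dots> = (C m * \<bar>N (Suc m) (e (j - 1))\<bar> * 2 ^ j) * (N m x / (2 ^ j * c))"
        using ji c by simp
      also have "\<dots> \<le> c * (N m x / (2 ^ j * c))"
        using c_ge[of m] m N_nonneg[OF x] c by (intro mult_right_mono) auto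
      also have "\<dots> = (1 / 2) ^ j * N m x" using c by (simp add: power_divide)
      finally show ?thesis .
    qed
  qed
  then show ?thesis by blast
qed

lemma good_cong:
  assumes "\<And>i. i < j \<Longrightarrow> e i = e' i" "\<And>i. i < j \<Longrightarrow> f i = f' i"
  shows "good d e f j b g t = good d e' f' j b g t"
proof -
  have "(\<Sum>i<j. s (f i (d j)) (e i)) = (\<Sum>i<j. s (f' i (d j)) (e' i))"
    by (intro sum.cong refl) (use assms in auto)
  moreover have "(\<forall>i<j. f i b = 0 \<and> g (e i) = 0) = (\<forall>i<j. f' i b = 0 \<and> g (e' i) = 0)"
    using assms by auto
  moreover have "(\<forall>i. j = Suc i \<longrightarrow> (\<forall>m. \<beta> j \<le> m \<and> m \<le> j \<longrightarrow>
        (\<forall>x\<in>V m. norm (g x) * N (Suc m) (e i) \<le> (1 / 2) ^ j * N m x))) =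
      (\<forall>i. j = Suc i \<longrightarrow> (\<forall>m. \<beta> j \<le> m \<and> m \<le> j \<longrightarrow>
        (\<forall>x\<in>V m. norm (g x) * N (Suc m) (e' i) \<le> (1 / 2) ^ j * N m x)))"
    using assms(1) by auto
  ultimately show ?thesis unfolding good_def by presburger
qed

lemma biorthogonal_system:
  assumes d: "\<And>j. d j \<in> V (\<beta> j)"
  shows "\<exists>e f t. \<forall>j. good d e f j (e j) (f j) (t j)"
proof -
  let ?R = "\<lambda>(h :: nat \<Rightarrow> 'a \<times> ('a \<Rightarrow> 'k) \<times> 'k) j (b, g, t). good d (\<lambda>i. fst (h i)) (\<lambda>i. fst (snd (h i))) j b g t"
  have "\<exists>h. \<forall>j. ?R h j (h j)"
  proof (rule dependent_wellorder_choice)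
    fix r :: "'a \<times> ('a \<Rightarrow> 'k) \<times> 'k" and h h' :: "nat \<Rightarrow> 'a \<times> ('a \<Rightarrow> 'k) \<times> 'k" and j :: nat
    assume eq: "\<And>i. i < j \<Longrightarrow> h i = h' i"
    show "?R h j r = ?R h' j r"
      by (cases r) (simp only: prod.case, rule good_cong, simp_all add: eq)
  next
    fix j :: nat and h :: "nat \<Rightarrow> 'a \<times> ('a \<Rightarrow> 'k) \<times> 'k"
    assume "\<And>i. i < j \<Longrightarrow> ?R h i (h i)"
    then have "\<exists>b g u. good d (\<lambda>i. fst (h i)) (\<lambda>i. fst (snd (h i))) j b g u"
      by (intro good_step[where t="\<lambda>i. snd (snd (h i))"] d) (simp add: case_prod_beta)
    then show "\<exists>r. ?R h j r" by auto
  qed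
  then obtain h where "\<And>j. ?R h j (h j)" by blast
  then show ?thesis
    by (intro exI[of _ "\<lambda>i. fst (h i)"] exI[of _ "\<lambda>i. fst (snd (h i))"] exI[of _ "\<lambda>i. snd (snd (h i))"])
       (simp add: case_prod_beta)
qed

end

section \<open>Convergence and operators\<close>

context seminorm_space
begin

definition converges :: "(nat \<Rightarrow> 'a) \<Rightarrow> 'a \<Rightarrow> bool" where
  "converges z l \<longleftrightarrow> l \<in> U \<and> (\<forall>p\<in>P. (\<lambda>n. p (z n - l)) \<longlonglongrightarrow> 0)"

lemma convergesD: "converges z l \<Longrightarrow> l \<in> U" "converges z l \<Longrightarrow> p \<in> P \<Longrightarrow> (\<lambda>n. p (z n - l)) \<longlonglongrightarrow> 0"
  by (simp_all add: converges_def)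

lemma seminorm_squeeze:
  assumes p: "p \<in> P" and z: "\<And>n. z n \<in> U" and le: "\<And>n. p (z n) \<le> a n" and a: "a \<longlonglongrightarrow> 0"
  shows "(\<lambda>n. p (z n)) \<longlonglongrightarrow> 0"
  by (rule tendsto_sandwich[OF always_eventually always_eventually tendsto_const a])
     (use le sn_nonneg[OF p z] in blast)+

lemma converges_unique:
  assumes H: "Hausdorff_space X" and z: "\<And>n. z n \<in> U" and l: "converges z l" "converges z l'"
  shows "l = l'"
proof (rule ccontr)
  assume "l \<noteq> l'"
  then have "l - l' \<in> U" "l - l' \<noteq> 0" using convergesD(1) l U_diff by auto
  then obtain p where p: "p \<in> P" "p (l - l') > 0" using H unfolding Hausdorff_X by meson
  have "(\<lambda>n. p (z n - l) + p (z n - l')) \<longlonglongrightarrow> 0 + 0"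
    by (intro tendsto_add convergesD(2) l p)
  moreover have "p (l - l') \<le> p (z n - l) + p (z n - l')" for n
    using sn_triangle[OF p(1) convergesD(1)[OF l(1)] z convergesD(1)[OF l(2)], of n]
      sn_diff_commute[OF p(1) convergesD(1)[OF l(1)] z, of n] by simp
  ultimately have "p (l - l') \<le> 0 + 0" by (intro LIMSEQ_le_const) auto
  then show False using p by simp
qed

lemma converges_add:
  assumes z: "\<And>n. z n \<in> U" "converges z l" and w: "\<And>n. w n \<in> U" "converges w k"
  shows "converges (\<lambda>n. z n + w n) (l + k)"
  unfolding converges_def
proof (intro conjI ballI)
  note lU = convergesD(1)[OF z(2)] and kU = convergesD(1)[OF w(2)]
  show "l + k \<in> U" by (rule U_add[OF lU kU])
  fix p assume p: "p \<in> P"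
  show "(\<lambda>n. p (z n + w n - (l + k))) \<longlonglongrightarrow> 0"
  proof (rule seminorm_squeeze[OF p])
    show "z n + w n - (l + k) \<in> U" for n by (intro U_diff U_add z w lU kU)
    show "p (z n + w n - (l + k)) \<le> p (z n - l) + p (w n - k)" for n
      using sn_add[OF p U_diff[OF z(1) lU] U_diff[OF w(1) kU], of n n] by (simp add: algebra_simps)
    show "(\<lambda>n. p (z n - l) + p (w n - k)) \<longlonglongrightarrow> 0"
      using tendsto_add[OF convergesD(2)[OF z(2) p] convergesD(2)[OF w(2) p]] by simp
  qed
qed

lemma converges_scale:
  assumes z: "\<And>n. z n \<in> U" "converges z l"
  shows "converges (\<lambda>n. s c (z n)) (s c l)"
  unfolding converges_def
proof (intro conjI ballI)
  note lU = convergesD(1)[OF z(2)]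
  show "s c l \<in> U" by (rule U_scale[OF lU])
  fix p assume p: "p \<in> P"
  have "p (s c (z n) - s c l) = norm c * p (z n - l)" for n
    using sn_scale[OF p U_diff[OF z(1) lU]] by (simp add: scale_right_diff_distrib)
  then show "(\<lambda>n. p (s c (z n) - s c l)) \<longlonglongrightarrow> 0"
    using tendsto_mult_left[OF convergesD(2)[OF z(2) p], of "norm c"] by simp
qed

definition operators :: "('a \<Rightarrow> 'a) set" where
  "operators = {T. linear_between s s U T \<and> T ` U \<subseteq> U \<and> (\<forall>p\<in>P. (\<lambda>x. p (T x)) \<in> P)}"

lemma operatorsI:
  assumes "\<And>x. x \<in> U \<Longrightarrow> T x \<in> U" "\<And>x y. x \<in> U \<Longrightarrow> y \<in> U \<Longrightarrow> T (x + y) = T x + T y"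
    "\<And>c x. x \<in> U \<Longrightarrow> T (s c x) = s c (T x)" "\<And>p. p \<in> P \<Longrightarrow> (\<lambda>x. p (T x)) \<in> P"
  shows "T \<in> operators"
  using assms by (simp add: operators_def linear_between_def image_subset_iff)

lemma operatorsD:
  assumes "T \<in> operators"
  shows "x \<in> U \<Longrightarrow> T x \<in> U" "x \<in> U \<Longrightarrow> y \<in> U \<Longrightarrow> T (x + y) = T x + T y"
    "x \<in> U \<Longrightarrow> T (s c x) = s c (T x)" "p \<in> P \<Longrightarrow> (\<lambda>x. p (T x)) \<in> P" "T 0 = 0"
    "x \<in> U \<Longrightarrow> y \<in> U \<Longrightarrow> T (x - y) = T x - T y"
    "(\<And>i. i \<in> A \<Longrightarrow> g i \<in> U) \<Longrightarrow> T (sum g A) = (\<Sum>i\<in>A. T (g i))"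
proof -
  have lin: "linear_between s s U T" using assms by (simp add: operators_def)
  show "x \<in> U \<Longrightarrow> T x \<in> U" using assms by (auto simp: operators_def)
  show "p \<in> P \<Longrightarrow> (\<lambda>x. p (T x)) \<in> P" using assms by (simp add: operators_def)
  show add: "T (x + y) = T x + T y" if "x \<in> U" "y \<in> U" for x y by (rule linear_betweenD(1)[OF lin that])
  show scale: "T (s c x) = s c (T x)" if "x \<in> U" for x c by (rule linear_betweenD(2)[OF lin that])
  show zero: "T 0 = 0" using scale[OF U_zero, of 0] by simp
  show "T (x - y) = T x - T y" if "x \<in> U" "y \<in> U" for x y
    using add[OF that(1) U_minus[OF that(2)]] scale[OF that(2), of "-1"] by simp
  show "T (sum g A) = (\<Sum>i\<in>A. T (g i))" if "\<And>i. i \<in> A \<Longrightarrow> g i \<in> U"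
    using that
  proof (induction A rule: infinite_finite_induct)
    case (insert i A)
    have "sum g A \<in> U" by (intro U_sum) (use insert in auto)
    then show ?case using insert add[of "g i" "sum g A"] by auto
  qed (auto simp: zero)
qed

lemma continuous_operator_operators:
  assumes "T \<in> operators"
  shows "continuous_operator s X T"
  unfolding continuous_operator_def topspace_X
proof
  show "linear_between s s U T" using assms by (simp add: operators_def)
  show "continuous_map X X T"
    by (rule continuous_map_seminorm[OF seminorm_space_axioms seminorm_space_axioms])
       (use assms in \<open>auto simp: operators_def\<close>)
qed

lemma funpow_operators:
  assumes T: "T \<in> operators"
  shows "T ^^ n \<in> operators"
proof (induction n)
  case 0
  show ?case by (simp add: operators_def linear_between_def)
next
  case (Suc n)
  show ?case
  proof (rule operatorsI)
    show "(\<lambda>x. p ((T ^^ Suc n) x)) \<in> P" if "p \<in> P" for p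
      using operatorsD(4)[OF Suc operatorsD(4)[OF T that]] by simp
  qed (simp_all add: operatorsD[OF T] operatorsD[OF Suc])
qed

lemma converges_operator:
  assumes T: "T \<in> operators" and z: "\<And>n. z n \<in> U" "converges z l"
  shows "converges (\<lambda>n. T (z n)) (T l)"
  unfolding converges_def
proof (intro conjI ballI)
  note lU = convergesD(1)[OF z(2)]
  show "T l \<in> U" by (rule operatorsD(1)[OF T lU])
  fix p assume "p \<in> P"
  then have "(\<lambda>n. p (T (z n - l))) \<longlonglongrightarrow> 0"
    by (rule convergesD(2)[OF z(2) operatorsD(4)[OF T]])
  then show "(\<lambda>n. p (T (z n) - T l)) \<longlonglongrightarrow> 0" by (simp add: operatorsD(6)[OF T z(1) lU])
qed

end

section \<open>The identity plus a generalised backward shift\<close>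

locale shift_system = block_chain s V N \<beta> lab
  for s :: "'k::real_or_complex \<Rightarrow> 'a::ab_group_add \<Rightarrow> 'a" and V N \<beta> lab +
  fixes d e :: "nat \<Rightarrow> 'a" and f :: "nat \<Rightarrow> 'a \<Rightarrow> 'k" and t :: "nat \<Rightarrow> 'k"
  assumes d_V: "d j \<in> V (\<beta> j)" and system: "good d e f j (e j) (f j) (t j)"
begin

lemma e_V: "e j \<in> V (\<beta> j)" and f_dual: "f j \<in> dual"
  and f_below: "x \<in> below (\<beta> j) \<Longrightarrow> f j x = 0"
  and f_bound: "\<beta> (Suc j) \<le> m \<Longrightarrow> m \<le> Suc j \<Longrightarrow> x \<in> V m \<Longrightarrow>
    norm (f (Suc j) x) * N (Suc m) (e j) \<le> (1 / 2) ^ Suc j * N m x"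
  using system[of j] system[of "Suc j"] by (simp_all add: good_def)

lemma e_U: "e j \<in> U"
  using e_V by (rule V_U)

lemma biorthogonal: "f i (e j) = (if i = j then 1 else 0)"
  using system[of i] system[of j] by (cases i j rule: linorder_cases) (auto simp: good_def)

definition partial :: "nat \<Rightarrow> 'a \<Rightarrow> 'a" where
  "partial n x = (\<Sum>j<n. s (f (Suc j) x) (e j))"

definition S :: "'a \<Rightarrow> 'a" where
  "S x = (SOME l. converges (\<lambda>n. partial n x) l)"

text \<open>A term that might leave \<open>V (Suc m)\<close> has coefficient zero: for
  \<open>\<beta> (Suc j) > m\<close> the functional vanishes on \<open>V m\<close>, and otherwise
  \<open>\<beta>_step\<close> keeps \<open>e j\<close> in the next step.\<close>

lemma term_V:
  assumes "x \<in> V m"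
  shows "s (f (Suc j) x) (e j) \<in> V (Suc m)"
proof (cases "\<beta> (Suc j) \<le> m")
  case True
  then have "\<beta> j \<le> Suc m" using \<beta>_step[of j] by simp
  then show ?thesis using e_V[of j] V_mono[of "\<beta> j" "Suc m"] by (intro V_scale) blast
next
  case False
  then have "x \<in> below (\<beta> (Suc j))" using V_below[of m "\<beta> (Suc j)"] assms by auto
  then show ?thesis using f_below V_zero by simp
qed

lemma partial_V: "x \<in> V m \<Longrightarrow> partial n x \<in> V (Suc m)"
  unfolding partial_def by (intro V_sum term_V)

lemma partial_U: "x \<in> U \<Longrightarrow> partial n x \<in> U"
  using partial_V by (elim UN_E) (rule V_U)

lemma term_bound:
  obtains \<kappa> where "summable \<kappa>" "\<And>j. \<kappa> j \<ge> 0"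
    "\<And>x j. x \<in> V m \<Longrightarrow> N (Suc m) (s (f (Suc j) x) (e j)) \<le> \<kappa> j * N m x"
proof -
  have "\<exists>C>0. \<forall>x\<in>V m. norm (f (Suc j) x) \<le> C * N m x" for j
    using dual_bound[OF f_dual] by metis
  then obtain C where C: "\<And>j. C j > 0" "\<And>j x. x \<in> V m \<Longrightarrow> norm (f (Suc j) x) \<le> C j * N m x"
    by (metis (no_types))
  \<comment> \<open>\<open>f_bound\<close> speaks of \<open>V m\<close> only from a certain index
    on; the finitely many earlier terms get constants of their own, and \<open>\<kappa>\<close> is
    eventually geometric.\<close>
  define \<kappa> where "\<kappa> j = (if j < m then C j * \<bar>N (Suc m) (e j)\<bar> else (1 / 2) ^ Suc j)" for j
  have "summable (\<lambda>j. (1 / 2 :: real) ^ Suc j)" by (subst summable_Suc_iff) (simp add: summable_geometric)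
  moreover have "eventually (\<lambda>j. \<kappa> j = (1 / 2) ^ Suc j) sequentially"
    using eventually_ge_at_top[of m] by eventually_elim (simp add: \<kappa>_def)
  ultimately have "summable \<kappa>" using summable_cong[of \<kappa> "\<lambda>j. (1 / 2) ^ Suc j"] by blast
  moreover have \<kappa>0: "\<kappa> j \<ge> 0" for j using C(1)[of j] by (simp add: \<kappa>_def)
  moreover have "N (Suc m) (s (f (Suc j) x) (e j)) \<le> \<kappa> j * N m x" if x: "x \<in> V m" for x j
  proof (cases "\<beta> (Suc j) \<le> m")
    case False
    then have "x \<in> below (\<beta> (Suc j))" using V_below[of m "\<beta> (Suc j)"] x by auto
    then show ?thesis using f_below N_zero \<kappa>0 N_nonneg[OF x] by simp
  next
    case True
    then have "\<beta> j \<le> Suc m" using \<beta>_step[of j] by simp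
    then have eV: "e j \<in> V (Suc m)" using e_V[of j] V_mono[of "\<beta> j" "Suc m"] by blast
    have "N (Suc m) (s (f (Suc j) x) (e j)) = norm (f (Suc j) x) * N (Suc m) (e j)" by (rule N_scale[OF eV])
    also have "\<dots> \<le> \<kappa> j * N m x"
    proof (cases "j < m")
      case False
      then have "m \<le> Suc j" by simp
      then show ?thesis using f_bound[OF True _ x] False by (simp add: \<kappa>_def)
    next
      case jm: True
      have "norm (f (Suc j) x) * N (Suc m) (e j) \<le> (C j * N m x) * N (Suc m) (e j)"
        by (rule mult_right_mono[OF C(2)[OF x] N_nonneg[OF eV]])
      then show ?thesis using jm N_nonneg[OF eV] by (simp add: \<kappa>_def mult_ac)
    qed
    finally show ?thesis .
  qed
  ultimately show ?thesis by (rule that)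
qed

lemma partial_bound:
  obtains K where "K \<ge> 0" "\<And>x n. x \<in> V m \<Longrightarrow> N (Suc m) (partial n x) \<le> K * N m x"
    "\<And>x. x \<in> V m \<Longrightarrow> \<exists>l. converges (\<lambda>n. partial n x) l"
proof -
  obtain \<kappa> where \<kappa>: "summable \<kappa>" "\<And>j. \<kappa> j \<ge> 0"
    "\<And>x j. x \<in> V m \<Longrightarrow> N (Suc m) (s (f (Suc j) x) (e j)) \<le> \<kappa> j * N m x" by (rule term_bound[of m], rule that)
  have "suminf \<kappa> \<ge> 0" by (rule suminf_nonneg[OF \<kappa>(1,2)])
  moreover have "N (Suc m) (partial n x) \<le> suminf \<kappa> * N m x" if x: "x \<in> V m" for x n
  proof -
    have "N (Suc m) (partial n x) \<le> (\<Sum>j<n. N (Suc m) (s (f (Suc j) x) (e j)))"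
      unfolding partial_def by (rule N_sum) (rule term_V[OF x])
    also have "\<dots> \<le> (\<Sum>j<n. \<kappa> j * N m x)" by (rule sum_mono) (rule \<kappa>(3)[OF x])
    also have "\<dots> = (\<Sum>j<n. \<kappa> j) * N m x" by (simp add: sum_distrib_right)
    also have "\<dots> \<le> suminf \<kappa> * N m x"
      by (intro mult_right_mono sum_le_suminf \<kappa> N_nonneg x) auto
    finally show ?thesis .
  qed
  moreover have "\<exists>l. converges (\<lambda>n. partial n x) l" if x: "x \<in> V m" for x
  proof -
    have "summable (\<lambda>j. N (Suc m) (s (f (Suc j) x) (e j)))"
    proof (rule summable_comparison_test')
      show "summable (\<lambda>j. \<kappa> j * N m x)" by (rule summable_mult2[OF \<kappa>(1)])
      show "norm (N (Suc m) (s (f (Suc j) x) (e j))) \<le> \<kappa> j * N m x" for j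
        using \<kappa>(3)[OF x] N_nonneg[OF term_V[OF x]] by simp
    qed
    from N_series_converges[where z="\<lambda>j. s (f (Suc j) x) (e j)", OF term_V[OF x] this]
    obtain l where l: "l \<in> V (Suc m)"
      "(\<lambda>n. N (Suc m) ((\<Sum>j<n. s (f (Suc j) x) (e j)) - l)) \<longlonglongrightarrow> 0"
      by (elim bexE)
    have "(\<lambda>n. p (partial n x - l)) \<longlonglongrightarrow> 0" if "p \<in> P" for p
      by (rule P_tendsto[OF that partial_V[OF x] l(1)]) (use l(2) in \<open>simp add: partial_def\<close>)
    then show ?thesis using V_U[OF l(1)] by (intro exI[of _ l]) (simp add: converges_def)
  qed
  ultimately show ?thesis by (rule that)
qed

lemma S_converges:
  assumes "x \<in> U"
  shows "converges (\<lambda>n. partial n x) (S x)"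
proof -
  obtain m where m: "x \<in> V m" using assms by blast
  have "\<exists>l. converges (\<lambda>n. partial n x) l" by (rule partial_bound[of m]) (use m in blast)
  then show ?thesis unfolding S_def by (rule someI_ex)
qed

lemma S_unique: "x \<in> U \<Longrightarrow> converges (\<lambda>n. partial n x) l \<Longrightarrow> S x = l"
  by (rule converges_unique[OF Hausdorff partial_U S_converges])

lemma S_operators: "S \<in> operators"
proof -
  have SU: "S x \<in> U" if "x \<in> U" for x by (rule convergesD(1)[OF S_converges[OF that]])
  have add: "S (x + y) = S x + S y" if "x \<in> U" "y \<in> U" for x y
  proof (rule S_unique[OF U_add[OF that]])
    have "partial n (x + y) = partial n x + partial n y" for n
      unfolding partial_def using dualD(3)[OF f_dual that]
      by (simp add: scale_left_distrib sum.distrib)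
    then show "converges (\<lambda>n. partial n (x + y)) (S x + S y)"
      using converges_add[OF partial_U S_converges partial_U S_converges] that by simp
  qed
  have scale: "S (s c x) = s c (S x)" if "x \<in> U" for c x
  proof (rule S_unique[OF U_scale[OF that]])
    have "partial n (s c x) = s c (partial n x)" for n
      unfolding partial_def using dualD(4)[OF f_dual that]
      by (simp add: scale_sum_right)
    then show "converges (\<lambda>n. partial n (s c x)) (s c (S x))"
      using converges_scale[OF partial_U S_converges] that by simp
  qed
  have pull: "(\<lambda>x. p (S x)) \<in> P" if p: "p \<in> P" for p
  proof (rule P_intro)
    show "seminorm_on s U (\<lambda>x. p (S x))"
      using sn_add[OF p SU SU] sn_scale[OF p SU] by (simp add: seminorm_on_def add scale)
    fix m
    obtain K where K: "K \<ge> 0" "\<And>x n. x \<in> V m \<Longrightarrow> N (Suc m) (partial n x) \<le> K * N m x"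
      using partial_bound[of m] by metis
    obtain C where C: "C > 0" "\<And>x. x \<in> V (Suc m) \<Longrightarrow> p x \<le> C * N (Suc m) x" using P_bound[OF p] by metis
    have "p (S x) \<le> C * K * N m x" if x: "x \<in> V m" for x
    proof -
      have xU: "x \<in> U" by (rule V_U[OF x])
      have "p (S x) \<le> p (partial n x - S x) + C * K * N m x" for n
      proof -
        have "p (S x) \<le> p (partial n x) + p (partial n x - S x)"
          using sn_diff[OF p partial_U[OF xU] U_diff[OF partial_U[OF xU] SU[OF xU]], of n n] by simp
        moreover have "p (partial n x) \<le> C * N (Suc m) (partial n x)" by (rule C(2)[OF partial_V[OF x]])
        moreover have "C * N (Suc m) (partial n x) \<le> C * (K * N m x)"
          by (rule mult_left_mono[OF K(2)[OF x]]) (use C(1) in simp)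
        ultimately show ?thesis by (simp add: mult.assoc)
      qed
      moreover have "(\<lambda>n. p (partial n x - S x) + C * K * N m x) \<longlonglongrightarrow> 0 + C * K * N m x"
        by (intro tendsto_add tendsto_const convergesD(2)[OF S_converges[OF xU] p])
      ultimately have "p (S x) \<le> 0 + C * K * N m x" by (intro LIMSEQ_le_const) auto
      then show ?thesis by simp
    qed
    then show "\<exists>C. \<forall>x\<in>V m. p (S x) \<le> C * N m x" by blast
  qed
  show ?thesis by (rule operatorsI[OF SU add scale pull])
qed

lemma S_e: "S (e i) = (if i = 0 then 0 else e (i - 1))"
proof (rule S_unique[OF e_U])
  have eq: "partial n (e i) = (if i = 0 then 0 else e (i - 1))" if "n \<ge> i" for n
  proof -
    have "partial n (e i) = (\<Sum>j<n. if Suc j = i then e j else 0)"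
      unfolding partial_def by (intro sum.cong refl) (simp add: biorthogonal)
    also have "\<dots> = (if i = 0 then 0 else e (i - 1))"
    proof (cases i)
      case (Suc k)
      then have "k < n" using that by simp
      then show ?thesis using Suc by simp
    qed simp
    finally show ?thesis .
  qed
  have "(\<lambda>n. p (partial n (e i) - (if i = 0 then 0 else e (i - 1)))) \<longlonglongrightarrow> 0" if "p \<in> P" for p
  proof (rule tendsto_eventually)
    show "\<forall>\<^sub>F n in sequentially. p (partial n (e i) - (if i = 0 then 0 else e (i - 1))) = 0"
      using eventually_ge_at_top[of i] by eventually_elim (simp only: eq, simp add: sn_zero[OF that])
  qed
  then show "converges (\<lambda>n. partial n (e i)) (if i = 0 then 0 else e (i - 1))"
    using e_U U_zero by (simp add: converges_def)
qed

definition T :: "'a \<Rightarrow> 'a" where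
  "T x = x + S x"

lemma T_operators: "T \<in> operators"
proof -
  note S = operatorsD[OF S_operators]
  have TU: "T x \<in> U" if "x \<in> U" for x unfolding T_def by (intro U_add S that)
  have add: "T (x + y) = T x + T y" if "x \<in> U" "y \<in> U" for x y
    unfolding T_def using S(2)[OF that] by (simp add: algebra_simps)
  have scale: "T (s c x) = s c (T x)" if "x \<in> U" for c x
    unfolding T_def using S(3)[OF that] by (simp add: scale_right_distrib)
  have pull: "(\<lambda>x. p (T x)) \<in> P" if p: "p \<in> P" for p
  proof (rule dominated_in_P[where C=1])
    show "(\<lambda>x. p x + p (S x)) \<in> P" by (rule add_in_P[OF p S(4)[OF p]])
    show "seminorm_on s U (\<lambda>x. p (T x))"
      using sn_add[OF p TU TU] sn_scale[OF p TU] by (simp add: seminorm_on_def add scale)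
    show "p (T x) \<le> 1 * (p x + p (S x))" if "x \<in> U" for x
      unfolding T_def using sn_add[OF p that S(1)[OF that]] by simp
  qed
  show ?thesis by (rule operatorsI[OF TU add scale pull])
qed

lemma T_combination:
  "T (\<Sum>i\<le>D. s (c i) (e i)) = (\<Sum>i\<le>D. s (c i + (if i < D then c (Suc i) else 0)) (e i))"
proof -
  have "S (\<Sum>i\<le>D. s (c i) (e i)) = (\<Sum>i\<le>D. S (s (c i) (e i)))"
    by (rule operatorsD(7)[OF S_operators]) (intro U_scale e_U)
  also have "\<dots> = (\<Sum>i\<le>D. s (c i) (if i = 0 then 0 else e (i - 1)))"
    by (intro sum.cong refl) (simp only: operatorsD(3)[OF S_operators e_U] S_e)
  also have "\<dots> = (\<Sum>i<D. s (c (Suc i)) (e i))"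
  proof -
    have "(\<Sum>i\<le>D. s (c i) (if i = 0 then 0 else e (i - 1))) =
        s (c 0) (if (0::nat) = 0 then 0 else e (0 - 1)) +
        (\<Sum>i<D. s (c (Suc i)) (if Suc i = 0 then 0 else e (Suc i - 1)))"
      unfolding lessThan_Suc_atMost[symmetric] by (rule sum.lessThan_Suc_shift)
    then show ?thesis by simp
  qed
  also have "\<dots> = (\<Sum>i\<le>D. s (if i < D then c (Suc i) else 0) (e i))"
    by (simp add: lessThan_Suc_atMost[symmetric])
  finally show ?thesis by (simp only: T_def scale_left_distrib sum.distrib)
qed

text \<open>On the span of \<open>e 0\<close> to \<open>e D\<close> the operator is a Jordan block
  with eigenvalue 1; the induction step is Pascal's rule.\<close>

lemma T_power_combination:
  "(T ^^ n) (\<Sum>i\<le>D. s (c i) (e i)) =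
   (\<Sum>q\<le>D. s (\<Sum>i=q..D. of_nat (n choose (i - q)) * c i) (e q))"
proof (induction n)
  case 0
  have "(\<Sum>i=q..D. of_nat (0 choose (i - q)) * c i) = c q" if "q \<le> D" for q
  proof -
    have "(\<Sum>i=q..D. of_nat (0 choose (i - q)) * c i) = (\<Sum>i=q..D. if i = q then c i else 0)"
      by (intro sum.cong refl) auto
    then show ?thesis using that by simp
  qed
  then show ?case by simp
next
  case (Suc n)
  let ?a = "\<lambda>n q. \<Sum>i=q..D. of_nat (n choose (i - q)) * c i"
  have "?a n q + (if q < D then ?a n (Suc q) else 0) = ?a (Suc n) q" if q: "q \<le> D" for q
  proof -
    have split: "?a n q = c q + (\<Sum>i=Suc q..D. of_nat (n choose (i - q)) * c i)" for n
      using q by (simp add: sum.atLeast_Suc_atMost)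
    have "(if q < D then ?a n (Suc q) else 0) = ?a n (Suc q)" by auto
    then have "?a n q + (if q < D then ?a n (Suc q) else 0) =
      c q + (\<Sum>i=Suc q..D. of_nat (n choose (i - q)) * c i + of_nat (n choose (i - Suc q)) * c i)"
      unfolding split by (simp add: sum.distrib)
    also have "(\<Sum>i=Suc q..D. of_nat (n choose (i - q)) * c i + of_nat (n choose (i - Suc q)) * c i) =
        (\<Sum>i=Suc q..D. of_nat (Suc n choose (i - q)) * c i)"
    proof (rule sum.cong[OF refl])
      fix i assume "i \<in> {Suc q..D}"
      then have "i - q = Suc (i - Suc q)" by auto
      then show "of_nat (n choose (i - q)) * c i + of_nat (n choose (i - Suc q)) * c i =
          of_nat (Suc n choose (i - q)) * c i" by (simp add: algebra_simps)
    qed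
    finally show ?thesis unfolding split .
  qed
  then show ?case by (simp add: Suc T_combination)
qed

lemma span_combination:
  assumes "x \<in> span (range e)"
  shows "\<exists>D c. (\<forall>i>D. c i = 0) \<and> (\<forall>R\<ge>D. x = (\<Sum>i\<le>R. s (c i) (e i)))"
  using assms
proof (induction rule: span_induct_alt)
  case base
  show ?case by (intro exI[of _ 0] exI[of _ "\<lambda>_. 0"]) simp
next
  case (step a b y)
  then obtain k where k: "b = e k" by blast
  obtain D c where c: "\<And>i. i > D \<Longrightarrow> c i = 0" "\<And>R. R \<ge> D \<Longrightarrow> y = (\<Sum>i\<le>R. s (c i) (e i))"
    using step by blast
  let ?c = "\<lambda>i. (if i = k then a else 0) + c i"
  have "s a b + y = (\<Sum>i\<le>R. s (?c i) (e i))" if "R \<ge> max D k" for R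
  proof -
    have "(\<Sum>i\<le>R. s (if i = k then a else 0) (e i)) = (\<Sum>i\<le>R. if i = k then s a (e i) else 0)"
      by (intro sum.cong refl) simp
    also have "\<dots> = s a b" using that k by simp
    finally show ?thesis using c(2)[of R] that by (simp add: scale_left_distrib sum.distrib)
  qed
  moreover have "\<forall>i>max D k. ?c i = 0" using c(1) by auto
  ultimately show ?case by (intro exI[of _ "max D k"] exI[of _ ?c]) blast
qed

text \<open>On a stretch where \<open>\<beta>\<close> vanishes, smallness of coefficients translates
  into smallness in the one norm \<open>N 0\<close>.\<close>

lemma combination_in_V0:
  assumes Q: "\<And>j. Q \<le> j \<Longrightarrow> j \<le> R \<Longrightarrow> \<beta> j = 0"
    and c: "\<And>i. i < Q \<Longrightarrow> c i = 0" "\<And>i. Q \<le> i \<Longrightarrow> i \<le> R \<Longrightarrow> norm (c i) \<le> \<eta>"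
  shows "(\<Sum>i\<le>R. s (c i) (e i)) \<in> V 0 \<and> N 0 (\<Sum>i\<le>R. s (c i) (e i)) \<le> \<eta> * (\<Sum>i=Q..R. N 0 (e i))"
proof -
  have eV: "e i \<in> V 0" if "i \<in> {Q..R}" for i using e_V[of i] Q that by simp
  have "(\<Sum>i\<le>R. s (c i) (e i)) = (\<Sum>i=Q..R. s (c i) (e i))"
    by (intro sum.mono_neutral_right) (use c(1) in auto)
  moreover have "(\<Sum>i=Q..R. s (c i) (e i)) \<in> V 0" by (intro V_sum V_scale eV)
  moreover have "N 0 (\<Sum>i=Q..R. s (c i) (e i)) \<le> (\<Sum>i=Q..R. N 0 (s (c i) (e i)))"
    by (intro N_sum V_scale eV)
  moreover have "(\<Sum>i=Q..R. N 0 (s (c i) (e i))) \<le> (\<Sum>i=Q..R. \<eta> * N 0 (e i))"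
  proof (rule sum_mono)
    fix i assume i: "i \<in> {Q..R}"
    then have "norm (c i) * N 0 (e i) \<le> \<eta> * N 0 (e i)"
      by (intro mult_right_mono c(2) N_nonneg eV) auto
    then show "N 0 (s (c i) (e i)) \<le> \<eta> * N 0 (e i)" using N_scale[OF eV[OF i]] by simp
  qed
  ultimately show ?thesis by (simp add: sum_distrib_left)
qed

text \<open>\<open>Q\<close> begins a long zero stretch of \<open>\<beta>\<close> beyond the
  supports of \<open>u\<close> and \<open>y\<close>. The correction sits at indices from
  \<open>M\<close> to \<open>M + Q\<close> and the final error at indices above \<open>Q\<close>, so
  both lie in \<open>V 0\<close>. Smallness of \<open>z\<close> under the first \<open>m\<close>
  powers protects the visits the orbit has already made.\<close>

lemma steering:
  assumes u: "u \<in> span (range e)" and y: "y \<in> span (range e)" and \<epsilon>: "\<epsilon> > 0"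
  shows "\<exists>n. \<exists>z\<in>span (range e). (\<forall>k\<le>m. (T ^^ k) z \<in> V 0 \<and> N 0 ((T ^^ k) z) \<le> \<epsilon>) \<and>
    (T ^^ n) (u + z) - y \<in> V 0 \<and> N 0 ((T ^^ n) (u + z) - y) \<le> \<epsilon>"
proof -
  obtain Du cu where cu: "\<And>i. i > Du \<Longrightarrow> cu i = 0" "\<And>R. R \<ge> Du \<Longrightarrow> u = (\<Sum>i\<le>R. s (cu i) (e i))"
    using span_combination[OF u] by blast
  obtain Dy cy where cy: "\<And>i. i > Dy \<Longrightarrow> cy i = 0" "\<And>R. R \<ge> Dy \<Longrightarrow> y = (\<Sum>i\<le>R. s (cy i) (e i))"
    using span_combination[OF y] by blast
  obtain Q where Q: "Q \<ge> max (max Du Dy) (Suc m)" "\<forall>j. Q \<le> j \<and> j \<le> 4 * Q \<longrightarrow> \<beta> j = 0"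
    using \<beta>_zero by blast
  \<comment> \<open>As \<open>m < Q\<close>, the first \<open>m\<close> powers of \<open>T\<close>
    carry nothing from index \<open>M\<close> or above to an index below \<open>Q\<close>; and
    \<open>M + Q = 3 * Q + 1 \<le> 4 * Q\<close> stays inside the stretch.\<close>
  define M where "M = 2 * Q + 1"
  define R where "R = M + Q"
  have zero: "\<beta> j = 0" if "Q \<le> j" "j \<le> R" for j using Q that by (simp add: M_def R_def)
  \<comment> \<open>\<open>E\<close> bounds the norms of the vectors involved, \<open>B\<close> the
    growth of coefficients under at most \<open>m\<close> powers: at most \<open>R + 1\<close> terms
    with binomials up to \<open>2 ^ m\<close>.\<close>
  define E where "E = 1 + (\<Sum>i=Q..R. N 0 (e i))"
  define B where "B = 1 + real (R + 1) * 2 ^ m"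
  have "N 0 (e i) \<ge> 0" if "i \<in> {Q..R}" for i using N_nonneg[of "e i" 0] e_V[of i] zero that by simp
  then have "(\<Sum>i=Q..R. N 0 (e i)) \<ge> 0" by (rule sum_nonneg)
  then have E: "E \<ge> 1" by (simp add: E_def)
  have B: "B \<ge> 1" by (simp add: B_def)
  define \<eta> where "\<eta> = \<epsilon> / (B * E)"
  have \<eta>: "\<eta> > 0" using \<epsilon> B E by (simp add: \<eta>_def)
  have B\<eta>E: "B * \<eta> * E = \<epsilon>" using B E by (simp add: \<eta>_def)
  have le_\<epsilon>: "x * (\<Sum>i=Q..R. N 0 (e i)) \<le> \<epsilon>" if "0 \<le> x" "x \<le> B * \<eta>" for x
  proof -
    have "x * (\<Sum>i=Q..R. N 0 (e i)) \<le> x * E" by (rule mult_left_mono) (use that in \<open>auto simp: E_def\<close>)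
    also have "\<dots> \<le> B * \<eta> * E" by (rule mult_right_mono) (use that E in auto)
    finally show ?thesis using B\<eta>E by simp
  qed
  have "\<exists>n a. (\<forall>i. a i \<noteq> 0 \<longrightarrow> M \<le> i \<and> i \<le> M + Q) \<and> (\<forall>i. norm (a i) \<le> \<eta>) \<and>
    (\<forall>q\<le>Q. (\<Sum>i=q..M+Q. of_nat (n choose (i - q)) * (cu i + a i)) = cy q) \<and>
    (\<forall>q. Q < q \<longrightarrow> q \<le> M + Q \<longrightarrow> norm (\<Sum>i=q..M+Q. of_nat (n choose (i - q)) * (cu i + a i)) \<le> \<eta>)"
    by (rule Jordan_block_steering) (use Q(1) cu(1) cy(1) \<eta> in \<open>auto simp: M_def\<close>)
  then obtain n a where a: "\<And>i. a i \<noteq> 0 \<Longrightarrow> M \<le> i \<and> i \<le> R" "\<And>i. norm (a i) \<le> \<eta>"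
    "\<And>q. q \<le> Q \<Longrightarrow> (\<Sum>i=q..R. of_nat (n choose (i - q)) * (cu i + a i)) = cy q"
    "\<And>q. Q < q \<Longrightarrow> q \<le> R \<Longrightarrow> norm (\<Sum>i=q..R. of_nat (n choose (i - q)) * (cu i + a i)) \<le> \<eta>"
    unfolding R_def by blast
  define z where "z = (\<Sum>i\<le>R. s (a i) (e i))"
  have "z \<in> span (range e)" unfolding z_def by (intro span_sum span_scale span_base) auto
  moreover have "(T ^^ k) z \<in> V 0 \<and> N 0 ((T ^^ k) z) \<le> \<epsilon>" if k: "k \<le> m" for k
  proof -
    let ?c = "\<lambda>q. \<Sum>i=q..R. of_nat (k choose (i - q)) * a i"
    have c1: "?c q = 0" if q: "q < Q" for q
    proof (rule sum.neutral, rule ballI)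
      fix i
      show "of_nat (k choose (i - q)) * a i = 0"
      proof (cases "a i = 0")
        case False
        then have "2 * Q + 1 \<le> i" using a(1) by (simp add: M_def)
        then have "k + q < i" using q k Q(1) by linarith
        then have "k < i - q" by simp
        then show ?thesis by (simp add: binomial_eq_0)
      qed simp
    qed
    have c2: "norm (?c q) \<le> B * \<eta>" for q
    proof -
      have "norm (?c q) \<le> (\<Sum>i=q..R. norm (of_nat (k choose (i - q)) * a i))" by (rule norm_sum)
      also have "\<dots> \<le> (\<Sum>i=q..R. 2 ^ m * \<eta>)"
      proof (rule sum_mono)
        fix i
        have "k choose (i - q) \<le> 2 ^ k" by (rule binomial_le_pow2)
        also have "(2::nat) ^ k \<le> 2 ^ m" using k by (intro power_increasing) auto
        finally have "real (k choose (i - q)) \<le> 2 ^ m" by (metis of_nat_le_iff of_nat_numeral of_nat_power)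
        then show "norm (of_nat (k choose (i - q)) * a i) \<le> 2 ^ m * \<eta>"
          unfolding norm_mult norm_of_nat by (intro mult_mono a(2)) auto
      qed
      also have "\<dots> = real (card {q..R}) * (2 ^ m * \<eta>)" by simp
      also have "\<dots> \<le> real (R + 1) * (2 ^ m * \<eta>)" using \<eta> by (intro mult_right_mono) auto
      also have "\<dots> \<le> B * \<eta>" using \<eta> by (simp add: B_def algebra_simps)
      finally show ?thesis .
    qed
    have "(T ^^ k) z = (\<Sum>q\<le>R. s (?c q) (e q))" unfolding z_def by (rule T_power_combination)
    moreover have "0 \<le> B * \<eta>" using B \<eta> by simp
    ultimately show ?thesis
      using combination_in_V0[of Q R ?c "B * \<eta>", OF zero c1 c2] le_\<epsilon>[of "B * \<eta>"] by simp
  qed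
  moreover have "(T ^^ n) (u + z) - y \<in> V 0 \<and> N 0 ((T ^^ n) (u + z) - y) \<le> \<epsilon>"
  proof -
    let ?c = "\<lambda>q. (\<Sum>i=q..R. of_nat (n choose (i - q)) * (cu i + a i)) - cy q"
    have uz: "u + z = (\<Sum>i\<le>R. s (cu i + a i) (e i))"
      using cu(2)[of R] Q(1) by (simp add: z_def R_def M_def scale_left_distrib sum.distrib)
    have yR: "y = (\<Sum>i\<le>R. s (cy i) (e i))" by (rule cy(2)) (use Q(1) in \<open>simp add: R_def M_def\<close>)
    have "(T ^^ n) (u + z) - y = (\<Sum>q\<le>R. s (?c q) (e q))"
      unfolding uz T_power_combination by (subst yR) (simp only: scale_left_diff_distrib sum_subtractf)
    moreover have c1: "?c q = 0" if "q < Q" for q using a(3)[of q] that by simp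
    moreover have c2: "norm (?c q) \<le> \<eta>" if "Q \<le> q" "q \<le> R" for q
    proof (cases "q = Q")
      case False
      then show ?thesis using a(4)[of q] cy(1)[of q] Q(1) that by simp
    qed (use a(3)[of Q] \<eta> in simp)
    moreover have "\<eta> \<le> B * \<eta>" using B \<eta> by simp
    ultimately show ?thesis
      using combination_in_V0[of Q R ?c \<eta>, OF zero c1 c2] le_\<epsilon>[of \<eta>] \<eta> by simp
  qed
  ultimately show ?thesis by blast
qed

end

section \<open>A hypercyclic vector\<close>

context shift_system
begin

text \<open>The orbit is steered to these approximations of the \<open>d j\<close>, since
  \<open>steering\<close> only reaches vectors in the span of the \<open>e i\<close>.\<close>

definition target :: "nat \<Rightarrow> 'a" where
  "target j = (\<Sum>i<j. s (f i (d j)) (e i)) + s (t j) (e j)"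

lemma target_span: "target j \<in> span (range e)"
  unfolding target_def by (intro span_add span_sum span_scale span_base) auto

lemma target_close: "d j - target j \<in> V (\<beta> j)" "N (\<beta> j) (d j - target j) \<le> 1 / real (Suc j)"
  using system[of j] by (simp_all add: good_def target_def diff_diff_eq)

text \<open>The vector is the sum of the corrections found by \<open>steering\<close>. The
  conclusion is in terms of seminorms because continuity of the powers of \<open>T\<close> controls
  limits in \<open>X\<close>; the time \<open>n\<close> depends on \<open>l\<close> alone and serves
  all \<open>q\<close> at once.\<close>

lemma approximating_orbit:
  "\<exists>x\<in>V 0. \<forall>l. \<exists>n. \<forall>q\<in>P. \<forall>C>0. (\<forall>x\<in>V 0. q x \<le> C * N 0 x) \<longrightarrow>
     q ((T ^^ n) x - target l) \<le> 2 * C * (1 / 2) ^ l"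
proof -
  let ?E = "span (range e)"
  \<comment> \<open>\<open>m\<close> bounds the times of all visits made so far; the correction is
    small under the powers up to \<open>m\<close>, so it disturbs none of them.\<close>
  let ?R = "\<lambda>l (u, m) (u', m'). u' - u \<in> V 0 \<and> m \<le> m' \<and>
      (\<forall>k\<le>m. (T ^^ k) (u' - u) \<in> V 0 \<and> N 0 ((T ^^ k) (u' - u)) \<le> (1 / 2) ^ l) \<and>
      (\<exists>n\<le>m'. (T ^^ n) u' - target l \<in> V 0 \<and> N 0 ((T ^^ n) u' - target l) \<le> (1 / 2) ^ l)"
  have "\<exists>h. \<forall>l. (fst (h l) \<in> ?E \<and> (l = 0 \<longrightarrow> fst (h l) = 0)) \<and> ?R l (h l) (h (Suc l))"
  proof (rule dependent_nat_choice)
    show "\<exists>h :: 'a \<times> nat. fst h \<in> ?E \<and> ((0::nat) = 0 \<longrightarrow> fst h = 0)"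
      by (intro exI[of _ "(0, 0)"]) (simp add: span_zero)
  next
    fix h :: "'a \<times> nat" and l :: nat
    assume h: "fst h \<in> ?E \<and> (l = 0 \<longrightarrow> fst h = 0)"
    obtain u m where um: "h = (u, m)" by (cases h)
    have "(1 / 2 :: real) ^ l > 0" by simp
    with steering[of u "target l" "(1 / 2) ^ l" m] h um target_span
    obtain n z where z: "z \<in> ?E" "\<forall>k\<le>m. (T ^^ k) z \<in> V 0 \<and> N 0 ((T ^^ k) z) \<le> (1 / 2) ^ l"
      "(T ^^ n) (u + z) - target l \<in> V 0" "N 0 ((T ^^ n) (u + z) - target l) \<le> (1 / 2) ^ l"
      by auto
    have "u + z \<in> ?E" using h um z(1) by (simp add: span_add)
    moreover have "z \<in> V 0" using z(2) by (auto dest: spec[of _ 0])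
    ultimately show "\<exists>h'. (fst h' \<in> ?E \<and> (Suc l = 0 \<longrightarrow> fst h' = 0)) \<and> ?R l h h'"
      using z um by (intro exI[of _ "(u + z, max m n)"]) (auto intro!: exI[of _ n])
  qed
  then obtain h where H: "\<forall>l. (fst (h l) \<in> ?E \<and> (l = 0 \<longrightarrow> fst (h l) = 0)) \<and> ?R l (h l) (h (Suc l))"
    by (elim exE)
  have h: "fst (h l) \<in> ?E" "fst (h 0) = 0" and R: "?R l (h l) (h (Suc l))" for l
    using H[rule_format, of l] H[rule_format, of 0] by simp_all
  define u where "u l = fst (h l)" for l
  define m where "m l = snd (h l)" for l
  have step: "u (Suc l) - u l \<in> V 0" "m l \<le> m (Suc l)"
    "\<And>k. k \<le> m l \<Longrightarrow> (T ^^ k) (u (Suc l) - u l) \<in> V 0"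
    "\<And>k. k \<le> m l \<Longrightarrow> N 0 ((T ^^ k) (u (Suc l) - u l)) \<le> (1 / 2) ^ l"
    "\<exists>n\<le>m (Suc l). (T ^^ n) (u (Suc l)) - target l \<in> V 0 \<and>
      N 0 ((T ^^ n) (u (Suc l)) - target l) \<le> (1 / 2) ^ l" for l
    using R[of l] by (simp_all add: u_def m_def case_prod_beta)
  have EU: "?E \<subseteq> U" by (rule span_minimal[OF _ subspace_U]) (use e_U in auto)
  have uU: "u l \<in> U" for l using h(1)[of l] EU by (auto simp: u_def)
  have m_mono: "m i \<le> m j" if "i \<le> j" for i j using that step(2) by (rule lift_Suc_mono_le[rotated])
  have u0: "u 0 = 0" by (simp add: u_def h(2))
  have u_sum: "(\<Sum>i<p. u (Suc i) - u i) = u p" for p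
    by (induction p) (simp_all add: u0)
  have uV: "u p \<in> V 0" for p
  proof -
    have "(\<Sum>i<p. u (Suc i) - u i) \<in> V 0" by (intro V_sum step(1))
    then show ?thesis by (simp only: u_sum)
  qed
  have "summable (\<lambda>i. N 0 (u (Suc i) - u i))"
  proof (rule summable_comparison_test')
    show "summable (\<lambda>i. (1 / 2 :: real) ^ i)" by (simp add: summable_geometric)
    show "norm (N 0 (u (Suc i) - u i)) \<le> (1 / 2) ^ i" for i
      using step(4)[of 0 i] N_nonneg[OF step(1)[of i]] by simp
  qed
  from N_series_converges[where z="\<lambda>i. u (Suc i) - u i", OF step(1) this]
  obtain x where x: "x \<in> V 0" "(\<lambda>p. N 0 (u p - x)) \<longlonglongrightarrow> 0" unfolding u_sum by (elim bexE)
  have conv: "converges u x"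
    unfolding converges_def using V_U[OF x(1)] P_tendsto[OF _ uV x] by simp
  have "\<exists>n. \<forall>q\<in>P. \<forall>C>0. (\<forall>x\<in>V 0. q x \<le> C * N 0 x) \<longrightarrow>
     q ((T ^^ n) x - target l) \<le> 2 * C * (1 / 2) ^ l" for l
  proof -
    obtain n where n: "n \<le> m (Suc l)" "(T ^^ n) (u (Suc l)) - target l \<in> V 0"
      "N 0 ((T ^^ n) (u (Suc l)) - target l) \<le> (1 / 2) ^ l" using step(5)[of l] by auto
    note Tn = operatorsD[OF funpow_operators[OF T_operators, of n]]
    \<comment> \<open>\<open>2 * (1 / 2) ^ l - 2 * (1 / 2) ^ p\<close> is the sum of
      \<open>(1 / 2) ^ i\<close> over \<open>l \<le> i < p\<close>: the error of the visit plus the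
      later disturbances.\<close>
    have near: "(T ^^ n) (u p) - target l \<in> V 0 \<and>
      N 0 ((T ^^ n) (u p) - target l) \<le> 2 * (1 / 2) ^ l - 2 * (1 / 2) ^ p" if "p \<ge> Suc l" for p
      using that
    proof (induction p rule: dec_induct)
      case base
      then show ?case using n by simp
    next
      case (step p)
      have np: "n \<le> m p" using n(1) m_mono[OF step(1)] by simp
      have eq: "(T ^^ n) (u (Suc p)) - target l =
          ((T ^^ n) (u p) - target l) + (T ^^ n) (u (Suc p) - u p)"
        by (simp add: Tn(6)[OF uU uU])
      have "N 0 ((T ^^ n) (u (Suc p)) - target l) \<le>
          N 0 ((T ^^ n) (u p) - target l) + N 0 ((T ^^ n) (u (Suc p) - u p))"
        unfolding eq by (rule N_add) (use step np \<open>\<And>l k. k \<le> m l \<Longrightarrow> (T ^^ k) (u (Suc l) - u l) \<in> V 0\<close> in auto)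
      moreover have "N 0 ((T ^^ n) (u (Suc p) - u p)) \<le> (1 / 2) ^ p"
        by (rule \<open>\<And>l k. k \<le> m l \<Longrightarrow> N 0 ((T ^^ k) (u (Suc l) - u l)) \<le> (1 / 2) ^ l\<close>[OF np])
      moreover have "(T ^^ n) (u (Suc p)) - target l \<in> V 0"
        unfolding eq by (rule V_add) (use step np \<open>\<And>l k. k \<le> m l \<Longrightarrow> (T ^^ k) (u (Suc l) - u l) \<in> V 0\<close> in auto)
      ultimately show ?case using step.IH by simp
    qed
    have "q ((T ^^ n) x - target l) \<le> 2 * C * (1 / 2) ^ l"
      if q: "q \<in> P" and C: "C > 0" "\<forall>x\<in>V 0. q x \<le> C * N 0 x" for q C
    proof -
      have convT: "converges (\<lambda>p. (T ^^ n) (u p)) ((T ^^ n) x)"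
        by (rule converges_operator[OF funpow_operators[OF T_operators] uU conv])
      have tU: "target l \<in> U" using target_span EU by blast
      have TxU: "(T ^^ n) x \<in> U" by (rule Tn(1)[OF V_U[OF x(1)]])
      have "q ((T ^^ n) x - target l) \<le> q ((T ^^ n) (u p) - (T ^^ n) x) + C * (2 * (1 / 2) ^ l)"
        if p: "p \<ge> Suc l" for p
      proof -
        have "q ((T ^^ n) x - target l) \<le> q ((T ^^ n) x - (T ^^ n) (u p)) + q ((T ^^ n) (u p) - target l)"
          by (rule sn_triangle[OF q TxU Tn(1)[OF uU] tU])
        moreover have "q ((T ^^ n) x - (T ^^ n) (u p)) = q ((T ^^ n) (u p) - (T ^^ n) x)"
          by (rule sn_diff_commute[OF q TxU Tn(1)[OF uU]])
        moreover have "q ((T ^^ n) (u p) - target l) \<le> C * N 0 ((T ^^ n) (u p) - target l)"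
          using C(2) near[OF p] by blast
        moreover have "C * N 0 ((T ^^ n) (u p) - target l) \<le> C * (2 * (1 / 2) ^ l)"
        proof (rule mult_left_mono)
          have "(1 / 2 :: real) ^ p > 0" by simp
          then show "N 0 ((T ^^ n) (u p) - target l) \<le> 2 * (1 / 2) ^ l" using near[OF p] by linarith
        qed (use C(1) in simp)
        ultimately show ?thesis by linarith
      qed
      moreover have "(\<lambda>p. q ((T ^^ n) (u p) - (T ^^ n) x) + C * (2 * (1 / 2) ^ l)) \<longlonglongrightarrow>
          0 + C * (2 * (1 / 2) ^ l)"
        by (intro tendsto_add tendsto_const convergesD(2)[OF convT q])
      ultimately have "q ((T ^^ n) x - target l) \<le> 0 + C * (2 * (1 / 2) ^ l)"
        by (intro LIMSEQ_le_const) auto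
      then show ?thesis by simp
    qed
    then show ?thesis by (intro exI[of _ n]) blast
  qed
  then show ?thesis using x(1) by (intro bexI[of _ x]) simp_all
qed

text \<open>\<open>d\<close> runs through dense sequences of the steps, and each entry recurs at
  arbitrarily large \<open>j\<close> by \<open>\<beta>_often\<close>; so the errors
  \<open>1 / (j + 1)\<close> and \<open>(1 / 2) ^ j\<close> become small while the vector to be
  approximated stays fixed.\<close>

lemma hypercyclic_T:
  assumes d: "\<And>j. d j = dd (\<beta> j) (lab j)"
    and dd: "\<And>k x e. x \<in> V k \<Longrightarrow> e > 0 \<Longrightarrow> \<exists>l. N k (dd k l - x) < e"
  shows "hypercyclic X T"
proof -
  obtain x where x: "x \<in> V 0" "\<forall>l. \<exists>n. \<forall>q\<in>P. \<forall>C>0. (\<forall>x\<in>V 0. q x \<le> C * N 0 x) \<longrightarrow>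
     q ((T ^^ n) x - target l) \<le> 2 * C * (1 / 2) ^ l" using approximating_orbit by (elim bexE)
  let ?O = "range (\<lambda>n. (T ^^ n) x)"
  have OU: "?O \<subseteq> U" using operatorsD(1)[OF funpow_operators[OF T_operators] V_U[OF x(1)]] by auto
  have targetU: "target j \<in> U" for j
  proof -
    have "span (range e) \<subseteq> U" by (rule span_minimal[OF _ subspace_U]) (use e_U in auto)
    then show ?thesis using target_span by blast
  qed
  have BU: "(\<Union>j. V (\<beta> j)) \<subseteq> U" by blast
  have "x0 \<in> X closure_of ?O" if x0: "x0 \<in> U" for x0
    unfolding in_closure_iff[OF OU]
  proof (intro conjI ballI allI impI)
    fix q and \<epsilon> :: real assume q: "q \<in> P" and \<epsilon>: "\<epsilon> > 0"
    have "x0 \<in> X closure_of (\<Union>j. V (\<beta> j))" using dense_blocks x0 by simp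
    from closure_mem(2)[OF BU this q, of "\<epsilon> / 4"] \<epsilon>
    obtain v where "v \<in> (\<Union>j. V (\<beta> j))" and v: "q (v - x0) < \<epsilon> / 4" by auto
    then obtain i where vi: "v \<in> V (\<beta> i)" by blast
    obtain C where C: "C > 0" "\<And>x. x \<in> V (\<beta> i) \<Longrightarrow> q x \<le> C * N (\<beta> i) x" using P_bound[OF q] by metis
    obtain C0 where C0: "C0 > 0" "\<And>x. x \<in> V 0 \<Longrightarrow> q x \<le> C0 * N 0 x" using P_bound[OF q] by metis
    obtain l where l: "N (\<beta> i) (dd (\<beta> i) l - v) < \<epsilon> / (4 * C)"
      using dd[OF vi, of "\<epsilon> / (4 * C)"] \<epsilon> C(1) by auto
    have "(\<lambda>j. C * (1 / real (Suc j)) + 2 * C0 * (1 / 2) ^ j) \<longlonglongrightarrow> C * 0 + 2 * C0 * 0"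
      by (intro tendsto_intros LIMSEQ_power_zero lim_1_over_n[THEN LIMSEQ_Suc]) auto
    then have "eventually (\<lambda>j. C * (1 / real (Suc j)) + 2 * C0 * (1 / 2) ^ j < \<epsilon> / 4) sequentially"
      using \<epsilon> by (intro order_tendstoD(2)[where y="C * 0 + 2 * C0 * 0"]) auto
    then obtain m where m: "\<And>j. j \<ge> m \<Longrightarrow> C * (1 / real (Suc j)) + 2 * C0 * (1 / 2) ^ j < \<epsilon> / 4"
      unfolding eventually_sequentially by blast
    obtain j where j: "j \<ge> m" "\<beta> j = \<beta> i" "lab j = l" using \<beta>_often by blast
    obtain n where n: "q ((T ^^ n) x - target j) \<le> 2 * C0 * (1 / 2) ^ j"
      using x(2) q C0 by blast
    have dj: "d j = dd (\<beta> i) l" using d[of j] j by simp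
    have dV: "d j \<in> V (\<beta> i)" using d_V[of j] j by simp
    have "q (d j - v) \<le> C * N (\<beta> i) (d j - v)" by (rule C(2)[OF V_diff[OF dV vi]])
    also have "\<dots> < \<epsilon> / 4" using l C(1) by (simp add: dj field_simps)
    finally have 1: "q (d j - v) < \<epsilon> / 4" .
    have "q (d j - target j) \<le> C * N (\<beta> i) (d j - target j)"
      by (rule C(2)) (use target_close(1)[of j] j in simp)
    also have "\<dots> \<le> C * (1 / real (Suc j))"
      by (rule mult_left_mono) (use target_close(2)[of j] j C(1) in auto)
    finally have 2: "q (d j - target j) \<le> C * (1 / real (Suc j))" .
    have U: "(T ^^ n) x \<in> U" "target j \<in> U" "d j \<in> U" "v \<in> U"
      using OU targetU V_U[OF dV] V_U[OF vi] by auto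
    have "q ((T ^^ n) x - x0) \<le> q ((T ^^ n) x - target j) + q (target j - x0)"
      by (rule sn_triangle[OF q U(1,2) x0])
    moreover have "q (target j - x0) \<le> q (target j - d j) + q (d j - x0)"
      by (rule sn_triangle[OF q U(2,3) x0])
    moreover have "q (d j - x0) \<le> q (d j - v) + q (v - x0)"
      by (rule sn_triangle[OF q U(3,4) x0])
    moreover have "q (target j - d j) = q (d j - target j)" by (rule sn_diff_commute[OF q U(2,3)])
    ultimately have "q ((T ^^ n) x - x0) < \<epsilon>" using 1 2 n v m[OF j(1)] \<epsilon> by linarith
    then show "\<exists>y\<in>?O. q (y - x0) < \<epsilon>" by blast
  qed (rule x0)
  moreover have "X closure_of ?O \<subseteq> U" using closure_of_subset_topspace[of X] by simp
  ultimately have "X closure_of ?O = U" by blast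
  then show ?thesis
    unfolding hypercyclic_def topspace_X using V_U[OF x(1)] by blast
qed

end

lemma (in block_chain) exists_hypercyclic: "\<exists>T\<in>operators. hypercyclic X T"
proof -
  have "\<exists>dd. range dd \<subseteq> V k \<and> (\<forall>x\<in>V k. \<forall>e>0. \<exists>l::nat. N k (dd l - x) < e)" for k
  proof -
    obtain D where D: "countable D" "D \<subseteq> V k" "\<forall>x\<in>V k. \<forall>e>0. \<exists>d\<in>D. N k (d - x) < e"
      using N_separable[of k] unfolding norm_separable_def by (elim exE conjE)
    have "D \<noteq> {}" using D(3)[rule_format, OF V_zero, of 1] by auto
    then have r: "range (from_nat_into D) = D" by (rule range_from_nat_into[OF _ D(1)])
    have "\<exists>l. N k (from_nat_into D l - x) < e" if xe: "x \<in> V k" "e > 0" for x e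
    proof -
      obtain y where "y \<in> D" "N k (y - x) < e" using D(3) xe by blast
      moreover obtain l where "y = from_nat_into D l" using \<open>y \<in> D\<close> r by auto
      ultimately show ?thesis by blast
    qed
    then show ?thesis using D(2) r by (intro exI[of _ "from_nat_into D"]) simp
  qed
  then obtain dd where dd: "\<And>k. range (dd k) \<subseteq> V k"
    "\<And>k x e. x \<in> V k \<Longrightarrow> e > 0 \<Longrightarrow> \<exists>l::nat. N k (dd k l - x) < e" by metis
  define d where "d j = dd (\<beta> j) (lab j)" for j
  have dV: "d j \<in> V (\<beta> j)" for j using dd(1) by (auto simp: d_def)
  obtain e f t where "\<forall>j. good d e f j (e j) (f j) (t j)" using biorthogonal_system[OF dV] by blast
  then interpret shift_system s V N \<beta> lab d e f t by unfold_locales (use dV in auto)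
  have "hypercyclic X T" by (rule hypercyclic_T[OF d_def dd(2)])
  then show ?thesis using T_operators by blast
qed

section \<open>Existence of hypercyclic operators\<close>

text \<open>Starting at \<open>a i = 10 ^ i - 1\<close>, \<open>\<beta>\<close> jumps to \<open>i\<close> and descends to \<open>0\<close> in unit steps.\<close>

lemma ramp_function:
  "\<exists>\<beta> lab :: nat \<Rightarrow> nat. (\<forall>j. \<beta> j \<le> Suc (\<beta> (Suc j))) \<and>
     (\<forall>q. \<exists>Q\<ge>q. \<forall>j. Q \<le> j \<and> j \<le> 4 * Q \<longrightarrow> \<beta> j = 0) \<and>
     (\<forall>k l m. \<exists>j\<ge>m. \<beta> j = k \<and> lab j = l)"
proof -
  \<comment> \<open>The factor 10 leaves a zero stretch of ratio above 4 between the end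
    \<open>a i + i\<close> of a ramp and the start of the next one (\<open>gap\<close>). Truncated
    subtraction makes \<open>h i j\<close> vanish past that end.\<close>
  define a where "a i = 10 ^ i - (1::nat)" for i
  define h where "h i j = i + a i - j" for i j
  define A where "A j = {i. a i \<le> j}" for j
  define \<beta> where "\<beta> j = Max ((\<lambda>i. h i j) ` A j)" for j
  define lab where "lab j = fst (prod_decode (Max (A j)))" for j
  have pow: "i < (10::nat) ^ i" for i by (induction i) auto
  have ge: "i \<le> a i" for i using pow[of i] by (simp add: a_def)
  have mono: "a i \<le> a j" if "i \<le> j" for i j
    unfolding a_def using that by (intro diff_le_mono power_increasing) auto
  have gap: "4 * (a i + i) < a (Suc i)" for i
    using pow[of i] unfolding a_def by (simp; arith)
  have fin: "finite (A j)" for j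
    by (rule finite_subset[of _ "{..j}"]) (use ge order_trans in \<open>auto simp: A_def\<close>)
  have zero: "0 \<in> A j" for j by (simp add: A_def a_def)
  have A_le: "i' \<le> i" if "i' \<in> A j" "j < a (Suc i)" for i i' j
    using that mono[of "Suc i" i'] by (auto simp: A_def not_less_eq_eq[symmetric])
  have "\<beta> j \<le> Suc (\<beta> (Suc j))" for j
  proof -
    have "\<beta> j \<in> (\<lambda>i. h i j) ` A j" unfolding \<beta>_def by (intro Max_in) (use fin zero in auto)
    then obtain i where i: "i \<in> A j" "\<beta> j = h i j" by blast
    have "h i (Suc j) \<le> \<beta> (Suc j)"
      unfolding \<beta>_def by (rule Max_ge) (use fin i in \<open>auto simp: A_def\<close>)
    then show ?thesis using i(2) by (simp add: h_def)
  qed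
  moreover have "\<exists>Q\<ge>q. \<forall>j. Q \<le> j \<and> j \<le> 4 * Q \<longrightarrow> \<beta> j = 0" for q
  proof (intro exI[of _ "a q + q"] conjI allI impI)
    fix j assume j: "a q + q \<le> j \<and> j \<le> 4 * (a q + q)"
    have "h i j = 0" if "i \<in> A j" for i
    proof -
      have "i \<le> q" by (rule A_le[OF that]) (use j gap[of q] in simp)
      then show ?thesis using mono[of i q] j by (simp add: h_def)
    qed
    then have "(\<lambda>i. h i j) ` A j = {0}" using zero by auto
    then show "\<beta> j = 0" by (simp add: \<beta>_def)
  qed simp
  moreover have "\<exists>j\<ge>m. \<beta> j = k \<and> lab j = l" for k l m
  proof -
    \<comment> \<open>The number of the ramp encodes the label \<open>l\<close>. Since it is at
      least \<open>max m k\<close>, the ramp starts late enough and passes through height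
      \<open>k\<close>, namely at index \<open>a i + (i - k)\<close>.\<close>
    define i where "i = prod_encode (l, max m k)"
    have i: "i \<ge> m" "i \<ge> k" using le_prod_encode_2[of "max m k" l] by (auto simp: i_def)
    define j where "j = a i + (i - k)"
    have j: "a i \<le> j" "j < a (Suc i)" using gap[of i] by (auto simp: j_def)
    have iA: "i \<in> A j" using j by (simp add: A_def)
    have "Max (A j) = i" by (rule Max_eqI[OF fin _ iA]) (use A_le j(2) in blast)
    then have "lab j = l" by (simp add: lab_def i_def)
    moreover have "\<beta> j = k"
      unfolding \<beta>_def
    proof (rule Max_eqI)
      have "h i j = k" using i by (simp add: h_def j_def)
      then show "k \<in> (\<lambda>i. h i j) ` A j" using iA by (auto intro!: image_eqI[of _ _ i])
      fix y assume "y \<in> (\<lambda>i. h i j) ` A j"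
      then obtain i' where i': "i' \<in> A j" "y = h i' j" by blast
      have "i' \<le> i" by (rule A_le[OF i'(1) j(2)])
      show "y \<le> k"
      proof (cases "i' = i")
        case False
        then have "Suc i' \<le> i" using \<open>i' \<le> i\<close> by simp
        then have "a i' + i' \<le> a i" using gap[of i'] mono[of "Suc i'" i] by simp
        then show ?thesis using i'(2) j(1) by (simp add: h_def)
      qed (use i' \<open>h i j = k\<close> in simp)
    qed (use fin in simp)
    moreover have "j \<ge> m" using i ge[of i] by (simp add: j_def)
    ultimately show ?thesis by blast
  qed
  ultimately show ?thesis by (intro exI[of _ \<beta>] exI[of _ lab]) blast
qed

context Banach_chain
begin

text \<open>A subsequence of steps is cofinal, so it yields the same space and the same seminorms;
  this allows restarting or thinning out the chain.\<close>

lemma subchain: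
  assumes r: "strict_mono r"
  shows "(\<Union>n. V (r n)) = U" "bounded_seminorms s (\<lambda>n. V (r n)) (\<lambda>n. N (r n)) = P"
    "Banach_chain s (\<lambda>n. V (r n)) (\<lambda>n. N (r n))"
proof -
  have le: "n \<le> r n" for n by (rule strict_mono_imp_increasing[OF r])
  have sub: "V n \<subseteq> V (r n)" for n by (rule V_mono[OF le])
  show U: "(\<Union>n. V (r n)) = U" using sub by blast
  have bounded: "(\<forall>n. \<exists>C. \<forall>x\<in>V n. p x \<le> C * N n x) \<longleftrightarrow> (\<forall>n. \<exists>C. \<forall>x\<in>V (r n). p x \<le> C * N (r n) x)"
    if p: "seminorm_on s U p" for p
  proof
    assume b: "\<forall>n. \<exists>C. \<forall>x\<in>V (r n). p x \<le> C * N (r n) x"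
    show "\<forall>n. \<exists>C. \<forall>x\<in>V n. p x \<le> C * N n x"
    proof
      fix n
      obtain C where C: "\<forall>x\<in>V (r n). p x \<le> C * N (r n) x" using b by blast
      obtain D where D: "D > 0" "\<And>x. x \<in> V n \<Longrightarrow> N (r n) x \<le> D * N n x" using N_mono[OF le] by metis
      have "p x \<le> \<bar>C\<bar> * D * N n x" if x: "x \<in> V n" for x
      proof -
        have xr: "x \<in> V (r n)" using sub x by blast
        have "p x \<le> C * N (r n) x" using C xr by blast
        also have "\<dots> \<le> \<bar>C\<bar> * N (r n) x" using N_nonneg[OF xr] by (intro mult_right_mono) auto
        also have "\<dots> \<le> \<bar>C\<bar> * (D * N n x)" by (intro mult_left_mono D x) simp
        finally show ?thesis by (simp add: mult.assoc)
      qed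
      then show "\<exists>C. \<forall>x\<in>V n. p x \<le> C * N n x" by blast
    qed
  qed blast
  show P: "bounded_seminorms s (\<lambda>n. V (r n)) (\<lambda>n. N (r n)) = P"
    unfolding bounded_seminorms_def U by (intro Collect_cong conj_cong refl) (simp add: bounded)
  show "Banach_chain s (\<lambda>n. V (r n)) (\<lambda>n. N (r n))"
  proof unfold_locales
    fix n
    have r_Suc: "r n \<le> r (Suc n)" using r by (simp add: strict_mono_less_eq)
    show "subspace (V (r n))" by (rule subspace_V)
    show "V (r n) \<subseteq> V (r (Suc n))" by (rule V_mono[OF r_Suc])
    show "seminorm_on s (V (r n)) (N (r n))" by (rule seminorm_N)
    show "x = 0" if "x \<in> V (r n)" "N (r n) x = 0" for x by (rule N_definite[OF that])
    show "norm_complete (V (r n)) (N (r n))" by (rule N_complete)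
    show "norm_separable (V (r n)) (N (r n))" by (rule N_separable)
    show "V (r n) \<noteq> {0}" by (rule V_nonzero)
    show "\<exists>C. \<forall>x\<in>V (r n). N (r (Suc n)) x \<le> C * N (r n) x"
      by (rule N_mono[OF r_Suc]) blast
  next
    fix x assume "x \<in> (\<Union>n. V (r n))" "x \<noteq> 0"
    then show "\<exists>p\<in>bounded_seminorms s (\<lambda>n. V (r n)) (\<lambda>n. N (r n)). p x > 0"
      unfolding U P by (rule P_separates)
  qed
qed

lemma operators_subchain:
  assumes "strict_mono r"
  shows "seminorm_space.operators s (\<Union>n. V (r n)) (bounded_seminorms s (\<lambda>n. V (r n)) (\<lambda>n. N (r n))) = operators"
  by (simp only: subchain(1,2)[OF assms])

text \<open>With the chain restarted at the dense step, the constant \<open>\<beta> = 0\<close> is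
  admissible. That step is infinite-dimensional: a finite set has a closed span, which would contain
  the closure of the step and so be all of \<open>U\<close>.\<close>

lemma hypercyclic_if_dense_step:
  assumes inf: "\<And>B. finite B \<Longrightarrow> \<not> U \<subseteq> span B" and dense: "X closure_of (V m) = U"
  shows "\<exists>T\<in>operators. hypercyclic X T"
proof -
  define r where "r = (\<lambda>n. m + n)"
  have r: "strict_mono r" by (simp add: r_def strict_mono_def)
  interpret C: Banach_chain s "\<lambda>n. V (r n)" "\<lambda>n. N (r n)" by (rule subchain(3)[OF r])
  note eq = subchain(1,2)[OF r]
  have "block_chain s (\<lambda>n. V (r n)) (\<lambda>n. N (r n)) (\<lambda>_. 0) (\<lambda>j. fst (prod_decode j))"
  proof unfold_locales
    fix m l :: nat
    have "prod_encode (l, m) \<ge> m" by (rule le_prod_encode_2)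
    then show "\<exists>j\<ge>m. (0::nat) = 0 \<and> fst (prod_decode j) = l" by (intro exI[of _ "prod_encode (l, m)"]) simp
  next
    fix B :: "'a set"
    assume "finite B" "B \<subseteq> C.U"
    then have B: "finite B" "B \<subseteq> U" by (simp_all add: eq)
    show "\<not> V (r 0) \<subseteq> span (C.below 0 \<union> B)"
    proof
      assume "V (r 0) \<subseteq> span (C.below 0 \<union> B)"
      moreover have "C.below 0 = {0}" by (simp add: C.below_def)
      ultimately have "V m \<subseteq> span B" by (simp add: r_def span_insert_0)
      then have "X closure_of (V m) \<subseteq> X closure_of (span B)" by (rule closure_of_mono)
      then have "U \<subseteq> span B" using closed_finite_span[OF Hausdorff B] dense by simp
      then show False using inf B by blast
    qed
  next
    show "C.X closure_of (\<Union>j::nat. V (r 0)) = C.U" unfolding eq using dense by (simp add: r_def)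
  qed auto
  from block_chain.exists_hypercyclic[OF this] show ?thesis
    unfolding operators_subchain[OF r] eq .
qed

lemma hypercyclic_if_infinite_steps:
  assumes inf: "\<And>n. \<exists>m. \<forall>B. finite B \<longrightarrow> B \<subseteq> U \<longrightarrow> \<not> V m \<subseteq> span (X closure_of (V n) \<union> B)"
  shows "\<exists>T\<in>operators. hypercyclic X T"
proof -
  let ?J = "\<lambda>n m. \<forall>B. finite B \<longrightarrow> B \<subseteq> U \<longrightarrow> \<not> V m \<subseteq> span (X closure_of (V n) \<union> B)"
  have VU: "V n \<subseteq> U" for n by blast
  have less: "n < m" if "?J n m" for n m
  proof (rule ccontr)
    assume "\<not> n < m"
    then have "V m \<subseteq> V n" by (intro V_mono) simp
    also have "V n \<subseteq> X closure_of (V n)" by (rule closure_of_subset) auto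
    also have "\<dots> \<subseteq> span (X closure_of (V n) \<union> {})" by (simp add: span_superset)
    finally show False using that[rule_format, of "{}"] by simp
  qed
  obtain m0 where m0: "?J 0 m0" using inf[of 0] by (elim exE)
  \<comment> \<open>The first conjunct provides the infinite dimension of \<open>V (r 0)\<close>,
    which has no preceding step to be compared with.\<close>
  have "\<exists>r. \<forall>k. (\<exists>n. ?J n (r k)) \<and> ?J (r k) (r (Suc k))"
  proof (rule dependent_nat_choice)
    show "\<exists>m. \<exists>n. ?J n m" using m0 by (intro exI)
    show "\<exists>m'. (\<exists>n. ?J n m') \<and> ?J m m'" for m
    proof -
      obtain m' where "?J m m'" using inf[of m] by (elim exE)
      then show ?thesis by (intro exI[of _ m'] conjI exI[of _ m])
    qed
  qed
  then obtain r where "\<forall>k. (\<exists>n. ?J n (r k)) \<and> ?J (r k) (r (Suc k))" by (elim exE)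
  then have r: "\<exists>n. ?J n (r k)" "?J (r k) (r (Suc k))" for k by simp_all
  have mono: "strict_mono r" unfolding strict_mono_Suc_iff by (intro allI less r(2))
  interpret C: Banach_chain s "\<lambda>n. V (r n)" "\<lambda>n. N (r n)" by (rule subchain(3)[OF mono])
  note eq = subchain(1,2)[OF mono]
  obtain \<beta> lab :: "nat \<Rightarrow> nat" where \<beta>: "\<And>j. \<beta> j \<le> Suc (\<beta> (Suc j))"
    "\<And>q. \<exists>Q\<ge>q. \<forall>j. Q \<le> j \<and> j \<le> 4 * Q \<longrightarrow> \<beta> j = 0"
    "\<And>k l m. \<exists>j\<ge>m. \<beta> j = k \<and> lab j = l" using ramp_function by blast
  have "block_chain s (\<lambda>n. V (r n)) (\<lambda>n. N (r n)) \<beta> lab"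
  proof unfold_locales
    fix B :: "'a set" and j
    assume "finite B" "B \<subseteq> C.U"
    then have B: "finite B" "B \<subseteq> U" by (simp_all add: eq)
    show "\<not> V (r (\<beta> j)) \<subseteq> span (C.below (\<beta> j) \<union> B)"
    proof (cases "\<beta> j")
      case 0
      obtain n where n: "?J n (r 0)" using r(1)[of 0] by (elim exE)
      have "span (C.below 0 \<union> B) \<subseteq> span (X closure_of (V n) \<union> B)"
        by (simp add: C.below_def span_insert_0 span_mono)
      moreover have "\<not> V (r 0) \<subseteq> span (X closure_of (V n) \<union> B)" using n B by simp
      ultimately show ?thesis unfolding 0 by blast
    next
      case (Suc k)
      then show ?thesis using r(2)[of k] B by (simp add: C.below_def eq)
    qed
  next
    have "(\<Union>j. V (r (\<beta> j))) = (\<Union>n. V (r n))"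
    proof
      show "(\<Union>n. V (r n)) \<subseteq> (\<Union>j. V (r (\<beta> j)))"
      proof
        fix x assume "x \<in> (\<Union>n. V (r n))"
        then obtain n where n: "x \<in> V (r n)" by blast
        obtain j where "\<beta> j = n" using \<beta>(3) by blast
        then show "x \<in> (\<Union>j. V (r (\<beta> j)))" using n by auto
      qed
    qed blast
    then show "C.X closure_of (\<Union>j. V (r (\<beta> j))) = C.U"
      using closure_of_topspace[of C.X] by simp
  qed (use \<beta> in blast)+
  from block_chain.exists_hypercyclic[OF this] show ?thesis
    unfolding operators_subchain[OF mono] eq .
qed

end

section \<open>Splitting off a copy of \<open>\<phi>\<close>\<close>

lemma (in scalar_space) normed_by_subtopology:
  assumes V: "subspace V" and N: "seminorm_on s V N" and X: "normed_by V N X"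
  shows "normed_by (V \<inter> L) N (subtopology X L)"
proof -
  have top: "topspace X = V"
    and op: "\<And>W. openin X W \<longleftrightarrow> W \<subseteq> V \<and> (\<forall>x\<in>W. \<exists>e>0. \<forall>y\<in>V. N (y - x) < e \<longrightarrow> y \<in> W)"
    using X by (simp_all add: normed_by_def)
  have "openin (subtopology X L) W \<longleftrightarrow>
      W \<subseteq> V \<inter> L \<and> (\<forall>x\<in>W. \<exists>e>0. \<forall>y\<in>V \<inter> L. N (y - x) < e \<longrightarrow> y \<in> W)" (is "_ \<longleftrightarrow> ?r") for W
  proof
    assume "openin (subtopology X L) W"
    then obtain T where T: "openin X T" "W = T \<inter> L" by (auto simp: openin_subtopology)
    have TV: "T \<subseteq> V" and Te: "\<And>x. x \<in> T \<Longrightarrow> \<exists>e>0. \<forall>y\<in>V. N (y - x) < e \<longrightarrow> y \<in> T"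
      using T(1) unfolding op by blast+
    have "\<exists>e>0. \<forall>y\<in>V \<inter> L. N (y - x) < e \<longrightarrow> y \<in> W" if "x \<in> W" for x
    proof -
      have "x \<in> T" using that T(2) by blast
      from Te[OF this] obtain e where "e > 0" "\<forall>y\<in>V. N (y - x) < e \<longrightarrow> y \<in> T" by (elim exE conjE)
      then show ?thesis using T(2) by (intro exI[of _ e]) simp
    qed
    then show ?r using TV T(2) by blast
  next
    assume W: ?r
    define T where "T = {y \<in> V. \<exists>w\<in>W. \<exists>e>0. N (y - w) < e \<and> (\<forall>z\<in>V \<inter> L. N (z - w) < e \<longrightarrow> z \<in> W)}"
    have "openin X T"
      unfolding op
    proof (intro conjI ballI)
      fix x assume "x \<in> T"
      then obtain w e where x: "x \<in> V" and w: "w \<in> W" "e > 0" "N (x - w) < e"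
        "\<forall>z\<in>V \<inter> L. N (z - w) < e \<longrightarrow> z \<in> W" unfolding T_def by blast
      have wV: "w \<in> V" using w(1) W by blast
      have "y \<in> T" if y: "y \<in> V" "N (y - x) < e - N (x - w)" for y
      proof -
        have "N ((y - x) + (x - w)) \<le> N (y - x) + N (x - w)"
          by (intro seminorm_onD(1)[OF V N] subspace_diff[OF V] x y wV)
        then have "N (y - w) < e" using y(2) by simp
        then show ?thesis unfolding T_def using y(1) w by blast
      qed
      then show "\<exists>d>0. \<forall>y\<in>V. N (y - x) < d \<longrightarrow> y \<in> T"
        using w(3) by (intro exI[of _ "e - N (x - w)"]) simp
    qed (auto simp: T_def)
    moreover have "W = T \<inter> L"
    proof
      show "T \<inter> L \<subseteq> W" unfolding T_def by blast
      show "W \<subseteq> T \<inter> L"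
      proof
        fix x assume x: "x \<in> W"
        then have "\<exists>e>0. \<forall>y\<in>V \<inter> L. N (y - x) < e \<longrightarrow> y \<in> W" using W by blast
        then obtain e where e: "e > 0" "\<forall>y\<in>V \<inter> L. N (y - x) < e \<longrightarrow> y \<in> W" by (elim exE conjE)
        have "N (x - x) < e" using seminorm_onD(3)[OF V N] e(1) by simp
        then have "x \<in> T"
          unfolding T_def mem_Collect_eq using x W e by (intro conjI bexI[of _ x] exI[of _ e]) auto
        then show "x \<in> T \<inter> L" using x W by blast
      qed
    qed
    ultimately show "openin (subtopology X L) W" by (auto simp: openin_subtopology)
  qed
  then show ?thesis using top by (simp add: normed_by_def)
qed

section \<open>A complement to the closure of the first step\<close>

context Banach_chain
begin

abbreviation "L \<equiv> X closure_of (V 0)"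

lemma L_facts: "subspace L" "L \<subseteq> U" "X closure_of L = L" "V 0 \<subseteq> L"
proof -
  have VU: "V 0 \<subseteq> U" by blast
  show "subspace L" by (rule subspace_closure[OF subspace_V VU])
  show "L \<subseteq> U" using closure_of_subset_topspace[of X] by simp
  show "V 0 \<subseteq> L" by (rule closure_of_subset) auto
qed simp

definition stage :: "(nat \<Rightarrow> 'a) \<Rightarrow> nat \<Rightarrow> 'a set" where
  "stage e k = span (L \<union> e ` {..<k})"

text \<open>\<open>m\<close> is the first step not contained in the current stage. Taking vectors
  from the earliest such step uses up each step before a later one is touched, and makes the steps
  nondecreasing, so that earlier \<open>e i\<close> stay available inside
  \<open>V m\<close>.\<close>

definition good_complement ::
  "(nat \<Rightarrow> 'a) \<Rightarrow> (nat \<Rightarrow> 'a \<Rightarrow> 'k) \<Rightarrow> nat \<Rightarrow> 'a \<Rightarrow> ('a \<Rightarrow> 'k) \<Rightarrow> nat \<Rightarrow> bool" where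
  "good_complement e g k b h m \<longleftrightarrow>
     b \<in> V m \<and> \<not> V m \<subseteq> stage e k \<and> (\<forall>m'<m. V m' \<subseteq> stage e k) \<and>
     h \<in> dual \<and> h b = 1 \<and> (\<forall>x\<in>L. h x = 0) \<and> (\<forall>i<k. h (e i) = 0 \<and> g i b = 0)"

lemma stage_mono: "i \<le> k \<Longrightarrow> stage e i \<subseteq> stage e k"
  unfolding stage_def by (rule span_mono) auto

lemma good_complement_step:
  assumes nd: "\<And>m. X closure_of (V m) \<noteq> U"
    and prev: "\<And>i. i < k \<Longrightarrow> good_complement e g i (e i) (g i) (\<mu> i)"
  shows "\<exists>b h m. good_complement e g k b h m"
proof -
  have e: "e i \<in> V (\<mu> i)" and gd: "g i \<in> dual" and ge: "g i (e i) = 1"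
    and min: "m' < \<mu> i \<Longrightarrow> V m' \<subseteq> stage e i" if "i < k" for i m'
    using prev[OF that] by (simp_all add: good_complement_def)
  have biorth: "g i (e l) = (if i = l then 1 else 0)" if il: "i < k" "l < k" for i l
  proof (rule linorder_cases[of i l])
    assume "i < l"
    then show ?thesis using prev[OF il(2)] by (simp add: good_complement_def)
  next
    assume "l < i"
    then show ?thesis using prev[OF il(1)] by (simp add: good_complement_def)
  qed (use ge il in simp)
  have eU: "e i \<in> U" if "i < k" for i by (rule V_U[OF e[OF that]])
  have Q: "subspace (stage e k)" "stage e k \<subseteq> U" "X closure_of (stage e k) = stage e k"
  proof -
    show "subspace (stage e k)" by (simp add: stage_def)
    show "stage e k \<subseteq> U" unfolding stage_def by (rule span_minimal[OF _ subspace_U]) (use L_facts eU in auto)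
    show "X closure_of (stage e k) = stage e k"
      unfolding stage_def by (rule closed_span_Un_finite[OF L_facts(1-3)]) (use eU in auto)
  qed
  \<comment> \<open>A stage is contained in the closure of a single step, so it cannot be everything
    when no step is dense.\<close>
  have "\<exists>m. \<not> V m \<subseteq> stage e k"
  proof (rule ccontr)
    assume "\<not> ?thesis"
    then have US: "U \<subseteq> stage e k" by blast
    define M where "M = Max (insert 0 (\<mu> ` {..<k}))"
    have VM: "V M \<subseteq> U" by blast
    have "e i \<in> X closure_of (V M)" if i: "i < k" for i
    proof -
      have "\<mu> i \<le> M" unfolding M_def by (rule Max_ge) (use i in auto)
      then have "e i \<in> V M" using e[OF i] V_mono by blast
      moreover have "V M \<subseteq> X closure_of (V M)" by (rule closure_of_subset) auto
      ultimately show ?thesis by blast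
    qed
    moreover have "L \<subseteq> X closure_of (V M)" by (rule closure_of_mono[OF V_mono]) simp
    ultimately have "L \<union> e ` {..<k} \<subseteq> X closure_of (V M)" by auto
    then have "stage e k \<subseteq> X closure_of (V M)"
      unfolding stage_def by (rule span_minimal[OF _ subspace_closure[OF subspace_V VM]])
    moreover have "X closure_of (V M) \<subseteq> U" using closure_of_subset_topspace[of X] by simp
    ultimately show False using US nd[of M] by blast
  qed
  then obtain m where m: "\<not> V m \<subseteq> stage e k" "\<And>m'. m' < m \<Longrightarrow> V m' \<subseteq> stage e k"
    using exists_least_iff[of "\<lambda>m. \<not> V m \<subseteq> stage e k"] by blast
  have \<mu>m: "\<mu> i \<le> m" if i: "i < k" for i
  proof (rule ccontr)
    assume "\<not> \<mu> i \<le> m"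
    then have "V m \<subseteq> stage e i" using min[OF i] by simp
    also have "\<dots> \<subseteq> stage e k" by (rule stage_mono) (use i in simp)
    finally show False using m(1) by simp
  qed
  have eV: "e i \<in> V m" if i: "i < k" for i using e[OF i] V_mono[OF \<mu>m[OF i]] by blast
  obtain x where x: "x \<in> V m" "x \<notin> stage e k" using m(1) by blast
  define b where "b = x - (\<Sum>i<k. s (g i x) (e i))"
  have sumV: "(\<Sum>i<k. s (g i x) (e i)) \<in> V m" by (intro V_sum V_scale eV) simp
  have b: "b \<in> V m" unfolding b_def by (rule V_diff[OF x(1) sumV])
  have "(\<Sum>i<k. s (g i x) (e i)) \<in> stage e k"
    unfolding stage_def by (intro span_sum span_scale span_base) auto
  then have "b + (\<Sum>i<k. s (g i x) (e i)) \<in> stage e k" if "b \<in> stage e k" using subspace_add[OF Q(1) that] by blast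
  then have "b \<notin> stage e k" using x(2) by (auto simp: b_def)
  then have "b \<notin> X closure_of (stage e k)" using Q(3) by simp
  from separating_functional[OF Q(1,2) V_U[OF b] this]
  obtain h where h: "h \<in> dual" "\<forall>x\<in>stage e k. h x = 0" "h b = 1" by (elim bexE conjE)
  have gb: "g l b = 0" if l: "l < k" for l
  proof -
    have "g l (\<Sum>i<k. s (g i x) (e i)) = (\<Sum>i<k. g l (s (g i x) (e i)))"
      by (rule dualD(8)[OF gd[OF l]]) (use eU U_scale in auto)
    also have "\<dots> = (\<Sum>i<k. if i = l then g i x else 0)"
      by (intro sum.cong refl) (use dualD(4)[OF gd[OF l]] eU biorth l in auto)
    finally have "g l (\<Sum>i<k. s (g i x) (e i)) = g l x" using l by simp
    then show ?thesis unfolding b_def using dualD(7)[OF gd[OF l] V_U[OF x(1)] V_U[OF sumV]] by simp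
  qed
  have "L \<union> e ` {..<k} \<subseteq> stage e k" unfolding stage_def by (rule span_superset)
  then have "h x = 0" if "x \<in> L \<union> e ` {..<k}" for x using h(2) that by blast
  then have "good_complement e g k b h m"
    unfolding good_complement_def using b m h gb by simp
  then show ?thesis by blast
qed

lemma complement_system:
  assumes nd: "\<And>m. X closure_of (V m) \<noteq> U"
  shows "\<exists>e g \<mu>. \<forall>k. good_complement e g k (e k) (g k) (\<mu> k)"
proof -
  let ?R = "\<lambda>(r :: nat \<Rightarrow> 'a \<times> ('a \<Rightarrow> 'k) \<times> nat) k (b, h, m).
    good_complement (\<lambda>i. fst (r i)) (\<lambda>i. fst (snd (r i))) k b h m"
  have "\<exists>r. \<forall>k. ?R r k (r k)"
  proof (rule dependent_wellorder_choice)
    fix z :: "'a \<times> ('a \<Rightarrow> 'k) \<times> nat" and r r' :: "nat \<Rightarrow> 'a \<times> ('a \<Rightarrow> 'k) \<times> nat" and k :: nat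
    assume eq: "\<And>i. i < k \<Longrightarrow> r i = r' i"
    have "stage (\<lambda>i. fst (r i)) k = stage (\<lambda>i. fst (r' i)) k"
      unfolding stage_def by (intro arg_cong[where f=span] arg_cong2[where f="(\<union>)"] image_cong refl) (simp add: eq)
    then show "?R r k z = ?R r' k z" by (cases z) (simp add: good_complement_def eq)
  next
    fix k :: nat and r :: "nat \<Rightarrow> 'a \<times> ('a \<Rightarrow> 'k) \<times> nat"
    assume "\<And>i. i < k \<Longrightarrow> ?R r i (r i)"
    then have "\<exists>b h m. good_complement (\<lambda>i. fst (r i)) (\<lambda>i. fst (snd (r i))) k b h m"
      by (intro good_complement_step[where \<mu>="\<lambda>i. snd (snd (r i))"] nd) (simp add: case_prod_beta)
    then show "\<exists>z. ?R r k z" by auto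
  qed
  then obtain r where "\<forall>k. ?R r k (r k)" by (elim exE)
  then show ?thesis
    by (intro exI[of _ "\<lambda>i. fst (r i)"] exI[of _ "\<lambda>i. fst (snd (r i))"] exI[of _ "\<lambda>i. snd (snd (r i))"])
       (simp add: case_prod_beta)
qed

end

text \<open>The space is the closure \<open>L\<close> of \<open>V 0\<close> plus the span of the vectors \<open>e k\<close>, whose coordinate
  functionals \<open>g k\<close> are continuous; only finitely many of them are nonzero on each \<open>V m\<close>.\<close>

locale splitting_system = Banach_chain s V N
  for s :: "'k::real_or_complex \<Rightarrow> 'a::ab_group_add \<Rightarrow> 'a" and V N +
  fixes e :: "nat \<Rightarrow> 'a" and g :: "nat \<Rightarrow> 'a \<Rightarrow> 'k" and \<mu> :: "nat \<Rightarrow> nat"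
  assumes complement: "good_complement e g k (e k) (g k) (\<mu> k)"
    and finite_codimension: "\<exists>B. finite B \<and> V m \<subseteq> span (L \<union> B)"
begin

lemma e_V: "e k \<in> V (\<mu> k)" and e_U: "e k \<in> U" and g_dual: "g k \<in> dual"
  and g_L: "x \<in> L \<Longrightarrow> g k x = 0"
  and \<mu>_stage: "\<not> V (\<mu> k) \<subseteq> stage e k" "m' < \<mu> k \<Longrightarrow> V m' \<subseteq> stage e k"
  using complement[of k] by (auto simp: good_complement_def)

lemma biorthogonal: "g i (e j) = (if i = j then 1 else 0)"
  using complement[of i] complement[of j] by (cases i j rule: linorder_cases) (auto simp: good_complement_def)

text \<open>Otherwise all \<open>e k\<close> lie in \<open>V m\<close>, and modulo \<open>L\<close>
  they are represented by vectors \<open>v k\<close> in the span of a finite set. The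
  \<open>g i\<close> vanish on \<open>L\<close>, so they are still biorthogonal to the
  \<open>v k\<close>, and these are infinitely many independent vectors.\<close>

lemma V_stage: "\<exists>K. V m \<subseteq> stage e K"
proof (rule ccontr)
  assume "\<not> ?thesis"
  then have no: "\<not> V m \<subseteq> stage e k" for k by blast
  have eV: "e k \<in> V m" for k
  proof -
    have "\<mu> k \<le> m" using \<mu>_stage(2)[of m k] no[of k] by (meson not_le)
    then show ?thesis using e_V[of k] V_mono by blast
  qed
  obtain B where B: "finite B" "V m \<subseteq> span (L \<union> B)" using finite_codimension by blast
  have "\<exists>v. v \<in> span B \<and> e k - v \<in> L" for k
  proof -
    have "e k \<in> span (L \<union> B)" using eV B(2) by blast
    then obtain l v where "e k = l + v" "l \<in> span L" "v \<in> span B" unfolding span_Un by blast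
    then show ?thesis using L_facts(1) by (intro exI[of _ v]) (simp add: span_eq_iff[THEN iffD2])
  qed
  then obtain v where v: "\<And>k. v k \<in> span B" "\<And>k. e k - v k \<in> L" by metis
  have gv: "g i (v k) = (if i = k then 1 else 0)" and vU: "v k \<in> U" for i k
  proof -
    have lU: "e k - v k \<in> U" using v(2) L_facts(2) by blast
    have eq: "v k = e k - (e k - v k)" by simp
    show "v k \<in> U" by (subst eq) (rule U_diff[OF e_U lU])
    show "g i (v k) = (if i = k then 1 else 0)"
      by (subst eq) (simp only: dualD(7)[OF g_dual e_U lU] g_L[OF v(2)] biorthogonal diff_zero)
  qed
  have inj: "inj v"
  proof
    fix i k assume "v i = v k"
    then show "i = k" using gv[of i i] gv[of i k] by (auto split: if_splits)
  qed
  have "independent (range v)"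
    unfolding independent_explicit_module
  proof (intro allI impI)
    fix S u w assume S: "finite S" "S \<subseteq> range v" "(\<Sum>v\<in>S. s (u v) v) = 0" "w \<in> S"
    obtain i where i: "w = v i" using S by blast
    have SU: "x \<in> U" if "x \<in> S" for x using that S(2) vU by blast
    have "g i (\<Sum>x\<in>S. s (u x) x) = (\<Sum>x\<in>S. g i (s (u x) x))"
      by (rule dualD(8)[OF g_dual]) (intro U_scale SU)
    also have "\<dots> = (\<Sum>x\<in>S. if x = w then u x else 0)"
    proof (rule sum.cong[OF refl])
      fix x assume x: "x \<in> S"
      then obtain k where k: "x = v k" using S(2) by blast
      have "x = w \<longleftrightarrow> i = k" using k i inj by (auto simp: inj_eq)
      then show "g i (s (u x) x) = (if x = w then u x else 0)"
        using dualD(4)[OF g_dual SU[OF x]] gv[of i k] k by simp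
    qed
    also have "\<dots> = u w" using S by simp
    finally show "u w = 0" using S(3) dualD(5)[OF g_dual] by simp
  qed
  then have "finite (range v)" using independent_span_bound[OF B(1)] v(1) by blast
  then show False using inj by (simp add: finite_image_iff)
qed

lemma stage_decomposition:
  assumes "x \<in> stage e K"
  shows "x - (\<Sum>i<K. s (g i x) (e i)) \<in> L" "K \<le> k \<Longrightarrow> g k x = 0"
proof -
  have "x \<in> U \<and> x - (\<Sum>i<K. s (g i x) (e i)) \<in> L \<and> (\<forall>k\<ge>K. g k x = 0)"
    using assms unfolding stage_def
  proof (induction rule: span_induct)
    case base
    show ?case
    proof (rule subspaceI)
      show "0 \<in> {x. x \<in> U \<and> x - (\<Sum>i<K. s (g i x) (e i)) \<in> L \<and> (\<forall>k\<ge>K. g k x = 0)}"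
        using U_zero dualD(5)[OF g_dual] subspace_0[OF L_facts(1)] by simp
    next
      fix x y
      assume x: "x \<in> {x. x \<in> U \<and> x - (\<Sum>i<K. s (g i x) (e i)) \<in> L \<and> (\<forall>k\<ge>K. g k x = 0)}"
        and y: "y \<in> {x. x \<in> U \<and> x - (\<Sum>i<K. s (g i x) (e i)) \<in> L \<and> (\<forall>k\<ge>K. g k x = 0)}"
      have g: "g i (x + y) = g i x + g i y" for i using dualD(3)[OF g_dual] x y by simp
      have "x + y - (\<Sum>i<K. s (g i (x + y)) (e i)) =
          (x - (\<Sum>i<K. s (g i x) (e i))) + (y - (\<Sum>i<K. s (g i y) (e i)))"
        by (simp add: g scale_left_distrib sum.distrib)
      also have "\<dots> \<in> L" using x y by (intro subspace_add[OF L_facts(1)]) auto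
      finally show "x + y \<in> {x. x \<in> U \<and> x - (\<Sum>i<K. s (g i x) (e i)) \<in> L \<and> (\<forall>k\<ge>K. g k x = 0)}"
        using x y U_add g by simp
    next
      fix c x
      assume x: "x \<in> {x. x \<in> U \<and> x - (\<Sum>i<K. s (g i x) (e i)) \<in> L \<and> (\<forall>k\<ge>K. g k x = 0)}"
      have g: "g i (s c x) = c * g i x" for i using dualD(4)[OF g_dual] x by simp
      have "s c x - (\<Sum>i<K. s (g i (s c x)) (e i)) = s c (x - (\<Sum>i<K. s (g i x) (e i)))"
        by (simp add: g scale_right_diff_distrib scale_sum_right)
      also have "\<dots> \<in> L" using x by (intro subspace_scale[OF L_facts(1)]) auto
      finally show "s c x \<in> {x. x \<in> U \<and> x - (\<Sum>i<K. s (g i x) (e i)) \<in> L \<and> (\<forall>k\<ge>K. g k x = 0)}"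
        using x U_scale g by simp
    qed
  next
    case (step x)
    show ?case
    proof (cases "x \<in> L")
      case True
      then show ?thesis using L_facts(2) g_L[OF True] by auto
    next
      case False
      then obtain j where j: "j < K" "x = e j" using step by blast
      have "(\<Sum>i<K. s (g i x) (e i)) = (\<Sum>i<K. if i = j then e i else 0)"
        by (intro sum.cong refl) (simp add: j biorthogonal)
      also have "\<dots> = x" using j by simp
      finally have sum_eq: "(\<Sum>i<K. s (g i x) (e i)) = x" .
      have "x - (\<Sum>i<K. s (g i x) (e i)) \<in> L" unfolding sum_eq using subspace_0[OF L_facts(1)] by simp
      moreover have "x \<in> U" "\<forall>k\<ge>K. g k x = 0" using j e_U by (auto simp: biorthogonal)
      ultimately show ?thesis by blast
    qed
  qed
  then show "x - (\<Sum>i<K. s (g i x) (e i)) \<in> L" "K \<le> k \<Longrightarrow> g k x = 0" by blast+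
qed

definition coords :: "'a \<Rightarrow> nat \<Rightarrow> 'k" where
  "coords x = (\<lambda>i. g i x)"

definition embed :: "(nat \<Rightarrow> 'k) \<Rightarrow> 'a" where
  "embed c = (\<Sum>i | c i \<noteq> 0. s (c i) (e i))"

definition proj :: "'a \<Rightarrow> 'a" where
  "proj x = x - embed (coords x)"

lemma embed_eq: "(\<And>k. k \<ge> K \<Longrightarrow> c k = 0) \<Longrightarrow> embed c = (\<Sum>i<K. s (c i) (e i))"
  unfolding embed_def by (rule sum.mono_neutral_left) (auto simp: not_le[symmetric])

lemma finitely_supported_bound:
  assumes "c \<in> finitely_supported"
  obtains K where "\<And>k. k \<ge> K \<Longrightarrow> c k = (0::'k)"
proof -
  have "finite {i. c i \<noteq> 0}" using assms by (simp add: finitely_supported_def)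
  then obtain K where "\<forall>i\<in>{i. c i \<noteq> 0}. i < K" unfolding finite_nat_set_iff_bounded by blast
  then show ?thesis by (intro that[of K]) (auto simp: not_le[symmetric])
qed

lemma finitely_supportedI: "(\<And>k. k \<ge> K \<Longrightarrow> c k = 0) \<Longrightarrow> c \<in> finitely_supported"
  unfolding finitely_supported_def finite_nat_set_iff_bounded by (auto simp: not_le[symmetric])

lemma proj_on_V:
  obtains K where "\<And>x. x \<in> V m \<Longrightarrow> proj x = x - (\<Sum>i<K. s (g i x) (e i))"
    "\<And>x. x \<in> V m \<Longrightarrow> proj x \<in> L" "\<And>x k. x \<in> V m \<Longrightarrow> K \<le> k \<Longrightarrow> g k x = 0"
proof -
  obtain K where K: "V m \<subseteq> stage e K" using V_stage by blast
  have g0: "g k x = 0" if "x \<in> V m" "K \<le> k" for x k using stage_decomposition(2) K that by blast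
  have eq: "proj x = x - (\<Sum>i<K. s (g i x) (e i))" if "x \<in> V m" for x
    unfolding proj_def using embed_eq[of K "coords x"] g0[OF that] by (simp add: coords_def)
  have "proj x \<in> L" if "x \<in> V m" for x unfolding eq[OF that] using stage_decomposition(1) K that by blast
  then show ?thesis using eq g0 by (intro that[of K]) auto
qed

lemma proj_L: "x \<in> U \<Longrightarrow> proj x \<in> L"
  using proj_on_V by (metis UN_E)

lemma coords_finite:
  assumes "x \<in> U"
  shows "coords x \<in> finitely_supported"
proof -
  from assms obtain m where m: "x \<in> V m" by blast
  obtain K where K: "\<And>x k. x \<in> V m \<Longrightarrow> K \<le> k \<Longrightarrow> g k x = 0" using proj_on_V[of m] by metis
  show ?thesis by (rule finitely_supportedI[of K]) (simp add: coords_def K[OF m])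
qed

lemma proj_id: "x \<in> L \<Longrightarrow> proj x = x"
  by (simp add: proj_def coords_def embed_def g_L)

lemma embed_U: "embed c \<in> U"
  unfolding embed_def by (intro U_sum U_scale e_U)

lemma embed_linear: "linear_between seq_scale s finitely_supported embed"
  unfolding linear_between_def
proof (intro conjI ballI allI)
  fix c d :: "nat \<Rightarrow> 'k" assume "c \<in> finitely_supported" "d \<in> finitely_supported"
  then obtain K K' where K: "\<And>k. k \<ge> K \<Longrightarrow> c k = 0" "\<And>k. k \<ge> K' \<Longrightarrow> d k = 0"
    using finitely_supported_bound by metis
  define M where "M = max K K'"
  have "embed c = (\<Sum>i<M. s (c i) (e i))" "embed d = (\<Sum>i<M. s (d i) (e i))"
    "embed (c + d) = (\<Sum>i<M. s ((c + d) i) (e i))"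
    by (rule embed_eq; simp add: M_def K)+
  then show "embed (c + d) = embed c + embed d" by (simp add: scale_left_distrib sum.distrib)
next
  fix a and c :: "nat \<Rightarrow> 'k" assume "c \<in> finitely_supported"
  then obtain K where K: "\<And>k. k \<ge> K \<Longrightarrow> c k = 0" using finitely_supported_bound by metis
  have "embed c = (\<Sum>i<K. s (c i) (e i))" "embed (seq_scale a c) = (\<Sum>i<K. s (seq_scale a c i) (e i))"
    by (rule embed_eq; simp add: K seq_scale_def)+
  then show "embed (seq_scale a c) = s a (embed c)" by (simp add: seq_scale_def scale_sum_right)
qed

lemma coords_embed: "c \<in> finitely_supported \<Longrightarrow> coords (embed c) = c"
proof
  fix i
  assume c: "c \<in> finitely_supported"
  have "g i (embed c) = (\<Sum>j | c j \<noteq> 0. g i (s (c j) (e j)))"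
    unfolding embed_def by (rule dualD(8)[OF g_dual]) (intro U_scale e_U)
  also have "\<dots> = (\<Sum>j | c j \<noteq> 0. if j = i then c j else 0)"
    by (intro sum.cong refl) (simp add: dualD(4)[OF g_dual e_U] biorthogonal)
  also have "\<dots> = c i" using c by (simp add: finitely_supported_def)
  finally show "coords (embed c) i = c i" by (simp add: coords_def)
qed

lemma coords_linear: "linear_between s seq_scale U coords"
  by (auto simp: linear_between_def coords_def seq_scale_def fun_eq_iff dualD(3,4)[OF g_dual])

lemma proj_linear: "linear_between s s U proj"
  unfolding linear_between_def
proof (intro conjI ballI allI)
  fix x y assume xy: "x \<in> U" "y \<in> U"
  show "proj (x + y) = proj x + proj y"
    unfolding proj_def linear_betweenD(1)[OF coords_linear xy]
      linear_betweenD(1)[OF embed_linear coords_finite[OF xy(1)] coords_finite[OF xy(2)]] by simp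
next
  fix c x assume x: "x \<in> U"
  show "proj (s c x) = s c (proj x)"
    unfolding proj_def linear_betweenD(2)[OF coords_linear x]
      linear_betweenD(2)[OF embed_linear coords_finite[OF x]] by (simp add: scale_right_diff_distrib)
qed

sublocale phi: seminorm_space seq_scale "finitely_supported :: (nat \<Rightarrow> 'k) set"
  "{p. seminorm_on seq_scale (finitely_supported :: (nat \<Rightarrow> 'k) set) p}"
  by (rule scalar_space.seminorm_space_all_seminorms[OF scalar_space_seq_scale subspace_finitely_supported])

lemma continuous_embed: "continuous_map phi.X X embed"
proof (rule continuous_map_seminorm[OF phi.seminorm_space_axioms seminorm_space_axioms embed_linear])
  fix q assume q: "q \<in> P"
  show "(\<lambda>x. q (embed x)) \<in> {p. seminorm_on seq_scale finitely_supported p}"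
    using sn_add[OF q embed_U embed_U] sn_scale[OF q embed_U] linear_betweenD[OF embed_linear]
    by (simp add: seminorm_on_def)
qed (use embed_U in blast)

text \<open>On each \<open>V m\<close> only finitely many coordinates are nonzero, so any seminorm
  of the coordinate sequence is bounded there through finitely many functionals.\<close>

lemma continuous_coords: "continuous_map X phi.X coords"
proof (rule continuous_map_seminorm[OF seminorm_space_axioms phi.seminorm_space_axioms coords_linear])
  fix q :: "(nat \<Rightarrow> 'k) \<Rightarrow> real" assume q: "q \<in> {p. seminorm_on seq_scale finitely_supported p}"
  define \<delta> :: "nat \<Rightarrow> nat \<Rightarrow> 'k" where "\<delta> i = (\<lambda>j. if j = i then 1 else 0)" for i
  have \<delta>: "\<delta> i \<in> finitely_supported" for i by (rule finitely_supportedI[of "Suc i"]) (simp add: \<delta>_def)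
  show "(\<lambda>x. q (coords x)) \<in> P"
  proof (rule P_intro)
    show "seminorm_on s U (\<lambda>x. q (coords x))"
      using phi.sn_add[OF q coords_finite coords_finite] phi.sn_scale[OF q coords_finite] linear_betweenD[OF coords_linear]
      by (simp add: seminorm_on_def)
    fix m
    obtain K where K: "\<And>x k. x \<in> V m \<Longrightarrow> K \<le> k \<Longrightarrow> g k x = 0" using proj_on_V[of m] by metis
    have "\<forall>i. \<exists>C>0. \<forall>x\<in>V m. norm (g i x) \<le> C * N m x" using dual_bound[OF g_dual] by metis
    then obtain C where C: "\<And>i. C i > 0" "\<And>i x. x \<in> V m \<Longrightarrow> norm (g i x) \<le> C i * N m x"
      by (auto dest!: choice)
    have "q (coords x) \<le> (\<Sum>i<K. C i * q (\<delta> i)) * N m x" if x: "x \<in> V m" for x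
    proof -
      have "coords x j = (\<Sum>i<K. seq_scale (g i x) (\<delta> i)) j" for j
      proof -
        have "(\<Sum>i<K. seq_scale (g i x) (\<delta> i)) j = (\<Sum>i<K. seq_scale (g i x) (\<delta> i) j)"
          by (induction K) auto
        also have "\<dots> = (\<Sum>i<K. if i = j then g i x else 0)"
          by (intro sum.cong refl) (simp add: seq_scale_def \<delta>_def)
        also have "\<dots> = coords x j" using K[OF x, of j] by (simp add: coords_def)
        finally show ?thesis by simp
      qed
      then have "coords x = (\<Sum>i<K. seq_scale (g i x) (\<delta> i))" by (rule ext)
      then have "q (coords x) \<le> (\<Sum>i<K. q (seq_scale (g i x) (\<delta> i)))"
        using phi.sn_sum[OF q, of "{..<K}" "\<lambda>i. seq_scale (g i x) (\<delta> i)"] phi.U_scale[OF \<delta>] by simp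
      also have "\<dots> = (\<Sum>i<K. norm (g i x) * q (\<delta> i))"
        by (intro sum.cong refl phi.sn_scale[OF q \<delta>])
      also have "\<dots> \<le> (\<Sum>i<K. (C i * N m x) * q (\<delta> i))"
        by (intro sum_mono mult_right_mono C(2) x phi.sn_nonneg[OF q \<delta>])
      also have "\<dots> = (\<Sum>i<K. C i * q (\<delta> i)) * N m x"
        unfolding sum_distrib_right by (intro sum.cong refl) (simp add: mult_ac)
      finally show ?thesis .
    qed
    then show "\<exists>C. \<forall>x\<in>V m. q (coords x) \<le> C * N m x" by blast
  qed
qed (use coords_finite in blast)

abbreviation "P\<^sub>L \<equiv> bounded_seminorms s (\<lambda>n. V n \<inter> L) N"

lemma P_subset:
  assumes p: "p \<in> P"
  shows "p \<in> P\<^sub>L"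
proof -
  have "\<exists>C. \<forall>x\<in>V n \<inter> L. p x \<le> C * N n x" for n
    by (rule P_bound[OF p, of n]) blast
  moreover have "seminorm_on s (\<Union>n. V n \<inter> L) p"
    by (rule seminorm_on_subset[OF seminorm[OF p]]) blast
  ultimately show ?thesis by (simp only: bounded_seminorms_def mem_Collect_eq) blast
qed

lemma L_chain: "(\<Union>n. V n \<inter> L) = L" "Banach_chain s (\<lambda>n. V n \<inter> L) N"
proof -
  show UL: "(\<Union>n. V n \<inter> L) = L" using L_facts(2) by blast
  have VU: "V n \<inter> L \<subseteq> V n" for n by blast
  show "Banach_chain s (\<lambda>n. V n \<inter> L) N"
  proof unfold_locales
    fix n
    show "subspace (V n \<inter> L)" by (rule subspace_inter[OF subspace_V L_facts(1)])
    show "V n \<inter> L \<subseteq> V (Suc n) \<inter> L" using V_Suc by blast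
    show "seminorm_on s (V n \<inter> L) (N n)" by (rule seminorm_on_subset[OF seminorm_N VU])
    show "x = 0" if "x \<in> V n \<inter> L" "N n x = 0" for x using N_definite that by blast
    show "norm_complete (V n \<inter> L) (N n)"
      unfolding norm_complete_def
    proof (intro allI impI)
      fix x :: "nat \<Rightarrow> 'a"
      assume x: "range x \<subseteq> V n \<inter> L" "\<forall>e>0. \<exists>m. \<forall>i\<ge>m. \<forall>j\<ge>m. N n (x i - x j) < e"
      then have xV: "x i \<in> V n" and xL: "x i \<in> L" for i by auto
      obtain l where l: "l \<in> V n" "(\<lambda>i. N n (x i - l)) \<longlonglongrightarrow> 0"
        using N_complete[of n, unfolded norm_complete_def, rule_format, of x] x by auto
      \<comment> \<open>Norm limits in a step are limits in \<open>X\<close>, where \<open>L\<close>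
        is closed.\<close>
      have "l \<in> X closure_of L"
        unfolding in_closure_iff[OF L_facts(2)]
      proof (intro conjI ballI allI impI)
        show "l \<in> U" by (rule V_U[OF l(1)])
        fix p and \<epsilon> :: real assume "p \<in> P" and e: "\<epsilon> > 0"
        then have "(\<lambda>i. p (x i - l)) \<longlonglongrightarrow> 0" by (intro P_tendsto[OF _ xV l])
        then have "eventually (\<lambda>i. p (x i - l) < \<epsilon>) sequentially" using e by (rule order_tendstoD(2))
        then obtain i where "p (x i - l) < \<epsilon>" by (auto simp: eventually_sequentially)
        then show "\<exists>y\<in>L. p (y - l) < \<epsilon>" using xL by blast
      qed
      then show "\<exists>l\<in>V n \<inter> L. (\<lambda>i. N n (x i - l)) \<longlonglongrightarrow> 0" using l by auto
    qed
    show "norm_separable (V n \<inter> L) (N n)"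
    proof -
      obtain D where D: "countable D" "D \<subseteq> V n" "\<forall>x\<in>V n. \<forall>e>0. \<exists>d\<in>D. N n (d - x) < e"
        using N_separable[of n] unfolding norm_separable_def by (elim exE conjE)
      \<comment> \<open>The points of \<open>D\<close> need not lie in \<open>L\<close>; for each of
        them and each tolerance a close point of \<open>V n \<inter> L\<close> is chosen where there
        is one.\<close>
      define near where "near = (\<lambda>(d, k::nat). SOME y. y \<in> V n \<inter> L \<and> N n (d - y) < 1 / Suc k)"
      define E where "E = {near (d, k) | d k. d \<in> D \<and> (\<exists>y. y \<in> V n \<inter> L \<and> N n (d - y) < 1 / Suc k)}"
      have near: "near (d, k) \<in> V n \<inter> L \<and> N n (d - near (d, k)) < 1 / Suc k"
        if "y \<in> V n \<inter> L" "N n (d - y) < 1 / Suc k" for d k y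
        unfolding near_def prod.case by (rule someI[of _ y]) (use that in blast)
      have "E \<subseteq> near ` (D \<times> UNIV)" by (auto simp: E_def)
      then have "countable E" 
        by (rule countable_subset) (intro countable_image countable_SIGMA D(1) countableI_type)
      moreover have "E \<subseteq> V n \<inter> L" unfolding E_def using near by blast
      moreover have "\<exists>d\<in>E. N n (d - x) < \<epsilon>" if x: "x \<in> V n \<inter> L" and e: "\<epsilon> > 0" for x \<epsilon>
      proof -
        obtain k :: nat where k: "2 / \<epsilon> < real k" using reals_Archimedean2 by blast
        have k0: "2 / real (Suc k) < \<epsilon>"
        proof -
          have "2 < \<epsilon> * real (Suc k)" using k e by (simp add: field_simps add_strict_increasing)
          then show ?thesis by (simp add: field_simps)
        qed
        obtain d where d: "d \<in> D" "N n (d - x) < 1 / Suc k"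
          using D(3)[rule_format, of x "1 / Suc k"] x by auto
        note y = near[OF x d(2)]
        have mem: "near (d, k) \<in> V n" "d \<in> V n" "x \<in> V n" using y d(1) D(2) x by auto
        have "N n ((near (d, k) - d) + (d - x)) \<le> N n (near (d, k) - d) + N n (d - x)"
          by (intro N_add V_diff mem)
        then have "N n (near (d, k) - x) < 2 / Suc k"
          using y d(2) N_diff_commute[OF mem(1,2)] by simp
        moreover have "near (d, k) \<in> E" unfolding E_def using d x by blast
        ultimately show ?thesis using k0 by (intro bexI[of _ "near (d, k)"]) auto
      qed
      ultimately show ?thesis unfolding norm_separable_def by (intro exI[of _ E]) blast
    qed
    have "V 0 \<subseteq> V n" by (rule V_mono) simp
    then have "V 0 \<subseteq> V n \<inter> L" using L_facts(4) by blast
    then show "V n \<inter> L \<noteq> {0}" using V_nonzero[of 0] V_zero[of 0] by blast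
    show "\<exists>C. \<forall>x\<in>V n \<inter> L. N (Suc n) x \<le> C * N n x" using N_Suc[of n] by blast
  next
    fix x assume x: "x \<in> (\<Union>n. V n \<inter> L)" "x \<noteq> 0"
    then have "x \<in> U" by blast
    from P_separates[OF this x(2)] obtain p where p: "p \<in> P" "p x > 0" by (elim bexE)
    show "\<exists>p\<in>P\<^sub>L. p x > 0" by (rule bexI[of _ p]) (rule p(2), rule P_subset[OF p(1)])
  qed
qed

lemma continuous_proj: "continuous_map X (seminorm_topology L P\<^sub>L) proj"
proof -
  interpret Y: Banach_chain s "\<lambda>n. V n \<inter> L" N by (rule L_chain(2))
  have YS: "seminorm_space s L P\<^sub>L" using Y.seminorm_space_axioms unfolding L_chain(1) .
  show ?thesis
  proof (rule continuous_map_seminorm[OF seminorm_space_axioms YS proj_linear])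
    fix q assume q: "q \<in> P\<^sub>L"
    show "(\<lambda>x. q (proj x)) \<in> P"
    proof (rule P_intro)
      show "seminorm_on s U (\<lambda>x. q (proj x))"
        using seminorm_space.sn_add[OF YS q proj_L proj_L] seminorm_space.sn_scale[OF YS q proj_L]
          linear_betweenD[OF proj_linear] by (simp add: seminorm_on_def)
      fix m
      obtain K where K: "\<And>x. x \<in> V m \<Longrightarrow> proj x = x - (\<Sum>i<K. s (g i x) (e i))"
        "\<And>x. x \<in> V m \<Longrightarrow> proj x \<in> L" using proj_on_V[of m] by metis
      \<comment> \<open>Subtracting components along the \<open>e i\<close> may lead from
        \<open>V m\<close> into a later step, so the estimate takes place in
        \<open>V M\<close>.\<close>
      define M where "M = Max (insert m (\<mu> ` {..<K}))"
      have mM: "m \<le> M" unfolding M_def by (rule Max_ge) auto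
      have eM: "e i \<in> V M" if "i < K" for i
      proof -
        have "\<mu> i \<le> M" unfolding M_def by (rule Max_ge) (use that in auto)
        then show ?thesis using e_V[of i] V_mono by blast
      qed
      obtain D where D: "D > 0" "\<And>x. x \<in> V m \<Longrightarrow> N M x \<le> D * N m x" using N_mono[OF mM] by metis
      have "\<forall>i. \<exists>C>0. \<forall>x\<in>V m. norm (g i x) \<le> C * N m x" using dual_bound[OF g_dual] by metis
      then obtain C where C: "\<And>i. C i > 0" "\<And>i x. x \<in> V m \<Longrightarrow> norm (g i x) \<le> C i * N m x"
        by (auto dest!: choice)
      obtain B where B: "B > 0" "\<And>x. x \<in> V M \<inter> L \<Longrightarrow> q x \<le> B * N M x" using Y.P_bound[OF q] by metis
      have "q (proj x) \<le> B * (D + (\<Sum>i<K. C i * N M (e i))) * N m x" if x: "x \<in> V m" for x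
      proof -
        have xM: "x \<in> V M" using x V_mono[OF mM] by blast
        have sumM: "(\<Sum>i<K. s (g i x) (e i)) \<in> V M" by (intro V_sum V_scale eM) simp
        have "proj x \<in> V M \<inter> L" using K[OF x] V_diff[OF xM sumM] by simp
        then have "q (proj x) \<le> B * N M (proj x)" by (rule B(2))
        also have "N M (proj x) \<le> N M x + N M (\<Sum>i<K. s (g i x) (e i))"
          unfolding K(1)[OF x] by (rule N_diff[OF xM sumM])
        also have "N M (\<Sum>i<K. s (g i x) (e i)) \<le> (\<Sum>i<K. N M (s (g i x) (e i)))"
          by (intro N_sum V_scale eM) simp
        also have "\<dots> = (\<Sum>i<K. norm (g i x) * N M (e i))"
          by (intro sum.cong refl N_scale eM) simp
        also have "\<dots> \<le> (\<Sum>i<K. (C i * N m x) * N M (e i))"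
          by (intro sum_mono mult_right_mono C(2) x N_nonneg eM) simp
        also have "\<dots> = (\<Sum>i<K. C i * N M (e i)) * N m x"
          unfolding sum_distrib_right by (intro sum.cong refl) (simp add: mult_ac)
        also have "N M x \<le> D * N m x" by (rule D(2)[OF x])
        finally show ?thesis using B(1) by (simp add: algebra_simps)
      qed
      then show "\<exists>C. \<forall>x\<in>V m. q (proj x) \<le> C * N m x" by blast
    qed
  qed (use proj_L in blast)
qed

text \<open>A closed subspace of an inductive limit need not carry the limit topology of its traces
  \<open>V n \<inter> L\<close>. It does here because \<open>proj\<close> is continuous into the
  latter and is the identity on \<open>L\<close>.\<close>

lemma subtopology_L: "subtopology X L = seminorm_topology L P\<^sub>L"
proof -
  interpret Y: Banach_chain s "\<lambda>n. V n \<inter> L" N by (rule L_chain(2))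
  have YS: "seminorm_space s L P\<^sub>L" using Y.seminorm_space_axioms unfolding L_chain(1) .
  have "openin (subtopology X L) W \<longleftrightarrow> openin (seminorm_topology L P\<^sub>L) W" for W
  proof
    assume "openin (subtopology X L) W"
    then obtain T where T: "openin X T" "W = T \<inter> L" by (auto simp: openin_subtopology)
    show "openin (seminorm_topology L P\<^sub>L) W"
      unfolding seminorm_space.openin_X[OF YS]
    proof (intro conjI ballI)
      fix x assume "x \<in> W"
      then have "x \<in> T" using T(2) by blast
      then obtain p where p: "p \<in> P" "\<forall>y\<in>U. p (y - x) < 1 \<longrightarrow> y \<in> T"
        using T(1) unfolding openin_X by (elim conjE) (drule bspec, assumption, elim bexE)
      show "\<exists>p\<in>P\<^sub>L. \<forall>y\<in>L. p (y - x) < 1 \<longrightarrow> y \<in> W"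
        by (rule bexI[OF _ P_subset[OF p(1)]]) (use p(2) T(2) L_facts(2) in blast)
    qed (use T in blast)
  next
    assume W: "openin (seminorm_topology L P\<^sub>L) W"
    have WL: "W \<subseteq> L" using openin_subset[OF W] seminorm_space.topspace_X[OF YS] by simp
    have "openin X {x \<in> topspace X. proj x \<in> W}"
      by (rule openin_continuous_map_preimage[OF continuous_proj W])
    moreover have "W = {x \<in> topspace X. proj x \<in> W} \<inter> L"
      using WL L_facts(2) proj_id by auto
    ultimately show "openin (subtopology X L) W" unfolding openin_subtopology by blast
  qed
  then show ?thesis by (simp add: topology_eq)
qed

lemma isomorphic_splitting:
  "isomorphic_spaces s X (prod_scale s seq_scale) (prod_topology (subtopology X L) phi.X)"
proof -
  let ?Y = "subtopology X L"
  let ?h = "\<lambda>x. (proj x, coords x)" and ?k = "\<lambda>z. fst z + embed (snd z)"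
  have topY: "topspace ?Y = L" using L_facts(2) by (simp add: Int_absorb1)
  have "homeomorphic_maps X (prod_topology ?Y phi.X) ?h ?k"
    unfolding homeomorphic_maps_def
  proof (intro conjI ballI)
    show "continuous_map X (prod_topology ?Y phi.X) ?h"
      by (intro continuous_map_pairedI) (use continuous_proj continuous_coords subtopology_L in simp_all)
    have "continuous_map (prod_topology ?Y phi.X) X fst"
      using continuous_map_fst[of ?Y phi.X] by (simp add: continuous_map_in_subtopology)
    moreover have "continuous_map (prod_topology ?Y phi.X) X (embed \<circ> snd)"
      by (rule continuous_map_compose[OF continuous_map_snd continuous_embed])
    ultimately have "continuous_map (prod_topology ?Y phi.X) (prod_topology X X) (\<lambda>z. (fst z, embed (snd z)))"
      by (intro continuous_map_pairedI) (simp_all add: o_def)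
    moreover have "continuous_map (prod_topology X X) X (\<lambda>(x, y). x + y)"
      using locally_convex_X by (simp add: locally_convex_space_def)
    ultimately have "continuous_map (prod_topology ?Y phi.X) X ((\<lambda>(x, y). x + y) \<circ> (\<lambda>z. (fst z, embed (snd z))))"
      by (rule continuous_map_compose)
    then show "continuous_map (prod_topology ?Y phi.X) X ?k" by (simp add: o_def)
    show "?k (?h x) = x" if "x \<in> topspace X" for x by (simp add: proj_def)
    show "?h (?k z) = z" if "z \<in> topspace (prod_topology ?Y phi.X)" for z
    proof -
      have z: "fst z \<in> L" "snd z \<in> finitely_supported" using that topY by auto
      have "coords (?k z) = coords (fst z) + coords (embed (snd z))"
        by (rule linear_betweenD(1)[OF coords_linear _ embed_U]) (use z L_facts(2) in blast)
      moreover have "coords (fst z) = 0" using g_L[OF z(1)] by (auto simp: coords_def)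
      ultimately have "coords (?k z) = snd z" using coords_embed[OF z(2)] by simp
      then show ?thesis by (simp add: proj_def)
    qed
  qed
  then have "homeomorphic_map X (prod_topology ?Y phi.X) ?h" by (rule homeomorphic_maps_map[THEN iffD1, THEN conjunct1])
  moreover have "linear_between s (prod_scale s seq_scale) U ?h"
    using linear_betweenD[OF proj_linear] linear_betweenD[OF coords_linear]
    by (simp add: linear_between_def prod_scale_def)
  ultimately show ?thesis unfolding isomorphic_spaces_def topspace_X by blast
qed

lemma splitting:
  assumes nb: "\<And>n. normed_by (V n) (N n) (Xs n)"
  shows "\<exists>(Y :: 'a topology) Ys (F :: (nat \<Rightarrow> 'k) topology).
    separable_Banach_limit s Ys Y \<and> Y closure_of (topspace (Ys 0)) = topspace Y \<and> is_phi F \<and>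
    isomorphic_spaces s X (prod_scale s seq_scale) (prod_topology Y F)"
proof (intro exI conjI)
  let ?Y = "subtopology X L" and ?Ys = "\<lambda>n. subtopology (Xs n) L"
  have top: "topspace (?Ys n) = V n \<inter> L" for n using nb by (simp add: normed_by_def)
  have "normed_by (V n \<inter> L) (N n) (?Ys n)" for n
    by (rule normed_by_subtopology[OF subspace_V seminorm_N nb])
  then show "separable_Banach_limit s ?Ys ?Y"
    unfolding separable_Banach_limit_iff top
    using L_chain subtopology_L by (intro exI[of _ N] conjI allI) simp_all
  have "?Y closure_of (V 0 \<inter> L) = L \<inter> X closure_of (V 0)"
    using L_facts(4) by (simp add: closure_of_subtopology Int_absorb1 Int_absorb2)
  then show "?Y closure_of (topspace (?Ys 0)) = topspace ?Y"
    unfolding top using L_facts(2) by (simp add: Int_absorb1)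
  show "is_phi phi.X" unfolding is_phi_iff ..
  show "isomorphic_spaces s X (prod_scale s seq_scale) (prod_topology ?Y phi.X)" by (rule isomorphic_splitting)
qed

end

section \<open>Spaces with a quotient \<open>\<phi>\<close> have no cyclic operators with dense range\<close>

text \<open>For a point outside \<open>Q\<close> some algebraic functional vanishes on
  \<open>Q\<close> but not at the point, and every algebraic functional is continuous when all
  seminorms are.\<close>

lemma (in scalar_space) strongest_closed_subspace:
  assumes U: "subspace U" and Q: "subspace Q" "Q \<subseteq> U"
  shows "seminorm_topology U {p. seminorm_on s U p} closure_of Q = Q"
proof -
  interpret A: seminorm_space s U "{p. seminorm_on s U p}" by (rule seminorm_space_all_seminorms[OF U])
  interpret K: vector_space_pair s "(*) :: 'k \<Rightarrow> 'k \<Rightarrow> 'k"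
    by unfold_locales (simp_all add: algebra_simps)
  have "x \<in> Q" if x: "x \<in> A.X closure_of Q" for x
  proof (rule ccontr)
    assume "x \<notin> Q"
    obtain B where B: "B \<subseteq> Q" "independent B" "Q \<subseteq> span B" using basis_exists[of Q] by metis
    have "span B \<subseteq> Q" by (rule span_minimal[OF B(1) Q(1)])
    then have xB: "x \<notin> span B" using \<open>x \<notin> Q\<close> by blast
    then have "independent (insert x B)" using B(2) by (rule independent_insertI)
    then obtain f where f: "Vector_Spaces.linear s (*) f" "\<forall>b\<in>insert x B. f b = (if b = x then 1 else 0)"
      using K.linear_independent_extend[of "insert x B" "\<lambda>b. if b = x then 1 else 0"] by blast
    interpret f: Vector_Spaces.linear s "(*) :: 'k \<Rightarrow> 'k \<Rightarrow> 'k" f by (rule f(1))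
    have lin: "linear_between s (*) U f" by (simp add: linear_between_def f.add f.scale)
    have dual: "f \<in> A.dual" using lin seminorm_on_norm_linear[OF U lin] by (simp add: A.dual_def)
    have "f b = 0" if "b \<in> B" for b using f(2) that xB span_base[of b B] by auto
    then have "f q = 0" if "q \<in> Q" for q using K.linear_eq_0_on_span[OF f(1), of B] B(3) that by blast
    then have "f x = 0" by (rule A.dual_zero_on_closure[OF dual Q(2) _ x])
    then show False using f(2) by simp
  qed
  moreover have "Q \<subseteq> A.X closure_of Q" by (rule closure_of_subset) (use Q in simp)
  ultimately show ?thesis by blast
qed

text \<open>More rows than columns: Gaussian elimination with a pivot in column \<open>r\<close>. It
  will provide a combination of vectors of \<open>Z\<close> that the operator maps back into
  \<open>Z\<close>.\<close>

lemma linear_relation: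
  fixes c :: "nat \<Rightarrow> nat \<Rightarrow> 'k::field"
  assumes "finite S" "card S > r" "\<And>n i. n \<in> S \<Longrightarrow> r \<le> i \<Longrightarrow> c n i = 0"
  shows "\<exists>a. (\<exists>n\<in>S. a n \<noteq> 0) \<and> (\<forall>i. (\<Sum>n\<in>S. a n * c n i) = 0)"
  using assms
proof (induction r arbitrary: S c)
  case 0
  then obtain n where "n \<in> S" by fastforce
  then show ?case using 0 by (intro exI[of _ "\<lambda>_. 1"]) auto
next
  case (Suc r)
  show ?case
  proof (cases "\<forall>n\<in>S. c n r = 0")
    case True
    have "c n i = 0" if "n \<in> S" "r \<le> i" for n i
      using True Suc.prems(3)[OF that(1), of i] that by (cases "i = r") auto
    then show ?thesis using Suc.IH[of S c] Suc.prems by auto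
  next
    case False
    then obtain m where m: "m \<in> S" "c m r \<noteq> 0" by blast
    define d where "d n = c n r / c m r" for n
    define c' where "c' n i = c n i - d n * c m i" for n i
    have "c' n i = 0" if "n \<in> S - {m}" "r \<le> i" for n i
      using that m Suc.prems(3)[of n i] Suc.prems(3)[of m i] by (cases "i = r") (auto simp: c'_def d_def)
    moreover have "card (S - {m}) > r" using Suc.prems m by simp
    ultimately obtain a where a: "\<exists>n\<in>S - {m}. a n \<noteq> 0" "\<And>i. (\<Sum>n\<in>S - {m}. a n * c' n i) = 0"
      using Suc.IH[of "S - {m}" c'] Suc.prems(1) by auto
    define b where "b n = (if n = m then - (\<Sum>n\<in>S - {m}. a n * d n) else a n)" for n
    have "(\<Sum>n\<in>S. b n * c n i) = 0" for i
    proof -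
      have "(\<Sum>n\<in>S. b n * c n i) = b m * c m i + (\<Sum>n\<in>S - {m}. b n * c n i)"
        using Suc.prems(1) m(1) by (rule sum.remove)
      also have "(\<Sum>n\<in>S - {m}. b n * c n i) = (\<Sum>n\<in>S - {m}. a n * c n i)"
        by (intro sum.cong refl) (simp add: b_def)
      also have "b m * c m i = - (\<Sum>n\<in>S - {m}. a n * (d n * c m i))"
        by (simp add: b_def sum_distrib_right mult.assoc)
      also have "\<dots> + (\<Sum>n\<in>S - {m}. a n * c n i) = (\<Sum>n\<in>S - {m}. a n * c' n i)"
        by (simp add: c'_def right_diff_distrib sum_subtractf)
      finally show ?thesis using a(2) by simp
    qed
    moreover have "\<exists>n\<in>S. b n \<noteq> 0" using a(1) by (auto simp: b_def)
    ultimately show ?thesis by blast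
  qed
qed

text \<open>Of the decomposition \<open>Y \<times> \<phi>\<close> only the projection
  \<open>\<pi>\<close> onto \<phi> is retained; \<open>Y\<close> survives as its kernel
  \<open>Z\<close>.\<close>

locale phi_quotient = seminorm_space s U P
  for s :: "'k::real_or_complex \<Rightarrow> 'a::ab_group_add \<Rightarrow> 'a" and U P +
  fixes \<pi> :: "'a \<Rightarrow> nat \<Rightarrow> 'k"
  assumes Hausdorff: "Hausdorff_space X"
    and \<pi>_linear: "linear_between s seq_scale U \<pi>"
    and \<pi>_surj: "\<pi> ` U = finitely_supported"
    and \<pi>_pull: "seminorm_on seq_scale finitely_supported q \<Longrightarrow> (\<lambda>x. q (\<pi> x)) \<in> P"
begin

sublocale phi: seminorm_space seq_scale "finitely_supported :: (nat \<Rightarrow> 'k) set"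
  "{p. seminorm_on seq_scale (finitely_supported :: (nat \<Rightarrow> 'k) set) p}"
  by (rule scalar_space.seminorm_space_all_seminorms[OF scalar_space_seq_scale subspace_finitely_supported])

definition Z :: "'a set" where
  "Z = {x \<in> U. \<pi> x = 0}"

lemma \<pi>_facts:
  "x \<in> U \<Longrightarrow> \<pi> x \<in> finitely_supported" "x \<in> U \<Longrightarrow> y \<in> U \<Longrightarrow> \<pi> (x + y) = \<pi> x + \<pi> y"
  "x \<in> U \<Longrightarrow> \<pi> (s c x) = seq_scale c (\<pi> x)" "\<pi> 0 = 0"
  "x \<in> U \<Longrightarrow> y \<in> U \<Longrightarrow> \<pi> (x - y) = \<pi> x - \<pi> y"
proof -
  show "\<pi> x \<in> finitely_supported" if "x \<in> U" for x using \<pi>_surj that by blast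
  show add: "\<pi> (x + y) = \<pi> x + \<pi> y" if "x \<in> U" "y \<in> U" for x y by (rule linear_betweenD(1)[OF \<pi>_linear that])
  show scale: "\<pi> (s c x) = seq_scale c (\<pi> x)" if "x \<in> U" for x c by (rule linear_betweenD(2)[OF \<pi>_linear that])
  show "\<pi> 0 = 0" using scale[OF U_zero, of 0] by (simp add: seq_scale_def fun_eq_iff)
  show "\<pi> (x - y) = \<pi> x - \<pi> y" if "x \<in> U" "y \<in> U" for x y
    using add[OF that(1) U_minus[OF that(2)]] scale[OF that(2), of "-1"]
    by (simp add: seq_scale_def fun_eq_iff)
qed

lemma subspace_Z: "subspace Z"
  by (rule subspaceI) (auto simp: Z_def U_zero U_add U_scale \<pi>_facts seq_scale_def fun_eq_iff)

lemma subspace_image: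
  assumes "subspace E" "E \<subseteq> U"
  shows "phi.subspace (\<pi> ` E)"
proof (rule phi.subspaceI)
  show "0 \<in> \<pi> ` E" using subspace_0[OF assms(1)] \<pi>_facts(4) by force
  show "x + y \<in> \<pi> ` E" if xy: "x \<in> \<pi> ` E" "y \<in> \<pi> ` E" for x y
  proof -
    obtain a b where ab: "a \<in> E" "b \<in> E" "x = \<pi> a" "y = \<pi> b" using xy by blast
    have "a \<in> U" "b \<in> U" using ab assms(2) by blast+
    then have "x + y = \<pi> (a + b)" by (simp only: ab(3,4) \<pi>_facts(2))
    then show ?thesis using subspace_add[OF assms(1) ab(1,2)] by blast
  qed
  show "seq_scale c x \<in> \<pi> ` E" if x: "x \<in> \<pi> ` E" for c x
  proof -
    obtain a where a: "a \<in> E" "x = \<pi> a" using x by blast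
    have "a \<in> U" using a assms(2) by blast
    then have "seq_scale c x = \<pi> (s c a)" by (simp only: a(2) \<pi>_facts(3))
    then show ?thesis using subspace_scale[OF assms(1) a(1)] by blast
  qed
qed

text \<open>Density passes to the image, and in \<phi> a dense subspace is everything because all
  subspaces are closed.\<close>

lemma image_dense:
  assumes E: "subspace E" "E \<subseteq> U" "X closure_of E = U" and Q: "phi.subspace Q" "Q \<subseteq> finitely_supported" "\<pi> ` E \<subseteq> Q"
  shows "finitely_supported \<subseteq> Q"
proof
  fix c :: "nat \<Rightarrow> 'k" assume "c \<in> finitely_supported"
  then obtain x where x: "x \<in> U" "c = \<pi> x" using \<pi>_surj by blast
  have "c \<in> phi.X closure_of Q"
    unfolding phi.in_closure_iff[OF Q(2)]
  proof (intro conjI ballI allI impI)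
    show "c \<in> finitely_supported" by fact
    fix q :: "(nat \<Rightarrow> 'k) \<Rightarrow> real" and e :: real
    assume q: "q \<in> {p. seminorm_on seq_scale finitely_supported p}" and e: "e > 0"
    then have "(\<lambda>x. q (\<pi> x)) \<in> P" by (intro \<pi>_pull) simp
    from closure_mem(2)[OF E(2) _ this e, of x] x(1) E(3)
    obtain y where y: "y \<in> E" "q (\<pi> (y - x)) < e" by auto
    have "\<pi> (y - x) = \<pi> y - c" using \<pi>_facts(5)[of y x] y(1) x E(2) by auto
    then show "\<exists>y\<in>Q. q (y - c) < e" using y Q(3) by (intro bexI[of _ "\<pi> y"]) auto
  qed
  then show "c \<in> Q" using phi.strongest_closed_subspace[OF subspace_finitely_supported Q(1,2)] by simp
qed

lemma finitely_supported_not_finite_dimensional: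
  assumes "finite B" "B \<subseteq> finitely_supported"
  shows "\<not> finitely_supported \<subseteq> phi.span (B :: (nat \<Rightarrow> 'k) set)"
proof
  assume sub: "finitely_supported \<subseteq> phi.span B"
  have "finite (\<Union>b\<in>B. {i. b i \<noteq> 0})" using assms by (auto simp: finitely_supported_def)
  then obtain K where K: "\<forall>i\<in>(\<Union>b\<in>B. {i. b i \<noteq> 0}). i < K" unfolding finite_nat_set_iff_bounded by blast
  have "phi.subspace {c :: nat \<Rightarrow> 'k. c K = 0}"
    by (rule phi.subspaceI) (auto simp: seq_scale_def)
  moreover have "B \<subseteq> {c. c K = 0}" using K by auto
  ultimately have "phi.span B \<subseteq> {c. c K = 0}" by (rule phi.span_minimal[rotated])
  moreover have "(\<lambda>i. if i = K then 1 else 0 :: 'k) \<in> finitely_supported" by (simp add: finitely_supported_def)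
  ultimately show False using sub by auto
qed

text \<open>A basis of the image of \<open>E\<close> is lifted into \<open>E\<close>, the rest of a
  basis of \<phi> arbitrarily. Continuity comes for free, since the topology of \<phi> admits all
  seminorms.\<close>

lemma linear_section:
  assumes E: "subspace E" "E \<subseteq> U"
  shows "\<exists>\<sigma>. linear_between seq_scale s finitely_supported \<sigma> \<and>
    (\<forall>c\<in>finitely_supported. \<sigma> c \<in> U \<and> \<pi> (\<sigma> c) = c) \<and> (\<forall>c\<in>\<pi> ` E. \<sigma> c \<in> E)"
proof -
  interpret pair: vector_space_pair "seq_scale :: 'k \<Rightarrow> _" s ..
  have img: "\<pi> ` E \<subseteq> finitely_supported" using \<pi>_facts(1) E(2) by blast
  obtain B1 where B1: "B1 \<subseteq> \<pi> ` E" "phi.independent B1" "\<pi> ` E \<subseteq> phi.span B1"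
    using phi.basis_exists[of "\<pi> ` E"] by metis
  obtain B2 where B2: "B1 \<subseteq> B2" "B2 \<subseteq> finitely_supported" "phi.independent B2" "finitely_supported \<subseteq> phi.span B2"
    using phi.maximal_independent_subset_extend[of B1 finitely_supported] B1 img by (metis order_trans)
  have "\<exists>u. u \<in> U \<and> \<pi> u = b \<and> (b \<in> B1 \<longrightarrow> u \<in> E)" if b: "b \<in> B2" for b
  proof (cases "b \<in> B1")
    case True
    then show ?thesis using B1(1) E(2) by blast
  next
    case False
    have "b \<in> \<pi> ` U" using b B2(2) \<pi>_surj by blast
    then show ?thesis using False by blast
  qed
  then obtain u where u: "\<And>b. b \<in> B2 \<Longrightarrow> u b \<in> U" "\<And>b. b \<in> B2 \<Longrightarrow> \<pi> (u b) = b" "\<And>b. b \<in> B2 \<Longrightarrow> b \<in> B1 \<Longrightarrow> u b \<in> E"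
    by metis
  obtain \<sigma> where \<sigma>: "Vector_Spaces.linear seq_scale s \<sigma>" "\<And>b. b \<in> B2 \<Longrightarrow> \<sigma> b = u b"
    using pair.linear_independent_extend[OF B2(3), of u] by blast
  interpret \<sigma>: Vector_Spaces.linear "seq_scale :: 'k \<Rightarrow> _" s \<sigma> by (rule \<sigma>(1))
  have 1: "\<sigma> c \<in> U \<and> \<pi> (\<sigma> c) = c" if "c \<in> phi.span B2" for c
    using that
  proof (induction rule: phi.span_induct_alt)
    case base
    show ?case unfolding \<sigma>.zero using U_zero \<pi>_facts(4) by simp
  next
    case (step a b c)
    then have b: "\<sigma> b \<in> U" "\<pi> (\<sigma> b) = b" and c: "\<sigma> c \<in> U" "\<pi> (\<sigma> c) = c" using u \<sigma>(2) by auto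
    have eq: "\<sigma> (seq_scale a b + c) = s a (\<sigma> b) + \<sigma> c" by (simp only: \<sigma>.add \<sigma>.scale)
    show ?case
      unfolding eq using U_add[OF U_scale[OF b(1)] c(1)]
      by (simp only: \<pi>_facts(2)[OF U_scale[OF b(1)] c(1)] \<pi>_facts(3)[OF b(1)] b(2) c(2))
  qed
  have 2: "\<sigma> c \<in> E" if "c \<in> phi.span B1" for c
    using that
  proof (induction rule: phi.span_induct_alt)
    case base
    show ?case unfolding \<sigma>.zero by (rule subspace_0[OF E(1)])
  next
    case (step a b c)
    then have "\<sigma> b \<in> E" using u \<sigma>(2) B2(1) by auto
    then show ?case
      unfolding \<sigma>.add \<sigma>.scale using step by (intro subspace_add[OF E(1)] subspace_scale[OF E(1)])
  qed
  have "linear_between seq_scale s finitely_supported \<sigma>" by (simp add: linear_between_def \<sigma>.add \<sigma>.scale)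
  then show ?thesis using 1 2 B1(3) B2(4) by (intro exI[of _ \<sigma>] conjI ballI) blast+
qed

text \<open>\<open>R\<close> is a continuous projection onto \<open>Z\<close> that maps
  \<open>E\<close> into \<open>E \<inter> Z\<close>. The latter is finite-dimensional, hence closed,
  so by density \<open>R\<close> maps all of \<open>U\<close> into it; and \<open>E\<close> already
  covers \<phi>.\<close>

lemma dense_subspace_eq:
  assumes E: "subspace E" "E \<subseteq> U" "X closure_of E = U" and B: "finite B" "E \<inter> Z \<subseteq> span B"
  shows "E = U"
proof -
  obtain \<sigma> where \<sigma>: "linear_between seq_scale s finitely_supported \<sigma>"
    "\<And>c. c \<in> finitely_supported \<Longrightarrow> \<sigma> c \<in> U" "\<And>c. c \<in> finitely_supported \<Longrightarrow> \<pi> (\<sigma> c) = c"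
    "\<And>c. c \<in> \<pi> ` E \<Longrightarrow> \<sigma> c \<in> E" using linear_section[OF E(1,2)] by metis
  define R where "R x = x - \<sigma> (\<pi> x)" for x
  have sub: "subspace (E \<inter> Z)" by (rule subspace_inter[OF E(1) subspace_Z])
  obtain B' where B': "B' \<subseteq> E \<inter> Z" "independent B'" "E \<inter> Z \<subseteq> span B'"
    using basis_exists[of "E \<inter> Z"] by metis
  have "finite B'" using independent_span_bound[OF B(1) B'(2)] B'(1) B(2) by blast
  moreover have "B' \<subseteq> U" using B'(1) E(2) by blast
  ultimately have "X closure_of (span B') = span B'" by (rule closed_finite_span[OF Hausdorff])
  moreover have "span B' = E \<inter> Z" using B'(3) span_minimal[OF B'(1) sub] by blast
  ultimately have closed: "X closure_of (E \<inter> Z) = E \<inter> Z" by simp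
  have RE: "R y \<in> E \<inter> Z" if y: "y \<in> E" for y
  proof -
    have yU: "y \<in> U" using y E(2) by blast
    have "R y \<in> E" unfolding R_def using \<sigma>(4) y by (intro subspace_diff[OF E(1)]) auto
    moreover have "\<pi> (R y) = 0"
      unfolding R_def using \<pi>_facts(5)[OF yU \<sigma>(2)[OF \<pi>_facts(1)[OF yU]]] \<sigma>(3)[OF \<pi>_facts(1)[OF yU]] by simp
    ultimately show ?thesis using E(2) by (auto simp: Z_def)
  qed
  have imgE: "finitely_supported \<subseteq> \<pi> ` E"
  proof (rule image_dense[OF E subspace_image[OF E(1,2)]])
    show "\<pi> ` E \<subseteq> finitely_supported" using \<pi>_facts(1) E(2) by blast
  qed simp
  have "x \<in> E" if x: "x \<in> U" for x
  proof -
    have RxU: "R x \<in> U" unfolding R_def by (intro U_diff x \<sigma>(2) \<pi>_facts(1))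
    have EU: "E \<inter> Z \<subseteq> U" using E(2) by blast
    have "R x \<in> X closure_of (E \<inter> Z)"
      unfolding in_closure_iff[OF EU]
    proof (intro conjI ballI allI impI)
      fix p and e :: real assume p: "p \<in> P" and e: "e > 0"
      have "seminorm_on seq_scale finitely_supported (\<lambda>c. p (\<sigma> c))"
        using sn_add[OF p \<sigma>(2) \<sigma>(2)] sn_scale[OF p \<sigma>(2)] linear_betweenD[OF \<sigma>(1)]
        by (simp add: seminorm_on_def)
      then have "(\<lambda>x. p x + p (\<sigma> (\<pi> x))) \<in> P" by (intro add_in_P p \<pi>_pull)
      from closure_mem(2)[OF E(2) _ this e, of x] x E(3)
      obtain y where y: "y \<in> E" "p (y - x) + p (\<sigma> (\<pi> (y - x))) < e" by auto
      have yU: "y \<in> U" using y(1) E(2) by blast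
      have "\<sigma> (\<pi> (y - x) + \<pi> x) = \<sigma> (\<pi> (y - x)) + \<sigma> (\<pi> x)"
        by (intro linear_betweenD(1)[OF \<sigma>(1)] \<pi>_facts(1) U_diff x yU)
      then have "R y - R x = (y - x) - \<sigma> (\<pi> (y - x))"
        unfolding R_def using \<pi>_facts(5)[OF yU x] by simp
      then have "p (R y - R x) \<le> p (y - x) + p (\<sigma> (\<pi> (y - x)))"
        using sn_diff[OF p U_diff[OF yU x] \<sigma>(2)[OF \<pi>_facts(1)[OF U_diff[OF yU x]]]] by simp
      then show "\<exists>z\<in>E \<inter> Z. p (z - R x) < e" using RE[OF y(1)] y(2) by (intro bexI[of _ "R y"]) auto
    qed (rule RxU)
    then have "R x \<in> E" using closed by blast
    moreover have "\<sigma> (\<pi> x) \<in> E" by (rule \<sigma>(4)) (use imgE \<pi>_facts(1)[OF x] in blast)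
    ultimately have "R x + \<sigma> (\<pi> x) \<in> E" by (rule subspace_add[OF E(1)])
    then show ?thesis by (simp add: R_def)
  qed
  then show ?thesis using E(2) by blast
qed

text \<open>In \<open>E\<close>, filtered by the \<open>W n\<close>, the last \<open>w n\<close>
  that occurs acts as a leading term, and \<open>T\<close> raises its degree by one. The hypothesis
  \<open>fin\<close> says that \<open>T\<close> maps a subspace of codimension at most
  \<open>r\<close> in \<open>Z\<close> back into \<open>Z\<close>.\<close>

lemma no_cyclic_dense_range:
  assumes T: "linear_between s s U T" "T ` U \<subseteq> U"
    and fin: "\<And>z i. z \<in> Z \<Longrightarrow> r \<le> i \<Longrightarrow> \<pi> (T z) i = 0"
    and x: "x \<in> U" and cyclic: "X closure_of (span (range (\<lambda>n. (T ^^ n) x))) = U"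
    and dense: "X closure_of (T ` U) = U"
  shows False
proof -
  define w where "w n = (T ^^ n) x" for n
  define W where "W n = span (w ` {..<n})" for n
  define E where "E = span (range w)"
  have TU: "T y \<in> U" if "y \<in> U" for y using T(2) that by blast
  have Tadd: "T (y + z) = T y + T z" if "y \<in> U" "z \<in> U" for y z by (rule linear_betweenD(1)[OF T(1) that])
  have Tscale: "T (s c y) = s c (T y)" if "y \<in> U" for y c by (rule linear_betweenD(2)[OF T(1) that])
  have Tzero: "T 0 = 0" using Tscale[OF U_zero, of 0] by simp
  have wU: "w n \<in> U" for n by (induction n) (use x TU in \<open>auto simp: w_def\<close>)
  have Tw: "T (w n) = w (Suc n)" for n by (simp add: w_def)
  have WU: "W n \<subseteq> U" for n unfolding W_def by (rule span_minimal[OF _ subspace_U]) (use wU in auto)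
  have W_sub: "subspace (W n)" for n by (simp add: W_def)
  have W_mono: "W m \<subseteq> W n" if "m \<le> n" for m n unfolding W_def by (rule span_mono) (use that in auto)
  have W_w: "w m \<in> W n" if "m < n" for m n unfolding W_def by (rule span_base) (use that in blast)
  have EU: "E \<subseteq> U" unfolding E_def by (rule span_minimal[OF _ subspace_U]) (use wU in auto)
  have E: "subspace E" "E \<subseteq> U" "X closure_of E = U"
    using EU cyclic by (simp_all add: E_def w_def[abs_def])
  have W_Suc: "\<exists>a. y - s a (w n) \<in> W n" if "y \<in> W (Suc n)" for y n
  proof -
    have "W (Suc n) = span (insert (w n) (w ` {..<n}))" by (simp add: W_def lessThan_Suc)
    then show ?thesis using that by (auto simp: span_insert W_def)
  qed
  have T_span: "T y \<in> span (T ` A)" if y: "y \<in> span A" and A: "A \<subseteq> U" for y A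
  proof -
    have "y \<in> U \<and> T y \<in> span (T ` A)"
      using y
    proof (induction rule: span_induct_alt)
      case base
      then show ?case by (simp add: Tzero span_zero U_zero)
    next
      case (step c a y)
      have aU: "a \<in> U" using step(1) A by blast
      have "T (s c a + y) = s c (T a) + T y" using step aU by (simp add: Tadd Tscale U_scale)
      moreover have "T a \<in> span (T ` A)" using step(1) by (intro span_base) blast
      ultimately show ?case using step aU by (simp add: U_add U_scale span_add span_scale)
    qed
    then show ?thesis by simp
  qed
  have TW: "T y \<in> W (Suc n)" if "y \<in> W n" for y n
  proof -
    have "T y \<in> span (T ` w ` {..<n})" by (rule T_span) (use that wU in \<open>auto simp: W_def\<close>)
    also have "\<dots> \<subseteq> W (Suc n)" unfolding W_def by (rule span_mono) (auto simp: Tw)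
    finally show ?thesis .
  qed
  have E_W: "\<exists>n. y \<in> W n" if "y \<in> E" for y
    using that unfolding E_def
  proof (induction rule: span_induct_alt)
    case base
    then show ?case using subspace_0[OF W_sub] by blast
  next
    case (step c a y)
    obtain k n where k: "a = w k" and n: "y \<in> W n" using step by blast
    have "s c a \<in> W (max n (Suc k))" unfolding k by (intro subspace_scale[OF W_sub] W_w) simp
    moreover have "y \<in> W (max n (Suc k))" using W_mono[of n "max n (Suc k)"] n by auto
    ultimately show ?case using subspace_add[OF W_sub] by blast
  qed
  have image_W: "\<pi> ` W n \<subseteq> phi.span (\<pi> ` w ` {..<n})" for n
  proof
    fix c assume "c \<in> \<pi> ` W n"
    then obtain y where y: "y \<in> span (w ` {..<n})" "c = \<pi> y" by (auto simp: W_def)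
    have "y \<in> U \<and> \<pi> y \<in> phi.span (\<pi> ` w ` {..<n})"
      using y(1)
    proof (induction rule: span_induct_alt)
      case base
      show ?case unfolding \<pi>_facts(4) using U_zero phi.span_zero by blast
    next
      case (step c a y)
      have aU: "a \<in> U" using step(1) wU by blast
      have "\<pi> a \<in> phi.span (\<pi> ` w ` {..<n})" using step(1) by (intro phi.span_base) blast
      moreover have "\<pi> (s c a + y) = seq_scale c (\<pi> a) + \<pi> y"
        using step aU by (simp only: \<pi>_facts(2,3) U_scale)
      ultimately show ?case
        using step aU U_add[OF U_scale[OF aU]] phi.span_add[OF phi.span_scale] by (simp only:)
    qed
    then show "c \<in> phi.span (\<pi> ` w ` {..<n})" using y(2) by simp
  qed
  have not_in_finite: "\<not> \<pi> ` E \<subseteq> phi.span (\<pi> ` w ` {..<n})" for n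
  proof
    assume sub: "\<pi> ` E \<subseteq> phi.span (\<pi> ` w ` {..<n})"
    have b: "\<pi> ` w ` {..<n} \<subseteq> finitely_supported" using \<pi>_facts(1) wU by auto
    have "phi.span (\<pi> ` w ` {..<n}) \<subseteq> finitely_supported" by (rule phi.span_minimal[OF b subspace_finitely_supported])
    then have "finitely_supported \<subseteq> phi.span (\<pi> ` w ` {..<n})"
      by (rule image_dense[OF E phi.subspace_span _ sub])
    then show False using finitely_supported_not_finite_dimensional[OF _ b] by simp
  qed
  have indep: "w n \<notin> W n" for n
  proof
    assume wn: "w n \<in> W n"
    have "w m \<in> W n" for m
    proof (induction m)
      case 0
      then show ?case using wn W_w[of 0 n] by (cases "n = 0") auto
    next
      case (Suc m)
      obtain a where "T (w m) - s a (w n) \<in> W n" using W_Suc[OF TW[OF Suc]] by blast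
      then have "T (w m) - s a (w n) + s a (w n) \<in> W n"
        by (intro subspace_add[OF W_sub] subspace_scale[OF W_sub] wn)
      then show ?case by (simp add: Tw)
    qed
    then have "E \<subseteq> W n" unfolding E_def by (intro span_minimal[OF _ W_sub]) auto
    then show False using not_in_finite[of n] image_W[of n] by blast
  qed
  \<comment> \<open>The degrees of the elements of \<open>E \<inter> Z\<close>, with leading
    coefficient normalised to 1.\<close>
  define A where "A = {n. \<exists>y\<in>Z. y - w n \<in> W n}"
  have ZU: "Z \<subseteq> U" by (auto simp: Z_def)
  \<comment> \<open>Of \<open>r + 1\<close> normalised elements of distinct degrees some nontrivial
    combination is mapped into \<open>Z\<close>. Its degree \<open>m\<close> is one of theirs, and
    \<open>T\<close> raises it to \<open>m + 1\<close>, although \<open>m + 1\<close> is not in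
    \<open>A\<close>.\<close>
  have exits: "finite {n \<in> A. Suc n \<notin> A}"
  proof (rule ccontr)
    assume "infinite {n \<in> A. Suc n \<notin> A}"
    then obtain S where S: "S \<subseteq> {n \<in> A. Suc n \<notin> A}" "finite S" "card S = Suc r"
      using infinite_arbitrarily_large by blast
    then have "\<forall>n\<in>S. \<exists>y. y \<in> Z \<and> y - w n \<in> W n" unfolding A_def by blast
    then obtain y where y: "\<And>n. n \<in> S \<Longrightarrow> y n \<in> Z" "\<And>n. n \<in> S \<Longrightarrow> y n - w n \<in> W n" by metis
    obtain a where a: "\<exists>n\<in>S. a n \<noteq> 0" "\<forall>i. (\<Sum>n\<in>S. a n * \<pi> (T (y n)) i) = 0"
      using linear_relation[of S r "\<lambda>n. \<pi> (T (y n))"] S fin[OF y(1)] by auto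
    define z where "z = (\<Sum>n\<in>S. s (a n) (y n))"
    have zZ: "z \<in> Z" unfolding z_def by (intro subspace_sum[OF subspace_Z] subspace_scale[OF subspace_Z] y)
    have "T (\<Sum>n\<in>S'. s (a n) (y n)) \<in> U \<and> \<pi> (T (\<Sum>n\<in>S'. s (a n) (y n))) = (\<lambda>i. \<Sum>n\<in>S'. a n * \<pi> (T (y n)) i)"
      if "S' \<subseteq> S" for S'
    proof -
      have "finite S'" using that S(2) finite_subset by blast
      then show ?thesis using that
      proof (induction S' rule: finite_induct)
        case empty
        then show ?case by (simp add: Tzero U_zero \<pi>_facts(4) fun_eq_iff)
      next
        case (insert n S')
        have yn: "y n \<in> U" using y(1)[of n] insert(4) ZU by auto
        have sumU: "(\<Sum>n\<in>S'. s (a n) (y n)) \<in> U"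
          by (intro U_sum U_scale) (use y(1) insert(4) ZU in blast)
        have "T (\<Sum>n\<in>insert n S'. s (a n) (y n)) = s (a n) (T (y n)) + T (\<Sum>n\<in>S'. s (a n) (y n))"
          using insert(1,2) by (simp add: Tadd[OF U_scale[OF yn] sumU] Tscale[OF yn])
        then show ?case
          using insert TU[OF yn] by (simp add: U_add U_scale \<pi>_facts seq_scale_def fun_eq_iff)
      qed
    qed
    from this[of S] have Tz: "T z \<in> Z" using a(2) by (auto simp: Z_def z_def fun_eq_iff)
    define m where "m = Max {n \<in> S. a n \<noteq> 0}"
    have "m \<in> {n \<in> S. a n \<noteq> 0}" unfolding m_def by (rule Max_in) (use S(2) a(1) in auto)
    then have m: "m \<in> S" "a m \<noteq> 0" by auto
    have m_max: "n \<le> m" if "n \<in> S" "a n \<noteq> 0" for n unfolding m_def by (rule Max_ge) (use that S(2) in auto)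
    have "z - s (a m) (w m) \<in> W m"
    proof -
      have "z = s (a m) (y m) + (\<Sum>n\<in>S - {m}. s (a n) (y n))"
        unfolding z_def using S(2) m(1) by (rule sum.remove)
      then have eq: "z - s (a m) (w m) = s (a m) (y m - w m) + (\<Sum>n\<in>S - {m}. s (a n) (y n))"
        by (simp add: scale_right_diff_distrib)
      have rest: "s (a n) (y n) \<in> W m" if n: "n \<in> S - {m}" for n
      proof (cases "a n = 0")
        case False
        then have nm: "n < m" using m_max[of n] n by auto
        have "y n - w n \<in> W m" using y(2)[of n] n W_mono[of n m] nm by auto
        then have "y n - w n + w n \<in> W m" by (rule subspace_add[OF W_sub _ W_w[OF nm]])
        then show ?thesis by (simp add: subspace_scale[OF W_sub])
      qed (simp add: subspace_0[OF W_sub])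
      show ?thesis
        unfolding eq by (intro subspace_add[OF W_sub] subspace_scale[OF W_sub] subspace_sum[OF W_sub] y(2)[OF m(1)] rest)
    qed
    then have "T (z - s (a m) (w m)) \<in> W (Suc m)" by (rule TW)
    moreover have "T (z - s (a m) (w m)) = T z - s (a m) (w (Suc m))"
    proof -
      have zU: "z \<in> U" using zZ ZU by blast
      have "T (z + s (- a m) (w m)) = T z + s (- a m) (T (w m))"
        by (simp only: Tadd[OF zU U_scale[OF wU]] Tscale[OF wU])
      then show ?thesis by (simp add: Tw)
    qed
    ultimately have "s (1 / a m) (T z - s (a m) (w (Suc m))) \<in> W (Suc m)" by (simp add: subspace_scale[OF W_sub])
    then have "s (1 / a m) (T z) - w (Suc m) \<in> W (Suc m)" using m(2) by (simp add: scale_right_diff_distrib)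
    then have "Suc m \<in> A" unfolding A_def using subspace_scale[OF subspace_Z Tz] by blast
    then show False using S(1) m(1) by blast
  qed
  \<comment> \<open>An infinite \<open>A\<close> would contain all large \<open>n\<close>. Then
    almost every \<open>\<pi> (w n)\<close> would be a combination of earlier ones, and the image of
    \<open>E\<close> in \<phi> would be finite-dimensional.\<close>
  have "finite A"
  proof (rule ccontr)
    assume "infinite A"
    obtain K where K: "\<forall>n\<in>{n \<in> A. Suc n \<notin> A}. n < K" using exits unfolding finite_nat_set_iff_bounded by blast
    obtain k where k: "k \<in> A" "k \<ge> K" using \<open>infinite A\<close> by (meson infinite_nat_iff_unbounded_le)
    have all: "n \<in> A" if "k \<le> n" for n
      using that
    proof (induction n rule: dec_induct)
      case (step n)
      then show ?case using K k(2) by (metis (mono_tags, lifting) le_trans linorder_not_less mem_Collect_eq)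
    qed (rule k(1))
    have "\<pi> (w n) \<in> phi.span (\<pi> ` w ` {..<k})" for n
    proof (induction n rule: less_induct)
      case (less n)
      show ?case
      proof (cases "n < k")
        case True
        then show ?thesis by (intro phi.span_base) blast
      next
        case False
        then obtain y where y: "y \<in> Z" "y - w n \<in> W n" using all[of n] by (auto simp: A_def)
        have "\<pi> ` w ` {..<n} \<subseteq> phi.span (\<pi> ` w ` {..<k})" using less by auto
        then have "phi.span (\<pi> ` w ` {..<n}) \<subseteq> phi.span (\<pi> ` w ` {..<k})"
          by (rule phi.span_minimal[OF _ phi.subspace_span])
        then have "\<pi> (y - w n) \<in> phi.span (\<pi> ` w ` {..<k})" using image_W[of n] y(2) by blast
        moreover have "\<pi> (y - w n) = - \<pi> (w n)"
          using \<pi>_facts(5)[of y "w n"] y(1) wU by (simp add: Z_def)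
        ultimately show ?thesis using phi.span_neg[of "- \<pi> (w n)"] by simp
      qed
    qed
    then have sub: "\<pi> ` w ` {..<n} \<subseteq> phi.span (\<pi> ` w ` {..<k})" for n by blast
    have "\<pi> ` E \<subseteq> phi.span (\<pi> ` w ` {..<k})"
    proof
      fix c assume "c \<in> \<pi> ` E"
      then obtain y where y: "y \<in> E" "c = \<pi> y" by blast
      obtain n where "y \<in> W n" using E_W[OF y(1)] by blast
      then have "c \<in> phi.span (\<pi> ` w ` {..<n})" using image_W[of n] y(2) by blast
      then show "c \<in> phi.span (\<pi> ` w ` {..<k})"
        using phi.span_minimal[OF sub[of n] phi.subspace_span] by blast
    qed
    then show False using not_in_finite by blast
  qed
  then obtain K where K: "\<forall>n\<in>A. n < K" unfolding finite_nat_set_iff_bounded by blast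
  have in_W: "z \<in> W K" if "z \<in> W n" "z \<in> Z" for z n
    using that
  proof (induction n)
    case 0
    then show ?case using W_mono[of 0 K] by auto
  next
    case (Suc n)
    show ?case
    proof (cases "n < K")
      case True
      then show ?thesis using Suc.prems W_mono[of "Suc n" K] by auto
    next
      case False
      obtain a where a: "z - s a (w n) \<in> W n" using W_Suc[OF Suc.prems(1)] by blast
      have "a = 0"
      proof (rule ccontr)
        assume "a \<noteq> 0"
        have "s (1 / a) (z - s a (w n)) \<in> W n" by (rule subspace_scale[OF W_sub a])
        then have "s (1 / a) z - w n \<in> W n" using \<open>a \<noteq> 0\<close> by (simp add: scale_right_diff_distrib)
        then have "n \<in> A" unfolding A_def using subspace_scale[OF subspace_Z Suc.prems(2)] by blast
        then show False using K False by blast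
      qed
      then show ?thesis using a Suc by simp
    qed
  qed
  have EZ: "E \<inter> Z \<subseteq> span (w ` {..<K})"
  proof
    fix z assume z: "z \<in> E \<inter> Z"
    then obtain n where "z \<in> W n" using E_W[of z] by blast
    then have "z \<in> W K" using in_W z by blast
    then show "z \<in> span (w ` {..<K})" by (simp add: W_def)
  qed
  have EU': "E = U" by (rule dense_subspace_eq[OF E _ EZ]) simp
  have "subspace (T ` U)"
  proof (rule subspaceI)
    show "0 \<in> T ` U" using Tzero U_zero by force
    show "a + b \<in> T ` U" if ab: "a \<in> T ` U" "b \<in> T ` U" for a b
    proof -
      obtain a' b' where ab': "a' \<in> U" "b' \<in> U" "a = T a'" "b = T b'" using ab by blast
      then have "a + b = T (a' + b')" by (simp add: Tadd)
      then show ?thesis using U_add[OF ab'(1,2)] by blast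
    qed
    show "s c a \<in> T ` U" if "a \<in> T ` U" for c a
    proof -
      obtain a' where a': "a' \<in> U" "a = T a'" using \<open>a \<in> T ` U\<close> by blast
      then have "s c a = T (s c a')" by (simp add: Tscale)
      then show ?thesis using U_scale[OF a'(1)] by blast
    qed
  qed
  \<comment> \<open>The range meets \<open>Z\<close> in a finite-dimensional space because, by
    \<open>E = U\<close>, all of \<open>U\<close> does.\<close>
  then have "T ` U = U"
    by (rule dense_subspace_eq[OF _ T(2) dense, of "w ` {..<K}"]) (use EZ EU' T(2) in auto)
  then obtain u where u: "u \<in> U" "x = T u" using x by blast
  obtain n where n: "u \<in> W n" using E_W u(1) EU' by blast
  \<comment> \<open>A preimage of \<open>w 0\<close> would express \<open>w 0\<close> through later
    members of the orbit, against linear independence.\<close>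
  have "T u \<in> span (T ` w ` {..<n})" by (rule T_span) (use n wU in \<open>auto simp: W_def\<close>)
  then have "w 0 \<in> span (w ` Suc ` {..<n})" using u(2) by (simp add: w_def image_image)
  moreover have "w 0 \<notin> span (w ` Suc ` {..<n})" for n
  proof (induction n)
    case 0
    then show ?case using indep[of 0] by (simp add: W_def)
  next
    case (Suc n)
    have sub: "span (w ` Suc ` {..<n}) \<subseteq> W (Suc n)" unfolding W_def by (rule span_mono) auto
    show ?case
    proof
      assume "w 0 \<in> span (w ` Suc ` {..<Suc n})"
      then have "w 0 \<in> span (insert (w (Suc n)) (w ` Suc ` {..<n}))" by (simp add: lessThan_Suc)
      then obtain a where a: "w 0 - s a (w (Suc n)) \<in> span (w ` Suc ` {..<n})" by (auto simp: span_insert)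
      have "a \<noteq> 0" using a Suc by auto
      have "w 0 - (w 0 - s a (w (Suc n))) \<in> W (Suc n)"
        by (rule subspace_diff[OF W_sub W_w subsetD[OF sub a]]) simp
      then have "s (1 / a) (w 0 - (w 0 - s a (w (Suc n)))) \<in> W (Suc n)" by (rule subspace_scale[OF W_sub])
      then show False using \<open>a \<noteq> 0\<close> indep[of "Suc n"] by simp
    qed
  qed
  ultimately show False by blast
qed

end

section \<open>The equivalence\<close>

text \<open>Converse of \<open>continuous_map_seminorm\<close>, needed where a map is given by
  topological means such as a homeomorphism.\<close>

lemma continuous_seminorm_pull:
  assumes X: "seminorm_space s U P" and Z: "seminorm_space s' U' P'"
    and f: "linear_between s s' U f" and cont: "continuous_map (seminorm_topology U P) (seminorm_topology U' P') f"
    and q: "q \<in> P'"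
  shows "(\<lambda>x. q (f x)) \<in> P"
proof -
  interpret X: seminorm_space s U P by (rule X)
  interpret Z: seminorm_space s' U' P' by (rule Z)
  have fU: "f x \<in> U'" if "x \<in> U" for x
    using continuous_map_image_subset_topspace[OF cont] that by auto
  have f0: "f 0 = 0" using linear_betweenD(2)[OF f X.U_zero, of 0] by simp
  have sn: "seminorm_on s U (\<lambda>x. q (f x))"
    using Z.sn_add[OF q fU fU] Z.sn_scale[OF q fU] linear_betweenD[OF f] by (simp add: seminorm_on_def)
  have "openin Z.X {y \<in> U'. q (y - 0) < 1}" by (rule Z.openin_ball[OF q Z.U_zero])
  from openin_continuous_map_preimage[OF cont this]
  have op: "openin X.X {x \<in> U. f x \<in> {y \<in> U'. q (y - 0) < 1}}" by simp
  have zero: "0 \<in> {x \<in> U. f x \<in> {y \<in> U'. q (y - 0) < 1}}"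
    using X.U_zero Z.U_zero Z.sn_zero[OF q] f0 by simp
  from op[unfolded X.openin_X, THEN conjunct2, rule_format, OF zero]
  obtain p where p: "p \<in> P" "\<forall>y\<in>U. p (y - 0) < 1 \<longrightarrow> y \<in> {x \<in> U. f x \<in> {y \<in> U'. q (y - 0) < 1}}"
    by (elim bexE)
  have ball: "q (f y) < 1" if "y \<in> U" "p y < 1" for y using p(2) that by simp
  have "\<exists>C. \<forall>x\<in>U. q (f x) \<le> C * p x"
    by (rule X.seminorm_bound[OF X.subspace_U X.seminorm[OF p(1)] sn zero_less_one]) (rule ball)
  then obtain C where "\<forall>x\<in>U. q (f x) \<le> C * p x" by (elim exE)
  then show ?thesis by (intro X.dominated_in_P[OF p(1) sn]) blast
qed

context seminorm_space
begin

lemma range_subspace: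
  assumes "linear_between s s U T"
  shows "subspace (T ` U)"
proof (rule subspaceI)
  have "T (s 0 0) = s 0 (T 0)" by (rule linear_betweenD(2)[OF assms U_zero])
  then show "0 \<in> T ` U" using U_zero by force
  show "a + b \<in> T ` U" if ab: "a \<in> T ` U" "b \<in> T ` U" for a b
  proof -
    obtain a' b' where ab': "a' \<in> U" "b' \<in> U" "a = T a'" "b = T b'" using ab by blast
    then have "a + b = T (a' + b')" using linear_betweenD(1)[OF assms] by simp
    then show ?thesis using U_add[OF ab'(1,2)] by blast
  qed
  show "s c a \<in> T ` U" if a: "a \<in> T ` U" for c a
  proof -
    obtain a' where a': "a' \<in> U" "a = T a'" using a by blast
    then have "s c a = T (s c a')" using linear_betweenD(2)[OF assms] by simp
    then show ?thesis using U_scale[OF a'(1)] by blast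
  qed
qed

text \<open>The orbit lies in the closed set consisting of \<open>x\<close> and the closure
  \<open>?M\<close> of the range, which is therefore all of \<open>U\<close>. If \<open>x\<close>
  were outside the subspace \<open>?M\<close>, then \<open>s 2 x\<close> would be in neither
  part.\<close>

lemma hypercyclic_imp_cyclic_dense_range:
  assumes H: "Hausdorff_space X" and T: "continuous_operator s X T" and hyp: "hypercyclic X T"
  shows "cyclic s X T" "dense_range X T"
proof -
  obtain x where x: "x \<in> U" "X closure_of (range (\<lambda>n. (T ^^ n) x)) = U"
    using hyp unfolding hypercyclic_def topspace_X by (elim bexE)
  have lin: "linear_between s s U T" and TU: "T ` U \<subseteq> U"
    using T continuous_map_image_subset_topspace[of X X T] by (auto simp: continuous_operator_def)
  have orbit: "(T ^^ n) x \<in> U" for n by (induction n) (use x TU in auto)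
  have "X closure_of (range (\<lambda>n. (T ^^ n) x)) \<subseteq> X closure_of (span (range (\<lambda>n. (T ^^ n) x)))"
    by (rule closure_of_mono[OF span_superset])
  then have "X closure_of (span (range (\<lambda>n. (T ^^ n) x))) = U"
    using x(2) closure_of_subset_topspace[of X] by fastforce
  then show "cyclic s X T" unfolding cyclic_def topspace_X using x(1) by blast
  let ?M = "X closure_of (T ` U)"
  have M: "subspace ?M" by (rule subspace_closure[OF range_subspace[OF lin] TU])
  have TM: "T ` U \<subseteq> ?M" by (rule closure_of_subset) (use TU in simp)
  have "closedin X (insert x ?M)"
    using closedin_Hausdorff_singleton[OF H, of x] x(1) closedin_Un[of X "{x}" ?M] by simp
  moreover have "range (\<lambda>n. (T ^^ n) x) \<subseteq> insert x ?M"
  proof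
    fix y assume "y \<in> range (\<lambda>n. (T ^^ n) x)"
    then obtain n where n: "y = (T ^^ n) x" by blast
    show "y \<in> insert x ?M"
    proof (cases n)
      case (Suc k)
      then have "y \<in> T ` U" using n orbit[of k] by simp
      then show ?thesis using TM by blast
    qed (use n in simp)
  qed
  ultimately have "U \<subseteq> insert x ?M" using closure_of_minimal x(2) by metis
  moreover have "x \<in> ?M"
  proof (rule ccontr)
    assume no: "x \<notin> ?M"
    have "s 2 x \<in> insert x ?M" using U_scale[OF x(1)] \<open>U \<subseteq> insert x ?M\<close> by blast
    then show False
    proof
      assume "s 2 x = x"
      moreover have "s 2 x = x + x" using scale_left_distrib[of 1 1 x] by simp
      ultimately have "x = 0" by simp
      then show False using no subspace_0[OF M] by simp
    next
      assume "s 2 x \<in> ?M"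
      then have "s (1 / 2) (s 2 x) \<in> ?M" by (rule subspace_scale[OF M])
      then show False using no by simp
    qed
  qed
  moreover have "?M \<subseteq> U" using closure_of_subset_topspace[of X] by simp
  ultimately show "dense_range X T" unfolding dense_range_def topspace_X by blast
qed

section \<open>Cyclic operators on finite-dimensional spaces\<close>

lemma sum_in_P:
  assumes "\<And>i. i \<in> A \<Longrightarrow> q i \<in> P"
  shows "(\<lambda>x. \<Sum>i\<in>A. q i x) \<in> P"
  using assms
proof (induction A rule: infinite_finite_induct)
  case (insert i A)
  then have "(\<lambda>x. q i x + (\<Sum>i\<in>A. q i x)) \<in> P" by (intro add_in_P) auto
  then show ?case using insert(1,2) by simp
qed (simp_all add: zero_in_P)

text \<open>On a finite-dimensional space the cyclic permutation of a basis is cyclic and surjective.\<close>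

lemma finite_dimensional_cyclic:
  assumes H: "Hausdorff_space X" and B0: "finite B0" "U \<subseteq> span B0" and U: "U \<noteq> {0}"
  shows "\<exists>T. continuous_operator s X T \<and> cyclic s X T \<and> dense_range X T"
proof -
  obtain B where B: "B \<subseteq> U" "independent B" "U \<subseteq> span B" using basis_exists[of U] by metis
  have finB: "finite B" using independent_span_bound[OF B0(1) B(2)] B(1) B0(2) by blast
  have spanB: "span B = U" using B(3) span_minimal[OF B(1) subspace_U] by blast
  obtain b where b: "bij_betw b {..<card B} B" using ex_bij_betw_nat_finite[OF finB] by (auto simp: lessThan_atLeast0)
  define d where "d = card B"
  have d: "d > 0"
  proof -
    have "B \<noteq> {}" using spanB U by auto
    then show ?thesis using finB by (simp add: d_def card_gt_0_iff)
  qed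
  have bB: "b i \<in> B" if "i < d" for i using bij_betwE[OF b] that by (simp add: d_def)
  have bU: "b i \<in> U" if "i < d" for i using bB[OF that] B(1) by blast
  have inj: "b i = b j \<longleftrightarrow> i = j" if "i < d" "j < d" for i j
    using bij_betw_imp_inj_on[OF b] that by (simp add: inj_on_eq_iff d_def)
  have "\<exists>f. f \<in> dual \<and> (\<forall>j<d. f (b j) = (if i = j then 1 else 0))" if i: "i < d" for i
  proof -
    let ?Q = "span (B - {b i})"
    have Q: "subspace ?Q" "?Q \<subseteq> U" by (simp, rule span_minimal[OF _ subspace_U]) (use B(1) in auto)
    have "X closure_of ?Q = ?Q" by (rule closed_finite_span[OF H]) (use finB B(1) in auto)
    moreover have "b i \<notin> ?Q" using B(2) bB[OF i] by (auto simp: dependent_def)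
    ultimately have "b i \<notin> X closure_of ?Q" by simp
    from separating_functional[OF Q bU[OF i] this]
    obtain f where f: "f \<in> dual" "\<forall>x\<in>?Q. f x = 0" "f (b i) = 1" by (elim bexE conjE)
    have "f (b j) = (if i = j then 1 else 0)" if j: "j < d" for j
    proof (cases "i = j")
      case False
      then have "b j \<in> B - {b i}" using bB[OF j] inj[OF i j] by auto
      then show ?thesis using f(2) span_base[of "b j" "B - {b i}"] False by simp
    qed (use f in simp)
    then show ?thesis using f(1) by blast
  qed
  then obtain f where f: "\<And>i. i < d \<Longrightarrow> f i \<in> dual"
    "\<And>i j. i < d \<Longrightarrow> j < d \<Longrightarrow> f i (b j) = (if i = j then 1 else 0)" by metis
  define T where "T x = (\<Sum>i<d. s (f i x) (b (Suc i mod d)))" for x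
  have mod: "Suc i mod d < d" for i using d by simp
  have T_op: "T \<in> operators"
  proof (rule operatorsI)
    show TU: "T x \<in> U" for x unfolding T_def by (intro U_sum U_scale bU mod)
    show "T (x + y) = T x + T y" if "x \<in> U" "y \<in> U" for x y
      unfolding T_def sum.distrib[symmetric] scale_left_distrib[symmetric]
      by (intro sum.cong refl) (simp add: dualD(3)[OF f(1)] that)
    show "T (s c x) = s c (T x)" if "x \<in> U" for c x
      unfolding T_def scale_sum_right by (intro sum.cong refl) (simp add: dualD(4)[OF f(1)] that)
    show "(\<lambda>x. p (T x)) \<in> P" if p: "p \<in> P" for p
    proof (rule dominated_in_P[where C=1])
      show "(\<lambda>x. \<Sum>i<d. p (b (Suc i mod d)) * norm (f i x)) \<in> P"
        by (intro sum_in_P scaled_in_P dualD(2)[OF f(1)] sn_nonneg[OF p bU[OF mod]]) simp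
      show "seminorm_on s U (\<lambda>x. p (T x))"
        using sn_add[OF p TU TU] sn_scale[OF p TU] \<open>\<And>x y. x \<in> U \<Longrightarrow> y \<in> U \<Longrightarrow> T (x + y) = T x + T y\<close>
          \<open>\<And>c x. x \<in> U \<Longrightarrow> T (s c x) = s c (T x)\<close> by (simp add: seminorm_on_def)
      fix x
      have "p (T x) \<le> (\<Sum>i<d. p (s (f i x) (b (Suc i mod d))))"
        unfolding T_def by (intro sn_sum[OF p] U_scale bU mod)
      also have "\<dots> = (\<Sum>i<d. p (b (Suc i mod d)) * norm (f i x))"
        by (intro sum.cong refl) (simp add: sn_scale[OF p bU[OF mod]])
      finally show "p (T x) \<le> 1 * (\<Sum>i<d. p (b (Suc i mod d)) * norm (f i x))" by simp
    qed
  qed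
  have Tb: "T (b j) = b (Suc j mod d)" if j: "j < d" for j
  proof -
    have "T (b j) = (\<Sum>i<d. if i = j then b (Suc i mod d) else 0)"
      unfolding T_def by (intro sum.cong refl) (use f(2) j in auto)
    then show ?thesis using j by simp
  qed
  have orbit: "(T ^^ n) (b 0) = b (n mod d)" for n
  proof (induction n)
    case (Suc n)
    then show ?case using Tb[of "n mod d"] d by (simp add: mod_Suc_eq)
  qed simp
  have B_eq: "B = b ` {..<d}" using bij_betw_imp_surj_on[OF b] by (simp add: d_def)
  have "B \<subseteq> range (\<lambda>n. (T ^^ n) (b 0))"
  proof
    fix x assume "x \<in> B"
    then obtain i where "i < d" "x = b i" using B_eq by auto
    then show "x \<in> range (\<lambda>n. (T ^^ n) (b 0))" by (intro image_eqI[of _ _ i]) (simp_all add: orbit)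
  qed
  then have "span B \<subseteq> span (range (\<lambda>n. (T ^^ n) (b 0)))" by (rule span_mono)
  moreover have "span (range (\<lambda>n. (T ^^ n) (b 0))) \<subseteq> U"
    by (rule span_minimal[OF _ subspace_U]) (use orbit bU mod_less_divisor[OF d] in auto)
  ultimately have "span (range (\<lambda>n. (T ^^ n) (b 0))) = U" using spanB by blast
  then have "cyclic s X T"
    unfolding cyclic_def topspace_X using bU[OF d] closure_of_topspace[of X] by (intro bexI[of _ "b 0"]) simp_all
  moreover have "dense_range X T"
  proof -
    have lin: "linear_between s s U T" and TU: "T ` U \<subseteq> U" using T_op by (simp_all add: operators_def)
    have "b i \<in> T ` U" if i: "i < d" for i
    proof -
      have "Suc (i + (d - 1)) mod d = i" using i d by simp
      then have "T (b ((i + (d - 1)) mod d)) = b i" using Tb[of "(i + (d - 1)) mod d"] d by (simp add: mod_Suc_eq)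
      then show ?thesis using bU[of "(i + (d - 1)) mod d"] d by (intro image_eqI[of _ _ "b ((i + (d - 1)) mod d)"]) simp_all
    qed
    then have "B \<subseteq> T ` U" using B_eq by auto
    then have "U \<subseteq> T ` U" using span_minimal[OF _ range_subspace[OF lin]] spanB by blast
    then have "T ` U = U" using TU by blast
    then show ?thesis unfolding dense_range_def topspace_X using closure_of_topspace[of X] by simp
  qed
  ultimately show ?thesis using continuous_operator_operators[OF T_op] by blast
qed

end

section \<open>The two directions for a chain of Banach spaces\<close>

context Banach_chain
begin

lemma U_nonzero: "U \<noteq> {0}"
  using V_nonzero[of 0] V_zero[of 0] by blast

text \<open>If not every step is followed by one of infinite codimension modulo its closure, then
  for some \<open>n\<close> all steps have finite codimension modulo the closure of
  \<open>V n\<close>. Unless a step is dense, the chain is restarted at \<open>n\<close>, which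
  turns this closure into \<open>L\<close>.\<close>

lemma hypercyclic_or_splitting:
  assumes nb: "\<And>n. normed_by (V n) (N n) (Xs n)" and inf: "\<And>B. finite B \<Longrightarrow> \<not> U \<subseteq> span B"
  shows "(\<exists>T\<in>operators. hypercyclic X T) \<or>
    (\<exists>(Y :: 'a topology) Ys (F :: (nat \<Rightarrow> 'k) topology).
      separable_Banach_limit s Ys Y \<and> Y closure_of (topspace (Ys 0)) = topspace Y \<and> is_phi F \<and>
      isomorphic_spaces s X (prod_scale s seq_scale) (prod_topology Y F))"
proof (cases "\<forall>n. \<exists>m. \<forall>B. finite B \<longrightarrow> B \<subseteq> U \<longrightarrow> \<not> V m \<subseteq> span (X closure_of (V n) \<union> B)")
  case True
  have "\<exists>T\<in>operators. hypercyclic X T" by (rule hypercyclic_if_infinite_steps) (rule True[rule_format])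
  then show ?thesis by (rule disjI1)
next
  case False
  then have "\<exists>n. \<forall>m. \<exists>B. finite B \<and> B \<subseteq> U \<and> V m \<subseteq> span (X closure_of (V n) \<union> B)"
    by (simp only: not_all not_ex not_imp not_not)
  then obtain n where "\<forall>m. \<exists>B. finite B \<and> B \<subseteq> U \<and> V m \<subseteq> span (X closure_of (V n) \<union> B)"
    by (elim exE)
  then have n: "\<exists>B. finite B \<and> B \<subseteq> U \<and> V m \<subseteq> span (X closure_of (V n) \<union> B)" for m by (rule spec)
  show ?thesis
  proof (cases "\<exists>m. X closure_of (V m) = U")
    case True
    then obtain m where "X closure_of (V m) = U" by (elim exE)
    from hypercyclic_if_dense_step[OF inf this] show ?thesis by (rule disjI1)
  next
    case no_dense: False
    define r where "r = (\<lambda>k. n + k)"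
    have r: "strict_mono r" by (simp add: r_def strict_mono_def)
    interpret C: Banach_chain s "\<lambda>k. V (r k)" "\<lambda>k. N (r k)" by (rule subchain(3)[OF r])
    note eq = subchain(1,2)[OF r]
    have "C.X closure_of (V (r m)) \<noteq> C.U" for m using no_dense unfolding eq by simp
    from C.complement_system[OF this]
    obtain e g \<mu> where sys: "\<forall>k. C.good_complement e g k (e k) (g k) (\<mu> k)" by (elim exE)
    have fin: "\<exists>B. finite B \<and> V (r m) \<subseteq> span (C.L \<union> B)" for m
    proof -
      obtain B where "finite B" "V (r m) \<subseteq> span (X closure_of (V n) \<union> B)" using n[of "r m"] by blast
      moreover have "C.L = X closure_of (V n)" unfolding eq by (simp add: r_def)
      ultimately show ?thesis by auto
    qed
    interpret S: splitting_system s "\<lambda>k. V (r k)" "\<lambda>k. N (r k)" e g \<mu>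
    proof unfold_locales
      show "C.good_complement e g k (e k) (g k) (\<mu> k)" for k by (rule sys[rule_format])
    qed (rule fin)
    show ?thesis by (rule disjI2) (rule S.splitting[OF nb, unfolded eq])
  qed
qed

lemma no_cyclic_if_splitting:
  assumes Y: "separable_Banach_limit s Ys Y" and dY: "Y closure_of (topspace (Ys 0)) = topspace Y"
    and F: "is_phi F" and iso: "isomorphic_spaces s X (prod_scale s seq_scale) (prod_topology Y F)"
    and T: "continuous_operator s X T" "cyclic s X T" "dense_range X T"
  shows False
proof -
  obtain N' where nb: "\<And>n. normed_by (topspace (Ys n)) (N' n) (Ys n)"
    and CB: "Banach_chain s (\<lambda>n. topspace (Ys n)) N'"
    and Y_eq: "Y = seminorm_topology (\<Union>n. topspace (Ys n)) (bounded_seminorms s (\<lambda>n. topspace (Ys n)) N')"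
    using Y unfolding separable_Banach_limit_iff by blast
  interpret C: Banach_chain s "\<lambda>n. topspace (Ys n)" N' by (rule CB)
  interpret phi: seminorm_space seq_scale "finitely_supported :: (nat \<Rightarrow> 'k) set"
    "{p. seminorm_on seq_scale (finitely_supported :: (nat \<Rightarrow> 'k) set) p}"
    by (rule scalar_space.seminorm_space_all_seminorms[OF scalar_space_seq_scale subspace_finitely_supported])
  have F_eq: "F = phi.X" using F by (simp add: is_phi_iff)
  have topY: "topspace Y = C.U" unfolding Y_eq by simp
  have topF: "topspace F = finitely_supported" unfolding F_eq by simp
  obtain h where h: "linear_between s (prod_scale s seq_scale) U h" "homeomorphic_map X (prod_topology Y F) h"
    using iso unfolding isomorphic_spaces_def topspace_X by blast
  obtain k where "homeomorphic_maps X (prod_topology Y F) h k" using h(2) homeomorphic_map_maps by blast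
  then have hc: "continuous_map X (prod_topology Y F) h" and kc: "continuous_map (prod_topology Y F) X k"
    and kh: "\<And>x. x \<in> U \<Longrightarrow> k (h x) = x"
    and hk: "\<And>y c. y \<in> C.U \<Longrightarrow> c \<in> finitely_supported \<Longrightarrow> h (k (y, c)) = (y, c)"
    unfolding homeomorphic_maps_def topspace_prod_topology topY topF by auto
  have hU: "fst (h x) \<in> C.U" "snd (h x) \<in> finitely_supported" if "x \<in> U" for x
  proof -
    have "h x \<in> C.U \<times> finitely_supported"
      using continuous_map_image_subset_topspace[OF hc] that unfolding topspace_prod_topology topY topF topspace_X by blast
    then show "fst (h x) \<in> C.U" "snd (h x) \<in> finitely_supported" by (simp_all only: mem_Times_iff)
  qed
  have kU: "k (y, c) \<in> U" if "y \<in> C.U" "c \<in> finitely_supported" for y c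
    using continuous_map_image_subset_topspace[OF kc] that topY topF by (auto simp: image_subset_iff)
  define \<pi> where "\<pi> x = snd (h x)" for x
  have \<pi>_lin: "linear_between s seq_scale U \<pi>"
    using linear_betweenD[OF h(1)] by (auto simp: linear_between_def \<pi>_def prod_scale_def case_prod_beta)
  have zeroF: "(0 :: nat \<Rightarrow> 'k) \<in> finitely_supported" by (rule phi.U_zero)
  have \<pi>_cont: "continuous_map X phi.X \<pi>"
    using continuous_map_compose[OF hc continuous_map_snd] by (simp add: o_def \<pi>_def[abs_def] F_eq)
  interpret Q: phi_quotient s U P \<pi>
  proof unfold_locales
    show "Hausdorff_space X" by (rule Hausdorff)
    show "linear_between s seq_scale U \<pi>" by (rule \<pi>_lin)
    show "\<pi> ` U = finitely_supported"
    proof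
      show "\<pi> ` U \<subseteq> finitely_supported" using hU(2) by (auto simp: \<pi>_def)
      show "finitely_supported \<subseteq> \<pi> ` U"
      proof
        fix c :: "nat \<Rightarrow> 'k" assume c: "c \<in> finitely_supported"
        have "\<pi> (k (0, c)) = c" by (simp add: \<pi>_def hk[OF C.U_zero c])
        then show "c \<in> \<pi> ` U" using kU[OF C.U_zero c] by (intro image_eqI[of _ _ "k (0, c)"]) simp_all
      qed
    qed
    fix q :: "(nat \<Rightarrow> 'k) \<Rightarrow> real" assume "seminorm_on seq_scale finitely_supported q"
    then show "(\<lambda>x. q (\<pi> x)) \<in> P"
      by (intro continuous_seminorm_pull[OF seminorm_space_axioms phi.seminorm_space_axioms \<pi>_lin \<pi>_cont]) simp
  qed
  have Tlin: "linear_between s s U T" and Tcont: "continuous_map X X T"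
    using T(1) by (simp_all add: continuous_operator_def)
  have TU: "T ` U \<subseteq> U" using continuous_map_image_subset_topspace[OF Tcont] by simp
  define j where "j y = k (y, 0)" for y
  have jU: "j y \<in> U" if "y \<in> C.U" for y unfolding j_def by (rule kU[OF that zeroF])
  have hj: "h (j y) = (y, 0)" if "y \<in> C.U" for y unfolding j_def by (rule hk[OF that zeroF])
  have j_add: "j (y + z) = j y + j z" if "y \<in> C.U" "z \<in> C.U" for y z
  proof -
    have "h (j y + j z) = (y + z, 0)" using linear_betweenD(1)[OF h(1) jU jU] that hj by simp
    then show ?thesis using kh[OF U_add[OF jU[OF that(1)] jU[OF that(2)]]] by (simp add: j_def)
  qed
  have j_scale: "j (s a y) = s a (j y)" if "y \<in> C.U" for a y
  proof -
    have eq: "h (s a (j y)) = (s a y, 0)"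
      using linear_betweenD(2)[OF h(1) jU[OF that], of a] hj[OF that]
      by (simp add: prod_scale_def seq_scale_def fun_eq_iff)
    have "s a (j y) = k (h (s a (j y)))" by (rule kh[OF U_scale[OF jU[OF that]], symmetric])
    then show ?thesis unfolding eq by (simp only: j_def)
  qed
  have j_cont: "continuous_map Y X j"
  proof -
    have "continuous_map Y (prod_topology Y F) (\<lambda>y. (y, 0))"
      by (intro continuous_map_pairedI) (simp_all add: topF zeroF)
    from continuous_map_compose[OF this kc] show ?thesis by (simp add: o_def j_def[abs_def])
  qed
  define G where "G y = \<pi> (T (j y))" for y
  have G_cont: "continuous_map Y phi.X G"
    using continuous_map_compose[OF continuous_map_compose[OF j_cont Tcont] \<pi>_cont]
    by (simp add: o_def G_def[abs_def])
  have TjU: "T (j y) \<in> U" if "y \<in> C.U" for y using TU jU[OF that] by blast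
  have GF: "G y \<in> finitely_supported" if "y \<in> C.U" for y unfolding G_def by (rule Q.\<pi>_facts(1)[OF TjU[OF that]])
  have G_add: "G (y + z) = G y + G z" if "y \<in> C.U" "z \<in> C.U" for y z
    unfolding G_def j_add[OF that] linear_betweenD(1)[OF Tlin jU[OF that(1)] jU[OF that(2)]]
    by (rule Q.\<pi>_facts(2)[OF TjU[OF that(1)] TjU[OF that(2)]])
  have G_scale: "G (s a y) = seq_scale a (G y)" if "y \<in> C.U" for a y
    unfolding G_def j_scale[OF that] linear_betweenD(2)[OF Tlin jU[OF that]]
    by (rule Q.\<pi>_facts(3)[OF TjU[OF that]])
  \<comment> \<open>\<phi> is the increasing union of these finite-dimensional closed subspaces;
    their preimages under \<open>G\<close> form the closed cover to which Baire's theorem is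
    applied.\<close>
  define D where "D n = {c \<in> finitely_supported. \<forall>i\<ge>n. c i = (0::'k)}" for n :: nat
  have D_sub: "phi.subspace (D n)" for n
  proof (rule phi.subspaceI)
    show "seq_scale a c \<in> D n" if "c \<in> D n" for a c
      using that phi.U_scale[of c a] by (simp add: D_def) (simp add: seq_scale_def)
  qed (auto simp: D_def zeroF phi.U_add)
  have D_closed: "closedin phi.X (D n)" for n
    using phi.strongest_closed_subspace[OF subspace_finitely_supported D_sub, of n] closure_of_eq[of phi.X "D n"]
    by (auto simp: D_def)
  let ?V = "topspace (Ys 0)"
  have VU: "?V \<subseteq> C.U" by blast
  have id_cont: "continuous_map (Ys 0) Y (\<lambda>y. y)"
    unfolding continuous_map
  proof (intro conjI allI impI)
    show "(\<lambda>y. y) ` ?V \<subseteq> topspace Y" using VU topY by simp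
    fix W assume "openin Y W"
    then have W: "openin C.X W" by (simp add: Y_eq)
    have "openin (Ys 0) {y \<in> ?V. y \<in> W} \<longleftrightarrow>
      {y \<in> ?V. y \<in> W} \<subseteq> ?V \<and> (\<forall>x\<in>{y \<in> ?V. y \<in> W}. \<exists>e>0. \<forall>y\<in>?V. N' 0 (y - x) < e \<longrightarrow> y \<in> {y \<in> ?V. y \<in> W})"
      using nb[of 0] by (simp add: normed_by_def)
    then show "openin (Ys 0) {y \<in> ?V. y \<in> W}" using C.openin_X_inter_V[OF W, of _ 0] by simp
  qed
  have G_cont0: "continuous_map (Ys 0) phi.X G"
    using continuous_map_compose[OF id_cont G_cont] by (simp add: o_def)
  define A where "A n = {y \<in> ?V. G y \<in> D n}" for n
  have A_closed: "closedin (Ys 0) (A n)" for n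
    unfolding A_def by (rule closedin_continuous_map_preimage[OF G_cont0 D_closed])
  have A_Un: "(\<Union>n. A n) = ?V"
  proof
    show "?V \<subseteq> (\<Union>n. A n)"
    proof
      fix y assume y: "y \<in> ?V"
      have "finite {i. G y i \<noteq> 0}" using GF[of y] y VU by (auto simp: finitely_supported_def)
      then obtain n where "\<forall>i\<in>{i. G y i \<noteq> 0}. i < n" unfolding finite_nat_set_iff_bounded by blast
      then have "y \<in> A n" using y GF[of y] VU by (auto simp: A_def D_def not_le[symmetric])
      then show "y \<in> (\<Union>n. A n)" by blast
    qed
  qed (auto simp: A_def)
  have "completely_metrizable_space (Ys 0)"
  proof -
    have "separable_Banach_space s (Ys 0)" using Y by (simp add: separable_Banach_limit_def)
    then show ?thesis unfolding separable_Banach_space_def completely_metrizable_space_def by blast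
  qed
  then have "\<exists>n. Ys 0 interior_of (A n) \<noteq> {}"
  proof (rule contrapos_pp)
    assume "\<not> (\<exists>n. Ys 0 interior_of (A n) \<noteq> {})"
    then have "Ys 0 interior_of \<Union> (range A) = {}" if "completely_metrizable_space (Ys 0)"
      using Baire_category_alt[of "Ys 0" "range A"] that A_closed by auto
    then show "\<not> completely_metrizable_space (Ys 0)"
      using A_Un C.V_zero[of 0] by (auto simp: interior_of_topspace)
  qed
  then obtain n x0 where x0: "x0 \<in> Ys 0 interior_of (A n)" by blast
  have "openin (Ys 0) (Ys 0 interior_of (A n))" by (rule openin_interior_of)
  then have "\<exists>e>0. \<forall>y\<in>?V. N' 0 (y - x0) < e \<longrightarrow> y \<in> Ys 0 interior_of (A n)"
    using nb[of 0] x0 by (auto simp: normed_by_def)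
  then obtain e where e: "e > 0" "\<And>y. y \<in> ?V \<Longrightarrow> N' 0 (y - x0) < e \<Longrightarrow> y \<in> A n"
    using interior_of_subset[of "Ys 0" "A n"] by blast
  have x0A: "x0 \<in> A n" using x0 interior_of_subset[of "Ys 0" "A n"] by blast
  \<comment> \<open>A subspace that contains a ball is everything: a small multiple of
    \<open>y\<close> is added to the centre \<open>x0\<close> and the difference is scaled
    back.\<close>
  have G_D: "G y \<in> D n" if y: "y \<in> ?V" for y
  proof -
    have x0V: "x0 \<in> ?V" using x0A by (simp add: A_def)
    have yU: "y \<in> C.U" "x0 \<in> C.U" using y x0V VU by auto
    define a where "a = e / (2 * (1 + N' 0 y))"
    have Ny: "N' 0 y \<ge> 0" by (rule C.N_nonneg[OF y])
    have a: "a > 0" using e(1) Ny by (simp add: a_def)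
    have ay: "s (of_real a) y \<in> ?V" by (rule C.V_scale[OF y])
    have "N' 0 ((x0 + s (of_real a) y) - x0) = a * N' 0 y" using C.N_scale[OF y, of "of_real a"] a by simp
    also have "\<dots> = e / 2 * (N' 0 y / (1 + N' 0 y))" by (simp add: a_def)
    also have "\<dots> \<le> e / 2 * 1" using e(1) Ny by (intro mult_left_mono) auto
    also have "\<dots> < e" using e(1) by simp
    finally have "x0 + s (of_real a) y \<in> A n" by (intro e(2) C.V_add[OF x0V ay])
    then have 1: "G (x0 + s (of_real a) y) \<in> D n" by (simp add: A_def)
    have 2: "G x0 \<in> D n" using x0A by (simp add: A_def)
    have "G (x0 + s (of_real a) y) - G x0 \<in> D n" by (rule phi.subspace_diff[OF D_sub 1 2])
    also have "G (x0 + s (of_real a) y) - G x0 = seq_scale (of_real a) (G y)"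
      unfolding G_add[OF yU(2) C.U_scale[OF yU(1)]] G_scale[OF yU(1)] by (rule add_diff_cancel_left')
    finally have "seq_scale (of_real (1 / a)) (seq_scale (of_real a) (G y)) \<in> D n"
      by (rule phi.subspace_scale[OF D_sub])
    moreover have "seq_scale (of_real (1 / a)) (seq_scale (of_real a) (G y)) = G y"
      using a by (simp add: seq_scale_def)
    ultimately show ?thesis by simp
  qed
  \<comment> \<open>Here the density of \<open>Ys 0\<close> enters: it carries the bound
    \<open>n\<close> from one Banach space to all of \<open>Y\<close>, where otherwise
    \<open>n\<close> could depend on the step.\<close>
  have G_all: "G y \<in> D n" if y: "y \<in> C.U" for y
  proof -
    have "closedin Y {y \<in> topspace Y. G y \<in> D n}"
      by (rule closedin_continuous_map_preimage[OF G_cont D_closed])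
    moreover have "?V \<subseteq> {y \<in> topspace Y. G y \<in> D n}" using G_D VU topY by auto
    ultimately have "Y closure_of ?V \<subseteq> {y \<in> topspace Y. G y \<in> D n}" by (rule closure_of_minimal[rotated])
    then show ?thesis using dY y topY by auto
  qed
  have fin: "\<pi> (T z) i = 0" if z: "z \<in> Q.Z" and i: "n \<le> i" for z i
  proof -
    have zU: "z \<in> U" "snd (h z) = 0" using z by (simp_all add: Q.Z_def \<pi>_def)
    then have "h z = (fst (h z), 0)" by (metis prod.collapse)
    then have "z = j (fst (h z))" using kh[OF zU(1)] by (metis j_def)
    then have "\<pi> (T z) = G (fst (h z))" by (metis G_def)
    then show ?thesis using G_all[OF hU(1)[OF zU(1)]] i by (simp add: D_def)
  qed
  obtain x where x: "x \<in> U" "X closure_of (span (range (\<lambda>n. (T ^^ n) x))) = U"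
    using T(2) unfolding cyclic_def topspace_X by (elim bexE)
  have "X closure_of (T ` U) = U" using T(3) unfolding dense_range_def topspace_X .
  from Q.no_cyclic_dense_range[OF Tlin TU fin x this] show False .
qed

end

text \<open>In finite dimension the first equivalence holds with both sides false, whereas the
  second would fail: no operator on a nonzero finite-dimensional space is hypercyclic, although some
  are cyclic and onto. Hence the restriction to infinite dimension.\<close>

theorem theorem1p11:
  fixes s :: "'k::real_or_complex \<Rightarrow> 'a::ab_group_add \<Rightarrow> 'a"
    and X :: "'a topology"
  assumes "vector_space s"
    and "LBs_space s X"
  defines "no_hypercyclic \<equiv> \<not> (\<exists>T. continuous_operator s X T \<and> hypercyclic X T)"
    and "no_cyclic_dense_range \<equiv>
           \<not> (\<exists>T. continuous_operator s X T \<and> cyclic s X T \<and> dense_range X T)"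
    and "splits_phi \<equiv>
           (\<exists>(Y :: 'a topology) Ys (F :: (nat \<Rightarrow> 'k) topology).
              separable_Banach_limit s Ys Y \<and>
              Y closure_of (topspace (Ys 0)) = topspace Y \<and>
              is_phi F \<and>
              isomorphic_spaces s X (prod_scale s seq_scale) (prod_topology Y F))"
  shows "(no_cyclic_dense_range \<longleftrightarrow> splits_phi) \<and>
         (infinite_dimensional s (topspace X) \<longrightarrow> (no_hypercyclic \<longleftrightarrow> no_cyclic_dense_range))"
proof -
  interpret scalar_space s unfolding scalar_space_def by (rule assms(1))
  obtain Xs where "separable_Banach_limit s Xs X" using assms(2) unfolding LBs_space_def by blast
  then obtain N where nb: "\<And>n. normed_by (topspace (Xs n)) (N n) (Xs n)"
    and C: "Banach_chain s (\<lambda>n. topspace (Xs n)) N"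
    and X: "X = seminorm_topology (\<Union>n. topspace (Xs n)) (bounded_seminorms s (\<lambda>n. topspace (Xs n)) N)"
    unfolding separable_Banach_limit_iff by blast
  interpret C: Banach_chain s "\<lambda>n. topspace (Xs n)" N by (rule C)
  have XC: "X = C.X" by (rule X)
  have top: "topspace X = C.U" unfolding XC by (rule C.topspace_X)
  have splits_no_cyclic: "splits_phi \<Longrightarrow> no_cyclic_dense_range"
    unfolding splits_phi_def no_cyclic_dense_range_def XC using C.no_cyclic_if_splitting by blast
  have hyp_cyclic: "no_cyclic_dense_range \<Longrightarrow> no_hypercyclic"
    unfolding no_hypercyclic_def no_cyclic_dense_range_def XC
    using C.hypercyclic_imp_cyclic_dense_range[OF C.Hausdorff] by blast
  have inf_splits: "no_hypercyclic \<Longrightarrow> splits_phi" if inf: "infinite_dimensional s (topspace X)"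
  proof -
    assume "no_hypercyclic"
    then have "\<not> (\<exists>T\<in>C.operators. hypercyclic C.X T)"
      unfolding no_hypercyclic_def XC using C.continuous_operator_operators by blast
    moreover have "\<not> C.U \<subseteq> span B" if "finite B" for B
      using inf that unfolding infinite_dimensional_def top by blast
    ultimately show splits_phi
      unfolding splits_phi_def XC using C.hypercyclic_or_splitting[OF nb] by blast
  qed
  have fin_cyclic: "\<not> no_cyclic_dense_range" if fin: "\<not> infinite_dimensional s (topspace X)"
  proof -
    obtain B where "finite B" "C.U \<subseteq> span B" using fin unfolding infinite_dimensional_def top by blast
    then show ?thesis
      unfolding no_cyclic_dense_range_def XC
      using C.finite_dimensional_cyclic[OF C.Hausdorff _ _ C.U_nonzero] by blast
  qed
  show ?thesis using splits_no_cyclic hyp_cyclic inf_splits fin_cyclic by blast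
qed

end
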